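(* Let $n\ge6$ and $m\ge1$ be integers with $\gcd(n,m)=1$. There exists a connected orientable one-vertex ideal triangulation $\mathcal T_{n,m}$ with $mn$ tetrahedra and exactly $m+1$ quotient edges $a_0,\ldots,a_{m-1},b$, such that $$v(a_r)=n\quad(0\le r<m),\qquad v(b)=5mn.$$ Every tetrahedron contains one local occurrence of some $a_r$ and five local occurrences of $b$. The associated compact $3$-manifold has connected boundary of genus $m(n-1)$.
   Context: Face-pairing complexes: take a finite disjoint union of tetrahedra and pair their codimension-one faces (each face with exactly one other face) by affine extensions of vertex bijections; the quotient is a closed pseudo 3-manifold. A quotient edge is an equivalence class of local edges (edges of the individual tetrahedra) under the face pairings; the local edges in the class $e$ are the local occurrences of $e$, and the valence $v(e)$ is their number. Ideal triangulation: for a compact 3-manifold $N$ with nonempty boundary, $C(N)$ is obtained by collapsing each boundary component to a point; an ideal triangulation of $N$ is a presentation of $C(N)$ as the quotient of a finite disjoint union of tetrahedra by pairing their codimension-one faces (each face with exactly one other face) via affine extensions of vertex bijections, such that the vertex set of the quotient is exactly the set of these points. $N$ is the associated compact 3-manifold (obtained from the quotient by deleting open cone neighbourhoods of the vertices). The ideal triangulation is called connected, orientable if $N$ is, and one-vertex if there is a single vertex. *)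

theory Defs
  imports "HOL-Analysis.Analysis" "HOL-Homology.Homology" "HOL-Combinatorics.Permutations"
begin

section \<open>Quotient spaces\<close>

definition equivalence_on :: "'a set \<Rightarrow> 'a rel \<Rightarrow> 'a rel" where
  "equivalence_on A s = Restr ((s \<union> s\<inverse>)\<^sup>*) A"

lemma equiv_equivalence_on: "equiv A (equivalence_on A s)"
proof (rule equivI)
  show "equivalence_on A s \<subseteq> A \<times> A" by (auto simp: equivalence_on_def)
  show "refl_on A (equivalence_on A s)"
    by (auto simp: equivalence_on_def refl_on_def)
  have "sym ((s \<union> s\<inverse>)\<^sup>*)" by (rule sym_rtrancl) (auto simp: sym_def)
  then show "sym (equivalence_on A s)" by (auto simp: equivalence_on_def sym_def)
  show "trans (equivalence_on A s)"
    by (auto simp: equivalence_on_def trans_def dest: rtrancl_trans)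
qed

text \<open>The points of the quotient space of \<open>X\<close> by \<open>r\<close> are the equivalence classes themselves.\<close>

definition quotient_space :: "'a topology \<Rightarrow> 'a rel \<Rightarrow> 'a set topology" where
  "quotient_space X r = topology (\<lambda>\<U>. \<U> \<subseteq> topspace X // r \<and> openin X (\<Union>\<U>))"

lemma openin_quotient_space:
  assumes "equiv (topspace X) r"
  shows "openin (quotient_space X r) \<U> \<longleftrightarrow> \<U> \<subseteq> topspace X // r \<and> openin X (\<Union>\<U>)"
proof -
  have int: "\<Union>(S \<inter> T) = \<Union>S \<inter> \<Union>T"
    if "S \<subseteq> topspace X // r" "T \<subseteq> topspace X // r" for S T
  proof
    show "\<Union>S \<inter> \<Union>T \<subseteq> \<Union>(S \<inter> T)"
    proof
      fix x assume "x \<in> \<Union>S \<inter> \<Union>T"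
      then obtain A B where AB: "A \<in> S" "x \<in> A" "B \<in> T" "x \<in> B" by auto
      then have "A = B"
        using quotient_disj[OF assms, of A B] that by auto
      then show "x \<in> \<Union>(S \<inter> T)" using AB by auto
    qed
  qed auto
  have un: "openin X (\<Union>(\<Union>\<K>))" if "\<forall>K\<in>\<K>. openin X (\<Union>K)" for \<K>
  proof -
    have "\<Union>(\<Union>\<K>) = (\<Union>K\<in>\<K>. \<Union>K)" by auto
    then show ?thesis using that by auto
  qed
  have "istopology (\<lambda>\<U>. \<U> \<subseteq> topspace X // r \<and> openin X (\<Union>\<U>))"
    unfolding istopology_def using int un by (auto simp: openin_Int)
  then show ?thesis
    unfolding quotient_space_def by (simp add: topology_inverse')
qed

lemma topspace_quotient_space:
  assumes "equiv (topspace X) r"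
  shows "topspace (quotient_space X r) = topspace X // r"
proof
  show "topspace (quotient_space X r) \<subseteq> topspace X // r"
    using openin_quotient_space[OF assms] openin_topspace by blast
  have "openin (quotient_space X r) (topspace X // r)"
    using Union_quotient[OF assms] by (simp add: openin_quotient_space[OF assms])
  then show "topspace X // r \<subseteq> topspace (quotient_space X r)"
    by (rule openin_subset)
qed

lemma quotient_map_quotient_space:
  assumes eq: "equiv (topspace X) r"
  shows "quotient_map X (quotient_space X r) (\<lambda>x. r `` {x})"
  unfolding quotient_map_def
proof (intro conjI allI impI)
  show "(\<lambda>x. r `` {x}) ` topspace X = topspace (quotient_space X r)"
    by (auto simp: topspace_quotient_space[OF eq] quotient_def)
  fix \<U> assume "\<U> \<subseteq> topspace (quotient_space X r)"
  then have sub: "\<U> \<subseteq> topspace X // r" by (simp add: topspace_quotient_space[OF eq])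
  have "{x \<in> topspace X. r `` {x} \<in> \<U>} = \<Union>\<U>"
  proof (intro Set.set_eqI iffI)
    fix x assume "x \<in> {x \<in> topspace X. r `` {x} \<in> \<U>}"
    then show "x \<in> \<Union>\<U>" using equiv_class_self[OF eq, of x] by blast
  next
    fix x assume "x \<in> \<Union>\<U>"
    then obtain A where A: "A \<in> \<U>" "x \<in> A" by auto
    with sub obtain y where y: "y \<in> topspace X" "A = r `` {y}" by (auto elim!: quotientE)
    then have "r `` {x} = A" using A equiv_class_eq[OF eq] by blast
    moreover have "x \<in> topspace X" using A y eq by (auto simp: equiv_def)
    ultimately show "x \<in> {x \<in> topspace X. r `` {x} \<in> \<U>}" using A by auto
  qed
  then show "openin X {x \<in> topspace X. r `` {x} \<in> \<U>} = openin (quotient_space X r) \<U>"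
    using sub by (simp add: openin_quotient_space[OF eq])
qed

section \<open>Topological manifolds with boundary\<close>

definition half_space :: "nat \<Rightarrow> (nat \<Rightarrow> real) topology" where
  "half_space n = subtopology (Euclidean_space n) {x. 0 \<le> x 0}"

definition open_embedding_on :: "'a topology \<Rightarrow> 'b topology \<Rightarrow> 'a set \<Rightarrow> ('a \<Rightarrow> 'b) \<Rightarrow> bool" where
  "open_embedding_on X Y U f \<longleftrightarrow> openin X U \<and> openin Y (f ` U) \<and>
     homeomorphic_map (subtopology X U) (subtopology Y (f ` U)) f"

definition manifold_with_boundary :: "nat \<Rightarrow> 'a topology \<Rightarrow> bool" where
  "manifold_with_boundary n X \<longleftrightarrow> Hausdorff_space X \<and> second_countable X \<and>
     (\<forall>x \<in> topspace X. \<exists>U f. x \<in> U \<and> open_embedding_on X (half_space n) U f)"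

definition manifold_interior :: "nat \<Rightarrow> 'a topology \<Rightarrow> 'a set" where
  "manifold_interior n X = {x. \<exists>U f. x \<in> U \<and> open_embedding_on X (Euclidean_space n) U f}"

definition manifold_boundary :: "nat \<Rightarrow> 'a topology \<Rightarrow> 'a set" where
  "manifold_boundary n X = topspace X - manifold_interior n X"

text \<open>A homeomorphism between open subsets of \<open>n\<close>-space preserves orientation if its local degree
  is \<open>1\<close> everywhere; the local degree at \<open>x\<close> is the degree of the self-map
  \<open>u \<mapsto> (f (x + r u) - f x) / |f (x + r u) - f x|\<close> of the unit sphere, for small \<open>r > 0\<close>.\<close>

definition sphere_map ::
    "nat \<Rightarrow> ((nat \<Rightarrow> real) \<Rightarrow> nat \<Rightarrow> real) \<Rightarrow> (nat \<Rightarrow> real) \<Rightarrow> real \<Rightarrow> (nat \<Rightarrow> real) \<Rightarrow> nat \<Rightarrow> real" where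
  "sphere_map n f x r u =
     (let w = (\<lambda>i. f (\<lambda>j. x j + r * u j) i - f x i)
      in (\<lambda>i. w i / sqrt (\<Sum>j<n. (w j)\<^sup>2)))"

definition orientation_preserving ::
    "nat \<Rightarrow> (nat \<Rightarrow> real) set \<Rightarrow> ((nat \<Rightarrow> real) \<Rightarrow> nat \<Rightarrow> real) \<Rightarrow> bool" where
  "orientation_preserving n W f \<longleftrightarrow>
     (\<forall>x \<in> W. \<forall>\<^sub>F r in at_right 0. Brouwer_degree2 (n - 1) (sphere_map n f x r) = 1)"

text \<open>As usual, a manifold with boundary is orientable if its interior has an atlas
  (here a set of pairs of a domain and a chart) all of whose transition maps preserve orientation.\<close>

definition orientable_manifold :: "nat \<Rightarrow> 'a topology \<Rightarrow> bool" where
  "orientable_manifold n X \<longleftrightarrow> manifold_with_boundary n X \<and>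
     (\<exists>\<A>. (\<forall>(U, f) \<in> \<A>. open_embedding_on X (Euclidean_space n) U f) \<and>
          (\<Union>(U, f) \<in> \<A>. U) = manifold_interior n X \<and>
          (\<forall>(U, f) \<in> \<A>. \<forall>(U', f') \<in> \<A>.
             orientation_preserving n (f ` (U \<inter> U')) (f' \<circ> inv_into U f)))"

section \<open>Face-pairing complexes\<close>

text \<open>The simplices are numbered \<open>0, \<dots>, num_simplices - 1\<close>, the vertices of each
  \<open>d\<close>-simplex \<open>0, \<dots>, d\<close>, and \<open>(s, i)\<close> is the facet of simplex \<open>s\<close> opposite its vertex \<open>i\<close>.
  The facet \<open>F\<close> is glued to \<open>mate F\<close> by \<open>vmap F\<close> on vertices.\<close>

record pairing =
  num_simplices :: nat
  mate :: "nat \<times> nat \<Rightarrow> nat \<times> nat"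
  vmap :: "nat \<times> nat \<Rightarrow> nat \<Rightarrow> nat"

definition facets :: "nat \<Rightarrow> pairing \<Rightarrow> (nat \<times> nat) set" where
  "facets d G = {..<num_simplices G} \<times> {..d}"

definition facet_vertices :: "nat \<Rightarrow> nat \<times> nat \<Rightarrow> nat set" where
  "facet_vertices d F = {..d} - {snd F}"

definition face_pairing :: "nat \<Rightarrow> pairing \<Rightarrow> bool" where
  "face_pairing d G \<longleftrightarrow> (\<forall>F \<in> facets d G.
     mate G F \<in> facets d G \<and> mate G F \<noteq> F \<and> mate G (mate G F) = F \<and>
     bij_betw (vmap G F) (facet_vertices d F) (facet_vertices d (mate G F)) \<and>
     (\<forall>v \<in> facet_vertices d F. vmap G (mate G F) (vmap G F v) = v))"

text \<open>Points of a simplex are given by barycentric coordinates, so the affine extension of a vertex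
  bijection just moves the coordinates.\<close>

definition affine_extension ::
    "nat \<Rightarrow> pairing \<Rightarrow> nat \<times> nat \<Rightarrow> (nat \<Rightarrow> real) \<Rightarrow> nat \<Rightarrow> real" where
  "affine_extension d G F x = (\<lambda>w. \<Sum>v \<in> facet_vertices d F. if vmap G F v = w then x v else 0)"

definition disjoint_simplices :: "nat \<Rightarrow> pairing \<Rightarrow> (nat \<times> (nat \<Rightarrow> real)) topology" where
  "disjoint_simplices d G = prod_topology (discrete_topology {..<num_simplices G})
     (subtopology (powertop_real UNIV) (standard_simplex d))"

definition point_identification :: "nat \<Rightarrow> pairing \<Rightarrow> (nat \<times> (nat \<Rightarrow> real)) rel" where
  "point_identification d G = equivalence_on (topspace (disjoint_simplices d G))
     {((s, x), (fst (mate G (s, i)), affine_extension d G (s, i) x)) | s i x.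
        (s, i) \<in> facets d G \<and> x \<in> standard_simplex d \<and> x i = 0}"

definition complex_space :: "nat \<Rightarrow> pairing \<Rightarrow> (nat \<times> (nat \<Rightarrow> real)) set topology" where
  "complex_space d G = quotient_space (disjoint_simplices d G) (point_identification d G)"

definition complex_vertices :: "nat \<Rightarrow> pairing \<Rightarrow> (nat \<times> (nat \<Rightarrow> real)) set set" where
  "complex_vertices d G =
     {point_identification d G `` {(s, \<lambda>w. if w = v then 1 else 0)} | s v.
        s < num_simplices G \<and> v \<le> d}"

text \<open>A local \<open>k\<close>-face is a pair \<open>(s, A)\<close> with \<open>A\<close> a set of \<open>k + 1\<close> vertices of the simplex \<open>s\<close>.
  A quotient \<open>k\<close>-face is a class of these, i.e. the set of its local occurrences.\<close>

definition local_faces :: "nat \<Rightarrow> pairing \<Rightarrow> nat \<Rightarrow> (nat \<times> nat set) set" where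
  "local_faces d G k = {(s, A). s < num_simplices G \<and> A \<subseteq> {..d} \<and> card A = Suc k}"

definition quotient_faces :: "nat \<Rightarrow> pairing \<Rightarrow> nat \<Rightarrow> (nat \<times> nat set) set set" where
  "quotient_faces d G k = local_faces d G k // equivalence_on (local_faces d G k)
     {((s, A), (fst (mate G (s, i)), vmap G (s, i) ` A)) | s i A.
        (s, i) \<in> facets d G \<and> A \<subseteq> facet_vertices d (s, i)}"

definition valence :: "(nat \<times> nat set) set \<Rightarrow> nat" where
  "valence e = card e"

definition occurrences_in :: "nat \<Rightarrow> (nat \<times> nat set) set \<Rightarrow> nat" where
  "occurrences_in s e = card {A. (s, A) \<in> e}"

section \<open>Genus of a closed orientable surface\<close>

definition Euler_characteristic :: "nat \<Rightarrow> pairing \<Rightarrow> int" where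
  "Euler_characteristic d G = (\<Sum>k\<le>d. (-1) ^ k * int (card (quotient_faces d G k)))"

text \<open>The simplices can be oriented such that all pairings reverse the induced orientations of
  the facets: \<open>o s = \<plusminus>1\<close> compares the orientation of \<open>s\<close> with that of its vertex order, and the
  vertex bijection is extended to a permutation by matching the opposite vertices.\<close>

definition coherently_orientable :: "nat \<Rightarrow> pairing \<Rightarrow> bool" where
  "coherently_orientable d G \<longleftrightarrow> (\<exists>ori :: nat \<Rightarrow> int. (\<forall>s. ori s \<in> {1, -1}) \<and>
     (\<forall>(s, i) \<in> facets d G. case mate G (s, i) of (t, j) \<Rightarrow>
        ori t = - ori s * sign (\<lambda>v. if v \<in> facet_vertices d (s, i) then vmap G (s, i) v
                                    else if v = i then j else v)))"

text \<open>Triangles glued along all their sides in pairs always form a closed surface. Its genus \<open>g\<close>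
  is given by \<open>\<chi> = 2 - 2g\<close>, with \<open>\<chi>\<close> computed from a triangulation.\<close>

definition closed_orientable_surface_of_genus :: "nat \<Rightarrow> 'a topology \<Rightarrow> bool" where
  "closed_orientable_surface_of_genus g S \<longleftrightarrow>
     topspace S \<noteq> {} \<and> connected_space S \<and>
     (\<exists>G. face_pairing 2 G \<and> coherently_orientable 2 G \<and> complex_space 2 G homeomorphic_space S \<and>
          Euler_characteristic 2 G = 2 - 2 * int g)"

section \<open>Ideal triangulations\<close>

definition boundary_components :: "nat \<Rightarrow> 'a topology \<Rightarrow> 'a set set" where
  "boundary_components n X = connected_components_of (subtopology X (manifold_boundary n X))"

text \<open>The point of \<open>collapse_boundary n X\<close> to which a boundary component \<open>C\<close> is collapsed
  is the set \<open>C\<close> itself.\<close>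

definition collapse_boundary :: "nat \<Rightarrow> 'a topology \<Rightarrow> 'a set topology" where
  "collapse_boundary n X =
     quotient_space X (Id_on (topspace X) \<union> (\<Union>C \<in> boundary_components n X. C \<times> C))"

definition ideal_triangulation :: "pairing \<Rightarrow> 'a topology \<Rightarrow> bool" where
  "ideal_triangulation T N \<longleftrightarrow>
     face_pairing 3 T \<and>
     manifold_with_boundary 3 N \<and> compact_space N \<and> manifold_boundary 3 N \<noteq> {} \<and>
     (\<exists>h. homeomorphic_map (collapse_boundary 3 N) (complex_space 3 T) h \<and>
          h ` boundary_components 3 N = complex_vertices 3 T)"

text \<open>The regions \<open>x i > 3/4\<close> of the tetrahedra form disjoint open cone neighbourhoods of the
  vertices of the quotient.\<close>

definition associated_manifold :: "pairing \<Rightarrow> (nat \<times> (nat \<Rightarrow> real)) set topology" where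
  "associated_manifold T =
     subtopology (complex_space 3 T) {p. \<forall>(s, x) \<in> p. \<forall>i. x i \<le> 3/4}"

end

theory Submission
  imports Defs
begin

text \<open>The tetrahedra are numbered by the residues modulo \<open>mn\<close>, and facet \<open>i\<close> of tetrahedron \<open>s\<close> is glued
  to facet \<open>3 - i\<close> of a shifted tetrahedron such that the order of the vertices is preserved. Since
  \<open>i\<close> and \<open>3 - i\<close> have different parity, all gluings reverse the induced orientations, and since the
  order is preserved, no edge is identified with its reversal. With suitable shifts the edges \<open>{0, 3}\<close>
  fall into \<open>m\<close> cycles of length \<open>n\<close> and all others form a single cycle.

  The tetrahedra around an edge form a fan, which is mapped to equal wedges around an axis in
  3-space. Each point of the truncated complex lies in the open star of an edge, so these maps yield an
  atlas. On the interiors of the tetrahedra, which are dense, the transition maps are affine with positive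
  determinant; as the local degree is locally constant, it is \<open>1\<close> everywhere.

  The boundary is glued from the \<open>4mn\<close> triangles that cut off the vertices. Its \<open>2(m + 1)\<close> vertices are the
  ends of the edges, so \<open>\<chi> = 2(m + 1) - 6mn + 4mn = 2 - 2m(n - 1)\<close>.\<close>

section \<open>Spaces of simplices with paired facets\<close>

text \<open>A tetrahedron may occur several times around one edge, so the natural map from 3-space
  onto the star of an edge need not be injective. The work is therefore done with these
  parametrisations, and charts are their inverses on small sets. The first coordinate is 3/4 minus
  the weight of one end of the edge, so that the truncation becomes the wall of a half-space; each
  edge is used in both directions in order to see both ends.

  Degrees of linear maps are found without determinants: an invertible map has degree 1 or -1, so a
  square has degree 1, and so has a map whose cube is the identity. Rotations and positive shears
  are squares, and even changes of the vertex order are products of 3-cycles.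

  Paired facets need opposite shifts. With shift \<open>m\<close> at facet 1 and \<open>x\<close> at
  facet 0, the tour through the five edges other than {0, 3} shifts by -m - x - m + 2x = x - 2m. The
  choice \<open>x = 2 * m - 1\<close> makes this -1, a generator of the residues, so these edges
  form a single class.\<close>

lemma equivalence_on_rtrancl:
  assumes "sym s"
  shows "equivalence_on A s = Restr (s\<^sup>*) A"
proof -
  have "s \<union> s\<inverse> = s" using assms by (auto simp: sym_conv_converse_eq)
  then show ?thesis by (simp add: equivalence_on_def)
qed

text \<open>A label that is constant along the generators and whose fibres are chained together by
  them has the equivalence classes as its fibres. All counts of quotient faces reduce to counting
  labels in this way.\<close>

lemma quotient_equivalence_on_by_label:
  assumes step: "\<And>x y. x \<in> A \<Longrightarrow> (x, y) \<in> s \<union> s\<inverse> \<Longrightarrow> y \<in> A \<and> c y = c x"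
    and conn: "\<And>x y. x \<in> A \<Longrightarrow> y \<in> A \<Longrightarrow> c x = c y \<Longrightarrow> (x, y) \<in> (s \<union> s\<inverse>)\<^sup>*"
  shows "A // equivalence_on A s = (\<lambda>l. {x \<in> A. c x = l}) ` c ` A"
    and "card (A // equivalence_on A s) = card (c ` A)"
proof -
  have inv: "y \<in> A \<and> c y = c x" if "(x, y) \<in> (s \<union> s\<inverse>)\<^sup>*" "x \<in> A" for x y
    using that
  proof (induction rule: rtrancl_induct)
    case (step y z)
    then show ?case using assms(1)[of y z] by auto
  qed auto
  have cls: "equivalence_on A s `` {x} = {y \<in> A. c y = c x}" if "x \<in> A" for x
  proof (intro Set.set_eqI iffI)
    fix y assume "y \<in> equivalence_on A s `` {x}"
    then show "y \<in> {y \<in> A. c y = c x}" using inv[of x y] that by (simp add: equivalence_on_def)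
  next
    fix y assume "y \<in> {y \<in> A. c y = c x}"
    then show "y \<in> equivalence_on A s `` {x}" using conn[of x y] that by (simp add: equivalence_on_def)
  qed
  show q: "A // equivalence_on A s = (\<lambda>l. {x \<in> A. c x = l}) ` c ` A"
    unfolding quotient_def image_image UNION_singleton_eq_range using cls by (intro image_cong) simp_all
  have "inj_on (\<lambda>l. {x \<in> A. c x = l}) (c ` A)"
  proof (rule inj_onI)
    fix l l' assume "l \<in> c ` A" and eq: "{x \<in> A. c x = l} = {x \<in> A. c x = l'}"
    then obtain x where "x \<in> A" "c x = l" by auto
    then have "x \<in> {x \<in> A. c x = l}" by simp
    then have "x \<in> {x \<in> A. c x = l'}" by (subst (asm) eq)
    then show "l = l'" using \<open>c x = l\<close> by simp
  qed
  then show "card (A // equivalence_on A s) = card (c ` A)"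
    unfolding q by (rule card_image)
qed

text \<open>The generators of \<open>point_identification\<close>, named so that their closure can
  be studied by induction.\<close>

definition facet_gluing :: "nat \<Rightarrow> pairing \<Rightarrow> (nat \<times> (nat \<Rightarrow> real)) rel" where
  "facet_gluing d G = {((s, x), (fst (mate G (s, i)), affine_extension d G (s, i) x)) | s i x.
     (s, i) \<in> facets d G \<and> x \<in> standard_simplex d \<and> x i = 0}"

definition point_class :: "nat \<Rightarrow> pairing \<Rightarrow> nat \<times> (nat \<Rightarrow> real) \<Rightarrow> (nat \<times> (nat \<Rightarrow> real)) set" where
  "point_class d G p = point_identification d G `` {p}"

definition simplex_points :: "nat \<Rightarrow> pairing \<Rightarrow> (nat \<times> (nat \<Rightarrow> real)) set" where
  "simplex_points d G = {..<num_simplices G} \<times> standard_simplex d"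

text \<open>Rewritten as a subspace in the type class topology of pairs, with \<open>nat\<close>
  discrete, so that the continuity and compactness theory of analysis applies.\<close>

lemma disjoint_simplices_eq: "disjoint_simplices d G = top_of_set (simplex_points d G)"
proof -
  have "discrete_topology {..<num_simplices G} = top_of_set {..<num_simplices G}"
    by (rule topology_eq[THEN iffD2]) (auto simp: openin_open open_discrete)
  then show ?thesis
    by (simp add: disjoint_simplices_def euclidean_product_topology simplex_points_def
        flip: subtopology_Times)
qed

lemma topspace_disjoint_simplices [simp]:
  "topspace (disjoint_simplices d G) = simplex_points d G"
  by (simp add: disjoint_simplices_eq)

lemma equiv_point_identification: "equiv (simplex_points d G) (point_identification d G)"
  unfolding point_identification_def using equiv_equivalence_on by fastforce

lemma point_class_self: "p \<in> simplex_points d G \<Longrightarrow> p \<in> point_class d G p"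
  unfolding point_class_def by (rule equiv_class_self[OF equiv_point_identification])

lemma point_class_eqI: "p' \<in> point_class d G p \<Longrightarrow> point_class d G p' = point_class d G p"
  unfolding point_class_def using equiv_class_eq[OF equiv_point_identification] by (metis Image_singleton_iff)

lemma topspace_complex_space: "topspace (complex_space d G) = point_class d G ` simplex_points d G"
  unfolding complex_space_def
  by (subst topspace_quotient_space)
    (use equiv_point_identification in \<open>auto simp: quotient_def point_class_def\<close>)

lemma quotient_map_point_class:
  "quotient_map (top_of_set (simplex_points d G)) (complex_space d G) (point_class d G)"
proof -
  have "quotient_map (disjoint_simplices d G) (complex_space d G)
          (\<lambda>x. point_identification d G `` {x})"
    unfolding complex_space_def
    by (rule quotient_map_quotient_space) (use equiv_point_identification in auto)
  then show ?thesis
    by (simp add: disjoint_simplices_eq point_class_def[abs_def])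
qed

lemma compact_simplex_points: "compact (simplex_points d G)"
proof -
  have "compact (standard_simplex d)"
    using compactin_standard_simplex[of d] by (simp add: euclidean_product_topology)
  then show ?thesis
    unfolding simplex_points_def by (intro compact_Times) (auto simp: finite_imp_compact)
qed

lemma compact_complex_space: "compact_space (complex_space d G)"
proof -
  have "compact_space (top_of_set (simplex_points d G))"
    using compact_simplex_points compact_space_subtopology compactin_euclidean_iff by blast
  then have "compactin (complex_space d G) (point_class d G ` simplex_points d G)"
    using image_compactin[OF _ quotient_imp_continuous_map[OF quotient_map_point_class]]
    by (simp add: compact_space_def)
  then show ?thesis by (simp add: compact_space_def topspace_complex_space)
qed

section \<open>Facet pairings and invariants of glued points\<close>

locale facet_pairing =
  fixes d :: nat and G :: pairing
  assumes pairing: "face_pairing d G"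
begin

lemma mate_in: "F \<in> facets d G \<Longrightarrow> mate G F \<in> facets d G"
  and mate_mate: "F \<in> facets d G \<Longrightarrow> mate G (mate G F) = F"
  and mate_neq: "F \<in> facets d G \<Longrightarrow> mate G F \<noteq> F"
  and vmap_bij: "F \<in> facets d G \<Longrightarrow> bij_betw (vmap G F) (facet_vertices d F) (facet_vertices d (mate G F))"
  and vmap_inverse: "F \<in> facets d G \<Longrightarrow> v \<in> facet_vertices d F \<Longrightarrow> vmap G (mate G F) (vmap G F v) = v"
  using pairing by (auto simp: face_pairing_def)

lemma vmap_in: "F \<in> facets d G \<Longrightarrow> v \<in> facet_vertices d F \<Longrightarrow> vmap G F v \<in> facet_vertices d (mate G F)"
  using vmap_bij bij_betwE by blast

text \<open>The vertex bijection is injective, so the defining sum has at most one nonzero term; the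
  inverse bijection \<open>vmap G (mate G F)\<close> names it.\<close>

lemma affine_extension_eq:
  assumes F: "F \<in> facets d G"
  shows "affine_extension d G F x =
    (\<lambda>w. if w \<in> facet_vertices d (mate G F) then x (vmap G (mate G F) w) else 0)"
proof
  fix w
  have fin: "finite (facet_vertices d F)" by (simp add: facet_vertices_def)
  show "affine_extension d G F x w =
    (if w \<in> facet_vertices d (mate G F) then x (vmap G (mate G F) w) else 0)"
  proof (cases "w \<in> facet_vertices d (mate G F)")
    case True
    let ?u = "vmap G (mate G F) w"
    have u: "?u \<in> facet_vertices d F" "vmap G F ?u = w"
      using vmap_in[OF mate_in[OF F] True] vmap_inverse[OF mate_in[OF F] True] mate_mate[OF F] by auto
    have "vmap G F v = w \<longleftrightarrow> v = ?u" if "v \<in> facet_vertices d F" for v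
      using vmap_inverse[OF F that] u by auto
    then have "affine_extension d G F x w = (\<Sum>v\<in>facet_vertices d F. if v = ?u then x v else 0)"
      unfolding affine_extension_def by (intro sum.cong) auto
    also have "\<dots> = x ?u" using u fin by simp
    finally show ?thesis using True by simp
  next
    case False
    then have "vmap G F v \<noteq> w" if "v \<in> facet_vertices d F" for v
      using vmap_in[OF F that] by auto
    then have "affine_extension d G F x w = 0"
      unfolding affine_extension_def by (intro sum.neutral) auto
    then show ?thesis using False by simp
  qed
qed

lemma affine_extension_vmap:
  assumes "F \<in> facets d G" "v \<in> facet_vertices d F"
  shows "affine_extension d G F x (vmap G F v) = x v"
  using assms by (simp add: affine_extension_eq vmap_in vmap_inverse)

lemma affine_extension_mate: "F \<in> facets d G \<Longrightarrow> affine_extension d G F x (snd (mate G F)) = 0"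
  by (simp add: affine_extension_eq facet_vertices_def)

lemma affine_extension_in_simplex:
  assumes F: "F \<in> facets d G" and x: "x \<in> standard_simplex d" "x (snd F) = 0"
  shows "affine_extension d G F x \<in> standard_simplex d"
proof -
  have sF: "snd F \<le> d" "snd (mate G F) \<le> d" using F mate_in[OF F] by (auto simp: facets_def)
  have split: "(\<Sum>i\<le>d. g i) = g j + sum g ({..d} - {j})" if "j \<le> d" for j and g :: "nat \<Rightarrow> real"
    using that by (simp add: sum.remove)
  have "(\<Sum>i\<le>d. affine_extension d G F x i) = (\<Sum>i\<in>facet_vertices d (mate G F). x (vmap G (mate G F) i))"
    by (subst split[OF sF(2)]) (simp add: affine_extension_eq[OF F] facet_vertices_def)
  also have "\<dots> = (\<Sum>i\<in>facet_vertices d F. x i)"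
    using sum.reindex_bij_betw[OF vmap_bij[OF mate_in[OF F]], of x] mate_mate[OF F] by simp
  also have "\<dots> = (\<Sum>i\<le>d. x i)"
    by (subst split[OF sF(1)]) (simp add: facet_vertices_def x)
  also have "\<dots> = 1" using x by (simp add: standard_simplex_def)
  finally show ?thesis
    using x by (auto simp: standard_simplex_def affine_extension_eq[OF F] facet_vertices_def)
qed

lemma affine_extension_inverse:
  assumes F: "F \<in> facets d G" and x: "x \<in> standard_simplex d" "x (snd F) = 0"
  shows "affine_extension d G (mate G F) (affine_extension d G F x) = x"
proof
  fix w
  show "affine_extension d G (mate G F) (affine_extension d G F x) w = x w"
    using x vmap_in[OF F] vmap_inverse[OF F]
    by (auto simp: affine_extension_eq[OF F] affine_extension_eq[OF mate_in[OF F]] mate_mate[OF F]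
        facet_vertices_def standard_simplex_def not_le)
qed

lemma facet_gluingI:
  assumes "(s, i) \<in> facets d G" "x \<in> standard_simplex d" "x i = 0"
  shows "((s, x), (fst (mate G (s, i)), affine_extension d G (s, i) x)) \<in> facet_gluing d G"
  using assms by (auto simp: facet_gluing_def)

lemma facet_gluing_subset: "facet_gluing d G \<subseteq> simplex_points d G \<times> simplex_points d G"
  using mate_in affine_extension_in_simplex
  by (fastforce simp: facet_gluing_def simplex_points_def facets_def)

text \<open>Gluing across the mate undoes a gluing. The generators are thus already symmetric, and
  inductions over a point class need only one kind of step.\<close>

lemma sym_facet_gluing: "sym (facet_gluing d G)"
proof (rule symI)
  fix p q assume "(p, q) \<in> facet_gluing d G"
  then obtain s i x where *: "(s, i) \<in> facets d G" "x \<in> standard_simplex d" "x i = 0"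
    and p: "p = (s, x)" and q: "q = (fst (mate G (s, i)), affine_extension d G (s, i) x)"
    by (auto simp: facet_gluing_def)
  obtain t j where m: "mate G (s, i) = (t, j)" by fastforce
  have "((t, affine_extension d G (s, i) x), (fst (mate G (t, j)),
      affine_extension d G (t, j) (affine_extension d G (s, i) x))) \<in> facet_gluing d G"
    using * mate_in[OF *(1)] affine_extension_in_simplex[OF *(1)] affine_extension_mate[OF *(1)] m
    by (intro facet_gluingI) auto
  then show "(q, p) \<in> facet_gluing d G"
    using mate_mate[OF *(1)] affine_extension_inverse[OF *(1,2)] * p q m by simp
qed

lemma point_identification_eq:
  "point_identification d G = Restr ((facet_gluing d G)\<^sup>*) (simplex_points d G)"
  unfolding point_identification_def
  using equivalence_on_rtrancl[OF sym_facet_gluing]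
  by (simp add: facet_gluing_def)

lemma point_identification_gluing:
  assumes "(s, i) \<in> facets d G" "x \<in> standard_simplex d" "x i = 0"
  shows "((s, x), (fst (mate G (s, i)), affine_extension d G (s, i) x)) \<in> point_identification d G"
  using facet_gluingI[OF assms] facet_gluing_subset unfolding point_identification_eq by blast

lemma point_class_gluing:
  assumes "(s, i) \<in> facets d G" "x \<in> standard_simplex d" "x i = 0"
  shows "point_class d G (fst (mate G (s, i)), affine_extension d G (s, i) x) = point_class d G (s, x)"
  using point_identification_gluing[OF assms]
  unfolding point_class_def by (metis equiv_class_eq equiv_point_identification)

lemma point_identification_induct [consumes 1, case_names start glue]:
  assumes "(p, q) \<in> point_identification d G" and "P p"
    and "\<And>s i x. \<lbrakk>(s, i) \<in> facets d G; x \<in> standard_simplex d; x i = 0; P (s, x)\<rbrakk>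
      \<Longrightarrow> P (fst (mate G (s, i)), affine_extension d G (s, i) x)"
  shows "P q"
proof -
  have "(p, q) \<in> (facet_gluing d G)\<^sup>*" using assms(1) by (auto simp: point_identification_eq)
  then show ?thesis
    by (induction rule: rtrancl_induct) (use assms(2,3) in \<open>auto simp: facet_gluing_def\<close>)
qed

lemma point_class_induct [consumes 1, case_names start glue]:
  assumes "q \<in> point_class d G p" and "P p"
    and "\<And>s i x. \<lbrakk>(s, i) \<in> facets d G; x \<in> standard_simplex d; x i = 0; P (s, x)\<rbrakk>
      \<Longrightarrow> P (fst (mate G (s, i)), affine_extension d G (s, i) x)"
  shows "P q"
proof (rule point_identification_induct)
  show "(p, q) \<in> point_identification d G" using assms(1) by (simp add: point_class_def)
qed (use assms(2,3) in blast)+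

text \<open>A gluing permutes coordinates and fills in a zero, so the set of coordinate values is an
  invariant of the class. Whether all values are \<le> 3/4, or whether 3/4 is attained, can hence be
  read off any representative.\<close>

lemma range_point_class:
  assumes "(t, y) \<in> point_class d G (s, x)"
  shows "range y = range x"
proof -
  have sub: "range (affine_extension d G F z) \<subseteq> range z"
    if "F \<in> facets d G" "z \<in> standard_simplex d" for F z
  proof -
    \<comment> \<open>Zero is a value of every point because of the indices beyond \<open>d\<close>,
      so the zeros filled in off the facet add no new value.\<close>
    have "z (Suc d) = 0" using that by (simp add: standard_simplex_def)
    then have "0 \<in> range z" by (metis rangeI)
    then show ?thesis unfolding affine_extension_eq[OF that(1)] by (simp add: image_subset_iff)
  qed
  have eq: "range (affine_extension d G F z) = range z"
    if F: "F \<in> facets d G" and z: "z \<in> standard_simplex d" "z (snd F) = 0" for F z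
    using sub[OF F z(1)] sub[OF mate_in[OF F] affine_extension_in_simplex[OF F z]]
      affine_extension_inverse[OF F z] by simp
  have "range (snd (t, y)) = range x"
    by (rule point_class_induct[OF assms, where P = "\<lambda>q. range (snd q) = range x"])
      (use eq in auto)
  then show ?thesis by simp
qed

end

section \<open>Dividing the plane into equal wedges\<close>

definition ray_angle :: "nat \<Rightarrow> nat \<Rightarrow> real" where
  "ray_angle N \<kappa> = 2 * pi * real \<kappa> / real N"

text \<open>\<open>wedge_u\<close> and \<open>wedge_v\<close> are the coordinates of the point \<open>(a, b)\<close> with respect to the unit vectors
  of the rays numbered \<open>\<kappa>\<close> and \<open>\<kappa> + 1\<close>.\<close>

definition wedge_u :: "nat \<Rightarrow> nat \<Rightarrow> real \<Rightarrow> real \<Rightarrow> real" where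
  "wedge_u N \<kappa> a b =
     (a * sin (ray_angle N (Suc \<kappa>)) - b * cos (ray_angle N (Suc \<kappa>))) / sin (ray_angle N 1)"

definition wedge_v :: "nat \<Rightarrow> nat \<Rightarrow> real \<Rightarrow> real \<Rightarrow> real" where
  "wedge_v N \<kappa> a b =
     (b * cos (ray_angle N \<kappa>) - a * sin (ray_angle N \<kappa>)) / sin (ray_angle N 1)"

lemma sin_ray_angle_pos:
  assumes "3 \<le> N"
  shows "0 < sin (ray_angle N 1)"
proof (rule sin_gt_zero)
  show "0 < ray_angle N 1" using assms by (simp add: ray_angle_def)
  have "2 * pi < pi * real N" using assms by simp
  then show "ray_angle N 1 < pi" using assms by (simp add: ray_angle_def field_simps)
qed

lemma ray_angle_Suc: "ray_angle N (Suc \<kappa>) = ray_angle N \<kappa> + ray_angle N 1"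
  by (simp add: ray_angle_def field_simps add_divide_distrib)

lemma ray_angle_period:
  assumes "0 < N"
  shows "cos (ray_angle N (\<kappa> + N)) = cos (ray_angle N \<kappa>)"
    and "sin (ray_angle N (\<kappa> + N)) = sin (ray_angle N \<kappa>)"
proof -
  have "ray_angle N (\<kappa> + N) = ray_angle N \<kappa> + 2 * pi"
    using assms by (simp add: ray_angle_def field_simps)
  then show "cos (ray_angle N (\<kappa> + N)) = cos (ray_angle N \<kappa>)"
    "sin (ray_angle N (\<kappa> + N)) = sin (ray_angle N \<kappa>)" by simp_all
qed

lemma sin_ray_angle_1:
  "sin (ray_angle N 1) = sin (ray_angle N (Suc \<kappa>)) * cos (ray_angle N \<kappa>)
     - cos (ray_angle N (Suc \<kappa>)) * sin (ray_angle N \<kappa>)"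
proof -
  have "ray_angle N 1 = ray_angle N (Suc \<kappa>) - ray_angle N \<kappa>"
    using ray_angle_Suc[of N \<kappa>] by simp
  then show ?thesis by (simp add: sin_diff)
qed

lemma wedge_coordinates:
  assumes N: "3 \<le> N"
    and a: "a = p * cos (ray_angle N \<kappa>) + q * cos (ray_angle N (Suc \<kappa>))"
    and b: "b = p * sin (ray_angle N \<kappa>) + q * sin (ray_angle N (Suc \<kappa>))"
  shows "wedge_u N \<kappa> a b = p" "wedge_v N \<kappa> a b = q"
proof -
  let ?S = "sin (ray_angle N 1)"
  have S: "?S \<noteq> 0" using sin_ray_angle_pos[OF N] by simp
  have "a * sin (ray_angle N (Suc \<kappa>)) - b * cos (ray_angle N (Suc \<kappa>)) = p * ?S"
    unfolding a b sin_ray_angle_1[of N \<kappa>] by (simp add: algebra_simps)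
  then show "wedge_u N \<kappa> a b = p" using S by (simp add: wedge_u_def)
  have "b * cos (ray_angle N \<kappa>) - a * sin (ray_angle N \<kappa>) = q * ?S"
    unfolding a b sin_ray_angle_1[of N \<kappa>] by (simp add: algebra_simps)
  then show "wedge_v N \<kappa> a b = q" using S by (simp add: wedge_v_def)
qed

lemma wedge_combination:
  assumes N: "3 \<le> N"
  shows "wedge_u N \<kappa> a b * cos (ray_angle N \<kappa>) + wedge_v N \<kappa> a b * cos (ray_angle N (Suc \<kappa>)) = a"
    and "wedge_u N \<kappa> a b * sin (ray_angle N \<kappa>) + wedge_v N \<kappa> a b * sin (ray_angle N (Suc \<kappa>)) = b"
proof -
  let ?S = "sin (ray_angle N 1)"
  have S: "?S \<noteq> 0" using sin_ray_angle_pos[OF N] by simp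
  let ?c = "cos (ray_angle N \<kappa>)" and ?c' = "cos (ray_angle N (Suc \<kappa>))"
  let ?s = "sin (ray_angle N \<kappa>)" and ?s' = "sin (ray_angle N (Suc \<kappa>))"
  have "(a * ?s' - b * ?c') * ?c + (b * ?c - a * ?s) * ?c' = a * ?S"
    unfolding sin_ray_angle_1[of N \<kappa>] by (simp add: algebra_simps)
  then show "wedge_u N \<kappa> a b * ?c + wedge_v N \<kappa> a b * ?c' = a"
    using S by (simp add: wedge_u_def wedge_v_def field_simps)
  have "(a * ?s' - b * ?c') * ?s + (b * ?c - a * ?s) * ?s' = b * ?S"
    unfolding sin_ray_angle_1[of N \<kappa>] by (simp add: algebra_simps)
  then show "wedge_u N \<kappa> a b * ?s + wedge_v N \<kappa> a b * ?s' = b"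
    using S by (simp add: wedge_u_def wedge_v_def field_simps)
qed

text \<open>\<open>\<tau>\<close> is the polar angle measured in wedges, so that ray
  \<open>\<kappa>\<close> lies at \<open>\<tau> = \<kappa>\<close>. For \<open>r > 0\<close> the
  signs of both wedge coordinates then depend only on \<open>\<tau> - \<kappa>\<close>.\<close>

lemma wedge_polar:
  assumes "0 < N"
  obtains r \<tau> where "0 \<le> r" "0 \<le> \<tau>" "\<tau> < real N" "(r = 0 \<longleftrightarrow> a = 0 \<and> b = 0)"
    "\<forall>\<kappa>. wedge_u N \<kappa> a b = r * sin (ray_angle N 1 * (1 - (\<tau> - real \<kappa>))) / sin (ray_angle N 1)"
    "\<forall>\<kappa>. wedge_v N \<kappa> a b = r * sin (ray_angle N 1 * (\<tau> - real \<kappa>)) / sin (ray_angle N 1)"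
proof -
  define z where "z = Complex a b"
  define \<phi> where "\<phi> = Arg2pi z"
  have z: "z = of_real (cmod z) * exp (\<i> * of_real \<phi>)" "0 \<le> \<phi>" "\<phi> < 2 * pi"
    unfolding \<phi>_def using Arg2pi[of z] by (auto simp: is_Arg_def)
  have a: "a = cmod z * cos \<phi>" and b: "b = cmod z * sin \<phi>"
    using arg_cong[OF z(1), of Re] arg_cong[OF z(1), of Im] by (simp_all add: z_def Re_exp Im_exp)
  define \<tau> where "\<tau> = \<phi> * real N / (2 * pi)"
  have ang: "ray_angle N 1 * (\<tau> - real \<kappa>) = \<phi> - ray_angle N \<kappa>"
    "ray_angle N 1 * (1 - (\<tau> - real \<kappa>)) = ray_angle N (Suc \<kappa>) - \<phi>" for \<kappa>
    using assms by (simp_all add: \<tau>_def ray_angle_def field_simps)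
  show thesis
  proof
    show "0 \<le> cmod z" by simp
    show "0 \<le> \<tau>" using z by (simp add: \<tau>_def)
    show "\<tau> < real N" using z assms by (simp add: \<tau>_def field_simps)
    show "cmod z = 0 \<longleftrightarrow> a = 0 \<and> b = 0" by (auto simp: z_def complex_eq_iff)
    show "\<forall>\<kappa>. wedge_u N \<kappa> a b = cmod z * sin (ray_angle N 1 * (1 - (\<tau> - real \<kappa>))) / sin (ray_angle N 1)"
    proof
      fix \<kappa>
      have "a * sin (ray_angle N (Suc \<kappa>)) - b * cos (ray_angle N (Suc \<kappa>)) = cmod z * sin (ray_angle N (Suc \<kappa>) - \<phi>)"
        by (subst a, subst b) (simp add: sin_diff algebra_simps)
      then show "wedge_u N \<kappa> a b = cmod z * sin (ray_angle N 1 * (1 - (\<tau> - real \<kappa>))) / sin (ray_angle N 1)"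
        unfolding wedge_u_def ang by simp
    qed
    show "\<forall>\<kappa>. wedge_v N \<kappa> a b = cmod z * sin (ray_angle N 1 * (\<tau> - real \<kappa>)) / sin (ray_angle N 1)"
    proof
      fix \<kappa>
      have "b * cos (ray_angle N \<kappa>) - a * sin (ray_angle N \<kappa>) = cmod z * sin (\<phi> - ray_angle N \<kappa>)"
        by (subst a, subst b) (simp add: sin_diff algebra_simps)
      then show "wedge_v N \<kappa> a b = cmod z * sin (ray_angle N 1 * (\<tau> - real \<kappa>)) / sin (ray_angle N 1)"
        unfolding wedge_v_def ang by simp
    qed
  qed
qed

lemma wedge_cover:
  assumes N: "3 \<le> N"
  obtains \<kappa> where "\<kappa> < N" "0 \<le> wedge_u N \<kappa> a b" "0 \<le> wedge_v N \<kappa> a b"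
proof -
  have N0: "0 < N" using N by simp
  obtain r \<tau> where r: "0 \<le> r" "0 \<le> \<tau>" "\<tau> < real N" "r = 0 \<longleftrightarrow> a = 0 \<and> b = 0"
    and uv: "\<forall>\<kappa>. wedge_u N \<kappa> a b = r * sin (ray_angle N 1 * (1 - (\<tau> - real \<kappa>))) / sin (ray_angle N 1)"
    "\<forall>\<kappa>. wedge_v N \<kappa> a b = r * sin (ray_angle N 1 * (\<tau> - real \<kappa>)) / sin (ray_angle N 1)"
    by (rule wedge_polar[of N a b, OF N0])
  note uv = uv[rule_format]
  define \<kappa> where "\<kappa> = nat \<lfloor>\<tau>\<rfloor>"
  have \<kappa>: "real \<kappa> \<le> \<tau>" "\<tau> \<le> real \<kappa> + 1" "\<kappa> < N"
    using r unfolding \<kappa>_def by linarith+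
  have ang: "0 \<le> ray_angle N 1" "ray_angle N 1 \<le> pi"
    using N by (simp_all add: ray_angle_def field_simps)
  have "0 \<le> sin (ray_angle N 1 * y)" if "0 \<le> y" "y \<le> 1" for y
    using that ang mult_mono[of "ray_angle N 1" pi y 1] by (intro sin_ge_zero) auto
  then have "0 \<le> wedge_u N \<kappa> a b" "0 \<le> wedge_v N \<kappa> a b"
    unfolding uv using \<kappa> r sin_ray_angle_pos[OF N] by (auto intro!: divide_nonneg_nonneg mult_nonneg_nonneg)
  with \<kappa>(3) show thesis by (rule that)
qed

text \<open>Here \<open>y\<close> stands for \<open>\<tau> - \<kappa>\<close>. If
  \<open>y > 1\<close>, nonnegativity of the first sine keeps the angle of \<open>y\<close> at most
  pi, which makes the second sine negative. A negative \<open>y\<close> is first moved up by a full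
  turn, that is by \<open>N\<close>; this produces the second alternative.\<close>

lemma wedge_angle_cases:
  assumes N: "3 \<le> N" and y: "-real N < y" "y < real N"
    and sin: "0 \<le> sin (ray_angle N 1 * y)" "0 \<le> sin (ray_angle N 1 * (1 - y))"
  shows "0 \<le> y \<and> y \<le> 1 \<or> y + real N \<le> 1"
proof -
  have ang: "0 < ray_angle N 1" "ray_angle N 1 < pi" "ray_angle N 1 * real N = 2 * pi"
    using N by (simp_all add: ray_angle_def field_simps)
  have main: "y \<le> 1" if "0 \<le> y" "y < real N" "0 \<le> sin (ray_angle N 1 * y)"
    "0 \<le> sin (ray_angle N 1 * (1 - y))" for y
  proof (rule ccontr)
    assume "\<not> y \<le> 1"
    have "ray_angle N 1 * y < 2 * pi"
      using that ang by (metis mult_strict_left_mono)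
    then have "ray_angle N 1 * y \<le> pi" using that(3) sin_lt_zero[of "ray_angle N 1 * y"] by linarith
    then have "0 < ray_angle N 1 * (y - 1)" "ray_angle N 1 * (y - 1) < pi"
      using ang \<open>\<not> y \<le> 1\<close> by (simp_all add: algebra_simps)
    then have "0 < sin (ray_angle N 1 * (y - 1))" by (rule sin_gt_zero)
    moreover have "sin (ray_angle N 1 * (1 - y)) = - sin (ray_angle N 1 * (y - 1))"
      by (metis minus_diff_eq mult_minus_right sin_minus)
    ultimately show False using that(4) by linarith
  qed
  show ?thesis
  proof (cases "0 \<le> y")
    case True
    then show ?thesis using main y sin by auto
  next
    case False
    have "ray_angle N 1 * (y + real N) = ray_angle N 1 * y + 2 * pi"
      "ray_angle N 1 * (1 - (y + real N)) = ray_angle N 1 * (1 - y) - 2 * pi"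
      using ang(3) by (simp_all add: algebra_simps)
    then have "0 \<le> sin (ray_angle N 1 * (y + real N))" "0 \<le> sin (ray_angle N 1 * (1 - (y + real N)))"
      using sin by (simp_all add: sin_diff)
    then show ?thesis using main[of "y + real N"] y False by auto
  qed
qed

text \<open>Two different intervals from \<open>\<kappa>\<close> to \<open>\<kappa> + 1\<close>
  share \<open>\<tau>\<close> only at a common end, that is, on a ray. Since
  \<open>\<tau> < N\<close>, the ray between the last wedge and the first appears as
  \<open>\<tau> = 0\<close> and is treated separately.\<close>

lemma wedge_overlap:
  assumes N: "3 \<le> N" and \<kappa>: "\<kappa> < N" "\<kappa>' < N" "\<kappa> \<noteq> \<kappa>'"
    and w: "0 \<le> wedge_u N \<kappa> a b" "0 \<le> wedge_v N \<kappa> a b"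
    and w': "0 \<le> wedge_u N \<kappa>' a b" "0 \<le> wedge_v N \<kappa>' a b"
    and nz: "\<not> (a = 0 \<and> b = 0)"
  shows "\<kappa>' = Suc \<kappa> mod N \<and> wedge_u N \<kappa> a b = 0 \<and> 0 < wedge_v N \<kappa> a b \<or>
         \<kappa> = Suc \<kappa>' mod N \<and> wedge_u N \<kappa>' a b = 0 \<and> 0 < wedge_v N \<kappa>' a b"
proof -
  have N0: "0 < N" using N by simp
  obtain r \<tau> where r: "0 \<le> r" "0 \<le> \<tau>" "\<tau> < real N" "r = 0 \<longleftrightarrow> a = 0 \<and> b = 0"
    and uv: "\<forall>\<kappa>. wedge_u N \<kappa> a b = r * sin (ray_angle N 1 * (1 - (\<tau> - real \<kappa>))) / sin (ray_angle N 1)"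
    "\<forall>\<kappa>. wedge_v N \<kappa> a b = r * sin (ray_angle N 1 * (\<tau> - real \<kappa>)) / sin (ray_angle N 1)"
    by (rule wedge_polar[of N a b, OF N0])
  note uv = uv[rule_format]
  have S: "0 < sin (ray_angle N 1)" by (rule sin_ray_angle_pos[OF N])
  have rpos: "0 < r" using r nz by linarith
  have nonneg: "0 \<le> x" if "0 \<le> r * x / sin (ray_angle N 1)" for x
    using that rpos S by (simp add: zero_le_divide_iff zero_le_mult_iff)
  have cases: "0 \<le> \<tau> - real k \<and> \<tau> - real k \<le> 1 \<or> Suc k = N \<and> \<tau> = 0"
    if "k < N" "0 \<le> wedge_u N k a b" "0 \<le> wedge_v N k a b" for k
  proof -
    have "0 \<le> \<tau> - real k \<and> \<tau> - real k \<le> 1 \<or> \<tau> - real k + real N \<le> 1"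
    proof (intro wedge_angle_cases[OF N])
      show "0 \<le> sin (ray_angle N 1 * (\<tau> - real k))" "0 \<le> sin (ray_angle N 1 * (1 - (\<tau> - real k)))"
        using that(2,3) unfolding uv by (auto intro: nonneg)
    qed (use that(1) r in auto)
    then show ?thesis using that(1) r by linarith
  qed
  have at1: "wedge_u N k a b = 0 \<and> 0 < wedge_v N k a b" if "\<tau> = real (Suc k)" for k
    unfolding uv using that S rpos by simp
  have at0: "wedge_u N k a b = 0 \<and> 0 < wedge_v N k a b" if "\<tau> = 0" "Suc k = N" for k
  proof -
    have N': "real N = 1 + real k" using that by simp
    have e: "ray_angle N 1 * (1 - (\<tau> - real k)) = 2 * pi" 
      using that N unfolding ray_angle_def N' by (simp add: field_simps)
    have "ray_angle N 1 * (\<tau> - real k) = ray_angle N 1 - 2 * pi"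
      using that e by (simp add: algebra_simps)
    then have "sin (ray_angle N 1 * (\<tau> - real k)) = sin (ray_angle N 1)" by (simp add: sin_diff)
    then show ?thesis unfolding uv e using S rpos by simp
  qed
  from cases[OF \<kappa>(1) w] cases[OF \<kappa>(2) w'] show ?thesis
  proof (elim disjE)
    assume h: "0 \<le> \<tau> - real \<kappa> \<and> \<tau> - real \<kappa> \<le> 1" "0 \<le> \<tau> - real \<kappa>' \<and> \<tau> - real \<kappa>' \<le> 1"
    then have "\<kappa>' = Suc \<kappa> \<and> \<tau> = real (Suc \<kappa>) \<or> \<kappa> = Suc \<kappa>' \<and> \<tau> = real (Suc \<kappa>')"
      using \<kappa>(3) by (cases "\<kappa> < \<kappa>'") linarith+
    then show ?thesis using at1 \<kappa> by auto
  next
    assume h: "0 \<le> \<tau> - real \<kappa> \<and> \<tau> - real \<kappa> \<le> 1" "Suc \<kappa>' = N \<and> \<tau> = 0"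
    then have "\<kappa> = 0" by auto
    then show ?thesis using at0[of \<kappa>'] h by auto
  next
    assume h: "Suc \<kappa> = N \<and> \<tau> = 0" "0 \<le> \<tau> - real \<kappa>' \<and> \<tau> - real \<kappa>' \<le> 1"
    then have "\<kappa>' = 0" by auto
    then show ?thesis using at0[of \<kappa>] h by auto
  next
    assume "Suc \<kappa> = N \<and> \<tau> = 0" "Suc \<kappa>' = N \<and> \<tau> = 0"
    then show ?thesis using \<kappa> by auto
  qed
qed

section \<open>The star of an edge\<close>

abbreviation E3 :: "(nat \<Rightarrow> real) set" where
  "E3 \<equiv> {w. \<forall>n\<ge>3. w n = 0}"

lemma Euclidean_space_3: "Euclidean_space 3 = top_of_set E3"
  by (simp add: Euclidean_space_def euclidean_product_topology)

lemma closed_E3: "closed E3"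
  using closedin_Euclidean_space[of 3] by (simp add: euclidean_product_topology topspace_Euclidean_space)

lemma E3_eqI:
  assumes "w \<in> E3" "w' \<in> E3" "w 0 = w' 0" "w 1 = w' 1" "w 2 = w' 2"
  shows "w = w'"
proof
  fix n :: nat
  consider "n = 0" | "n = 1" | "n = 2" | "n \<ge> 3" by linarith
  then show "w n = w' n" by cases (use assms in auto)
qed

lemma continuous_on_if_const:
  assumes "continuous_on S f" "continuous_on S g"
  shows "continuous_on S (\<lambda>x. if P then f x else g x)"
  using assms by (cases P) auto

text \<open>The tetrahedra \<open>tet \<kappa>\<close> are arranged cyclically around an edge, which joins the vertices \<open>vi \<kappa>\<close>
  and \<open>vj \<kappa>\<close> of \<open>tet \<kappa>\<close>; one crosses from \<open>tet \<kappa>\<close> to \<open>tet (\<kappa> + 1)\<close> through the facet opposite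
  \<open>vk \<kappa>\<close>, that is, the facet opposite \<open>vl (\<kappa> + 1)\<close>. The indices are taken modulo \<open>N\<close>.\<close>

locale fan = facet_pairing 3 G for G +
  fixes N :: nat and tet vi vj vk vl :: "nat \<Rightarrow> nat"
  assumes N: "3 \<le> N"
    and period: "tet (\<kappa> + N) = tet \<kappa>" "vi (\<kappa> + N) = vi \<kappa>" "vj (\<kappa> + N) = vj \<kappa>"
      "vk (\<kappa> + N) = vk \<kappa>" "vl (\<kappa> + N) = vl \<kappa>"
    and tet_less: "tet \<kappa> < num_simplices G"
    and vertices: "{..3} = {vi \<kappa>, vj \<kappa>, vk \<kappa>, vl \<kappa>}"
    and distinct: "distinct [vi \<kappa>, vj \<kappa>, vk \<kappa>, vl \<kappa>]"
    and cross: "mate G (tet \<kappa>, vk \<kappa>) = (tet (Suc \<kappa>), vl (Suc \<kappa>))"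
      "vmap G (tet \<kappa>, vk \<kappa>) (vi \<kappa>) = vi (Suc \<kappa>)"
      "vmap G (tet \<kappa>, vk \<kappa>) (vj \<kappa>) = vj (Suc \<kappa>)"
      "vmap G (tet \<kappa>, vk \<kappa>) (vl \<kappa>) = vk (Suc \<kappa>)"
    and once: "\<lbrakk>\<kappa> < N; \<kappa>' < N; tet \<kappa> = tet \<kappa>'; {vi \<kappa>, vj \<kappa>} = {vi \<kappa>', vj \<kappa>'}\<rbrakk> \<Longrightarrow> \<kappa> = \<kappa>'"
begin

abbreviation U :: "nat \<Rightarrow> (nat \<Rightarrow> real) \<Rightarrow> real" where "U \<kappa> w \<equiv> wedge_u N \<kappa> (w 1) (w 2)"
abbreviation V :: "nat \<Rightarrow> (nat \<Rightarrow> real) \<Rightarrow> real" where "V \<kappa> w \<equiv> wedge_v N \<kappa> (w 1) (w 2)"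

text \<open>The edge goes to the axis, and the weights of \<open>vk\<close> and \<open>vl\<close>
  are measured along the rays \<open>\<kappa>\<close> and \<open>\<kappa> + 1\<close>. The constant
  3/4 is the level of the truncation at \<open>vi\<close>, which thus becomes the plane where the
  first coordinate vanishes.\<close>

definition coords :: "nat \<Rightarrow> (nat \<Rightarrow> real) \<Rightarrow> nat \<Rightarrow> real" where
  "coords \<kappa> x = (\<lambda>n. if n = 0 then 3/4 - x (vi \<kappa>)
     else if n = 1 then x (vk \<kappa>) * cos (ray_angle N \<kappa>) + x (vl \<kappa>) * cos (ray_angle N (Suc \<kappa>))
     else if n = 2 then x (vk \<kappa>) * sin (ray_angle N \<kappa>) + x (vl \<kappa>) * sin (ray_angle N (Suc \<kappa>))
     else 0)"

text \<open>The inverse of \<open>coords \<kappa>\<close>; the value at \<open>vj \<kappa>\<close>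
  is whatever makes the coordinates sum to 1.\<close>

definition point :: "nat \<Rightarrow> (nat \<Rightarrow> real) \<Rightarrow> nat \<Rightarrow> real" where
  "point \<kappa> w = (\<lambda>n. if n = vi \<kappa> then 3/4 - w 0 else if n = vk \<kappa> then U \<kappa> w
     else if n = vl \<kappa> then V \<kappa> w else if n = vj \<kappa> then 1/4 + w 0 - U \<kappa> w - V \<kappa> w else 0)"

definition wedge :: "nat \<Rightarrow> (nat \<Rightarrow> real) set" where
  "wedge \<kappa> = {w. 0 \<le> U \<kappa> w \<and> 0 \<le> V \<kappa> w}"

text \<open>Imposing the condition in every wedge that contains the point makes the complement a
  finite union of closed sets, so that openness is immediate.\<close>

definition star :: "(nat \<Rightarrow> real) set" where
  "star = {w \<in> E3. \<forall>\<kappa><N. w \<in> wedge \<kappa> \<longrightarrow> 0 < point \<kappa> w (vi \<kappa>) \<and> 0 < point \<kappa> w (vj \<kappa>)}"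

text \<open>\<open>LEAST\<close> merely makes a choice; by \<open>chart_eq\<close> every wedge that
  contains a given point of the star yields the same class.\<close>

definition chart :: "(nat \<Rightarrow> real) \<Rightarrow> (nat \<times> (nat \<Rightarrow> real)) set" where
  "chart w = (let \<kappa> = (LEAST \<kappa>. \<kappa> < N \<and> w \<in> wedge \<kappa>) in point_class 3 G (tet \<kappa>, point \<kappa> w))"

lemma N_pos: "0 < N" using N by simp

lemma vertex_le: "vi \<kappa> \<le> 3" "vj \<kappa> \<le> 3" "vk \<kappa> \<le> 3" "vl \<kappa> \<le> 3"
  using vertices[of \<kappa>] by (auto simp flip: atMost_iff)

lemma vertex_neq:
  "vi \<kappa> \<noteq> vj \<kappa>" "vi \<kappa> \<noteq> vk \<kappa>" "vi \<kappa> \<noteq> vl \<kappa>" "vj \<kappa> \<noteq> vk \<kappa>" "vj \<kappa> \<noteq> vl \<kappa>" "vk \<kappa> \<noteq> vl \<kappa>"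
  "vj \<kappa> \<noteq> vi \<kappa>" "vk \<kappa> \<noteq> vi \<kappa>" "vl \<kappa> \<noteq> vi \<kappa>" "vk \<kappa> \<noteq> vj \<kappa>" "vl \<kappa> \<noteq> vj \<kappa>" "vl \<kappa> \<noteq> vk \<kappa>"
  using distinct[of \<kappa>] by auto

lemma vertex_cases: 
  obtains "n = vi \<kappa>" | "n = vj \<kappa>" | "n = vk \<kappa>" | "n = vl \<kappa>" | "3 < n"
  using vertices[of \<kappa>] by (metis atMost_iff insert_iff not_le singletonD)

lemma facet_in: "f \<le> 3 \<Longrightarrow> (tet \<kappa>, f) \<in> facets 3 G"
  using tet_less by (simp add: facets_def)

lemma point_simps [simp]:
  "point \<kappa> w (vi \<kappa>) = 3/4 - w 0" "point \<kappa> w (vk \<kappa>) = U \<kappa> w" "point \<kappa> w (vl \<kappa>) = V \<kappa> w"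
  "point \<kappa> w (vj \<kappa>) = 1/4 + w 0 - U \<kappa> w - V \<kappa> w" "3 < n \<Longrightarrow> point \<kappa> w n = 0"
  using vertex_neq[of \<kappa>] vertex_le[of \<kappa>] by (auto simp: point_def)

lemma coords_simps [simp]:
  "coords \<kappa> x 0 = 3/4 - x (vi \<kappa>)"
  "coords \<kappa> x (Suc 0) = x (vk \<kappa>) * cos (ray_angle N \<kappa>) + x (vl \<kappa>) * cos (ray_angle N (Suc \<kappa>))"
  "coords \<kappa> x 2 = x (vk \<kappa>) * sin (ray_angle N \<kappa>) + x (vl \<kappa>) * sin (ray_angle N (Suc \<kappa>))"
  by (auto simp: coords_def)

lemma coords_in_E3: "coords \<kappa> x \<in> E3"
  by (simp add: coords_def)

lemma sum_vertices: "(\<Sum>n\<le>3. x n) = x (vi \<kappa>) + x (vj \<kappa>) + x (vk \<kappa>) + x (vl \<kappa>)" for x :: "nat \<Rightarrow> real"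
  unfolding vertices[of \<kappa>] using vertex_neq[of \<kappa>] by simp

lemma simplex_nonneg: "x \<in> standard_simplex 3 \<Longrightarrow> 0 \<le> x n"
  by (simp add: standard_simplex_def)

lemma simplex_sum: "x \<in> standard_simplex 3 \<Longrightarrow> x (vi \<kappa>) + x (vj \<kappa>) + x (vk \<kappa>) + x (vl \<kappa>) = 1"
  using sum_vertices[of x \<kappa>] by (simp add: standard_simplex_def)

lemma UV_coords: "U \<kappa> (coords \<kappa> x) = x (vk \<kappa>)" "V \<kappa> (coords \<kappa> x) = x (vl \<kappa>)"
  using wedge_coordinates[OF N, of "coords \<kappa> x 1" "x (vk \<kappa>)" \<kappa> "x (vl \<kappa>)" "coords \<kappa> x 2"] by auto

lemma point_coords:
  assumes x: "x \<in> standard_simplex 3"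
  shows "point \<kappa> (coords \<kappa> x) = x"
proof
  fix n
  show "point \<kappa> (coords \<kappa> x) n = x n"
  proof (cases n rule: vertex_cases[of _ \<kappa>])
    case 5
    then show ?thesis using x by (simp add: standard_simplex_def)
  qed (use UV_coords simplex_sum[OF x, of \<kappa>] in auto)
qed

lemma coords_point:
  assumes "w \<in> E3"
  shows "coords \<kappa> (point \<kappa> w) = w"
  using wedge_combination[OF N, of \<kappa> "w 1" "w 2"]
  by (intro E3_eqI coords_in_E3 assms) (simp_all add: algebra_simps)

lemma coords_in_wedge: "x \<in> standard_simplex 3 \<Longrightarrow> coords \<kappa> x \<in> wedge \<kappa>"
  using UV_coords by (simp add: wedge_def simplex_nonneg)

lemma point_in_simplex:
  assumes "w \<in> wedge \<kappa>" "0 \<le> point \<kappa> w (vi \<kappa>)" "0 \<le> point \<kappa> w (vj \<kappa>)"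
  shows "point \<kappa> w \<in> standard_simplex 3"
proof -
  have nonneg: "0 \<le> point \<kappa> w n" for n
    by (cases n rule: vertex_cases[of _ \<kappa>]) (use assms in \<open>auto simp: wedge_def\<close>)
  have sum: "(\<Sum>n\<le>3. point \<kappa> w n) = 1" by (simp add: sum_vertices[of _ \<kappa>])
  have "point \<kappa> w n \<le> 1" for n
  proof (cases "n \<le> 3")
    case True
    then show ?thesis using sum nonneg member_le_sum[of n "{..3}" "point \<kappa> w"] by simp
  qed simp
  then show ?thesis using nonneg sum by (simp add: standard_simplex_def)
qed

lemma star_point:
  assumes "w \<in> star" "\<kappa> < N" "w \<in> wedge \<kappa>"
  shows "0 < point \<kappa> w (vi \<kappa>)" "0 < point \<kappa> w (vj \<kappa>)" "point \<kappa> w \<in> standard_simplex 3"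
proof -
  show "0 < point \<kappa> w (vi \<kappa>)" "0 < point \<kappa> w (vj \<kappa>)" using assms unfolding star_def by blast+
  then show "point \<kappa> w \<in> standard_simplex 3" using assms by (intro point_in_simplex) simp_all
qed

lemma star_E3: "w \<in> star \<Longrightarrow> w \<in> E3"
  by (simp add: star_def)

lemma wedge_exists:
  obtains \<kappa> where "\<kappa> < N" "w \<in> wedge \<kappa>"
  using wedge_cover[OF N, of "w 1" "w 2"] by (auto simp: wedge_def)

lemma period_mod: 
  "tet (\<kappa> mod N) = tet \<kappa>" "vi (\<kappa> mod N) = vi \<kappa>" "vj (\<kappa> mod N) = vj \<kappa>"
  "vk (\<kappa> mod N) = vk \<kappa>" "vl (\<kappa> mod N) = vl \<kappa>"
  "cos (ray_angle N (\<kappa> mod N)) = cos (ray_angle N \<kappa>)" "sin (ray_angle N (\<kappa> mod N)) = sin (ray_angle N \<kappa>)"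
  "cos (ray_angle N (Suc (\<kappa> mod N))) = cos (ray_angle N (Suc \<kappa>))"
  "sin (ray_angle N (Suc (\<kappa> mod N))) = sin (ray_angle N (Suc \<kappa>))"
proof -
  have *: "f (\<kappa> mod N) = f \<kappa>" if "\<And>\<kappa>. f (\<kappa> + N) = f \<kappa>" for f :: "nat \<Rightarrow> 'b"
  proof -
    have "f (a + b * N) = f a" for a b
    proof (induction b)
      case (Suc b)
      have "f (a + Suc b * N) = f ((a + b * N) + N)" by (simp add: algebra_simps)
      then show ?case using that[of "a + b * N"] Suc by simp
    qed simp
    from this[of "\<kappa> mod N" "\<kappa> div N"] show ?thesis by (simp add: mod_div_mult_eq)
  qed
  show "tet (\<kappa> mod N) = tet \<kappa>" "vi (\<kappa> mod N) = vi \<kappa>" "vj (\<kappa> mod N) = vj \<kappa>"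
    "vk (\<kappa> mod N) = vk \<kappa>" "vl (\<kappa> mod N) = vl \<kappa>"
    by (rule *[of tet] *[of vi] *[of vj] *[of vk] *[of vl], rule period)+
  show "cos (ray_angle N (\<kappa> mod N)) = cos (ray_angle N \<kappa>)" "sin (ray_angle N (\<kappa> mod N)) = sin (ray_angle N \<kappa>)"
    using *[of "\<lambda>k. cos (ray_angle N k)"] *[of "\<lambda>k. sin (ray_angle N k)"]
    by (simp_all add: ray_angle_period[OF N_pos])
  show "cos (ray_angle N (Suc (\<kappa> mod N))) = cos (ray_angle N (Suc \<kappa>))"
    "sin (ray_angle N (Suc (\<kappa> mod N))) = sin (ray_angle N (Suc \<kappa>))"
    using *[of "\<lambda>k. cos (ray_angle N (Suc k))"] *[of "\<lambda>k. sin (ray_angle N (Suc k))"]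
      ray_angle_period[OF N_pos, of "Suc _"] by simp_all
qed

lemma coords_mod: "coords (\<kappa> mod N) = coords \<kappa>"
  and point_mod: "point (\<kappa> mod N) = point \<kappa>"
  and wedge_mod: "wedge (\<kappa> mod N) = wedge \<kappa>"
  unfolding coords_def point_def wedge_def wedge_u_def wedge_v_def period_mod by (rule refl)+

text \<open>On the common facet \<open>vl \<kappa>\<close> becomes \<open>vk (Suc \<kappa>)\<close>,
  and the weights of both are measured along ray \<open>Suc \<kappa>\<close>. So neighbouring
  tetrahedra fit together in 3-space.\<close>

lemma glue_next_coords:
  assumes x: "x \<in> standard_simplex 3" "x (vk \<kappa>) = 0"
  shows "coords (Suc \<kappa>) (affine_extension 3 G (tet \<kappa>, vk \<kappa>) x) = coords \<kappa> x"
proof -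
  have F: "(tet \<kappa>, vk \<kappa>) \<in> facets 3 G" using vertex_le by (simp add: facet_in)
  have fv: "vi \<kappa> \<in> facet_vertices 3 (tet \<kappa>, vk \<kappa>)" "vl \<kappa> \<in> facet_vertices 3 (tet \<kappa>, vk \<kappa>)"
    using vertex_neq[of \<kappa>] vertex_le[of \<kappa>] by (auto simp: facet_vertices_def)
  have "affine_extension 3 G (tet \<kappa>, vk \<kappa>) x (vi (Suc \<kappa>)) = x (vi \<kappa>)"
    "affine_extension 3 G (tet \<kappa>, vk \<kappa>) x (vk (Suc \<kappa>)) = x (vl \<kappa>)"
    "affine_extension 3 G (tet \<kappa>, vk \<kappa>) x (vl (Suc \<kappa>)) = 0"
    using affine_extension_vmap[OF F fv(1), of x] affine_extension_vmap[OF F fv(2), of x]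
      affine_extension_mate[OF F, of x] by (simp_all add: cross)
  then show ?thesis by (intro ext) (simp add: coords_def x)
qed

lemma glue_prev_coords:
  assumes x: "x \<in> standard_simplex 3" "x (vl (Suc \<kappa>)) = 0"
  shows "coords \<kappa> (affine_extension 3 G (tet (Suc \<kappa>), vl (Suc \<kappa>)) x) = coords (Suc \<kappa>) x"
    and "mate G (tet (Suc \<kappa>), vl (Suc \<kappa>)) = (tet \<kappa>, vk \<kappa>)"
proof -
  have F: "(tet \<kappa>, vk \<kappa>) \<in> facets 3 G" using vertex_le by (simp add: facet_in)
  show m: "mate G (tet (Suc \<kappa>), vl (Suc \<kappa>)) = (tet \<kappa>, vk \<kappa>)"
    using mate_mate[OF F] by (simp add: cross)
  have F': "(tet (Suc \<kappa>), vl (Suc \<kappa>)) \<in> facets 3 G" using vertex_le by (simp add: facet_in)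
  let ?y = "affine_extension 3 G (tet (Suc \<kappa>), vl (Suc \<kappa>)) x"
  have y: "?y \<in> standard_simplex 3" "?y (vk \<kappa>) = 0"
    using affine_extension_in_simplex[OF F'] affine_extension_mate[OF F', of x] x m by auto
  have "affine_extension 3 G (tet \<kappa>, vk \<kappa>) ?y = x"
    using affine_extension_inverse[OF F'] x m by simp
  then show "coords \<kappa> ?y = coords (Suc \<kappa>) x"
    using glue_next_coords[OF y] by simp
qed

text \<open>For \<open>W\<close> inside the star this is the full preimage, in the disjoint
  tetrahedra, of the image of \<open>W\<close> under \<open>chart\<close> (see
  \<open>chart_preimage\<close>). Topological statements about the quotient are checked on
  it.\<close>

definition sheets :: "(nat \<Rightarrow> real) set \<Rightarrow> (nat \<times> (nat \<Rightarrow> real)) set" where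
  "sheets W = {(t, x). x \<in> standard_simplex 3 \<and> (\<exists>\<kappa>. t = tet \<kappa> \<and> coords \<kappa> x \<in> W)}"

lemma sheets_eq: "sheets W = (\<Union>\<kappa><N. {tet \<kappa>} \<times> {x \<in> standard_simplex 3. coords \<kappa> x \<in> W})"
proof (intro Set.set_eqI iffI)
  fix p assume "p \<in> sheets W"
  then obtain t x \<kappa> where p: "p = (t, x)" "x \<in> standard_simplex 3" "t = tet \<kappa>" "coords \<kappa> x \<in> W"
    by (auto simp: sheets_def)
  then show "p \<in> (\<Union>\<kappa><N. {tet \<kappa>} \<times> {x \<in> standard_simplex 3. coords \<kappa> x \<in> W})"
    using N_pos by (intro UN_I[of "\<kappa> mod N"]) (auto simp: period_mod coords_mod)
qed (auto simp: sheets_def)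

lemma sheets_subset: "sheets W \<subseteq> simplex_points 3 G"
  using tet_less by (auto simp: sheets_def simplex_points_def)

lemma sheets_positive:
  assumes "W \<subseteq> star" "x \<in> standard_simplex 3" "coords \<kappa> x \<in> W"
  shows "0 < x (vi \<kappa>)" "0 < x (vj \<kappa>)"
proof -
  have "coords (\<kappa> mod N) x \<in> star" using assms coords_mod by auto
  from star_point[OF this _ coords_in_wedge[OF assms(2)]] 
  show "0 < x (vi \<kappa>)" "0 < x (vj \<kappa>)"
    using N_pos point_coords[OF assms(2), of "\<kappa> mod N"] by (auto simp: period_mod simp del: point_simps)
qed

text \<open>In the star the weights of both ends of the edge are positive, so a gluing can only
  cross the facet opposite \<open>vk\<close> or \<open>vl\<close>. These crossings leave the
  position in 3-space unchanged.\<close>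

lemma sheets_saturated:
  assumes W: "W \<subseteq> star" and p: "p \<in> sheets W"
  shows "point_class 3 G p \<subseteq> sheets W"
proof
  fix q assume "q \<in> point_class 3 G p"
  then show "q \<in> sheets W"
  proof (induction rule: point_class_induct)
    case start
    show ?case by (rule p)
  next
    case (glue s f x)
    then obtain \<kappa>0 where \<kappa>0: "s = tet \<kappa>0" "coords \<kappa>0 x \<in> W" by (auto simp: sheets_def)
    \<comment> \<open>The predecessor of \<open>\<kappa>0\<close> modulo \<open>N\<close>, reached
      by going forward so that it also exists for \<open>\<kappa>0 = 0\<close>.\<close>
    define \<kappa> where "\<kappa> = \<kappa>0 + (N - 1)"
    have Suc: "Suc \<kappa> = \<kappa>0 + N" using N by (simp add: \<kappa>_def)
    have c0: "coords (Suc \<kappa>) = coords \<kappa>0" using coords_mod[of "\<kappa>0 + N"] coords_mod[of \<kappa>0] Suc by simp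
    have pos: "0 < x (vi \<kappa>0)" "0 < x (vj \<kappa>0)" using sheets_positive[OF W glue(2) \<kappa>0(2)] by auto
    have "f \<le> 3" using glue(1) by (simp add: facets_def)
    then consider "f = vk \<kappa>0" | "f = vl \<kappa>0"
      using pos glue(3) by (cases f rule: vertex_cases[of _ \<kappa>0]) auto
    then show ?case
    proof cases
      case 1
      then show ?thesis
        using glue_next_coords[of x \<kappa>0] affine_extension_in_simplex[OF glue(1)] glue \<kappa>0
        by (auto simp: sheets_def cross)
    next
      case 2
      then have f: "f = vl (Suc \<kappa>)" "s = tet (Suc \<kappa>)" using Suc period \<kappa>0 by auto
      have "coords \<kappa> (affine_extension 3 G (s, f) x) \<in> W"
        using glue_prev_coords(1)[of x \<kappa>] glue f c0 \<kappa>0 by simp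
      then show ?thesis
        using glue_prev_coords(2)[of x \<kappa>] affine_extension_in_simplex[OF glue(1)] glue f
        by (auto simp: sheets_def)
    qed
  qed
qed

end

section \<open>The parametrised star: topology and local injectivity\<close>

lemma continuous_on_coordinate: "continuous_on S (\<lambda>x :: nat \<Rightarrow> real. x n)"
  by (rule continuous_on_subset[OF continuous_on_product_coordinates]) simp

lemma openin_complex_space:
  assumes "U \<subseteq> topspace (complex_space d G)"
  shows "openin (complex_space d G) U \<longleftrightarrow>
    openin (top_of_set (simplex_points d G)) {p \<in> simplex_points d G. point_class d G p \<in> U}"
  using conjunct2[OF quotient_map_point_class[of d G, unfolded quotient_map_def], rule_format, OF assms]
  by simp

lemma closedin_complex_space:
  assumes "U \<subseteq> topspace (complex_space d G)"
  shows "closedin (complex_space d G) U \<longleftrightarrow>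
    closedin (top_of_set (simplex_points d G)) {p \<in> simplex_points d G. point_class d G p \<in> U}"
  using conjunct2[OF quotient_map_point_class[of d G, unfolded quotient_map_closedin], rule_format, OF assms]
  by simp

context fan
begin

lemma continuous_on_coords: "continuous_on S (coords \<kappa>)"
  unfolding coords_def
  by (intro continuous_on_coordinatewise_then_product continuous_on_if_const continuous_intros
      continuous_on_coordinate)

lemma continuous_on_U: "continuous_on S (U \<kappa>)"
  and continuous_on_V: "continuous_on S (V \<kappa>)"
  unfolding wedge_u_def wedge_v_def divide_inverse
  by (intro continuous_intros continuous_on_coordinate)+

lemma continuous_on_point: "continuous_on S (point \<kappa>)"
  unfolding point_def
  by (intro continuous_on_coordinatewise_then_product continuous_on_if_const continuous_intros
      continuous_on_coordinate continuous_on_U continuous_on_V)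

lemma continuous_on_point_component: "continuous_on S (\<lambda>w. point \<kappa> w n)"
  by (rule continuous_on_product_then_coordinatewise[OF continuous_on_point])

lemma closed_wedge: "closed (wedge \<kappa>)"
  unfolding wedge_def Collect_conj_eq
  by (intro closed_Int closed_Collect_le continuous_on_const continuous_on_U continuous_on_V)

lemma openin_star: "openin (top_of_set E3) star"
proof -
  let ?B = "\<Union>\<kappa><N. wedge \<kappa> \<inter> ({w. point \<kappa> w (vi \<kappa>) \<le> 0} \<union> {w. point \<kappa> w (vj \<kappa>) \<le> 0})"
  have "closed ?B"
    by (intro closed_UN ballI closed_Int closed_wedge closed_Un closed_Collect_le continuous_on_const
        continuous_on_point_component) (rule finite_lessThan)
  moreover have "star = E3 \<inter> - ?B"
    unfolding star_def by (auto simp: not_le simp del: point_simps)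
  ultimately show ?thesis by (auto simp: openin_open open_Compl)
qed

lemma glue_next_point:
  assumes w: "w \<in> E3" and x: "point \<kappa> w \<in> standard_simplex 3" and U: "U \<kappa> w = 0"
  shows "point (Suc \<kappa>) w = affine_extension 3 G (tet \<kappa>, vk \<kappa>) (point \<kappa> w)"
    and "point_class 3 G (tet (Suc \<kappa>), point (Suc \<kappa>) w) = point_class 3 G (tet \<kappa>, point \<kappa> w)"
    and "V (Suc \<kappa>) w = 0"
proof -
  have F: "(tet \<kappa>, vk \<kappa>) \<in> facets 3 G" using vertex_le by (simp add: facet_in)
  let ?y = "affine_extension 3 G (tet \<kappa>, vk \<kappa>) (point \<kappa> w)"
  have y: "?y \<in> standard_simplex 3"
    using affine_extension_in_simplex[OF F x] U by simp
  have "coords (Suc \<kappa>) ?y = w"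
    using glue_next_coords[OF x] U coords_point[OF w] by simp
  then show eq: "point (Suc \<kappa>) w = ?y" using point_coords[OF y, of "Suc \<kappa>"] by simp
  show "point_class 3 G (tet (Suc \<kappa>), point (Suc \<kappa>) w) = point_class 3 G (tet \<kappa>, point \<kappa> w)"
    using point_class_gluing[OF F x] U by (simp add: cross eq)
  show "V (Suc \<kappa>) w = 0"
    using affine_extension_mate[OF F, of "point \<kappa> w"] unfolding eq[symmetric] cross by simp
qed

lemma axis_UV: "w 1 = 0 \<Longrightarrow> w 2 = 0 \<Longrightarrow> U \<kappa> w = 0 \<and> V \<kappa> w = 0"
  by (simp add: wedge_u_def wedge_v_def)

lemma wedge_overlap_cases:
  assumes "\<kappa> < N" "\<kappa>' < N" "w \<in> wedge \<kappa>" "w \<in> wedge \<kappa>'"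
  obtains "\<kappa> = \<kappa>'" | "w 1 = 0" "w 2 = 0" | "\<kappa>' = Suc \<kappa> mod N" "U \<kappa> w = 0" "0 < V \<kappa> w"
    | "\<kappa> = Suc \<kappa>' mod N" "U \<kappa>' w = 0" "0 < V \<kappa>' w"
  using wedge_overlap[OF N assms(1,2), of "w 1" "w 2"] assms(3,4) unfolding wedge_def by blast

text \<open>Off the axis only neighbouring wedges meet, along one ray, and
  \<open>glue_next_point\<close> applies once. On the axis all wedges meet, and every class is
  compared with that of wedge 0 by walking around the edge.\<close>

lemma point_class_consistent:
  assumes w: "w \<in> star" and \<kappa>: "\<kappa> < N" "w \<in> wedge \<kappa>" and \<kappa>': "\<kappa>' < N" "w \<in> wedge \<kappa>'"
  shows "point_class 3 G (tet \<kappa>, point \<kappa> w) = point_class 3 G (tet \<kappa>', point \<kappa>' w)"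
proof (cases rule: wedge_overlap_cases[OF \<kappa>(1) \<kappa>'(1) \<kappa>(2) \<kappa>'(2)])
  case 1
  then show ?thesis by simp
next
  case 2
  have wd: "w \<in> wedge k" for k using axis_UV[of w k] 2 by (simp add: wedge_def)
  have "point_class 3 G (tet k, point k w) = point_class 3 G (tet 0, point 0 w)" if "k < N" for k
    using that
  proof (induction k)
    case (Suc k)
    then show ?case
      using glue_next_point(2)[OF star_E3[OF w] star_point(3)[OF w _ wd, of k]] axis_UV[of w k] 2 by simp
  qed simp
  then show ?thesis using \<kappa>(1) \<kappa>'(1) by metis
next
  case 3
  then show ?thesis
    using glue_next_point(2)[OF star_E3[OF w] star_point(3)[OF w \<kappa>]] by (simp add: period_mod point_mod)
next
  case 4
  then show ?thesis
    using glue_next_point(2)[OF star_E3[OF w] star_point(3)[OF w \<kappa>']] by (simp add: period_mod point_mod)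
qed

lemma chart_eq:
  assumes w: "w \<in> star" and \<kappa>: "\<kappa> < N" "w \<in> wedge \<kappa>"
  shows "chart w = point_class 3 G (tet \<kappa>, point \<kappa> w)"
proof -
  define \<kappa>' where "\<kappa>' = (LEAST \<kappa>. \<kappa> < N \<and> w \<in> wedge \<kappa>)"
  have "\<kappa>' < N \<and> w \<in> wedge \<kappa>'" unfolding \<kappa>'_def by (rule LeastI[of _ \<kappa>]) (use \<kappa> in simp)
  then have "point_class 3 G (tet \<kappa>', point \<kappa>' w) = point_class 3 G (tet \<kappa>, point \<kappa> w)"
    using point_class_consistent[OF w _ _ \<kappa>] by blast
  then show ?thesis by (simp add: chart_def Let_def \<kappa>'_def)
qed

lemma chart_coords:
  assumes x: "x \<in> standard_simplex 3" and w: "coords \<kappa> x \<in> star"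
  shows "chart (coords \<kappa> x) = point_class 3 G (tet \<kappa>, x)"
  using chart_eq[OF w, of "\<kappa> mod N"] coords_in_wedge[OF x, of \<kappa>] point_coords[OF x, of \<kappa>] N_pos
  by (simp add: period_mod point_mod wedge_mod)

lemma point_in_sheets:
  assumes "w \<in> star" "\<kappa> < N" "w \<in> wedge \<kappa>" "w \<in> W"
  shows "(tet \<kappa>, point \<kappa> w) \<in> sheets W"
  using star_point(3)[OF assms(1-3)] coords_point[OF star_E3[OF assms(1)], of \<kappa>] assms(4)
  by (auto simp: sheets_def)

lemma chart_image:
  assumes W: "W \<subseteq> star"
  shows "chart ` W = point_class 3 G ` sheets W"
proof
  show "chart ` W \<subseteq> point_class 3 G ` sheets W"
  proof
    fix p assume "p \<in> chart ` W"
    then obtain w where w: "w \<in> W" "p = chart w" by auto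
    obtain \<kappa> where "\<kappa> < N" "w \<in> wedge \<kappa>" by (rule wedge_exists)
    then show "p \<in> point_class 3 G ` sheets W"
      using chart_eq[of w \<kappa>] point_in_sheets[of w \<kappa> W] w W by blast
  qed
  show "point_class 3 G ` sheets W \<subseteq> chart ` W"
    using chart_coords W by (fastforce simp: sheets_def)
qed

lemma chart_subset_sheets:
  assumes "w \<in> star"
  shows "chart w \<subseteq> sheets {w}"
proof -
  have "chart w \<in> point_class 3 G ` sheets {w}"
    using chart_image[of "{w}"] assms by blast
  then obtain p where "p \<in> sheets {w}" "chart w = point_class 3 G p" by blast
  then show ?thesis using sheets_saturated[of "{w}" p] assms by simp
qed

lemma chart_preimage:
  assumes W: "W \<subseteq> star"
  shows "{p \<in> simplex_points 3 G. point_class 3 G p \<in> chart ` W} = sheets W"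
proof
  show "sheets W \<subseteq> {p \<in> simplex_points 3 G. point_class 3 G p \<in> chart ` W}"
    using sheets_subset chart_image[OF W] by blast
  show "{p \<in> simplex_points 3 G. point_class 3 G p \<in> chart ` W} \<subseteq> sheets W"
  proof
    fix p assume "p \<in> {p \<in> simplex_points 3 G. point_class 3 G p \<in> chart ` W}"
    then obtain p' where "p' \<in> sheets W" "point_class 3 G p = point_class 3 G p'" "p \<in> simplex_points 3 G"
      unfolding chart_image[OF W] by auto
    then show "p \<in> sheets W" using sheets_saturated[OF W, of p'] point_class_self[of p 3 G] by blast
  qed
qed

lemma chart_in_topspace: "w \<in> star \<Longrightarrow> chart w \<in> topspace (complex_space 3 G)"
  using chart_image[of "{w}"] sheets_subset[of "{w}"] unfolding topspace_complex_space by blast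

lemma openin_chart_image:
  assumes W: "openin (top_of_set E3) W" "W \<subseteq> star"
  shows "openin (complex_space 3 G) (chart ` W)"
proof -
  obtain T where T: "open T" "W = E3 \<inter> T" using W(1) by (auto simp: openin_open)
  have "sheets W = simplex_points 3 G \<inter> (\<Union>\<kappa><N. {tet \<kappa>} \<times> (coords \<kappa> -` T))"
    unfolding sheets_eq T(2) simplex_points_def using coords_in_E3 tet_less by auto
  moreover have "open (\<Union>\<kappa><N. {tet \<kappa>} \<times> (coords \<kappa> -` T))"
    using T(1) by (intro open_UN ballI open_Times open_discrete open_vimage continuous_on_coords)
  ultimately have "openin (top_of_set (simplex_points 3 G)) (sheets W)"
    by (auto simp: openin_open)
  moreover have "chart ` W \<subseteq> topspace (complex_space 3 G)" using chart_in_topspace W(2) by auto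
  ultimately show ?thesis
    by (simp add: openin_complex_space chart_preimage[OF W(2)])
qed

text \<open>Closedness in the whole complex, not only in the star, is what separates a point of the
  star from points outside it in the Hausdorff proof.\<close>

lemma closedin_chart_image:
  assumes W: "closed W" "W \<subseteq> star"
  shows "closedin (complex_space 3 G) (chart ` W)"
proof -
  have "sheets W = simplex_points 3 G \<inter> (\<Union>\<kappa><N. {tet \<kappa>} \<times> (coords \<kappa> -` W))"
    unfolding sheets_eq simplex_points_def using tet_less by auto
  moreover have "closed (\<Union>\<kappa><N. {tet \<kappa>} \<times> (coords \<kappa> -` W))"
    using W(1) by (intro closed_UN ballI closed_Times closed_vimage continuous_on_coords) auto
  ultimately have "closedin (top_of_set (simplex_points 3 G)) (sheets W)"
    by (auto simp: closedin_closed)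
  moreover have "chart ` W \<subseteq> topspace (complex_space 3 G)" using chart_in_topspace W(2) by auto
  ultimately show ?thesis
    by (simp add: closedin_complex_space chart_preimage[OF W(2)])
qed

text \<open>A pasting argument: on each of the finitely many closed wedges the map has a continuous
  formula, so the preimage of a closed set is a finite union of closed pieces.\<close>

lemma continuous_map_chart: "continuous_map (top_of_set star) (complex_space 3 G) chart"
  unfolding continuous_map_closedin
proof (intro conjI allI impI)
  show "chart \<in> topspace (top_of_set star) \<rightarrow> topspace (complex_space 3 G)"
    using chart_in_topspace by auto
  fix D assume D: "closedin (complex_space 3 G) D"
  define Q where "Q = {p \<in> simplex_points 3 G. point_class 3 G p \<in> D}"
  have "closedin (top_of_set (simplex_points 3 G)) Q"
    unfolding Q_def using closedin_continuous_map_preimage[OF quotient_imp_continuous_map[OF quotient_map_point_class] D]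
    by simp
  then have Q: "closed Q"
    using compact_imp_closed[OF compact_simplex_points] closedin_closed_eq by blast
  have "{w \<in> star. chart w \<in> D} = star \<inter> (\<Union>\<kappa><N. wedge \<kappa> \<inter> (\<lambda>w. (tet \<kappa>, point \<kappa> w)) -` Q)" (is "?L = ?R")
  proof
    show "?L \<subseteq> ?R"
    proof
      fix w assume w: "w \<in> ?L"
      obtain \<kappa> where \<kappa>: "\<kappa> < N" "w \<in> wedge \<kappa>" by (rule wedge_exists)
      then have "(tet \<kappa>, point \<kappa> w) \<in> Q"
        using chart_eq[of w \<kappa>] star_point(3)[of w \<kappa>] w tet_less by (auto simp: Q_def simplex_points_def)
      then show "w \<in> ?R" using \<kappa> w by auto
    qed
    show "?R \<subseteq> ?L" using chart_eq by (auto simp: Q_def)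
  qed
  moreover have "closed (\<Union>\<kappa><N. wedge \<kappa> \<inter> (\<lambda>w. (tet \<kappa>, point \<kappa> w)) -` Q)"
    by (intro closed_UN ballI closed_Int closed_wedge closed_vimage Q continuous_on_Pair
        continuous_on_const continuous_on_point) simp
  ultimately show "closedin (top_of_set star) {w \<in> topspace (top_of_set star). chart w \<in> D}"
    by (auto simp: closedin_closed)
qed

text \<open>On a ray off the axis the only vanishing coordinate of \<open>point \<kappa> w\<close>
  among the four vertices is that of \<open>vk \<kappa>\<close>. Equal points would therefore force
  \<open>vl (Suc \<kappa>) = vk \<kappa>\<close>, and the facet would be its own mate.\<close>

lemma point_neq_next:
  assumes w: "w \<in> star" and \<kappa>: "\<kappa> < N" "w \<in> wedge \<kappa>" and U: "U \<kappa> w = 0" "0 < V \<kappa> w"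
    and tet: "tet (Suc \<kappa>) = tet \<kappa>"
  shows "point (Suc \<kappa>) w \<noteq> point \<kappa> w"
proof
  assume eq: "point (Suc \<kappa>) w = point \<kappa> w"
  have "V (Suc \<kappa>) w = 0" using glue_next_point(3)[OF star_E3[OF w] star_point(3)[OF w \<kappa>] U(1)] .
  then have z: "point \<kappa> w (vl (Suc \<kappa>)) = 0" using point_simps(3)[of "Suc \<kappa>" w] by (simp add: eq del: point_simps)
  have "vl (Suc \<kappa>) = vk \<kappa>"
  proof (cases "vl (Suc \<kappa>)" rule: vertex_cases[of _ \<kappa>])
    case 1
    then show ?thesis using z star_point(1)[OF w \<kappa>] by (simp del: point_simps)
  next
    case 2
    then show ?thesis using z star_point(2)[OF w \<kappa>] by (simp del: point_simps)
  next
    case 4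
    then show ?thesis using z U by simp
  next
    case 5
    then show ?thesis using vertex_le(4)[of "Suc \<kappa>"] by simp
  qed
  then have "mate G (tet \<kappa>, vk \<kappa>) = (tet \<kappa>, vk \<kappa>)" by (simp add: cross tet)
  then show False using mate_neq[OF facet_in] vertex_le by blast
qed

text \<open>On the axis the positive coordinates are those of the two ends of the edge, so
  \<open>once\<close> tells the two occurrences of the tetrahedron apart. Off the axis the wedges
  are neighbours and \<open>point_neq_next\<close> applies.\<close>

lemma point_neq:
  assumes w: "w \<in> star" and \<kappa>: "\<kappa> < N" "w \<in> wedge \<kappa>" and \<kappa>': "\<kappa>' < N" "w \<in> wedge \<kappa>'"
    and tet: "tet \<kappa> = tet \<kappa>'" and neq: "\<kappa> \<noteq> \<kappa>'"
  shows "point \<kappa> w \<noteq> point \<kappa>' w"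
proof (cases rule: wedge_overlap_cases[OF \<kappa>(1) \<kappa>'(1) \<kappa>(2) \<kappa>'(2)])
  case 1
  then show ?thesis using neq by simp
next
  case 2
  have "{n. 0 < point k w n} = {vi k, vj k}" if "k < N" for k
  proof (intro Set.set_eqI iffI)
    fix n assume "n \<in> {n. 0 < point k w n}"
    then show "n \<in> {vi k, vj k}" using axis_UV[OF 2, of k] by (cases n rule: vertex_cases[of _ k]) auto
  next
    fix n assume n: "n \<in> {vi k, vj k}"
    have "w \<in> wedge k" using axis_UV[OF 2, of k] by (simp add: wedge_def)
    then show "n \<in> {n. 0 < point k w n}" using n star_point(1,2)[OF w that] by (auto simp del: point_simps)
  qed
  from this[OF \<kappa>(1)] this[OF \<kappa>'(1)] show ?thesis using once[OF \<kappa>(1) \<kappa>'(1) tet] neq by auto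
next
  case 3
  then show ?thesis using point_neq_next[OF w \<kappa>] tet by (simp add: period_mod point_mod)
next
  case 4
  then show ?thesis using point_neq_next[OF w \<kappa>'] tet by (simp add: period_mod point_mod)
qed

text \<open>Pairs of points that different sheets place at the same point of a tetrahedron form the
  closed sets \<open>bad\<close>. By \<open>point_neq\<close> the pair \<open>(w0, w0)\<close> is in
  none of them, so a box around it misses them all; within a single sheet the map is
  injective.\<close>

lemma chart_locally_injective:
  assumes w0: "w0 \<in> star"
  obtains W where "openin (top_of_set E3) W" "w0 \<in> W" "W \<subseteq> star" "inj_on chart W"
proof -
  define P where "P = {(\<kappa>, \<kappa>'). \<kappa> < N \<and> \<kappa>' < N \<and> \<kappa> \<noteq> \<kappa>' \<and> tet \<kappa> = tet \<kappa>'}"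
  define bad where "bad = (\<lambda>(\<kappa>, \<kappa>'). {q. fst q \<in> wedge \<kappa>' \<and> snd q \<in> wedge \<kappa> \<and> point \<kappa> (snd q) = point \<kappa>' (fst q)})"
  have "finite P" by (rule finite_subset[of _ "{..<N} \<times> {..<N}"]) (auto simp: P_def)
  moreover have "closed (bad z)" for z
  proof -
    obtain \<kappa> \<kappa>' where z: "z = (\<kappa>, \<kappa>')" by fastforce
    have eq: "bad z = fst -` wedge \<kappa>' \<inter> snd -` wedge \<kappa> \<inter> {q. (point \<kappa> \<circ> snd) q = (point \<kappa>' \<circ> fst) q}"
      by (auto simp: bad_def z)
    show ?thesis unfolding eq
      by (intro closed_Int closed_vimage closed_wedge closed_Collect_eq continuous_on_compose
          continuous_on_fst continuous_on_snd continuous_on_id continuous_on_point)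
  qed
  ultimately have "open (- (\<Union>z\<in>P. bad z))" by (intro open_Compl closed_UN) auto
  moreover have "(w0, w0) \<in> - (\<Union>z\<in>P. bad z)"
    using point_neq[OF w0] by (auto simp: P_def bad_def)
  ultimately obtain A B where AB: "open A" "open B" "w0 \<in> A" "w0 \<in> B" "A \<times> B \<subseteq> - (\<Union>z\<in>P. bad z)"
    by (auto elim!: open_prod_elim)
  define W where "W = star \<inter> (A \<inter> B)"
  show thesis
  proof
    show "openin (top_of_set E3) W" unfolding W_def using AB openin_star by (intro openin_Int_open) auto
    show "w0 \<in> W" "W \<subseteq> star" using AB w0 by (auto simp: W_def)
    show "inj_on chart W"
    proof (rule inj_onI)
      fix w w' assume w: "w \<in> W" "w' \<in> W" and eq: "chart w = chart w'"
      then have st: "w \<in> star" "w' \<in> star" by (auto simp: W_def)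
      obtain \<kappa> where \<kappa>: "\<kappa> < N" "w' \<in> wedge \<kappa>" by (rule wedge_exists)
      have p: "point \<kappa> w' \<in> standard_simplex 3" using star_point(3)[OF st(2) \<kappa>] .
      have "(tet \<kappa>, point \<kappa> w') \<in> chart w'"
        unfolding chart_eq[OF st(2) \<kappa>] using p tet_less by (intro point_class_self) (simp add: simplex_points_def)
      then have "(tet \<kappa>, point \<kappa> w') \<in> sheets {w}" using chart_subset_sheets[OF st(1)] eq by auto
      then obtain \<kappa>' where \<kappa>': "\<kappa>' < N" "tet \<kappa> = tet \<kappa>'" "coords \<kappa>' (point \<kappa> w') = w"
        unfolding sheets_eq by auto
      have "w \<in> wedge \<kappa>'" "point \<kappa>' w = point \<kappa> w'"
        using coords_in_wedge[OF p, of \<kappa>'] point_coords[OF p, of \<kappa>'] \<kappa>' by auto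
      then have b: "(w, w') \<in> bad (\<kappa>, \<kappa>')" using \<kappa> by (simp add: bad_def)
      have "(w, w') \<notin> (\<Union>z\<in>P. bad z)" using AB(5) w unfolding W_def by blast
      then have "(\<kappa>, \<kappa>') \<notin> P" using b by blast
      then have "\<kappa> = \<kappa>'" using \<kappa> \<kappa>' by (simp add: P_def)
      then show "w = w'" using \<kappa>'(3) coords_point[OF star_E3[OF st(2)], of \<kappa>'] by simp
    qed
  qed
qed

end

text \<open>\<open>(i, j, third i j, third j i)\<close> is an even permutation of \<open>(0, 1, 2, 3)\<close>; the zeros are junk.\<close>

definition third :: "nat \<Rightarrow> nat \<Rightarrow> nat" where
  "third i j = [[0, 2, 3, 1], [3, 0, 0, 2], [1, 3, 0, 0], [2, 0, 1, 0]] ! i ! j"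

definition even_order :: "nat \<Rightarrow> nat \<Rightarrow> nat \<Rightarrow> nat \<Rightarrow> bool" where
  "even_order i j k l \<longleftrightarrow> i \<le> 3 \<and> j \<le> 3 \<and> i \<noteq> j \<and> k = third i j \<and> l = third j i"

text \<open>\<open>coords\<close> with all its data passed explicitly, so that charts of different
  fans can be compared outside the locale.\<close>

definition tetra_coords :: "nat \<Rightarrow> nat \<Rightarrow> nat \<Rightarrow> nat \<Rightarrow> nat \<Rightarrow> (nat \<Rightarrow> real) \<Rightarrow> nat \<Rightarrow> real" where
  "tetra_coords N \<kappa> i k l x = (\<lambda>n. if n = 0 then 3/4 - x i
     else if n = 1 then x k * cos (ray_angle N \<kappa>) + x l * cos (ray_angle N (Suc \<kappa>))
     else if n = 2 then x k * sin (ray_angle N \<kappa>) + x l * sin (ray_angle N (Suc \<kappa>))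
     else 0)"

text \<open>The last condition says that the parametrisation \<open>g\<close> is affine and orientation preserving on tetrahedra.\<close>

definition star_chart ::
    "pairing \<Rightarrow> (nat \<Rightarrow> real) set \<Rightarrow> ((nat \<Rightarrow> real) \<Rightarrow> (nat \<times> (nat \<Rightarrow> real)) set) \<Rightarrow> bool" where
  "star_chart G W g \<longleftrightarrow> openin (top_of_set E3) W \<and>
     continuous_map (top_of_set W) (complex_space 3 G) g \<and>
     (\<forall>V. openin (top_of_set E3) V \<and> V \<subseteq> W \<longrightarrow> openin (complex_space 3 G) (g ` V)) \<and>
     (\<forall>V. closed V \<and> V \<subseteq> W \<longrightarrow> closedin (complex_space 3 G) (g ` V)) \<and>
     (\<forall>V. openin (top_of_set E3) V \<and> V \<subseteq> W \<and> V \<noteq> {} \<longrightarrow>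
        (\<exists>V' s N \<kappa> i j k l. openin (top_of_set E3) V' \<and> V' \<subseteq> V \<and> V' \<noteq> {} \<and> 3 \<le> N \<and> even_order i j k l \<and>
           (\<forall>w\<in>V'. \<exists>x\<in>standard_simplex 3. (\<forall>n\<le>3. 0 < x n) \<and> (s, x) \<in> g w \<and> w = tetra_coords N \<kappa> i k l x)))"

lemma star_chart_subset:
  assumes "star_chart G W g" "openin (top_of_set E3) V" "V \<subseteq> W"
  shows "star_chart G V g"
proof -
  note g = assms(1)[unfolded star_chart_def]
  have sub: "U \<subseteq> W" if "U \<subseteq> V" for U using that assms(3) by (rule subset_trans)
  show ?thesis
    unfolding star_chart_def
  proof (intro conjI allI impI; (elim conjE)?)
    show "continuous_map (top_of_set V) (complex_space 3 G) g"
      using conjunct1[OF conjunct2[OF g]] assms(3) by (rule continuous_map_from_subtopology_mono)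
  next
    fix U assume "openin (top_of_set E3) U" "U \<subseteq> V"
    then show "openin (complex_space 3 G) (g ` U)"
      using conjunct1[OF conjunct2[OF conjunct2[OF g]], rule_format, of U] sub by simp
  next
    fix U assume "closed U" "U \<subseteq> V"
    then show "closedin (complex_space 3 G) (g ` U)"
      using conjunct1[OF conjunct2[OF conjunct2[OF conjunct2[OF g]]], rule_format, of U] sub by simp
  next
    fix U assume U: "openin (top_of_set E3) U" "U \<subseteq> V" "U \<noteq> {}"
    show "\<exists>V' s N \<kappa> i j k l. openin (top_of_set E3) V' \<and> V' \<subseteq> U \<and> V' \<noteq> {} \<and> 3 \<le> N \<and> even_order i j k l \<and>
      (\<forall>w\<in>V'. \<exists>x\<in>standard_simplex 3. (\<forall>n\<le>3. 0 < x n) \<and> (s, x) \<in> g w \<and> w = tetra_coords N \<kappa> i k l x)"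
      by (rule conjunct2[OF conjunct2[OF conjunct2[OF conjunct2[OF g]]], rule_format])
        (intro conjI U sub)
  qed (rule assms(2))
qed

definition truncation_points :: "pairing \<Rightarrow> (nat \<times> (nat \<Rightarrow> real)) set set" where
  "truncation_points G = {p \<in> topspace (associated_manifold G). \<exists>(s, x) \<in> p. \<exists>n. x n = 3/4}"

definition adapted_chart ::
    "pairing \<Rightarrow> (nat \<Rightarrow> real) set \<Rightarrow> ((nat \<Rightarrow> real) \<Rightarrow> (nat \<times> (nat \<Rightarrow> real)) set) \<Rightarrow> bool" where
  "adapted_chart G W g \<longleftrightarrow> star_chart G W g \<and> inj_on g W \<and>
     (\<forall>w\<in>W. (g w \<in> topspace (associated_manifold G) \<longleftrightarrow> 0 \<le> w 0) \<and> (g w \<in> truncation_points G \<longleftrightarrow> w 0 = 0))"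

lemma topspace_associated_manifold:
  "topspace (associated_manifold G) =
     {p \<in> topspace (complex_space 3 G). \<forall>(s, x) \<in> p. \<forall>n. x n \<le> 3/4}"
  by (auto simp: associated_manifold_def)

section \<open>Charts adapted to the truncation\<close>

context fan
begin

lemma UV_mod: "U (\<kappa> mod N) w = U \<kappa> w" "V (\<kappa> mod N) w = V \<kappa> w"
  unfolding wedge_u_def wedge_v_def period_mod by (rule refl)+

lemma ray_UV:
  assumes "U \<kappa> w = 0"
  shows "U (Suc \<kappa>) w = V \<kappa> w" "V (Suc \<kappa>) w = 0"
  using wedge_coordinates[OF N, of "w 1" "V \<kappa> w" "Suc \<kappa>" 0 "w 2"]
    wedge_combination[OF N, of \<kappa> "w 1" "w 2"] assms by simp_all

text \<open>On a shared ray one weight vanishes in each wedge and the other is common to both. So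
  the weight of \<open>vj\<close>, which involves the wedge only through this sum, does not depend
  on the wedge.\<close>

lemma wedge_sum_consistent:
  assumes \<kappa>: "\<kappa> < N" "w \<in> wedge \<kappa>" and \<kappa>': "\<kappa>' < N" "w \<in> wedge \<kappa>'"
  shows "U \<kappa> w + V \<kappa> w = U \<kappa>' w + V \<kappa>' w"
proof (cases rule: wedge_overlap_cases[OF \<kappa>(1) \<kappa>'(1) \<kappa>(2) \<kappa>'(2)])
  case 2
  then show ?thesis using axis_UV by simp
next
  case 3
  then show ?thesis using ray_UV[of \<kappa> w] UV_mod[of "Suc \<kappa>" w] by simp
next
  case 4
  then show ?thesis using ray_UV[of \<kappa>' w] UV_mod[of "Suc \<kappa>'" w] by simp
qed simp

text \<open>The two additional inequalities keep all coordinates other than that of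
  \<open>vi\<close> below 3/4, so that in this region the truncation is governed by the first
  coordinate alone.\<close>

definition core :: "(nat \<Rightarrow> real) set" where
  "core = {w \<in> E3. \<forall>\<kappa><N. w \<in> wedge \<kappa> \<longrightarrow> 0 < point \<kappa> w (vi \<kappa>) \<and> 0 < point \<kappa> w (vj \<kappa>) \<and>
     point \<kappa> w (vj \<kappa>) < 3/4 \<and> U \<kappa> w + V \<kappa> w < 3/4}"

lemma core_subset: "core \<subseteq> star"
  by (auto simp: core_def star_def)

lemma openin_core: "openin (top_of_set E3) core"
proof -
  let ?B = "\<Union>\<kappa><N. wedge \<kappa> \<inter> ({w. point \<kappa> w (vi \<kappa>) \<le> 0} \<union> {w. point \<kappa> w (vj \<kappa>) \<le> 0} \<union>
    {w. 3/4 \<le> point \<kappa> w (vj \<kappa>)} \<union> {w. 3/4 \<le> U \<kappa> w + V \<kappa> w})"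
  have "closed ?B"
    by (intro closed_UN ballI closed_Int closed_wedge closed_Un closed_Collect_le continuous_on_const
        continuous_on_point_component continuous_on_add continuous_on_U continuous_on_V) (rule finite_lessThan)
  moreover have "core = E3 \<inter> - ?B"
    unfolding core_def by (auto simp: not_le simp del: point_simps)
  ultimately show ?thesis by (auto simp: openin_open open_Compl)
qed

lemma coords_wedge_values:
  assumes x: "x \<in> standard_simplex 3" and \<kappa>': "\<kappa>' < N" "coords \<kappa> x \<in> wedge \<kappa>'"
  shows "point \<kappa>' (coords \<kappa> x) (vi \<kappa>') = x (vi \<kappa>)"
    "point \<kappa>' (coords \<kappa> x) (vj \<kappa>') = x (vj \<kappa>)"
    "U \<kappa>' (coords \<kappa> x) + V \<kappa>' (coords \<kappa> x) = x (vk \<kappa>) + x (vl \<kappa>)"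
proof -
  have "coords \<kappa> x \<in> wedge (\<kappa> mod N)" using coords_in_wedge[OF x] by (simp add: wedge_mod)
  then have s: "U \<kappa>' (coords \<kappa> x) + V \<kappa>' (coords \<kappa> x) = U \<kappa> (coords \<kappa> x) + V \<kappa> (coords \<kappa> x)"
    using wedge_sum_consistent[OF \<kappa>' _ , of "\<kappa> mod N"] N_pos UV_mod[of \<kappa> "coords \<kappa> x"] by simp
  then show "U \<kappa>' (coords \<kappa> x) + V \<kappa>' (coords \<kappa> x) = x (vk \<kappa>) + x (vl \<kappa>)"
    by (simp only: UV_coords)
  then show "point \<kappa>' (coords \<kappa> x) (vi \<kappa>') = x (vi \<kappa>)"
    "point \<kappa>' (coords \<kappa> x) (vj \<kappa>') = x (vj \<kappa>)"
    using simplex_sum[OF x, of \<kappa>] by simp_all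
qed

lemma coords_in_star:
  assumes "x \<in> standard_simplex 3" "0 < x (vi \<kappa>)" "0 < x (vj \<kappa>)"
  shows "coords \<kappa> x \<in> star"
  unfolding star_def using coords_wedge_values[OF assms(1), of _ \<kappa>] assms(2,3) coords_in_E3[of \<kappa> x]
  by (auto simp del: point_simps)

text \<open>If \<open>x (vj \<kappa>)\<close> were at least 3/4, so would be the maximal
  \<open>x (vi \<kappa>)\<close>. If \<open>x (vk \<kappa>) + x (vl \<kappa>)\<close> were at least
  3/4, one of the summands, and hence \<open>x (vi \<kappa>)\<close>, would be at least 3/8. In both
  cases the sum of the coordinates exceeds 1.\<close>

lemma coords_in_core:
  assumes x: "x \<in> standard_simplex 3" "0 < x (vi \<kappa>)" "0 < x (vj \<kappa>)" and max: "\<And>n. x n \<le> x (vi \<kappa>)"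
  shows "coords \<kappa> x \<in> core"
proof -
  have "x (vj \<kappa>) < 3/4 \<and> x (vk \<kappa>) + x (vl \<kappa>) < 3/4"
    using simplex_sum[OF x(1), of \<kappa>] simplex_nonneg[OF x(1)] x(2,3) max[of "vj \<kappa>"] max[of "vk \<kappa>"] max[of "vl \<kappa>"]
      simplex_nonneg[OF x(1), of "vk \<kappa>"] simplex_nonneg[OF x(1), of "vl \<kappa>"] by linarith
  then have "0 < point \<kappa>' (coords \<kappa> x) (vi \<kappa>') \<and> 0 < point \<kappa>' (coords \<kappa> x) (vj \<kappa>') \<and>
    point \<kappa>' (coords \<kappa> x) (vj \<kappa>') < 3/4 \<and> U \<kappa>' (coords \<kappa> x) + V \<kappa>' (coords \<kappa> x) < 3/4"
    if "\<kappa>' < N" "coords \<kappa> x \<in> wedge \<kappa>'" for \<kappa>'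
    unfolding coords_wedge_values[OF x(1) that] using x(2,3) by simp
  then show ?thesis unfolding core_def using coords_in_E3[of \<kappa> x] by blast
qed

text \<open>In the core only the coordinate at \<open>vi\<close> can reach 3/4, and it equals
  \<open>3/4 - w 0\<close>. By \<open>range_point_class\<close> all representatives of the class
  show the same values.\<close>

lemma core_values:
  assumes w: "w \<in> core"
  shows "chart w \<in> topspace (associated_manifold G) \<longleftrightarrow> 0 \<le> w 0"
    and "chart w \<in> truncation_points G \<longleftrightarrow> w 0 = 0"
proof -
  have st: "w \<in> star" using w core_subset by auto
  obtain \<kappa> where \<kappa>: "\<kappa> < N" "w \<in> wedge \<kappa>" by (rule wedge_exists)
  have cl: "chart w = point_class 3 G (tet \<kappa>, point \<kappa> w)" by (rule chart_eq[OF st \<kappa>])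
  have x: "point \<kappa> w \<in> standard_simplex 3" by (rule star_point(3)[OF st \<kappa>])
  have self: "(tet \<kappa>, point \<kappa> w) \<in> chart w"
    unfolding cl using x tet_less by (intro point_class_self) (simp add: simplex_points_def)
  have r: "range y = range (point \<kappa> w)" if "(t, y) \<in> chart w" for t y
    using that range_point_class unfolding cl by blast
  have small: "point \<kappa> w n < 3/4" if "n \<noteq> vi \<kappa>" for n
    using w \<kappa> that by (cases n rule: vertex_cases[of _ \<kappa>]) (auto simp: core_def wedge_def)
  have "(\<forall>(t, y) \<in> chart w. \<forall>n. y n \<le> 3/4) \<longleftrightarrow> (\<forall>z\<in>range (point \<kappa> w). z \<le> 3/4)"
  proof
    show "\<forall>z\<in>range (point \<kappa> w). z \<le> 3/4" if "\<forall>(t, y) \<in> chart w. \<forall>n. y n \<le> 3/4"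
      using that self by auto
    show "\<forall>(t, y) \<in> chart w. \<forall>n. y n \<le> 3/4" if "\<forall>z\<in>range (point \<kappa> w). z \<le> 3/4"
    proof clarify
      fix t y n assume "(t, y) \<in> chart w"
      then have "y n \<in> range (point \<kappa> w)" using r by blast
      then show "y n \<le> 3/4" using that by blast
    qed
  qed
  also have "\<dots> \<longleftrightarrow> 0 \<le> w 0"
  proof
    show "0 \<le> w 0" if "\<forall>z\<in>range (point \<kappa> w). z \<le> 3/4"
    proof -
      have "point \<kappa> w (vi \<kappa>) \<le> 3/4" using that by blast
      then show ?thesis by simp
    qed
    have "point \<kappa> w n \<le> 3/4" if "0 \<le> w 0" for n
      using small[of n] that by (cases "n = vi \<kappa>") auto
    then show "\<forall>z\<in>range (point \<kappa> w). z \<le> 3/4" if "0 \<le> w 0" using that by blast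
  qed
  finally show A: "chart w \<in> topspace (associated_manifold G) \<longleftrightarrow> 0 \<le> w 0"
    using chart_in_topspace[OF st] by (simp add: topspace_associated_manifold)
  have "(\<exists>(t, y) \<in> chart w. \<exists>n. y n = 3/4) \<longleftrightarrow> 3/4 \<in> range (point \<kappa> w)"
  proof
    assume "\<exists>(t, y) \<in> chart w. \<exists>n. y n = 3/4"
    then obtain t y n where "(t, y) \<in> chart w" "y n = 3/4" by auto
    then show "3/4 \<in> range (point \<kappa> w)" using r[of t y] by (metis rangeI)
  next
    assume "3/4 \<in> range (point \<kappa> w)"
    then obtain n where "point \<kappa> w n = 3/4" by (metis imageE)
    then show "\<exists>(t, y) \<in> chart w. \<exists>n. y n = 3/4" using self by blast
  qed
  also have "\<dots> \<longleftrightarrow> w 0 = 0"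
  proof
    assume "3/4 \<in> range (point \<kappa> w)"
    then obtain n where "point \<kappa> w n = 3/4" by (metis imageE)
    then have "n = vi \<kappa>" using small[of n] by fastforce
    then show "w 0 = 0" using \<open>point \<kappa> w n = 3/4\<close> by simp
  next
    assume "w 0 = 0"
    then have "point \<kappa> w (vi \<kappa>) = 3/4" by simp
    then show "3/4 \<in> range (point \<kappa> w)" by (metis rangeI)
  qed
  finally show "chart w \<in> truncation_points G \<longleftrightarrow> w 0 = 0"
    unfolding truncation_points_def using A by auto
qed

lemma wedge_interior_meets:
  assumes Y: "openin (top_of_set E3) Y" "w \<in> Y" and \<kappa>: "w \<in> wedge \<kappa>"
  obtains w' where "w' \<in> Y" "0 < U \<kappa> w'" "0 < V \<kappa> w'"
proof -
  \<comment> \<open>Moves \<open>w\<close> by \<open>e\<close> times the sum of the two ray vectors,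
    so that both wedge coordinates grow by \<open>e\<close>.\<close>
  define c where "c = (\<lambda>e n. if n = 1 then w 1 + e * (cos (ray_angle N \<kappa>) + cos (ray_angle N (Suc \<kappa>)))
    else if n = 2 then w 2 + e * (sin (ray_angle N \<kappa>) + sin (ray_angle N (Suc \<kappa>))) else w n)"
  obtain T where T: "open T" "Y = E3 \<inter> T" using Y(1) by (auto simp: openin_open)
  have "continuous_on UNIV c"
    unfolding c_def
    by (intro continuous_on_coordinatewise_then_product continuous_on_if_const continuous_intros)
  then have "open (c -` T)" by (intro open_vimage T)
  moreover have "c 0 = w" by (auto simp: c_def)
  then have "0 \<in> c -` T" using Y T by auto
  ultimately obtain e where e: "0 < e" "\<And>y. dist y 0 < e \<Longrightarrow> y \<in> c -` T"
    by (metis open_dist)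
  have "U \<kappa> (c (e/2)) = U \<kappa> w + e/2" "V \<kappa> (c (e/2)) = V \<kappa> w + e/2"
    using wedge_coordinates[OF N, of "c (e/2) 1" "U \<kappa> w + e/2" \<kappa> "V \<kappa> w + e/2" "c (e/2) 2"]
      wedge_combination[OF N, of \<kappa> "w 1" "w 2"] by (simp_all add: c_def algebra_simps)
  moreover have "c (e/2) \<in> Y" using e(1) e(2)[of "e/2"] Y(2) unfolding T(2) by (simp add: c_def)
  ultimately show thesis using \<kappa> e(1) by (intro that[of "c (e/2)"]) (auto simp: wedge_def)
qed

lemma coords_eq_tetra_coords: "coords \<kappa> = tetra_coords N \<kappa> (vi \<kappa>) (vk \<kappa>) (vl \<kappa>)"
  unfolding coords_def tetra_coords_def by (rule refl)

text \<open>For the last condition of \<open>star_chart\<close>: every nonempty open set meets the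
  interior of some wedge, where the map is affine onto the interior of a single tetrahedron.\<close>

lemma star_chart_chart:
  assumes even: "\<And>\<kappa>. even_order (vi \<kappa>) (vj \<kappa>) (vk \<kappa>) (vl \<kappa>)"
  shows "star_chart G star chart"
  unfolding star_chart_def
proof (intro conjI allI impI; (elim conjE)?)
  fix Y assume Y: "openin (top_of_set E3) Y" "Y \<subseteq> star" "Y \<noteq> {}"
  then obtain w where w: "w \<in> Y" by auto
  obtain \<kappa> where \<kappa>: "\<kappa> < N" "w \<in> wedge \<kappa>" by (rule wedge_exists)
  define Y' where "Y' = Y \<inter> ({w. 0 < U \<kappa> w} \<inter> {w. 0 < V \<kappa> w})"
  show "\<exists>Y' s N \<kappa> i j k l. openin (top_of_set E3) Y' \<and> Y' \<subseteq> Y \<and> Y' \<noteq> {} \<and> 3 \<le> N \<and> even_order i j k l \<and>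
    (\<forall>w\<in>Y'. \<exists>x\<in>standard_simplex 3. (\<forall>n\<le>3. 0 < x n) \<and> (s, x) \<in> chart w \<and> w = tetra_coords N \<kappa> i k l x)"
  proof (intro exI conjI ballI)
    show "openin (top_of_set E3) Y'" unfolding Y'_def
      by (intro openin_Int_open Y open_Int open_Collect_less continuous_on_const continuous_on_U continuous_on_V)
    show "Y' \<subseteq> Y" by (auto simp: Y'_def)
    show "Y' \<noteq> {}" using wedge_interior_meets[OF Y(1) w \<kappa>(2)] unfolding Y'_def by blast
    show "3 \<le> N" "even_order (vi \<kappa>) (vj \<kappa>) (vk \<kappa>) (vl \<kappa>)" by (fact N, fact even)
    fix w assume w: "w \<in> Y'"
    then have st: "w \<in> star" and wd: "w \<in> wedge \<kappa>" using Y(2) by (auto simp: Y'_def wedge_def)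
    note sp = star_point[OF st \<kappa>(1) wd]
    have pos: "0 < point \<kappa> w n" if "n \<le> 3" for n
      using that w sp(1,2)
      by (cases n rule: vertex_cases[of _ \<kappa>]) (auto simp: Y'_def)
    have "(tet \<kappa>, point \<kappa> w) \<in> chart w"
      unfolding chart_eq[OF st \<kappa>(1) wd] using sp tet_less by (intro point_class_self) (simp add: simplex_points_def)
    then show "\<exists>x\<in>standard_simplex 3. (\<forall>n\<le>3. 0 < x n) \<and> (tet \<kappa>, x) \<in> chart w \<and>
        w = tetra_coords N \<kappa> (vi \<kappa>) (vk \<kappa>) (vl \<kappa>) x"
      using sp(3) pos coords_point[OF star_E3[OF st], of \<kappa>, unfolded coords_eq_tetra_coords]
      by (intro bexI[of _ "point \<kappa> w"]) simp_all
  qed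
qed (fact openin_star, fact continuous_map_chart, erule (1) openin_chart_image, erule (1) closedin_chart_image)

lemma adapted_chart_exists:
  assumes even: "\<And>\<kappa>. even_order (vi \<kappa>) (vj \<kappa>) (vk \<kappa>) (vl \<kappa>)"
    and x: "x \<in> standard_simplex 3" "0 < x (vi 0)" "0 < x (vj 0)" and max: "\<And>n. x n \<le> x (vi 0)"
  obtains W where "adapted_chart G W chart" "coords 0 x \<in> W" "chart (coords 0 x) = point_class 3 G (tet 0, x)"
proof -
  have core: "coords 0 x \<in> core" by (rule coords_in_core[OF x max])
  then have st: "coords 0 x \<in> star" using core_subset by auto
  obtain W where W: "openin (top_of_set E3) W" "coords 0 x \<in> W" "W \<subseteq> star" "inj_on chart W"
    by (rule chart_locally_injective[OF st])
  have "adapted_chart G (W \<inter> core) chart"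
    unfolding adapted_chart_def
    using star_chart_subset[OF star_chart_chart[OF even], of "W \<inter> core"] W core_values openin_core
    by (auto intro: openin_Int inj_on_subset)
  then show thesis
    using W core chart_coords[OF x(1) st] by (intro that[of "W \<inter> core"]) auto
qed

end

section \<open>The truncated complex is a manifold\<close>

lemma half_space_3: "half_space 3 = top_of_set (E3 \<inter> {w. 0 \<le> w 0})"
  by (simp add: half_space_def Euclidean_space_3 subtopology_subtopology)

lemma star_chartD:
  assumes "star_chart G W g"
  shows star_chart_domain: "openin (top_of_set E3) W"
    and star_chart_continuous: "continuous_map (top_of_set W) (complex_space 3 G) g"
    and star_chart_openin: "openin (top_of_set E3) V \<Longrightarrow> V \<subseteq> W \<Longrightarrow> openin (complex_space 3 G) (g ` V)"
    and star_chart_closedin: "closed V \<Longrightarrow> V \<subseteq> W \<Longrightarrow> closedin (complex_space 3 G) (g ` V)"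
  using assms unfolding star_chart_def by simp_all

lemma open_embedding_on_inv_into:
  assumes open_sets: "openin Y (g ` S)" "openin X S"
    and hom: "homeomorphic_map (subtopology X S) (subtopology Y (g ` S)) g"
    and inj: "inj_on g W" "S \<subseteq> W"
  shows "open_embedding_on Y X (g ` S) (inv_into W g)"
proof -
  have tX: "topspace (subtopology X S) = S" and tY: "topspace (subtopology Y (g ` S)) = g ` S"
    using openin_subset[OF open_sets(2)] openin_subset[OF open_sets(1)] by auto
  obtain g' where g': "homeomorphic_maps (subtopology X S) (subtopology Y (g ` S)) g g'"
    using hom homeomorphic_map_maps by blast
  have inv: "inv_into W g (g w) = w" if "w \<in> S" for w
    using that inj by (intro inv_into_f_f) auto
  have eq: "g' p = inv_into W g p" if "p \<in> g ` S" for p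
    using that g' inv tX unfolding homeomorphic_maps_def by auto
  have im: "inv_into W g ` g ` S = S" using inv by (force simp: image_image)
  have "homeomorphic_map (subtopology Y (g ` S)) (subtopology X S) g'"
    using g' homeomorphic_maps_map by blast
  then have "homeomorphic_map (subtopology Y (g ` S)) (subtopology X S) (inv_into W g)"
    by (rule homeomorphic_map_eq) (use eq tY in simp)
  then show ?thesis using open_sets im by (simp add: open_embedding_on_def)
qed

lemma star_chart_homeomorphic_map:
  assumes g: "star_chart G W g" "inj_on g W"
  shows "homeomorphic_map (top_of_set W) (subtopology (complex_space 3 G) (g ` W)) g"
proof (rule bijective_open_imp_homeomorphic_map)
  have W: "openin (top_of_set E3) W" by (rule star_chart_domain[OF g(1)])
  have openW: "openin (complex_space 3 G) (g ` W)" by (rule star_chart_openin[OF g(1) W subset_refl])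
  then have sub: "g ` W \<subseteq> topspace (complex_space 3 G)" by (rule openin_subset)
  show "continuous_map (top_of_set W) (subtopology (complex_space 3 G) (g ` W)) g"
    using star_chart_continuous[OF g(1)] by (auto simp: continuous_map_in_subtopology)
  show "open_map (top_of_set W) (subtopology (complex_space 3 G) (g ` W)) g"
    unfolding open_map_def
  proof (intro allI impI)
    fix V assume V: "openin (top_of_set W) V"
    then have "V \<subseteq> W" by (rule openin_imp_subset)
    moreover have "openin (top_of_set E3) V" using openin_trans[OF V W] .
    ultimately have "openin (complex_space 3 G) (g ` V)" by (intro star_chart_openin[OF g(1)])
    then show "openin (subtopology (complex_space 3 G) (g ` W)) (g ` V)"
      using \<open>V \<subseteq> W\<close> by (subst openin_open_subtopology[OF openW]) auto
  qed
  show "g ` topspace (top_of_set W) = topspace (subtopology (complex_space 3 G) (g ` W))" using sub by auto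
qed (use g in auto)

lemma subtopology_associated_manifold:
  assumes "S \<subseteq> topspace (associated_manifold G)"
  shows "subtopology (associated_manifold G) S = subtopology (complex_space 3 G) S"
proof -
  have "{p. \<forall>(s, x)\<in>p. \<forall>i. x i \<le> 3/4} \<inter> S = S"
    using assms unfolding associated_manifold_def topspace_subtopology by blast
  then show ?thesis by (simp add: associated_manifold_def subtopology_subtopology)
qed

definition vertex_point :: "nat \<Rightarrow> nat \<Rightarrow> real" where
  "vertex_point v = (\<lambda>w. if w = v then 1 else 0)"

text \<open>For a point other than a vertex, \<open>i\<close> is chosen as a position of the largest
  coordinate: only the end \<open>i\<close> can then be affected by the truncation near the point,
  as \<open>coords_in_core\<close> requires.\<close>

lemma simplex_vertex_or_edge:
  assumes x: "x \<in> standard_simplex 3"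
  obtains v where "v \<le> 3" "x = vertex_point v"
    | i j where "i \<le> 3" "j \<le> 3" "i \<noteq> j" "0 < x i" "0 < x j" "\<And>n. x n \<le> x i"
proof -
  have nonneg: "0 \<le> x n" and out: "3 < n \<Longrightarrow> x n = 0" for n using x by (auto simp: standard_simplex_def)
  have sum: "(\<Sum>n\<le>3. x n) = 1" using x by (simp add: standard_simplex_def)
  obtain i where i: "i \<le> 3" "x i = Max (x ` {..3})"
  proof -
    have "Max (x ` {..3}) \<in> x ` {..3}" by (rule Max_in) auto
    then show thesis using that by (metis (no_types, lifting) atMost_iff imageE)
  qed
  have max3: "x n \<le> x i" if "n \<le> 3" for n unfolding i(2) by (rule Max_ge) (use that in auto)
  then have max: "x n \<le> x i" for n using out[of n] nonneg[of i] by (cases "n \<le> 3") auto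
  show thesis
  proof (cases "\<exists>j\<le>3. j \<noteq> i \<and> 0 < x j")
    case True
    then obtain j where j: "j \<le> 3" "i \<noteq> j" "0 < x j" by auto
    moreover have "0 < x i" using j(3) max[of j] by linarith
    ultimately show thesis using that(2) i(1) max by blast
  next
    case False
    then have z: "x j = 0" if "j \<noteq> i" for j using nonneg[of j] out[of j] that by (cases "j \<le> 3") force+
    have "(\<Sum>n\<le>3. x n) = x i + sum x ({..3} - {i})" using i(1) by (simp add: sum.remove)
    also have "sum x ({..3} - {i}) = 0" by (rule sum.neutral) (use z in auto)
    finally have "x i = 1" using sum by simp
    then have "x = vertex_point i" using z by (auto simp: vertex_point_def fun_eq_iff)
    then show thesis using that(1) i(1) by blast
  qed
qed

text \<open>Fans are demanded for ordered pairs \<open>(i, j)\<close>. The adapted chart of a fan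
  shows the truncation at \<open>vi\<close> only, so each edge is needed in both directions.\<close>

locale fanned_complex = facet_pairing 3 G for G +
  assumes nonempty: "0 < num_simplices G"
    and fans: "\<lbrakk>s < num_simplices G; i \<le> 3; j \<le> 3; i \<noteq> j\<rbrakk> \<Longrightarrow>
      \<exists>N tet vi vj vk vl. fan G N tet vi vj vk vl \<and> (\<forall>\<kappa>. even_order (vi \<kappa>) (vj \<kappa>) (vk \<kappa>) (vl \<kappa>)) \<and>
        tet 0 = s \<and> vi 0 = i \<and> vj 0 = j"
    and one_vertex: "\<lbrakk>s < num_simplices G; t < num_simplices G; i \<le> 3; j \<le> 3\<rbrakk> \<Longrightarrow>
      point_class 3 G (s, vertex_point i) = point_class 3 G (t, vertex_point j)"
begin

abbreviation C where "C \<equiv> complex_space 3 G"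
abbreviation M where "M \<equiv> associated_manifold G"

lemma edge_star_chart:
  assumes "s < num_simplices G" "i \<le> 3" "j \<le> 3" "i \<noteq> j"
  obtains W g where "star_chart G W g"
    "\<forall>x\<in>standard_simplex 3. 0 < x i \<longrightarrow> 0 < x j \<longrightarrow> point_class 3 G (s, x) \<in> g ` W"
proof -
  obtain N tet vi vj vk vl where F: "fan G N tet vi vj vk vl"
    and even: "\<forall>\<kappa>. even_order (vi \<kappa>) (vj \<kappa>) (vk \<kappa>) (vl \<kappa>)" and d: "tet 0 = s" "vi 0 = i" "vj 0 = j"
    using fans[OF assms] by blast
  interpret F: fan G N tet vi vj vk vl by (rule F)
  show thesis
  proof
    show "star_chart G F.star F.chart" using F.star_chart_chart even by blast
    show "\<forall>x\<in>standard_simplex 3. 0 < x i \<longrightarrow> 0 < x j \<longrightarrow> point_class 3 G (s, x) \<in> F.chart ` F.star"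
    proof (intro ballI impI)
      fix x :: "nat \<Rightarrow> real" assume x: "x \<in> standard_simplex 3" "0 < x i" "0 < x j"
      then have st: "F.coords 0 x \<in> F.star" by (intro F.coords_in_star) (simp_all add: d)
      show "point_class 3 G (s, x) \<in> F.chart ` F.star"
        using F.chart_coords[OF x(1) st] st d by (metis imageI)
    qed
  qed
qed

lemma injective_star_chart:
  assumes "s < num_simplices G" "x \<in> standard_simplex 3" "i \<le> 3" "j \<le> 3" "i \<noteq> j" "0 < x i" "0 < x j"
  obtains W g w where "star_chart G W g" "inj_on g W" "w \<in> W" "g w = point_class 3 G (s, x)"
proof -
  obtain N tet vi vj vk vl where F: "fan G N tet vi vj vk vl"
    and even: "\<forall>\<kappa>. even_order (vi \<kappa>) (vj \<kappa>) (vk \<kappa>) (vl \<kappa>)" and d: "tet 0 = s" "vi 0 = i" "vj 0 = j"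
    using fans[OF assms(1,3,4,5)] by blast
  interpret F: fan G N tet vi vj vk vl by (rule F)
  have st: "F.coords 0 x \<in> F.star" using assms by (intro F.coords_in_star) (simp_all add: d)
  obtain W where W: "openin (top_of_set E3) W" "F.coords 0 x \<in> W" "W \<subseteq> F.star" "inj_on F.chart W"
    by (rule F.chart_locally_injective[OF st])
  show thesis
  proof
    show "star_chart G W F.chart"
      using star_chart_subset[OF F.star_chart_chart W(1,3)] even by blast
    show "F.chart (F.coords 0 x) = point_class 3 G (s, x)"
      using F.chart_coords[OF assms(2) st] d by simp
  qed (use W in auto)
qed

lemma adapted_chart_at:
  assumes p: "p \<in> topspace M"
  obtains W g w where "adapted_chart G W g" "w \<in> W" "g w = p"
proof -
  have "p \<in> topspace C" and le: "\<forall>(s, x) \<in> p. \<forall>n. x n \<le> 3/4"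
    using p by (auto simp: topspace_associated_manifold)
  then obtain s x where sx: "p = point_class 3 G (s, x)" "s < num_simplices G" "x \<in> standard_simplex 3"
    by (auto simp: topspace_complex_space simplex_points_def)
  have "(s, x) \<in> p" unfolding sx(1) using sx by (intro point_class_self) (simp add: simplex_points_def)
  then have xle: "x n \<le> 3/4" for n using le by auto
  show thesis
  proof (cases rule: simplex_vertex_or_edge[OF sx(3)])
    case (1 v)
    then show thesis using xle[of v] by (simp add: vertex_point_def)
  next
    case (2 i j)
    obtain N tet vi vj vk vl where F: "fan G N tet vi vj vk vl"
      and even: "\<forall>\<kappa>. even_order (vi \<kappa>) (vj \<kappa>) (vk \<kappa>) (vl \<kappa>)" and d: "tet 0 = s" "vi 0 = i" "vj 0 = j"
      using fans[OF sx(2) 2(1-3)] by blast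
    interpret F: fan G N tet vi vj vk vl by (rule F)
    obtain W where "adapted_chart G W F.chart" "F.coords 0 x \<in> W"
      "F.chart (F.coords 0 x) = point_class 3 G (tet 0, x)"
      by (rule F.adapted_chart_exists[of x]) (use even 2 sx d in auto)
    then show thesis using that sx d by blast
  qed
qed

text \<open>Every point except the class of the vertices has an injective star chart, and of two
  different points at least one is of this kind. If the other point lies in the image of the same
  chart, disjoint neighbourhoods come from 3-space.\<close>

lemma Hausdorff_complex_space: "Hausdorff_space C"
proof -
  have sep: "\<exists>A B. openin C A \<and> openin C B \<and> p \<in> A \<and> q \<in> B \<and> disjnt A B"
    if g: "star_chart G W g" "inj_on g W" "w \<in> W" "g w = p" and q: "q \<in> topspace C" "p \<noteq> q" for W g w p q
  proof -
    have W: "openin (top_of_set E3) W" by (rule star_chart_domain[OF g(1)])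
    have op: "openin C (g ` (W \<inter> T))" if "open T" for T
      by (rule star_chart_openin[OF g(1) openin_Int_open[OF W that]]) simp
    show ?thesis
    proof (cases "q \<in> g ` W")
      case True
      then obtain w' where w': "w' \<in> W" "q = g w'" by auto
      then obtain T T' where T: "open T" "open T'" "w \<in> T" "w' \<in> T'" "T \<inter> T' = {}"
        using hausdorff[of w w'] g q by metis
      then have "disjnt (g ` (W \<inter> T)) (g ` (W \<inter> T'))"
        using g(2) by (auto simp: disjnt_def inj_on_def)
      then show ?thesis using op[OF T(1)] op[OF T(2)] T w' g by blast
    next
      case False
      \<comment> \<open>The other point is outside the image of the chart. A small closed ball
        around \<open>w\<close> has a closed image, whose complement is a neighbourhood of that
        point.\<close>
      obtain T where T: "open T" "W = E3 \<inter> T" using W by (auto simp: openin_open)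
      have "w \<in> T" using T(2) g(3) by simp
      then obtain e where e: "0 < e" "cball w e \<subseteq> T" using T(1) open_contains_cball by meson
      have sub: "E3 \<inter> cball w e \<subseteq> W" using T e by auto
      have "closedin C (g ` (E3 \<inter> cball w e))"
        by (rule star_chart_closedin[OF g(1) closed_Int[OF closed_E3 closed_cball] sub])
      then have "openin C (topspace C - g ` (E3 \<inter> cball w e))" by blast
      moreover have "q \<in> topspace C - g ` (E3 \<inter> cball w e)" using q False sub by auto
      moreover have "disjnt (g ` (W \<inter> ball w e)) (topspace C - g ` (E3 \<inter> cball w e))"
        unfolding T(2) disjnt_def using ball_subset_cball[of w e] by blast
      moreover have "p \<in> g ` (W \<inter> ball w e)" using g(3,4) e(1) by (metis IntI centre_in_ball imageI)
      ultimately show ?thesis using op[OF open_ball] by blast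
    qed
  qed
  define z where "z = point_class 3 G (0, vertex_point 0)"
  have chart: "p = z \<or> (\<exists>W g w. star_chart G W g \<and> inj_on g W \<and> w \<in> W \<and> g w = p)"
    if p: "p \<in> topspace C" for p
  proof -
    obtain s x where sx: "p = point_class 3 G (s, x)" "s < num_simplices G" "x \<in> standard_simplex 3"
      using p by (auto simp: topspace_complex_space simplex_points_def)
    show ?thesis
    proof (cases rule: simplex_vertex_or_edge[OF sx(3)])
      case (1 v)
      then show ?thesis using one_vertex[OF sx(2) nonempty 1(1), of 0] sx by (simp add: z_def)
    next
      case (2 i j)
      then show ?thesis using injective_star_chart[OF sx(2,3) 2(1-5)] sx by metis
    qed
  qed
  show ?thesis
    unfolding Hausdorff_space_def
  proof (intro allI impI)
    fix p q assume pq: "p \<in> topspace C \<and> q \<in> topspace C \<and> p \<noteq> q"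
    then have "p \<noteq> z \<or> q \<noteq> z" by auto
    then show "\<exists>A B. openin C A \<and> openin C B \<and> p \<in> A \<and> q \<in> B \<and> disjnt A B"
    proof
      assume "p \<noteq> z"
      then show ?thesis using chart[of p] sep[of _ _ _ p q] pq by blast
    next
      assume "q \<noteq> z"
      then obtain A B where "openin C A" "openin C B" "q \<in> A" "p \<in> B" "disjnt A B"
        using chart[of q] sep[of _ _ _ q p] pq by metis
      then show ?thesis using disjnt_sym by blast
    qed
  qed
qed

lemma point_class_in_M:
  assumes "(s, x) \<in> simplex_points 3 G"
  shows "point_class 3 G (s, x) \<in> topspace M \<longleftrightarrow> (\<forall>n. x n \<le> 3/4)"
    and "point_class 3 G (s, x) \<in> truncation_points G \<longleftrightarrow> (\<forall>n. x n \<le> 3/4) \<and> (\<exists>n. x n = 3/4)"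
proof -
  have r: "range y = range x" if "(t, y) \<in> point_class 3 G (s, x)" for t y
    using range_point_class[OF that] .
  have self: "(s, x) \<in> point_class 3 G (s, x)" using point_class_self[OF assms] .
  have le: "(\<forall>n. y n \<le> 3/4) \<longleftrightarrow> (\<forall>n. x n \<le> 3/4)" if "(t, y) \<in> point_class 3 G (s, x)" for t y
  proof -
    have "(\<forall>n. y n \<le> 3/4) \<longleftrightarrow> (\<forall>z\<in>range y. z \<le> 3/4)" "(\<forall>n. x n \<le> 3/4) \<longleftrightarrow> (\<forall>z\<in>range x. z \<le> 3/4)" by blast+
    then show ?thesis using r[OF that] by simp
  qed
  have ex: "(\<exists>n. y n = 3/4) \<longleftrightarrow> (\<exists>n. x n = 3/4)" if "(t, y) \<in> point_class 3 G (s, x)" for t y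
  proof -
    have "(\<exists>n. y n = 3/4) \<longleftrightarrow> 3/4 \<in> range y" "(\<exists>n. x n = 3/4) \<longleftrightarrow> 3/4 \<in> range x" by (metis rangeE rangeI)+
    then show ?thesis using r[OF that] by simp
  qed
  have "point_class 3 G (s, x) \<in> topspace C" using assms by (auto simp: topspace_complex_space)
  then show A: "point_class 3 G (s, x) \<in> topspace M \<longleftrightarrow> (\<forall>n. x n \<le> 3/4)"
    unfolding topspace_associated_manifold using le self by blast
  show "point_class 3 G (s, x) \<in> truncation_points G \<longleftrightarrow> (\<forall>n. x n \<le> 3/4) \<and> (\<exists>n. x n = 3/4)"
    unfolding truncation_points_def using A ex self by blast
qed

lemma closedin_M: "closedin C (topspace M)"
proof -
  have "{p \<in> simplex_points 3 G. point_class 3 G p \<in> topspace M} = simplex_points 3 G \<inter> (\<Inter>n. {p. snd p n \<le> 3/4})"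
    using point_class_in_M(1) by auto
  moreover have "closed (\<Inter>n. {p :: nat \<times> (nat \<Rightarrow> real). snd p n \<le> 3/4})"
    by (intro closed_INT ballI closed_Collect_le continuous_on_const
        continuous_on_product_then_coordinatewise[OF continuous_on_snd[OF continuous_on_id]])
  ultimately show ?thesis
    by (subst closedin_complex_space) (auto simp: topspace_associated_manifold closedin_closed)
qed

lemma compact_M: "compact_space M"
proof -
  have "compactin C (topspace M)" using closedin_compact_space[OF compact_complex_space closedin_M] .
  then have "compact_space (subtopology C (topspace M))" by (rule compact_space_subtopology)
  then show ?thesis using subtopology_associated_manifold[of "topspace M" G] by simp
qed

lemma Hausdorff_M: "Hausdorff_space M"
  unfolding associated_manifold_def by (intro Hausdorff_space_subtopology Hausdorff_complex_space)

lemma openin_M: "openin M A \<longleftrightarrow> (\<exists>T. openin C T \<and> A = T \<inter> topspace M)"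
  using subtopology_associated_manifold[of "topspace M" G] openin_subtopology[of C "topspace M" A] by simp

text \<open>Finitely many parametrised stars, one for each directed edge of each tetrahedron, cover
  the truncated complex. They are open maps, so a countable basis of the function space is carried
  to a countable basis.\<close>

lemma second_countable_M: "second_countable M"
proof -
  define D where "D = {(s, i, j). s < num_simplices G \<and> i \<le> 3 \<and> j \<le> (3 :: nat) \<and> i \<noteq> j}"
  have "D \<subseteq> {..<num_simplices G} \<times> {..3} \<times> {..3}" by (auto simp: D_def)
  then have "finite D" by (rule finite_subset) simp
  define P where "P = (\<lambda>(s, i, j) (W, g). star_chart G W g \<and>
    (\<forall>x\<in>standard_simplex 3. 0 < x i \<longrightarrow> 0 < x j \<longrightarrow> point_class 3 G (s, x) \<in> g ` W))"
  have "\<exists>z. P d z" if d: "d \<in> D" for d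
  proof -
    obtain s i j where d: "d = (s, i, j)" "s < num_simplices G" "i \<le> 3" "j \<le> 3" "i \<noteq> j"
      using d by (auto simp: D_def)
    obtain W g where "star_chart G W g"
      "\<forall>x\<in>standard_simplex 3. 0 < x i \<longrightarrow> 0 < x j \<longrightarrow> point_class 3 G (s, x) \<in> g ` W"
      by (rule edge_star_chart[OF d(2-5)])
    then have "P d (W, g)" by (simp add: P_def d(1))
    then show ?thesis by blast
  qed
  then obtain F where F: "\<And>d. d \<in> D \<Longrightarrow> P d (F d)" by metis
  obtain B :: "(nat \<Rightarrow> real) set set" where B: "countable B" "topological_basis B"
    using ex_countable_basis by auto
  define \<B> where "\<B> = (\<Union>d\<in>D. (\<lambda>V. snd (F d) ` (fst (F d) \<inter> V) \<inter> topspace M) ` B)"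
  have chart: "star_chart G (fst (F d)) (snd (F d))" if "d \<in> D" for d
    using F[OF that] by (auto simp: P_def split: prod.splits)
  show ?thesis
    unfolding second_countable_def
  proof (intro exI conjI ballI allI impI)
    show "countable \<B>" unfolding \<B>_def by (intro countable_UN countable_image countable_finite \<open>finite D\<close> B(1))
  next
    fix A assume "A \<in> \<B>"
    then obtain d V where dV: "d \<in> D" "V \<in> B" "A = snd (F d) ` (fst (F d) \<inter> V) \<inter> topspace M"
      unfolding \<B>_def by blast
    have "open V" using topological_basis_open[OF B(2) dV(2)] .
    then have "openin C (snd (F d) ` (fst (F d) \<inter> V))"
      using chart[OF dV(1)] by (intro star_chart_openin[OF chart[OF dV(1)]] openin_Int_open star_chart_domain) auto
    then show "openin M A" unfolding openin_M using dV(3) by blast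
  next
    fix A p assume A: "openin M A \<and> p \<in> A"
    then obtain T where T: "openin C T" "A = T \<inter> topspace M" by (auto simp: openin_M)
    then have pM: "p \<in> topspace M" "p \<in> T" using A by auto
    obtain d w where d: "d \<in> D" and w: "w \<in> fst (F d)" "snd (F d) w = p"
    proof -
      have "p \<in> topspace C" and le: "\<forall>(s, x) \<in> p. \<forall>n. x n \<le> 3/4"
        using pM by (auto simp: topspace_associated_manifold)
      then obtain s x where sx: "p = point_class 3 G (s, x)" "s < num_simplices G" "x \<in> standard_simplex 3"
        by (auto simp: topspace_complex_space simplex_points_def)
      have "(s, x) \<in> p" unfolding sx(1) using sx by (intro point_class_self) (simp add: simplex_points_def)
      then have xle: "x n \<le> 3/4" for n using le by auto
      show thesis
      proof (cases rule: simplex_vertex_or_edge[OF sx(3)])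
        case (1 v)
        then show thesis using xle[of v] by (simp add: vertex_point_def)
      next
        case (2 i j)
        then have D: "(s, i, j) \<in> D" using sx by (simp add: D_def)
        have "p \<in> snd (F (s, i, j)) ` fst (F (s, i, j))"
          using F[OF D] sx 2(4,5) by (auto simp: P_def split: prod.splits)
        then show thesis using that[OF D] by blast
      qed
    qed
    let ?W = "fst (F d)" and ?g = "snd (F d)"
    have "openin (top_of_set ?W) {w \<in> ?W. ?g w \<in> T}"
      using openin_continuous_map_preimage[OF star_chart_continuous[OF chart[OF d]] T(1)] by simp
    then obtain T' where T': "open T'" "{w \<in> ?W. ?g w \<in> T} = ?W \<inter> T'" by (auto simp: openin_open)
    have "w \<in> T'" using w pM T'(2) by blast
    then obtain V where V: "V \<in> B" "w \<in> V" "V \<subseteq> T'"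
      using topological_basisE[OF B(2) T'(1)] by blast
    show "\<exists>V\<in>\<B>. p \<in> V \<and> V \<subseteq> A"
    proof (intro bexI conjI)
      show "?g ` (?W \<inter> V) \<inter> topspace M \<in> \<B>" using d V(1) unfolding \<B>_def by blast
      show "p \<in> ?g ` (?W \<inter> V) \<inter> topspace M" using w V(2) pM by blast
      show "?g ` (?W \<inter> V) \<inter> topspace M \<subseteq> A" using V(3) T'(2) unfolding T(2) by blast
    qed
  qed
qed

lemma star_chart_onto_M:
  assumes g: "star_chart G W g" "inj_on g W" and S: "S \<subseteq> W" "g ` S \<subseteq> topspace M"
  shows "homeomorphic_map (top_of_set S) (subtopology M (g ` S)) g"
proof -
  have "g ` S \<subseteq> topspace C" using S(2) by (auto simp: topspace_associated_manifold)
  then have "homeomorphic_map (subtopology (top_of_set W) S) (subtopology (subtopology C (g ` W)) (g ` S)) g"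
    using S(1) by (intro homeomorphic_map_subtopologies[OF star_chart_homeomorphic_map[OF g]]) auto
  moreover have "W \<inter> S = S" "g ` W \<inter> g ` S = g ` S" using S(1) by auto
  ultimately show ?thesis
    using subtopology_associated_manifold[OF S(2)] by (simp add: subtopology_subtopology)
qed

lemma adapted_chart_half_space:
  assumes g: "adapted_chart G W g"
  shows "open_embedding_on M (half_space 3) (g ` {w \<in> W. 0 \<le> w 0}) (inv_into W g)"
    and "g ` {w \<in> W. 0 \<le> w 0} \<subseteq> topspace M" and "openin M (g ` {w \<in> W. 0 \<le> w 0})"
proof -
  let ?S = "{w \<in> W. 0 \<le> w 0}"
  have sc: "star_chart G W g" and inj: "inj_on g W" and M: "\<And>w. w \<in> W \<Longrightarrow> g w \<in> topspace M \<longleftrightarrow> 0 \<le> w 0"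
    using g unfolding adapted_chart_def by simp_all
  show sub: "g ` ?S \<subseteq> topspace M" using M by auto
  have eq: "g ` ?S = g ` W \<inter> topspace M" using M by auto
  show op: "openin M (g ` ?S)"
    unfolding openin_M eq using star_chart_openin[OF sc star_chart_domain[OF sc] subset_refl] by blast
  obtain T where T: "open T" "W = E3 \<inter> T" using star_chart_domain[OF sc] by (auto simp: openin_open)
  then have S: "openin (half_space 3) ?S" unfolding half_space_3 by (auto simp: openin_open)
  have "subtopology (half_space 3) ?S = top_of_set ?S"
    using T(2) by (simp add: half_space_3 subtopology_subtopology) (metis (no_types, lifting) Collect_conj_eq Int_absorb1 inf.assoc inf_le2 inf.left_commute inf_commute Int_def mem_Collect_eq subset_eq)
  then show "open_embedding_on M (half_space 3) (g ` ?S) (inv_into W g)"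
    using star_chart_onto_M[OF sc inj _ sub] by (intro open_embedding_on_inv_into[OF op S]) (auto intro: inj)
qed

lemma adapted_chart_Euclidean:
  assumes g: "adapted_chart G W g" and S: "openin (top_of_set E3) S" "S \<subseteq> {w \<in> W. 0 < w 0}"
  shows "open_embedding_on M (Euclidean_space 3) (g ` S) (inv_into W g)"
proof -
  have sc: "star_chart G W g" and inj: "inj_on g W" and M: "\<And>w. w \<in> W \<Longrightarrow> g w \<in> topspace M \<longleftrightarrow> 0 \<le> w 0"
    using g unfolding adapted_chart_def by simp_all
  have SW: "S \<subseteq> W" using S(2) by auto
  have sub: "g ` S \<subseteq> topspace M" using S(2) M by auto
  have "openin C (g ` S)" by (rule star_chart_openin[OF sc S(1) SW])
  then have op: "openin M (g ` S)" unfolding openin_M using sub by blast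
  have "E3 \<inter> S = S" using openin_imp_subset[OF S(1)] by blast
  then have "subtopology (Euclidean_space 3) S = top_of_set S"
    by (simp add: Euclidean_space_3 subtopology_subtopology)
  then show ?thesis
    using star_chart_onto_M[OF sc inj SW sub] S(1)
    by (intro open_embedding_on_inv_into[OF op _ _ inj SW]) (simp_all add: Euclidean_space_3)
qed

lemma manifold_M: "manifold_with_boundary 3 M"
  unfolding manifold_with_boundary_def
proof (intro conjI ballI Hausdorff_M second_countable_M)
  fix p assume p: "p \<in> topspace M"
  obtain W g w where g: "adapted_chart G W g" "w \<in> W" "g w = p" by (rule adapted_chart_at[OF p])
  then have "0 \<le> w 0" using p unfolding adapted_chart_def by blast
  then have "p \<in> g ` {w \<in> W. 0 \<le> w 0}" using g by blast
  then show "\<exists>U f. p \<in> U \<and> open_embedding_on M (half_space 3) U f"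
    using adapted_chart_half_space(1)[OF g(1)] by (intro exI conjI)
qed

section \<open>Interior and boundary of the truncated complex\<close>

lemma E3_open_decrease:
  assumes Y: "openin (top_of_set E3) Y" "w \<in> Y"
  obtains w' where "w' \<in> Y" "w' 0 < w 0"
proof -
  obtain T where T: "open T" "Y = E3 \<inter> T" using Y(1) by (auto simp: openin_open)
  define c where "c = (\<lambda>t n. if n = 0 then t else w n)"
  have "continuous_on UNIV c"
    unfolding c_def
    by (intro continuous_on_coordinatewise_then_product continuous_on_if_const continuous_intros)
  then have "open (c -` T)" by (intro open_vimage T)
  moreover have "c (w 0) = w" by (auto simp: c_def)
  then have "w 0 \<in> c -` T" using Y T by auto
  ultimately obtain e where e: "0 < e" "\<And>y. dist y (w 0) < e \<Longrightarrow> y \<in> c -` T"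
    by (metis open_dist)
  have "c (w 0 - e/2) \<in> Y" using e(1) e(2)[of "w 0 - e/2"] Y(2) unfolding T(2) by (simp add: c_def dist_real_def)
  then show thesis using that[of "c (w 0 - e/2)"] e(1) by (simp add: c_def)
qed

text \<open>A Euclidean chart around a truncation point, followed by the half-space chart, would be
  an injective continuous map from an open set of 3-space into the half-space that hits the wall. By
  invariance of domain its image is open, but an open set containing a point of the wall leaves the
  half-space.\<close>

lemma truncation_not_interior:
  assumes p: "p \<in> truncation_points G"
  shows "p \<notin> manifold_interior 3 M"
proof
  assume "p \<in> manifold_interior 3 M"
  then obtain U f where U: "p \<in> U" and f: "open_embedding_on M (Euclidean_space 3) U f"
    by (auto simp: manifold_interior_def)
  have pM: "p \<in> topspace M" using p by (simp add: truncation_points_def)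
  obtain W g w where g: "adapted_chart G W g" "w \<in> W" "g w = p" by (rule adapted_chart_at[OF pM])
  have sc: "star_chart G W g" and inj: "inj_on g W" and w0: "w 0 = 0"
    using g p unfolding adapted_chart_def by auto
  let ?S = "{w \<in> W. 0 \<le> w 0}" and ?E = "Euclidean_space 3"
  note half = adapted_chart_half_space(2,3)[OF g(1)]
  define A where "A = U \<inter> g ` ?S"
  have openU: "openin M U" and fU: "openin ?E (f ` U)"
    and homf: "homeomorphic_map (subtopology M U) (subtopology ?E (f ` U)) f"
    using f by (auto simp: open_embedding_on_def)
  have "openin (subtopology M U) A"
    using openU half(2) unfolding A_def by (intro openin_subtopology_Int2)
  then have "openin (subtopology ?E (f ` U)) (f ` A)"
    using homeomorphic_imp_open_map[OF homf] by (simp add: open_map_def)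
  then have V: "openin ?E (f ` A)" using fU by (simp add: openin_open_subtopology)
  obtain f' where f': "homeomorphic_maps (subtopology M U) (subtopology ?E (f ` U)) f f'"
    using homf homeomorphic_map_maps by blast
  have homg: "homeomorphic_map (top_of_set ?S) (subtopology M (g ` ?S)) g"
    by (rule star_chart_onto_M[OF sc inj _ half(1)]) auto
  then obtain g' where g': "homeomorphic_maps (top_of_set ?S) (subtopology M (g ` ?S)) g g'"
    using homeomorphic_map_maps by blast
  have tU: "topspace (subtopology M U) = U" "topspace (subtopology M (g ` ?S)) = g ` ?S"
    using openin_subset[OF openU] half(1) by auto
  have f'f: "f' (f q) = q" if "q \<in> U" for q using f' that tU unfolding homeomorphic_maps_def by blast
  have g'g: "g' (g v) = v" if "v \<in> ?S" for v
    using g' that unfolding homeomorphic_maps_def topspace_euclidean_subtopology by blast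
  define h where "h = g' \<circ> f'"
  have "continuous_map (subtopology ?E (f ` A)) (subtopology M (g ` ?S)) f'"
  proof -
    have "continuous_map (subtopology ?E (f ` U)) M f'"
      using f' unfolding homeomorphic_maps_def continuous_map_in_subtopology by blast
    then have "continuous_map (subtopology ?E (f ` A)) M f'"
      by (rule continuous_map_from_subtopology_mono) (auto simp: A_def)
    moreover have "f' ` topspace (subtopology ?E (f ` A)) \<subseteq> g ` ?S"
      using f'f unfolding A_def topspace_subtopology by auto
    ultimately show ?thesis by (auto simp: continuous_map_in_subtopology)
  qed
  moreover have "continuous_map (subtopology M (g ` ?S)) (top_of_set ?S) g'"
    using g' by (simp add: homeomorphic_maps_def)
  ultimately have "continuous_map (subtopology ?E (f ` A)) (top_of_set ?S) h"
    unfolding h_def by (rule continuous_map_compose)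
  moreover have "?S \<subseteq> E3" using openin_imp_subset[OF star_chart_domain[OF sc]] by blast
  ultimately have "continuous_map (subtopology ?E (f ` A)) ?E h"
    unfolding Euclidean_space_3 continuous_map_in_subtopology by auto
  moreover have hf: "h (f (g v)) = v" if "v \<in> ?S" "g v \<in> U" for v
    using f'f[OF that(2)] g'g[OF that(1)] by (simp add: h_def)
  moreover have "inj_on h (f ` A)"
    by (rule inj_onI) (use hf in \<open>auto simp: A_def\<close>)
  ultimately have "openin ?E (h ` f ` A)"
    using invariance_of_domain_Euclidean_space[OF V] by blast
  then have "openin (top_of_set E3) (h ` f ` A)" by (simp add: Euclidean_space_3)
  moreover have "w \<in> ?S" using g w0 by simp
  then have "w \<in> h ` f ` A" using hf[of w] g(3) U unfolding A_def by (metis (no_types, lifting) IntI imageI)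
  ultimately obtain w' where w': "w' \<in> h ` f ` A" "w' 0 < w 0" by (rule E3_open_decrease)
  have "w' \<in> ?S" using w'(1) hf unfolding A_def by auto
  then show False using w'(2) w0 by simp
qed

lemma manifold_interior_M: "manifold_interior 3 M = topspace M - truncation_points G"
proof
  show "manifold_interior 3 M \<subseteq> topspace M - truncation_points G"
  proof
    fix p assume p: "p \<in> manifold_interior 3 M"
    then obtain U f where "p \<in> U" "openin M U" by (auto simp: manifold_interior_def open_embedding_on_def)
    then show "p \<in> topspace M - truncation_points G"
      using truncation_not_interior[of p] p openin_subset by blast
  qed
  show "topspace M - truncation_points G \<subseteq> manifold_interior 3 M"
  proof
    fix p assume p: "p \<in> topspace M - truncation_points G"
    then obtain W g w where g: "adapted_chart G W g" "w \<in> W" "g w = p" using adapted_chart_at[of p] by blast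
    then have "0 < w 0" using p unfolding adapted_chart_def by (metis DiffE less_eq_real_def)
    define S where "S = W \<inter> {w. 0 < w 0}"
    have "star_chart G W g" using g(1) by (simp add: adapted_chart_def)
    then have "openin (top_of_set E3) S" unfolding S_def
      by (intro openin_Int_open open_Collect_less continuous_on_const continuous_on_coordinate star_chart_domain)
    then have "open_embedding_on M (Euclidean_space 3) (g ` S) (inv_into W g)"
      by (rule adapted_chart_Euclidean[OF g(1)]) (auto simp: S_def)
    moreover have "p \<in> g ` S" using g \<open>0 < w 0\<close> by (auto simp: S_def)
    ultimately show "p \<in> manifold_interior 3 M"
      unfolding manifold_interior_def mem_Collect_eq by (intro exI conjI)
  qed
qed

lemma manifold_boundary_M: "manifold_boundary 3 M = truncation_points G"
proof -
  have "truncation_points G \<subseteq> topspace M" unfolding truncation_points_def by blast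
  then show ?thesis unfolding manifold_boundary_def manifold_interior_M by blast
qed

end

section \<open>Local degrees\<close>

definition norm3 :: "(nat \<Rightarrow> real) \<Rightarrow> real" where
  "norm3 w = sqrt (\<Sum>j<3. (w j)\<^sup>2)"

definition normalize3 :: "(nat \<Rightarrow> real) \<Rightarrow> nat \<Rightarrow> real" where
  "normalize3 w = (\<lambda>i. w i / norm3 w)"

abbreviation S2 :: "(nat \<Rightarrow> real) set" where
  "S2 \<equiv> {u \<in> E3. norm3 u = 1}"

lemma nsphere_2: "nsphere 2 = top_of_set S2"
proof -
  have 1: "(\<Sum>i\<le>2. (u i)\<^sup>2) = 1 \<longleftrightarrow> norm3 u = 1" for u :: "nat \<Rightarrow> real"
    by (simp add: norm3_def numeral_2_eq_2 numeral_3_eq_3 lessThan_Suc_atMost)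
  have 2: "(\<forall>i>2. u i = 0) \<longleftrightarrow> (\<forall>i\<ge>3. u i = 0)" for u :: "nat \<Rightarrow> real"
    by (simp add: numeral_2_eq_2 numeral_3_eq_3 Suc_le_eq)
  show ?thesis unfolding nsphere 1 2 euclidean_product_topology by (simp add: conj_commute)
qed

lemma norm3_eq_0: "w \<in> E3 \<Longrightarrow> norm3 w = 0 \<longleftrightarrow> w = (\<lambda>n. 0)"
proof
  assume w: "w \<in> E3" and "norm3 w = 0"
  then have "\<forall>j\<in>{..<3}. (w j)\<^sup>2 = 0" by (simp add: norm3_def sum_nonneg_eq_0_iff)
  then have "w n = 0" if "n < 3" for n using that by simp
  then show "w = (\<lambda>n. 0)" using w by (auto simp: fun_eq_iff) (meson not_le)
qed (simp add: norm3_def)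

lemma norm3_nonneg: "0 \<le> norm3 w"
  by (simp add: norm3_def sum_nonneg)

lemma norm3_scale: "0 \<le> c \<Longrightarrow> norm3 (\<lambda>n. c * w n) = c * norm3 w"
  by (simp add: norm3_def power_mult_distrib real_sqrt_mult flip: sum_distrib_left)

lemma normalize3_scale: "0 < c \<Longrightarrow> normalize3 (\<lambda>n. c * w n) = normalize3 w"
  by (simp add: normalize3_def norm3_scale fun_eq_iff)

lemma normalize3_S2: "u \<in> S2 \<Longrightarrow> normalize3 u = u"
  by (simp add: normalize3_def)

lemma normalize3_in_S2:
  assumes "w \<in> E3" "w \<noteq> (\<lambda>n. 0)"
  shows "normalize3 w \<in> S2"
proof -
  have pos: "0 < norm3 w" using norm3_eq_0[OF assms(1)] assms(2) norm3_nonneg[of w] by linarith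
  have "norm3 (\<lambda>n. inverse (norm3 w) * w n) = 1" using pos by (subst norm3_scale) auto
  then show ?thesis using assms(1) by (simp add: normalize3_def divide_inverse mult.commute)
qed

lemma S2_nonzero: "u \<in> S2 \<Longrightarrow> u \<noteq> (\<lambda>n. 0)"
  using norm3_eq_0[of u] by auto

lemma S2_bound: "u \<in> S2 \<Longrightarrow> \<bar>u n\<bar> \<le> 1"
proof (cases "n < 3")
  case True
  assume u: "u \<in> S2"
  have "(u n)\<^sup>2 \<le> (\<Sum>j<3. (u j)\<^sup>2)" using True by (intro member_le_sum) auto
  also have "\<dots> = 1" using u by (simp add: norm3_def)
  finally show ?thesis by (simp add: abs_square_le_1)
qed auto

lemma continuous_on_normalize3:
  assumes f: "continuous_on S f" "\<And>x. x \<in> S \<Longrightarrow> f x \<in> E3" "\<And>x. x \<in> S \<Longrightarrow> f x \<noteq> (\<lambda>n. 0)"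
  shows "continuous_on S (\<lambda>x. normalize3 (f x))"
proof -
  have c: "continuous_on S (\<lambda>x. f x n)" for n by (rule continuous_on_product_then_coordinatewise[OF f(1)])
  have "continuous_on S (\<lambda>x. norm3 (f x))" unfolding norm3_def by (intro continuous_intros c)
  moreover have "norm3 (f x) \<noteq> 0" if "x \<in> S" for x using norm3_eq_0[OF f(2)[OF that]] f(3)[OF that] by simp
  ultimately show ?thesis
    unfolding normalize3_def by (intro continuous_on_coordinatewise_then_product continuous_on_divide c) auto
qed

text \<open>Homogeneity makes normalisation compatible with composition up to a positive factor, so
  that the degree on the sphere becomes multiplicative. The intended examples are linear
  isomorphisms.\<close>

definition homogeneous3 :: "((nat \<Rightarrow> real) \<Rightarrow> nat \<Rightarrow> real) \<Rightarrow> bool" where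
  "homogeneous3 A \<longleftrightarrow> continuous_on E3 A \<and> (\<forall>u\<in>E3. A u \<in> E3 \<and> (u \<noteq> (\<lambda>n. 0) \<longrightarrow> A u \<noteq> (\<lambda>n. 0))) \<and>
     (\<forall>u\<in>E3. \<forall>c>0. A (\<lambda>n. c * u n) = (\<lambda>n. c * A u n))"

definition degree3 :: "((nat \<Rightarrow> real) \<Rightarrow> nat \<Rightarrow> real) \<Rightarrow> int" where
  "degree3 A = Brouwer_degree2 2 (\<lambda>u. normalize3 (A u))"

lemma degree3_cong: "(\<And>u. u \<in> E3 \<Longrightarrow> A u = B u) \<Longrightarrow> degree3 A = degree3 B"
  unfolding degree3_def by (rule Brouwer_degree2_eq) (simp add: nsphere_2)

lemma degree3_id: "degree3 (\<lambda>u. u) = 1"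
proof -
  have "Brouwer_degree2 2 (\<lambda>u. normalize3 u) = Brouwer_degree2 2 id"
    by (rule Brouwer_degree2_eq) (simp add: nsphere_2 normalize3_S2)
  then show ?thesis by (simp add: degree3_def)
qed

lemma homogeneous3_sphere:
  assumes "homogeneous3 A"
  shows "continuous_map (nsphere 2) (nsphere 2) (\<lambda>u. normalize3 (A u))"
proof -
  have "continuous_on S2 A" using assms unfolding homogeneous3_def by (blast intro: continuous_on_subset)
  then have "continuous_on S2 (\<lambda>u. normalize3 (A u))"
    by (rule continuous_on_normalize3) (use assms S2_nonzero in \<open>auto simp: homogeneous3_def\<close>)
  moreover have "normalize3 (A u) \<in> S2" if "u \<in> S2" for u
    using assms that S2_nonzero[OF that] unfolding homogeneous3_def by (intro normalize3_in_S2) auto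
  ultimately show ?thesis by (auto simp: nsphere_2)
qed

lemma homogeneous3_compose:
  assumes "homogeneous3 A" "homogeneous3 B"
  shows "homogeneous3 (\<lambda>u. A (B u))"
  unfolding homogeneous3_def
proof (intro conjI)
  have "B ` E3 \<subseteq> E3" using assms(2) unfolding homogeneous3_def by blast
  then show "continuous_on E3 (\<lambda>u. A (B u))"
    using assms unfolding homogeneous3_def by (intro continuous_on_compose2[of E3 A E3 B]) simp_all
qed (use assms in \<open>auto simp: homogeneous3_def\<close>)

lemma degree3_compose:
  assumes A: "homogeneous3 A" and B: "homogeneous3 B"
  shows "degree3 (\<lambda>u. A (B u)) = degree3 A * degree3 B"
proof -
  let ?a = "\<lambda>u. normalize3 (A u)" and ?b = "\<lambda>u. normalize3 (B u)"
  have "degree3 (\<lambda>u. A (B u)) = Brouwer_degree2 2 (?a \<circ> ?b)"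
    unfolding degree3_def
  proof (rule Brouwer_degree2_eq)
    fix u assume "u \<in> topspace (nsphere 2)"
    then have u: "u \<in> S2" by (simp add: nsphere_2)
    then have b: "B u \<in> E3" "B u \<noteq> (\<lambda>n. 0)"
      using B S2_nonzero[OF u] unfolding homogeneous3_def by auto
    then have pos: "0 < inverse (norm3 (B u))" using norm3_eq_0[OF b(1)] norm3_nonneg[of "B u"] by simp
    have "normalize3 (B u) = (\<lambda>n. inverse (norm3 (B u)) * B u n)" by (simp add: normalize3_def divide_inverse mult.commute)
    then have "A (normalize3 (B u)) = (\<lambda>n. inverse (norm3 (B u)) * A (B u) n)"
      using A b pos unfolding homogeneous3_def by simp
    then show "normalize3 (A (B u)) = (?a \<circ> ?b) u" using normalize3_scale[OF pos] by simp
  qed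
  also have "\<dots> = degree3 A * degree3 B"
    unfolding degree3_def by (rule Brouwer_degree2_compose) (intro homogeneous3_sphere assms)+
  finally show ?thesis .
qed

lemma homogeneous3I:
  assumes "continuous_on E3 A" "\<And>u. u \<in> E3 \<Longrightarrow> A u \<in> E3"
    "\<And>u c. u \<in> E3 \<Longrightarrow> 0 < c \<Longrightarrow> A (\<lambda>n. c * u n) = (\<lambda>n. c * A u n)"
    and "\<And>u. u \<in> E3 \<Longrightarrow> B (A u) = u" "B (\<lambda>n. 0) = (\<lambda>n. 0)"
  shows "homogeneous3 A"
proof -
  have "A u \<noteq> (\<lambda>n. 0)" if "u \<in> E3" "u \<noteq> (\<lambda>n. 0)" for u
  proof
    assume "A u = (\<lambda>n. 0)"
    then have "B (A u) = (\<lambda>n. 0)" using assms(5) by simp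
    then show False using assms(4)[OF that(1)] that(2) by simp
  qed
  then show ?thesis unfolding homogeneous3_def using assms(1-3) by blast
qed

lemma degree3_inverse:
  assumes "homogeneous3 A" "homogeneous3 B" "\<And>u. u \<in> E3 \<Longrightarrow> A (B u) = u"
  shows "degree3 A * degree3 B = 1"
proof -
  have "degree3 (\<lambda>u. A (B u)) = degree3 (\<lambda>u. u)" by (rule degree3_cong) (rule assms(3))
  then show ?thesis by (simp add: degree3_compose[OF assms(1,2)] degree3_id)
qed

text \<open>Degrees are multiplicative integers, so a map with a one-sided inverse has degree 1 or
  -1. Writing a map as a square thus proves that its degree is 1.\<close>

lemma degree3_square:
  assumes "homogeneous3 A" "homogeneous3 B" "\<And>u. u \<in> E3 \<Longrightarrow> A (B u) = u"
  shows "degree3 (\<lambda>u. A (A u)) = 1"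
  using degree3_inverse[OF assms] by (auto simp: degree3_compose[OF assms(1,1)] zmult_eq_1_iff)

text \<open>The only integer whose cube is 1 is 1. This serves the cyclic permutations of three
  vertices.\<close>

lemma degree3_cube:
  assumes A: "homogeneous3 A" and "\<And>u. u \<in> E3 \<Longrightarrow> A (A (A u)) = u"
  shows "degree3 A = 1"
proof -
  have "degree3 A * degree3 (\<lambda>u. A (A u)) = 1"
    by (rule degree3_inverse[OF A homogeneous3_compose[OF A A]]) (rule assms(2))
  then have "degree3 A * (degree3 A * degree3 A) = 1" by (simp add: degree3_compose[OF A A])
  then show ?thesis by (auto simp: zmult_eq_1_iff)
qed

definition vec3 :: "real \<Rightarrow> real \<Rightarrow> real \<Rightarrow> nat \<Rightarrow> real" where
  "vec3 a b c = (\<lambda>n. if n = 0 then a else if n = 1 then b else if n = 2 then c else 0)"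

lemma vec3_simps [simp]: "vec3 a b c 0 = a" "vec3 a b c (Suc 0) = b" "vec3 a b c 2 = c" "3 \<le> n \<Longrightarrow> vec3 a b c n = 0"
  by (simp_all add: vec3_def)

lemma E3_vec3: "u \<in> E3 \<Longrightarrow> u = vec3 (u 0) (u 1) (u 2)"
  by (rule E3_eqI) simp_all

lemma vec3_scale: "(\<lambda>n. c * vec3 x y z n) = vec3 (c * x) (c * y) (c * z)"
  by (auto simp: vec3_def)

lemma vec3_eqI: "a = a' \<Longrightarrow> b = b' \<Longrightarrow> c = c' \<Longrightarrow> vec3 a b c = vec3 a' b' c'"
  by simp

lemma continuous_on_vec3:
  assumes "continuous_on S f" "continuous_on S g" "continuous_on S h"
  shows "continuous_on S (\<lambda>x. vec3 (f x) (g x) (h x))"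
  unfolding vec3_def
  by (intro continuous_on_coordinatewise_then_product continuous_on_if_const continuous_on_const assms)

definition lin3 :: "real \<Rightarrow> real \<Rightarrow> real \<Rightarrow> real \<Rightarrow> real \<Rightarrow> real \<Rightarrow> real \<Rightarrow> real \<Rightarrow> real \<Rightarrow> (nat \<Rightarrow> real) \<Rightarrow> nat \<Rightarrow> real" where
  "lin3 a b c a2 b2 c2 a3 b3 c3 u = vec3 (a * u 0 + b * u 1 + c * u 2) (a2 * u 0 + b2 * u 1 + c2 * u 2)
     (a3 * u 0 + b3 * u 1 + c3 * u 2)"

lemma homogeneous3_lin3:
  assumes "\<And>u. u \<in> E3 \<Longrightarrow> lin3 p q r p2 q2 r2 p3 q3 r3 (lin3 a b c a2 b2 c2 a3 b3 c3 u) = u"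
  shows "homogeneous3 (lin3 a b c a2 b2 c2 a3 b3 c3)"
proof (rule homogeneous3I[where B = "lin3 p q r p2 q2 r2 p3 q3 r3"])
  show "continuous_on E3 (lin3 a b c a2 b2 c2 a3 b3 c3)"
    unfolding lin3_def[abs_def]
    by (intro continuous_on_vec3 continuous_intros continuous_on_coordinate)
  show "lin3 a b c a2 b2 c2 a3 b3 c3 (\<lambda>n. k * u n) = (\<lambda>n. k * lin3 a b c a2 b2 c2 a3 b3 c3 u n)" for u k
    unfolding lin3_def vec3_scale by (intro vec3_eqI) (simp_all add: algebra_simps)
  show "lin3 p q r p2 q2 r2 p3 q3 r3 (\<lambda>n. 0) = (\<lambda>n. 0)" by (auto simp: lin3_def vec3_def)
qed (use assms in \<open>auto simp: lin3_def\<close>)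

lemma lin3_lin3:
  "lin3 p q r p2 q2 r2 p3 q3 r3 (lin3 a b c a2 b2 c2 a3 b3 c3 u) =
   lin3 (p * a + q * a2 + r * a3) (p * b + q * b2 + r * b3) (p * c + q * c2 + r * c3)
        (p2 * a + q2 * a2 + r2 * a3) (p2 * b + q2 * b2 + r2 * b3) (p2 * c + q2 * c2 + r2 * c3)
        (p3 * a + q3 * a2 + r3 * a3) (p3 * b + q3 * b2 + r3 * b3) (p3 * c + q3 * c2 + r3 * c3) u"
  unfolding lin3_def by (intro vec3_eqI) (simp_all add: algebra_simps)

lemma lin3_id: "u \<in> E3 \<Longrightarrow> lin3 1 0 0 0 1 0 0 0 1 u = u"
  using E3_vec3[of u] by (simp add: lin3_def)

abbreviation rotation :: "real \<Rightarrow> (nat \<Rightarrow> real) \<Rightarrow> nat \<Rightarrow> real" where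
  "rotation \<phi> \<equiv> lin3 1 0 0 0 (cos \<phi>) (- sin \<phi>) 0 (sin \<phi>) (cos \<phi>)"

lemma rotation_add: "rotation \<phi> (rotation \<psi> u) = rotation (\<phi> + \<psi>) u"
  unfolding lin3_lin3 by (simp add: cos_add sin_add algebra_simps)

lemma rotation_inverse: "u \<in> E3 \<Longrightarrow> rotation (- \<phi>) (rotation \<phi> u) = u" "u \<in> E3 \<Longrightarrow> rotation \<phi> (rotation (- \<phi>) u) = u"
  unfolding rotation_add by (simp_all add: lin3_id)

lemma homogeneous3_rotation: "homogeneous3 (rotation \<phi>)"
  by (rule homogeneous3_lin3) (rule rotation_inverse(1))

lemma degree3_rotation: "degree3 (rotation \<phi>) = 1"
proof -
  have "degree3 (\<lambda>u. rotation (\<phi>/2) (rotation (\<phi>/2) u)) = 1"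
  proof (rule degree3_square)
    show "homogeneous3 (rotation (\<phi>/2))" "homogeneous3 (rotation (- (\<phi>/2)))"
      by (rule homogeneous3_rotation)+
    show "rotation (\<phi>/2) (rotation (- (\<phi>/2)) u) = u" if "u \<in> E3" for u
      by (rule rotation_inverse(2)[OF that])
  qed
  then show ?thesis unfolding rotation_add by simp
qed

text \<open>Fixes the first two basis vectors and sends the third to \<open>vec3 0 b c\<close>. With
  cosine and sine for \<open>b\<close> and \<open>c\<close> it opens the right angle between the
  last two axes to the angle of a wedge.\<close>

abbreviation shear :: "real \<Rightarrow> real \<Rightarrow> (nat \<Rightarrow> real) \<Rightarrow> nat \<Rightarrow> real" where
  "shear b c \<equiv> lin3 1 0 0 0 1 b 0 0 c"

lemma shear_inverse:
  assumes "c \<noteq> 0" "u \<in> E3"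
  shows "shear (- b / c) (1 / c) (shear b c u) = u" "shear b c (shear (- b / c) (1 / c) u) = u"
  unfolding lin3_lin3 using assms by (simp_all add: lin3_id)

lemma homogeneous3_shear: "c \<noteq> 0 \<Longrightarrow> homogeneous3 (shear b c)"
  by (rule homogeneous3_lin3) (rule shear_inverse(1))

text \<open>A square again: the shear with parameters \<open>b'\<close> and \<open>sqrt c\<close>,
  applied twice, has parameters \<open>b' * (1 + sqrt c)\<close> and \<open>c\<close>.\<close>

lemma degree3_shear:
  assumes c: "0 < c"
  shows "degree3 (shear b c) = 1"
proof -
  define b' where "b' = b / (1 + sqrt c)"
  have s: "sqrt c \<noteq> 0" "1 + sqrt c \<noteq> 0" using c real_sqrt_gt_zero[OF c] by linarith+
  have "degree3 (\<lambda>u. shear b' (sqrt c) (shear b' (sqrt c) u)) = 1"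
  proof (rule degree3_square)
    show "homogeneous3 (shear b' (sqrt c))" by (rule homogeneous3_shear[OF s(1)])
    show "homogeneous3 (shear (- b' / sqrt c) (1 / sqrt c))" by (rule homogeneous3_shear) (use s in simp)
    show "shear b' (sqrt c) (shear (- b' / sqrt c) (1 / sqrt c) u) = u" if "u \<in> E3" for u
      by (rule shear_inverse(2)[OF s(1) that])
  qed
  moreover have "shear b' (sqrt c) (shear b' (sqrt c) u) = shear b c u" for u
  proof -
    have "b' * (1 + sqrt c) = b" using s(2) by (simp add: b'_def)
    then have "b' + b' * sqrt c = b" by (simp add: algebra_simps)
    then show ?thesis unfolding lin3_lin3 using c by simp
  qed
  ultimately show ?thesis by simp
qed

section \<open>The local degree is locally constant\<close>

lemma sphere_map_3: "sphere_map 3 f x r u = normalize3 (\<lambda>i. f (\<lambda>j. x j + r * u j) i - f x i)"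
  by (simp add: sphere_map_def normalize3_def norm3_def Let_def)

definition local_degree3 :: "((nat \<Rightarrow> real) \<Rightarrow> nat \<Rightarrow> real) \<Rightarrow> (nat \<Rightarrow> real) \<Rightarrow> real \<Rightarrow> int" where
  "local_degree3 f x r = Brouwer_degree2 2 (sphere_map 3 f x r)"

lemma orientation_preserving_3:
  "orientation_preserving 3 W f \<longleftrightarrow> (\<forall>x\<in>W. \<forall>\<^sub>F r in at_right 0. local_degree3 f x r = 1)"
  by (simp add: orientation_preserving_def local_degree3_def)

text \<open>Passing through \<open>vec3\<close> turns neighbourhoods in the function space into
  boxes in three real coordinates, the form in which centres and radii are estimated below.\<close>

lemma E3_box:
  assumes "openin (top_of_set E3) V" "w \<in> V"
  obtains \<rho> where "0 < \<rho>" "\<forall>w'\<in>E3. (\<forall>n<3. \<bar>w' n - w n\<bar> < \<rho>) \<longrightarrow> w' \<in> V"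
proof -
  obtain T where T: "open T" "V = E3 \<inter> T" using assms(1) by (auto simp: openin_open)
  define c :: "real \<times> real \<times> real \<Rightarrow> nat \<Rightarrow> real" where "c = (\<lambda>z. vec3 (fst z) (fst (snd z)) (snd (snd z)))"
  have "continuous_on UNIV c" unfolding c_def by (intro continuous_on_vec3 continuous_intros)
  then have "open (c -` T)" by (intro open_vimage T)
  moreover have "c (w 0, w 1, w 2) \<in> T" using assms T(2) E3_vec3[of w] by (auto simp: c_def)
  ultimately obtain e where e: "0 < e" "\<And>z. dist z (w 0, w 1, w 2) < e \<Longrightarrow> c z \<in> T"
    by (metis open_dist vimageI2 vimageD)
  show thesis
  proof
    show "0 < e / 3" using e(1) by simp
    show "\<forall>w'\<in>E3. (\<forall>n<3. \<bar>w' n - w n\<bar> < e / 3) \<longrightarrow> w' \<in> V"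
    proof (intro ballI impI)
    fix w' assume w': "w' \<in> E3" "\<forall>n<3. \<bar>w' n - w n\<bar> < e / 3"
    have "dist (w' 0, w' 1, w' 2) (w 0, w 1, w 2) \<le> \<bar>w' 0 - w 0\<bar> + (\<bar>w' 1 - w 1\<bar> + \<bar>w' 2 - w 2\<bar>)"
      unfolding dist_Pair_Pair dist_real_def
      by (rule order_trans[OF sqrt_sum_squares_le_sum_abs]) (auto intro!: order_trans[OF sqrt_sum_squares_le_sum_abs])
    also have "\<dots> < e" using w'(2)[rule_format, of 0] w'(2)[rule_format, of 1] w'(2)[rule_format, of 2] by simp
    finally have "c (w' 0, w' 1, w' 2) \<in> T" by (rule e(2))
    then have "w' \<in> T" using E3_vec3[OF w'(1)] by (simp add: c_def)
    then show "w' \<in> V" using w'(1) T(2) by simp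
    qed
  qed
qed

text \<open>Moving the centre and changing the radius are homotopies of the sphere map.\<close>

lemma local_degree3_locally_constant:
  assumes V: "openin (top_of_set E3) V" and f: "continuous_on V f" "f ` V \<subseteq> E3" "inj_on f V" and w: "w \<in> V"
  obtains \<rho> where "0 < \<rho>" "\<forall>w'\<in>E3. (\<forall>n<3. \<bar>w' n - w n\<bar> < \<rho>) \<longrightarrow>
    (\<forall>r r'. 0 < r \<and> r < \<rho> \<and> 0 < r' \<and> r' < \<rho> \<longrightarrow> local_degree3 f w' r' = local_degree3 f w r)"
proof -
  obtain \<delta> where \<delta>: "0 < \<delta>" "\<forall>w'\<in>E3. (\<forall>n<3. \<bar>w' n - w n\<bar> < \<delta>) \<longrightarrow> w' \<in> V"
    by (rule E3_box[OF V w])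
  note \<delta> = \<delta>(1) \<delta>(2)[rule_format]
  have wE: "w \<in> E3" using V w openin_imp_subset by blast
  show thesis
  proof
    \<comment> \<open>One half bounds the displacement of the centre and one half the radius, so all
      spheres of the homotopy stay in the box of size \<open>\<delta>\<close>.\<close>
    show "0 < \<delta> / 2" using \<delta>(1) by simp
    show "\<forall>w'\<in>E3. (\<forall>n<3. \<bar>w' n - w n\<bar> < \<delta> / 2) \<longrightarrow>
      (\<forall>r r'. 0 < r \<and> r < \<delta> / 2 \<and> 0 < r' \<and> r' < \<delta> / 2 \<longrightarrow> local_degree3 f w' r' = local_degree3 f w r)"
    proof (intro ballI allI impI; elim conjE)
    fix w' r r'
    assume w': "w' \<in> E3" "\<forall>n<3. \<bar>w' n - w n\<bar> < \<delta> / 2"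
      and r: "0 < r" "r < \<delta> / 2" "0 < r'" "r' < \<delta> / 2"
    note w' = w'(1) w'(2)[rule_format]
    define c where "c = (\<lambda>t n. w n + t * (w' n - w n))"
    define s where "s = (\<lambda>t. r + t * (r' - r))"
    have s: "0 < s t" "s t < \<delta> / 2" if "t \<in> {0..1}" for t
    proof -
      have "s t = (1 - t) * r + t * r'" by (simp add: s_def algebra_simps)
      moreover have "0 < (1 - t) * r + t * r'"
        using that r by (cases "t = 0") (auto intro!: add_nonneg_pos mult_nonneg_nonneg)
      moreover have "(1 - t) * r + t * r' < (1 - t) * (\<delta>/2) + t * (\<delta>/2)"
      proof (cases "t = 0")
        case False
        then show ?thesis using that r by (intro add_le_less_mono mult_left_mono mult_strict_left_mono) auto
      qed (use r in simp)
      moreover have "(1 - t) * (\<delta>/2) + t * (\<delta>/2) = \<delta>/2" by (simp flip: distrib_right)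
      ultimately show "0 < s t" "s t < \<delta> / 2" by linarith+
    qed
    have cb: "\<bar>c t n - w n\<bar> < \<delta> / 2" if "t \<in> {0..1}" "n < 3" for t n
    proof -
      have "\<bar>c t n - w n\<bar> = t * \<bar>w' n - w n\<bar>" using that by (simp add: c_def abs_mult)
      also have "\<dots> \<le> \<bar>w' n - w n\<bar>" using that by (intro mult_left_le_one_le) auto
      finally show ?thesis using w'(2)[OF that(2)] by linarith
    qed
    have inV: "c t \<in> V" "(\<lambda>n. c t n + s t * u n) \<in> V" if "t \<in> {0..1}" "u \<in> S2" for t u
    proof -
      have cE: "c t \<in> E3" using wE w'(1) by (simp add: c_def)
      show "c t \<in> V" using \<delta>(1) cb[OF that(1)] by (intro \<delta>(2)[OF cE]) (smt (verit) field_sum_of_halves)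
      have "\<bar>s t * u n\<bar> \<le> s t" for n
        using S2_bound[OF that(2), of n] s[OF that(1)] by (simp add: abs_mult mult_left_le)
      then have "\<bar>(c t n + s t * u n) - w n\<bar> < \<delta>" if "n < 3" for n
        using cb[OF \<open>t \<in> {0..1}\<close> that] s(2)[OF \<open>t \<in> {0..1}\<close>] by (smt (verit) field_sum_of_halves)
      moreover have "(\<lambda>n. c t n + s t * u n) \<in> E3" using cE that(2) by simp
      ultimately show "(\<lambda>n. c t n + s t * u n) \<in> V" by (intro \<delta>(2))
    qed
    \<comment> \<open>Injectivity of \<open>f\<close> keeps this difference away from zero, so that
      it can be normalised along the whole homotopy.\<close>
    define D where "D = (\<lambda>z i. f (\<lambda>n. c (fst z) n + s (fst z) * snd z n) i - f (c (fst z)) i)"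
    have Dz: "D z \<in> E3 \<and> D z \<noteq> (\<lambda>n. 0)" if "z \<in> {0..1} \<times> S2" for z
    proof -
      have zz: "fst z \<in> {0..1}" "snd z \<in> S2" using that by auto
      have "f (\<lambda>n. c (fst z) n + s (fst z) * snd z n) \<in> E3" "f (c (fst z)) \<in> E3"
        using inV[OF zz] f(2) by blast+
      then have "D z \<in> E3" by (simp add: D_def)
      moreover have "D z \<noteq> (\<lambda>n. 0)"
      proof
        assume "D z = (\<lambda>n. 0)"
        then have "f (\<lambda>n. c (fst z) n + s (fst z) * snd z n) = f (c (fst z))" by (auto simp: D_def fun_eq_iff)
        then have "(\<lambda>n. c (fst z) n + s (fst z) * snd z n) = c (fst z)" using inj_onD[OF f(3)] inV[OF zz] by blast
        then have "snd z n = 0" for n using s(1)[OF zz(1)] by (auto simp: fun_eq_iff)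
        then show False using S2_nonzero[OF zz(2)] by auto
      qed
      ultimately show ?thesis by blast
    qed
    have "continuous_on ({0..1} \<times> S2) (\<lambda>z. normalize3 (D z))"
    proof (rule continuous_on_normalize3)
      have c1: "continuous_on ({0..1} \<times> S2) (\<lambda>z. c (fst z))"
        unfolding c_def by (intro continuous_on_coordinatewise_then_product continuous_intros)
      have csnd: "continuous_on ({0..1} \<times> S2) (\<lambda>z. snd z n)" for n
        by (rule continuous_on_product_then_coordinatewise[OF continuous_on_snd[OF continuous_on_id]])
      have c2: "continuous_on ({0..1} \<times> S2) (\<lambda>z n. c (fst z) n + s (fst z) * snd z n)"
        unfolding c_def s_def by (intro continuous_on_coordinatewise_then_product continuous_intros csnd)
      have cA: "continuous_on ({0..1} \<times> S2) (\<lambda>z. f (\<lambda>n. c (fst z) n + s (fst z) * snd z n))"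
        by (rule continuous_on_compose2[OF f(1) c2]) (use inV in auto)
      have cB: "continuous_on ({0..1} \<times> S2) (\<lambda>z. f (c (fst z)))"
        by (rule continuous_on_compose2[OF f(1) c1]) (use inV in auto)
      show "continuous_on ({0..1} \<times> S2) D" unfolding D_def
        by (intro continuous_on_coordinatewise_then_product continuous_on_diff
            continuous_on_product_then_coordinatewise[OF cA] continuous_on_product_then_coordinatewise[OF cB])
    qed (use Dz in auto)
    moreover have "normalize3 (D z) \<in> S2" if "z \<in> {0..1} \<times> S2" for z
      using Dz[OF that] by (intro normalize3_in_S2) auto
    ultimately have "continuous_map (prod_topology (top_of_set {0..1}) (nsphere 2)) (nsphere 2) (\<lambda>z. normalize3 (D z))"
      unfolding nsphere_2 prod_topology_subtopology_eu by auto
    moreover have "normalize3 (D (0, u)) = sphere_map 3 f w r u" "normalize3 (D (1, u)) = sphere_map 3 f w' r' u" for u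
      by (simp_all add: D_def c_def s_def sphere_map_3)
    ultimately have "homotopic_with (\<lambda>x. True) (nsphere 2) (nsphere 2) (sphere_map 3 f w r) (sphere_map 3 f w' r')"
      unfolding homotopic_with_def by blast
    then show "local_degree3 f w' r' = local_degree3 f w r"
      unfolding local_degree3_def by (metis Brouwer_degree2_homotopic)
    qed
  qed
qed

text \<open>Allows the local degree to be computed only where a transition map is affine: near every
  point there is a point with local degree 1, and by local constancy the degree is the same at
  both.\<close>

lemma local_degree3_dense:
  assumes V: "openin (top_of_set E3) V" and f: "continuous_on V f" "f ` V \<subseteq> E3" "inj_on f V"
    and dense: "\<And>Y. openin (top_of_set E3) Y \<Longrightarrow> Y \<subseteq> V \<Longrightarrow> Y \<noteq> {} \<Longrightarrow> \<exists>w\<in>Y. \<forall>\<^sub>F r in at_right 0. local_degree3 f w r = 1"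
  shows "orientation_preserving 3 V f"
  unfolding orientation_preserving_3
proof
  fix w assume w: "w \<in> V"
  obtain \<rho> where \<rho>: "0 < \<rho>" "\<forall>w'\<in>E3. (\<forall>n<3. \<bar>w' n - w n\<bar> < \<rho>) \<longrightarrow>
    (\<forall>r r'. 0 < r \<and> r < \<rho> \<and> 0 < r' \<and> r' < \<rho> \<longrightarrow> local_degree3 f w' r' = local_degree3 f w r)"
    by (rule local_degree3_locally_constant[OF V f w])
  define Y where "Y = V \<inter> (\<Inter>n\<in>{..<3}. {w'. \<bar>w' n - w n\<bar> < \<rho>})"
  have "openin (top_of_set E3) Y" unfolding Y_def
    by (intro openin_Int_open V open_INT ballI open_Collect_less continuous_intros continuous_on_coordinate) simp
  moreover have "w \<in> Y" using w \<rho>(1) by (simp add: Y_def)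
  moreover have "Y \<subseteq> V" by (simp add: Y_def)
  ultimately obtain w' where w': "w' \<in> Y" "\<forall>\<^sub>F r in at_right 0. local_degree3 f w' r = 1"
    using dense[of Y] by blast
  obtain b where b: "0 < b" "\<forall>r>0. r < b \<longrightarrow> local_degree3 f w' r = 1"
    using w'(2) unfolding eventually_at_right_field by auto
  define r' where "r' = min (b/2) (\<rho>/2)"
  have r': "0 < r'" "r' < b" "r' < \<rho>" using b(1) \<rho>(1) by (auto simp: r'_def)
  have "w' \<in> E3" "\<forall>n<3. \<bar>w' n - w n\<bar> < \<rho>" using w'(1) openin_imp_subset[OF V] by (auto simp: Y_def)
  then have "local_degree3 f w r = 1" if "0 < r" "r < \<rho>" for r
    using \<rho>(2)[rule_format, of w' r r'] that r' b(2)[rule_format, of r'] by simp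
  then show "\<forall>\<^sub>F r in at_right 0. local_degree3 f w r = 1"
    unfolding eventually_at_right_field using \<rho>(1) by auto
qed

section \<open>Linear parts of the transition maps\<close>

definition degree_one :: "((nat \<Rightarrow> real) \<Rightarrow> nat \<Rightarrow> real) \<Rightarrow> bool" where
  "degree_one A \<longleftrightarrow> homogeneous3 A \<and> degree3 A = 1"

lemma degree_one_compose: "degree_one A \<Longrightarrow> degree_one B \<Longrightarrow> degree_one (\<lambda>u. A (B u))"
  by (simp add: degree_one_def homogeneous3_compose degree3_compose)

lemma degree_one_cong:
  assumes eq: "\<And>u. u \<in> E3 \<Longrightarrow> A u = B u" and B: "degree_one B"
  shows "degree_one A"
proof -
  have "continuous_on E3 A \<longleftrightarrow> continuous_on E3 B" by (rule continuous_on_cong) (use eq in auto)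
  moreover have "(\<lambda>n. c * u n) \<in> E3" if "u \<in> E3" for u :: "nat \<Rightarrow> real" and c using that by simp
  ultimately have "homogeneous3 A" using B eq unfolding degree_one_def homogeneous3_def by simp
  then show ?thesis using B degree3_cong[OF eq] by (simp add: degree_one_def)
qed

lemma degree_one_inverse:
  assumes A: "degree_one A" and B: "homogeneous3 B" and "\<And>u. u \<in> E3 \<Longrightarrow> A (B u) = u"
  shows "degree_one B"
  using degree3_inverse[of A B] assms by (simp add: degree_one_def)

lemma degree_one_id: "degree_one (\<lambda>u. u)"
  unfolding degree_one_def degree3_id by (auto simp: homogeneous3_def)

text \<open>The linear part of \<open>tetra_coords\<close>: the shear sends the last two basis
  vectors to the rays 0 and 1, and the rotation carries these to the rays \<open>\<kappa>\<close>
  and \<open>\<kappa> + 1\<close>.\<close>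

definition wedge_frame :: "nat \<Rightarrow> nat \<Rightarrow> (nat \<Rightarrow> real) \<Rightarrow> nat \<Rightarrow> real" where
  "wedge_frame N \<kappa> u = rotation (ray_angle N \<kappa>) (shear (cos (ray_angle N 1)) (sin (ray_angle N 1)) u)"

definition wedge_frame_inv :: "nat \<Rightarrow> nat \<Rightarrow> (nat \<Rightarrow> real) \<Rightarrow> nat \<Rightarrow> real" where
  "wedge_frame_inv N \<kappa> u = shear (- cos (ray_angle N 1) / sin (ray_angle N 1)) (1 / sin (ray_angle N 1))
     (rotation (- ray_angle N \<kappa>) u)"

lemma lin3_E3: "lin3 a b c a2 b2 c2 a3 b3 c3 u \<in> E3"
  by (simp add: lin3_def)

lemma degree_one_rotation: "degree_one (rotation \<phi>)"
  by (simp add: degree_one_def homogeneous3_rotation degree3_rotation)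

lemma degree_one_shear: "0 < c \<Longrightarrow> degree_one (shear b c)"
  by (simp add: degree_one_def homogeneous3_shear degree3_shear)

lemma wedge_frame:
  assumes N: "3 \<le> N"
  shows "degree_one (wedge_frame N \<kappa>)" "degree_one (wedge_frame_inv N \<kappa>)"
    and "u \<in> E3 \<Longrightarrow> wedge_frame_inv N \<kappa> (wedge_frame N \<kappa> u) = u"
proof -
  have s: "0 < sin (ray_angle N 1)" by (rule sin_ray_angle_pos[OF N])
  show "degree_one (wedge_frame N \<kappa>)"
    unfolding wedge_frame_def[abs_def] by (rule degree_one_compose[OF degree_one_rotation degree_one_shear[OF s]])
  show "degree_one (wedge_frame_inv N \<kappa>)"
    unfolding wedge_frame_inv_def[abs_def]
    by (rule degree_one_compose[OF degree_one_shear degree_one_rotation]) (use s in simp)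
  assume u: "u \<in> E3"
  have s0: "sin (ray_angle N 1) \<noteq> 0" using s by simp
  show "wedge_frame_inv N \<kappa> (wedge_frame N \<kappa> u) = u"
    unfolding wedge_frame_def wedge_frame_inv_def rotation_inverse(1)[OF lin3_E3] by (rule shear_inverse(1)[OF s0 u])
qed

definition three_coords :: "nat \<Rightarrow> nat \<Rightarrow> nat \<Rightarrow> (nat \<Rightarrow> real) \<Rightarrow> nat \<Rightarrow> real" where
  "three_coords i k l y = vec3 (- y i) (y k) (y l)"

text \<open>Differences of points of a simplex have coordinate sum 0. On such vectors this inverts
  \<open>three_coords\<close>, the value at \<open>j\<close> being determined by the other three;
  the sign at \<open>i\<close> stems from the first chart coordinate
  \<open>3/4 - x i\<close>.\<close>

definition from_three :: "nat \<Rightarrow> nat \<Rightarrow> nat \<Rightarrow> nat \<Rightarrow> (nat \<Rightarrow> real) \<Rightarrow> nat \<Rightarrow> real" where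
  "from_three i j k l u = (\<lambda>n. if n = i then - u 0 else if n = k then u 1 else if n = l then u 2
     else if n = j then u 0 - u 1 - u 2 else 0)"

lemma tetra_coords_diff:
  "(\<lambda>n. tetra_coords N \<kappa> i k l x n - tetra_coords N \<kappa> i k l x' n) =
     wedge_frame N \<kappa> (three_coords i k l (\<lambda>n. x n - x' n))"
proof -
  have "tetra_coords N \<kappa> i k l z = vec3 (3/4 - z i)
      (z k * cos (ray_angle N \<kappa>) + z l * cos (ray_angle N (Suc \<kappa>)))
      (z k * sin (ray_angle N \<kappa>) + z l * sin (ray_angle N (Suc \<kappa>)))" for z
    by (simp add: tetra_coords_def vec3_def)
  moreover have "(\<lambda>n. vec3 a b c n - vec3 a' b' c' n) = vec3 (a - a') (b - b') (c - c')" for a b c a' b' c'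
    by (auto simp: vec3_def)
  ultimately show ?thesis
    unfolding wedge_frame_def lin3_def three_coords_def ray_angle_Suc cos_add sin_add
    by simp (intro vec3_eqI; simp add: algebra_simps)
qed

lemma even_order_cases:
  assumes "even_order i j k l"
  shows "(i, j, k, l) \<in> {(0, 1, 2, 3), (0, 2, 3, 1), (0, 3, 1, 2), (1, 0, 3, 2), (1, 2, 0, 3), (1, 3, 2, 0),
    (2, 0, 1, 3), (2, 1, 3, 0), (2, 3, 0, 1), (3, 0, 2, 1), (3, 1, 0, 2), (3, 2, 1, 0)}"
proof -
  have "i = 0 \<or> i = 1 \<or> i = 2 \<or> i = 3" "j = 0 \<or> j = 1 \<or> j = 2 \<or> j = 3"
    using assms by (auto simp: even_order_def)
  then show ?thesis using assms by (elim disjE) (simp_all add: even_order_def third_def)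
qed

lemma even_order_distinct:
  assumes "even_order i j k l"
  shows "distinct [i, j, k, l]" "{..3} = {i, j, k, l}"
proof -
  show "distinct [i, j, k, l]" using even_order_cases[OF assms] by auto
  have "{..3} = {0, 1, 2, 3 :: nat}" by auto
  then show "{..3} = {i, j, k, l}" using even_order_cases[OF assms] by auto
qed

lemma from_three_three_coords:
  assumes e: "even_order i j k l" and y: "(\<Sum>n\<le>3. y n) = 0" "\<And>n. 3 < n \<Longrightarrow> y n = 0"
  shows "from_three i j k l (three_coords i k l y) = y"
proof
  fix n
  have "y i + y j + y k + y l = 0"
    using y(1) even_order_distinct(1)[OF e] unfolding even_order_distinct(2)[OF e] by simp
  moreover have "n = i \<or> n = j \<or> n = k \<or> n = l \<or> 3 < n"
    using even_order_distinct(2)[OF e] by (metis atMost_iff insert_iff not_le singletonD)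
  moreover have "i \<le> 3 \<and> j \<le> 3 \<and> k \<le> 3 \<and> l \<le> 3"
    using even_order_distinct(2)[OF e] by (metis atMost_iff insertCI)
  ultimately show "from_three i j k l (three_coords i k l y) n = y n"
    using even_order_distinct(1)[OF e] y(2)[of n]
    by (auto simp: from_three_def three_coords_def)
qed

lemma three_coords_from_three:
  assumes e: "even_order i j k l" and u: "u \<in> E3"
  shows "three_coords i k l (from_three i j k l u) = u"
  using even_order_distinct(1)[OF e]
  by (intro E3_eqI u) (auto simp: from_three_def three_coords_def)

lemma from_three_sum:
  assumes e: "even_order i j k l"
  shows "(\<Sum>n\<le>3. from_three i j k l u n) = 0" "3 < n \<Longrightarrow> from_three i j k l u n = 0"
proof -
  show "(\<Sum>n\<le>3. from_three i j k l u n) = 0"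
    unfolding even_order_distinct(2)[OF e] using even_order_distinct(1)[OF e] by (auto simp: from_three_def)
  have "i \<le> 3 \<and> j \<le> 3 \<and> k \<le> 3 \<and> l \<le> 3"
    using even_order_distinct(2)[OF e] by (metis atMost_iff insertCI)
  then show "3 < n \<Longrightarrow> from_three i j k l u n = 0" by (auto simp: from_three_def)
qed

text \<open>The change of coordinates on vectors of sum 0 when the vertices are listed in another
  order. Up to the two wedge frames this is the linear part of a transition map on one
  tetrahedron.\<close>

definition reorder :: "nat \<Rightarrow> nat \<Rightarrow> nat \<Rightarrow> nat \<Rightarrow> nat \<Rightarrow> nat \<Rightarrow> nat \<Rightarrow> (nat \<Rightarrow> real) \<Rightarrow> nat \<Rightarrow> real" where
  "reorder i j k l i' k' l' u = three_coords i' k' l' (from_three i j k l u)"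

lemma reorder_compose:
  assumes "even_order i j k l" "even_order i' j' k' l'" "u \<in> E3"
  shows "reorder i' j' k' l' i'' k'' l'' (reorder i j k l i' k' l' u) = reorder i j k l i'' k'' l'' u"
  unfolding reorder_def
  by (simp only: from_three_three_coords[OF assms(2) from_three_sum(1)[OF assms(1)] from_three_sum(2)[OF assms(1)]])

text \<open>Cyclic permutations of three of the four vertices generate the even ones and have degree one,
  since their third power is the identity.\<close>

abbreviation cycle1 :: "(nat \<Rightarrow> real) \<Rightarrow> nat \<Rightarrow> real" where
  "cycle1 \<equiv> lin3 1 0 0 0 0 1 1 (-1) (-1)"

abbreviation cycle2 :: "(nat \<Rightarrow> real) \<Rightarrow> nat \<Rightarrow> real" where
  "cycle2 \<equiv> lin3 0 (-1) 0 1 (-1) (-1) 0 0 1"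

lemma degree_one_cycle: "degree_one cycle1" "degree_one cycle2"
proof -
  have h1: "homogeneous3 cycle1"
    by (rule homogeneous3_lin3[of 1 0 0 1 "-1" "-1" 0 1 0]) (simp add: lin3_lin3 lin3_id)
  have h2: "homogeneous3 cycle2"
    by (rule homogeneous3_lin3[of "-1" 1 1 "-1" 0 0 0 0 1]) (simp add: lin3_lin3 lin3_id)
  show "degree_one cycle1" "degree_one cycle2"
    unfolding degree_one_def using h1 h2
    by (auto intro!: degree3_cube simp: lin3_lin3 lin3_id)
qed

lemma degree_one_reorder_standard:
  assumes "even_order i j k l"
  shows "degree_one (reorder 0 1 2 3 i k l)"
proof -
  note simps = reorder_def three_coords_def from_three_def lin3_def
  note c = degree_one_cycle
  note cc = degree_one_compose
  have E: "A u = B u" if "A u 0 = B u 0" "A u 1 = B u 1" "A u 2 = B u 2" "A u \<in> E3" "B u \<in> E3"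
    for A B :: "(nat \<Rightarrow> real) \<Rightarrow> nat \<Rightarrow> real" and u
    using that by (intro E3_eqI)
  \<comment> \<open>\<open>cycle1\<close> fixes the vertex 0 and \<open>cycle2\<close> fixes the
    vertex 3. Each of the twelve even orders is reached from (0, 1, 2, 3) by the word in these two
    that is given as a composition.\<close>
  have r1: "degree_one (reorder 0 1 2 3 0 2 3)"
    by (rule degree_one_cong[OF _ degree_one_id], rule E) (simp_all add: simps)
  have r2: "degree_one (reorder 0 1 2 3 0 3 1)"
    by (rule degree_one_cong[OF _ c(1)], rule E) (simp_all add: simps)
  have r3: "degree_one (reorder 0 1 2 3 0 1 2)"
    by (rule degree_one_cong[OF _ cc[OF c(1) c(1)]], rule E) (simp_all add: simps)
  have r4: "degree_one (reorder 0 1 2 3 1 3 2)"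
    by (rule degree_one_cong[OF _ cc[OF c(2) cc[OF c(1) c(1)]]], rule E) (simp_all add: simps)
  have r5: "degree_one (reorder 0 1 2 3 1 0 3)"
    by (rule degree_one_cong[OF _ cc[OF c(1) cc[OF c(1) cc[OF c(2) cc[OF c(1) c(1)]]]]], rule E) (simp_all add: simps)
  have r6: "degree_one (reorder 0 1 2 3 1 2 0)"
    by (rule degree_one_cong[OF _ cc[OF c(1) cc[OF c(2) cc[OF c(1) c(1)]]]], rule E) (simp_all add: simps)
  have r7: "degree_one (reorder 0 1 2 3 2 1 3)"
    by (rule degree_one_cong[OF _ c(2)], rule E) (simp_all add: simps)
  have r8: "degree_one (reorder 0 1 2 3 2 3 0)"
    by (rule degree_one_cong[OF _ cc[OF c(1) c(2)]], rule E) (simp_all add: simps)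
  have r9: "degree_one (reorder 0 1 2 3 2 0 1)"
    by (rule degree_one_cong[OF _ cc[OF c(1) cc[OF c(1) c(2)]]], rule E) (simp_all add: simps)
  have r10: "degree_one (reorder 0 1 2 3 3 2 1)"
    by (rule degree_one_cong[OF _ cc[OF c(2) c(1)]], rule E) (simp_all add: simps)
  have r11: "degree_one (reorder 0 1 2 3 3 0 2)"
    by (rule degree_one_cong[OF _ cc[OF c(1) cc[OF c(1) cc[OF c(2) c(1)]]]], rule E) (simp_all add: simps)
  have r12: "degree_one (reorder 0 1 2 3 3 1 0)"
    by (rule degree_one_cong[OF _ cc[OF c(1) cc[OF c(2) c(1)]]], rule E) (simp_all add: simps)
  note r = r1 r2 r3 r4 r5 r6 r7 r8 r9 r10 r11 r12
  show ?thesis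
    using even_order_cases[OF assms] unfolding insert_iff empty_iff prod.inject
    by (elim disjE conjE FalseE; simp only: r)
qed

text \<open>The change of order passes through the standard order. Its first half is the inverse of
  a change from the standard order and inherits the degree from it.\<close>

lemma degree_one_reorder:
  assumes e: "even_order i j k l" and e': "even_order i' j' k' l'"
  shows "degree_one (reorder i j k l i' k' l')"
proof -
  have e0: "even_order 0 1 2 3" by (simp add: even_order_def third_def)
  have inv: "reorder 0 1 2 3 i k l (reorder i j k l 0 2 3 u) = u" if "u \<in> E3" for u
    using reorder_compose[OF e e0 that, of i k l] three_coords_from_three[OF e that] by (simp add: reorder_def)
  have "homogeneous3 (reorder i j k l 0 2 3)"
  proof (rule homogeneous3I[where B = "reorder 0 1 2 3 i k l"])
    show "reorder 0 1 2 3 i k l (reorder i j k l 0 2 3 u) = u" if "u \<in> E3" for u by (rule inv[OF that])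
    show "continuous_on E3 (reorder i j k l 0 2 3)"
      unfolding reorder_def three_coords_def from_three_def
      by (intro continuous_on_vec3 continuous_on_minus continuous_on_if_const continuous_intros continuous_on_coordinate)
    show "reorder i j k l 0 2 3 (\<lambda>n. c * u n) = (\<lambda>n. c * reorder i j k l 0 2 3 u n)" for u c
      unfolding reorder_def three_coords_def vec3_scale
      by (intro vec3_eqI) (simp_all add: from_three_def algebra_simps)
    show "reorder 0 1 2 3 i k l (\<lambda>n. 0) = (\<lambda>n. 0)"
    proof -
      have "from_three 0 1 2 3 (\<lambda>n. 0) = (\<lambda>n. 0)" by (simp add: from_three_def fun_eq_iff)
      then show ?thesis by (simp add: reorder_def three_coords_def vec3_def fun_eq_iff)
    qed
  qed (auto simp: reorder_def three_coords_def)
  then have "degree_one (reorder i j k l 0 2 3)"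
    using degree_one_inverse[OF degree_one_reorder_standard[OF e]] inv by blast
  then have "degree_one (\<lambda>u. reorder 0 1 2 3 i' k' l' (reorder i j k l 0 2 3 u))"
    by (rule degree_one_compose[OF degree_one_reorder_standard[OF e']])
  then show ?thesis
    by (rule degree_one_cong[rotated]) (use reorder_compose[OF e e0] in simp)
qed

text \<open>Both positions are affine in the same point \<open>x\<close> of the simplex, so
  \<open>\<tau>\<close> is affine on \<open>Y\<close> with linear part \<open>A\<close>. At small
  radius the sphere map is then exactly the normalised \<open>A\<close>.\<close>

lemma local_degree3_tetra:
  assumes Y: "openin (top_of_set E3) Y" "w \<in> Y" and N: "3 \<le> N" "3 \<le> N'"
    and e: "even_order i j k l" "even_order i' j' k' l'"
    and tau: "\<And>w. w \<in> Y \<Longrightarrow> \<exists>x\<in>standard_simplex 3. w = tetra_coords N \<kappa> i k l x \<and> \<tau> w = tetra_coords N' \<kappa>' i' k' l' x"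
  shows "\<forall>\<^sub>F r in at_right 0. local_degree3 \<tau> w r = 1"
proof -
  define A where "A = (\<lambda>u. wedge_frame N' \<kappa>' (reorder i j k l i' k' l' (wedge_frame_inv N \<kappa> u)))"
  have A: "degree_one A"
    unfolding A_def
    by (rule degree_one_compose[OF wedge_frame(1)[OF N(2)] degree_one_compose[OF degree_one_reorder[OF e] wedge_frame(2)[OF N(1)]]])
  obtain \<rho> where \<rho>: "0 < \<rho>" "\<forall>w'\<in>E3. (\<forall>n<3. \<bar>w' n - w n\<bar> < \<rho>) \<longrightarrow> w' \<in> Y"
    by (rule E3_box[OF Y])
  have wE: "w \<in> E3" using Y openin_imp_subset by blast
  have "local_degree3 \<tau> w r = 1" if r: "0 < r" "r < \<rho>" for r
  proof -
    have "local_degree3 \<tau> w r = degree3 A"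
      unfolding local_degree3_def degree3_def
    proof (rule Brouwer_degree2_eq)
      fix u assume "u \<in> topspace (nsphere 2)"
      then have u: "u \<in> S2" by (simp add: nsphere_2)
      define w' where "w' = (\<lambda>n. w n + r * u n)"
      have "w' \<in> E3" using wE u by (simp add: w'_def)
      moreover have "\<bar>w' n - w n\<bar> < \<rho>" for n
      proof -
        have "\<bar>w' n - w n\<bar> = r * \<bar>u n\<bar>" using r by (simp add: w'_def abs_mult)
        also have "\<dots> \<le> r" using S2_bound[OF u, of n] r by (simp add: mult_left_le)
        finally show ?thesis using r by simp
      qed
      ultimately have "w' \<in> Y" using \<rho>(2) by blast
      obtain x where x: "x \<in> standard_simplex 3" "w' = tetra_coords N \<kappa> i k l x" "\<tau> w' = tetra_coords N' \<kappa>' i' k' l' x"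
        using tau[OF \<open>w' \<in> Y\<close>] by blast
      obtain z where z: "z \<in> standard_simplex 3" "w = tetra_coords N \<kappa> i k l z" "\<tau> w = tetra_coords N' \<kappa>' i' k' l' z"
        using tau[OF Y(2)] by blast
      define y where "y = (\<lambda>n. x n - z n)"
      have y: "(\<Sum>n\<le>3. y n) = 0" "3 < n \<Longrightarrow> y n = 0" for n
        using x(1) z(1) by (simp_all add: y_def standard_simplex_def sum_subtractf)
      have ru: "(\<lambda>n. r * u n) = wedge_frame N \<kappa> (three_coords i k l y)"
        using tetra_coords_diff[of N \<kappa> i k l x z] unfolding y_def x(2)[symmetric] z(2)[symmetric] by (simp add: w'_def)
      have "(\<lambda>n. \<tau> w' n - \<tau> w n) = wedge_frame N' \<kappa>' (three_coords i' k' l' y)"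
        unfolding x(3) z(3) tetra_coords_diff y_def ..
      also have "three_coords i' k' l' y = reorder i j k l i' k' l' (three_coords i k l y)"
        unfolding reorder_def using from_three_three_coords[OF e(1) y] by simp
      also have "three_coords i k l y = wedge_frame_inv N \<kappa> (\<lambda>n. r * u n)"
        unfolding ru by (rule wedge_frame(3)[OF N(1), symmetric]) (simp add: three_coords_def)
      also have "wedge_frame N' \<kappa>' (reorder i j k l i' k' l' (wedge_frame_inv N \<kappa> (\<lambda>n. r * u n))) = A (\<lambda>n. r * u n)"
        by (simp add: A_def)
      also have "\<dots> = (\<lambda>n. r * A u n)"
        using A u r unfolding degree_one_def homogeneous3_def by simp
      finally have "normalize3 (\<lambda>n. \<tau> w' n - \<tau> w n) = normalize3 (A u)"
        using normalize3_scale[OF r(1)] by simp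
      then show "sphere_map 3 \<tau> w r u = normalize3 (A u)" by (simp add: sphere_map_3 w'_def)
    qed
    then show ?thesis using A by (simp add: degree_one_def)
  qed
  then show ?thesis unfolding eventually_at_right_field using \<rho>(1) by auto
qed

section \<open>Orientability of the truncated complex\<close>

context facet_pairing
begin

text \<open>Such a point lies on no facet, so no gluing moves it. Two charts that show the same
  interior point therefore see the same representative.\<close>

lemma point_class_interior:
  assumes "\<And>n. n \<le> d \<Longrightarrow> 0 < x n"
  shows "point_class d G (s, x) \<subseteq> {(s, x)}"
proof
  fix q assume "q \<in> point_class d G (s, x)"
  then show "q \<in> {(s, x)}"
  proof (induction rule: point_class_induct)
    case (glue t i y)
    then have "0 < y i" using assms[of i] by (simp add: facets_def)
    then show ?case using glue(3) by simp
  qed simp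
qed

end

context fanned_complex
begin

lemma star_chart_same_point:
  assumes "p \<in> topspace C" "(s, x) \<in> p" "(s', x') \<in> p" "\<forall>n\<le>3. 0 < x n"
  shows "s' = s \<and> x' = x"
proof -
  obtain q where "p = point_class 3 G q" using assms(1) by (auto simp: topspace_complex_space)
  then have "p = point_class 3 G (s, x)" using point_class_eqI assms(2) by blast
  then show ?thesis using point_class_interior[of x s] assms(3,4) by blast
qed

text \<open>In any open set, first shrink to a piece where \<open>g\<close> is affine on one
  tetrahedron. Its image under \<open>f\<close> is open by invariance of domain and can be shrunk to
  a piece where \<open>h\<close> is affine as well. Since interior points have only one
  representative, both descriptions concern the same tetrahedron and
  \<open>local_degree3_tetra\<close> applies.\<close>

lemma transition_orientation_preserving:
  assumes g: "star_chart G W g" "inj_on g W" and h: "star_chart G W' h" "inj_on h W'"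
    and V: "openin (top_of_set E3) V" "V \<subseteq> W" "g ` V \<subseteq> h ` W'"
    and f: "\<And>w. w \<in> V \<Longrightarrow> f w = inv_into W' h (g w)"
  shows "orientation_preserving 3 V f"
proof (rule local_degree3_dense[OF V(1)])
  have hf: "h (f w) = g w" "f w \<in> W'" if "w \<in> V" for w
    using f[OF that] that V(3) by (auto simp: f_inv_into_f inv_into_into image_subset_iff)
  have W'E: "W' \<subseteq> E3" using openin_imp_subset[OF star_chart_domain[OF h(1)]] .
  obtain h' where h': "homeomorphic_maps (top_of_set W') (subtopology C (h ` W')) h h'"
    using star_chart_homeomorphic_map[OF h] homeomorphic_map_maps by blast
  have "continuous_map (top_of_set V) C g"
    by (rule continuous_map_from_subtopology_mono[OF star_chart_continuous[OF g(1)] V(2)])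
  then have "continuous_map (top_of_set V) (subtopology C (h ` W')) g"
    using V(3) by (auto simp: continuous_map_in_subtopology)
  moreover have "continuous_map (subtopology C (h ` W')) (top_of_set W') h'"
    using h' by (simp add: homeomorphic_maps_def)
  ultimately have "continuous_map (top_of_set V) (top_of_set W') (h' \<circ> g)" by (rule continuous_map_compose)
  then have "continuous_on V (h' \<circ> g)" by simp
  moreover have "(h' \<circ> g) w = f w" if "w \<in> V" for w
  proof -
    have "h' (h (f w)) = f w" using h' hf(2)[OF that] unfolding homeomorphic_maps_def by simp
    then show ?thesis using hf(1)[OF that] by simp
  qed
  ultimately show contf: "continuous_on V f" using continuous_on_cong[OF refl, of V "h' \<circ> g" f] by blast
  show fE: "f ` V \<subseteq> E3" using hf(2) W'E by blast
  show injf: "inj_on f V"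
    by (rule inj_onI) (metis hf(1) inj_onD[OF g(2)] V(2) subsetD)
  fix Y assume Y: "openin (top_of_set E3) Y" "Y \<subseteq> V" "Y \<noteq> {}"
  then have "Y \<subseteq> W" using V(2) by simp
  then obtain Y1 s N \<kappa> i j k l where Y1: "openin (top_of_set E3) Y1" "Y1 \<subseteq> Y" "Y1 \<noteq> {}" "3 \<le> N" "even_order i j k l"
    "\<forall>w\<in>Y1. \<exists>x\<in>standard_simplex 3. (\<forall>n\<le>3. 0 < x n) \<and> (s, x) \<in> g w \<and> w = tetra_coords N \<kappa> i k l x"
    using conjunct2[OF conjunct2[OF conjunct2[OF conjunct2[OF g(1)[unfolded star_chart_def]]]], rule_format, of Y] Y
    by blast
  have Y1V: "Y1 \<subseteq> V" using Y1 Y by simp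
  have Y1E: "Y1 \<subseteq> E3" using openin_imp_subset[OF Y1(1)] .
  have "openin (Euclidean_space 3) (f ` Y1)"
  proof (rule invariance_of_domain_Euclidean_space)
    show "openin (Euclidean_space 3) Y1" using Y1(1) by (simp add: Euclidean_space_3)
    have "E3 \<inter> Y1 = Y1" using Y1E by blast
    moreover have "continuous_on Y1 f" using continuous_on_subset[OF contf Y1V] .
    moreover have "f ` Y1 \<subseteq> E3" using fE Y1V by blast
    ultimately show "continuous_map (subtopology (Euclidean_space 3) Y1) (Euclidean_space 3) f"
      by (simp add: Euclidean_space_3 subtopology_subtopology image_subset_iff_funcset)
    show "inj_on f Y1" using inj_on_subset[OF injf Y1V] .
  qed
  then have fY1: "openin (top_of_set E3) (f ` Y1)" by (simp add: Euclidean_space_3)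
  have "f ` Y1 \<subseteq> W'" using hf(2) Y1V by blast
  then obtain Y2 s' N' \<kappa>' i' j' k' l' where Y2: "openin (top_of_set E3) Y2" "Y2 \<subseteq> f ` Y1" "Y2 \<noteq> {}" "3 \<le> N'" "even_order i' j' k' l'"
    "\<forall>w\<in>Y2. \<exists>x\<in>standard_simplex 3. (\<forall>n\<le>3. 0 < x n) \<and> (s', x) \<in> h w \<and> w = tetra_coords N' \<kappa>' i' k' l' x"
    using conjunct2[OF conjunct2[OF conjunct2[OF conjunct2[OF h(1)[unfolded star_chart_def]]]], rule_format, of "f ` Y1"] fY1 Y1(3)
    by blast
  define Y3 where "Y3 = {w \<in> Y1. f w \<in> Y2}"
  have Y3: "openin (top_of_set E3) Y3"
  proof -
    obtain T where T: "open T" "Y2 = E3 \<inter> T" using Y2(1) by (auto simp: openin_open)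
    have "Y3 = Y1 \<inter> f -` T" unfolding Y3_def T(2) using fE Y1V by blast
    then have "openin (top_of_set Y1) Y3"
      using continuous_openin_preimage_gen[OF continuous_on_subset[OF contf Y1V] T(1)] by simp
    then show ?thesis using openin_trans Y1(1) by blast
  qed
  obtain w where w: "w \<in> Y3" using Y2(2,3) unfolding Y3_def by blast
  have "\<exists>x\<in>standard_simplex 3. w = tetra_coords N \<kappa> i k l x \<and> f w = tetra_coords N' \<kappa>' i' k' l' x" if w: "w \<in> Y3" for w
  proof -
    have wV: "w \<in> V" using w Y1V by (auto simp: Y3_def)
    obtain x where x: "x \<in> standard_simplex 3" "\<forall>n\<le>3. 0 < x n" "(s, x) \<in> g w" "w = tetra_coords N \<kappa> i k l x"
      using w Y1(6) by (auto simp: Y3_def)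
    obtain x' where x': "(s', x') \<in> h (f w)" "f w = tetra_coords N' \<kappa>' i' k' l' x'"
      using w Y2(6) by (auto simp: Y3_def)
    have "g w \<in> topspace C"
      using openin_subset[OF star_chart_openin[OF g(1) star_chart_domain[OF g(1)] subset_refl]] wV V(2) by blast
    then have "x' = x" using star_chart_same_point[of "g w" s x s' x'] x x'(1) hf(1)[OF wV] by simp
    then show ?thesis using x x' by blast
  qed
  then have "\<forall>\<^sub>F r in at_right 0. local_degree3 f w r = 1"
    by (rule local_degree3_tetra[OF Y3 w Y1(4) Y2(4) Y1(5) Y2(5)])
  then show "\<exists>w\<in>Y. \<forall>\<^sub>F r in at_right 0. local_degree3 f w r = 1"
    using w Y1(2) by (auto simp: Y3_def)
qed

lemma orientable_M: "orientable_manifold 3 M"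
  unfolding orientable_manifold_def
proof (intro conjI manifold_M exI)
  define pos where "pos = (\<lambda>W :: (nat \<Rightarrow> real) set. {w \<in> W. 0 < w 0})"
  define \<A> where "\<A> = {(g ` pos W, inv_into W g) | W g. adapted_chart G W g}"
  have op: "openin (top_of_set E3) (pos W)" if "adapted_chart G W g" for W g
  proof -
    have "star_chart G W g" using that by (simp add: adapted_chart_def)
    then have "openin (top_of_set E3) (W \<inter> {w. 0 < w 0})"
      by (intro openin_Int_open open_Collect_less continuous_on_const continuous_on_coordinate star_chart_domain)
    moreover have "pos W = W \<inter> {w. 0 < w 0}" by (auto simp: pos_def)
    ultimately show ?thesis by simp
  qed
  have atlasE: thesis
    if "(U, f) \<in> \<A>" and *: "\<And>W g. \<lbrakk>U = g ` pos W; f = inv_into W g; adapted_chart G W g\<rbrakk> \<Longrightarrow> thesis"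
    for U f thesis
  proof -
    have "\<exists>W g. (U, f) = (g ` pos W, inv_into W g) \<and> adapted_chart G W g"
      using that(1) unfolding \<A>_def mem_Collect_eq .
    then show thesis by (elim exE conjE) (rule *, simp_all)
  qed
  have emb: "open_embedding_on M (Euclidean_space 3) U f" if Uf: "(U, f) \<in> \<A>" for U f
  proof -
    obtain W g where g: "U = g ` pos W" "f = inv_into W g" "adapted_chart G W g" by (rule atlasE[OF Uf])
    have "pos W \<subseteq> {w \<in> W. 0 < w 0}" by (simp add: pos_def)
    then show ?thesis unfolding g(1,2) by (rule adapted_chart_Euclidean[OF g(3) op[OF g(3)]])
  qed
  then show "\<forall>(U, f)\<in>\<A>. open_embedding_on M (Euclidean_space 3) U f" by blast
  show "(\<Union>(U, f)\<in>\<A>. U) = manifold_interior 3 M"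
  proof
    show "(\<Union>(U, f)\<in>\<A>. U) \<subseteq> manifold_interior 3 M"
      using emb unfolding manifold_interior_def by blast
    show "manifold_interior 3 M \<subseteq> (\<Union>(U, f)\<in>\<A>. U)"
    proof
      fix p assume p: "p \<in> manifold_interior 3 M"
      then have pM: "p \<in> topspace M" "p \<notin> truncation_points G" unfolding manifold_interior_M by auto
      obtain W g w where g: "adapted_chart G W g" "w \<in> W" "g w = p" by (rule adapted_chart_at[OF pM(1)])
      then have "0 \<le> w 0" "w 0 \<noteq> 0" using pM unfolding adapted_chart_def by blast+
      then have "p \<in> g ` pos W" using g by (auto simp: pos_def)
      moreover have "(g ` pos W, inv_into W g) \<in> \<A>" using g(1) by (auto simp: \<A>_def)
      ultimately show "p \<in> (\<Union>(U, f)\<in>\<A>. U)" by blast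
    qed
  qed
  show "\<forall>(U, f)\<in>\<A>. \<forall>(U', f')\<in>\<A>. orientation_preserving 3 (f ` (U \<inter> U')) (f' \<circ> inv_into U f)"
  proof clarify
    fix U f U' f' assume "(U, f) \<in> \<A>" "(U', f') \<in> \<A>"
    note Uf = this
    obtain W g where U: "U = g ` pos W" "f = inv_into W g" and g: "adapted_chart G W g" by (rule atlasE[OF Uf(1)])
    obtain W' h where U': "U' = h ` pos W'" "f' = inv_into W' h" and h: "adapted_chart G W' h" by (rule atlasE[OF Uf(2)])
    have sg: "star_chart G W g" "inj_on g W" and sh: "star_chart G W' h" "inj_on h W'"
      using g h by (simp_all add: adapted_chart_def)
    have posW: "pos W \<subseteq> W" "pos W' \<subseteq> W'" by (auto simp: pos_def)
    have fg: "f (g w) = w" if "w \<in> pos W" for w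
      unfolding U(2) by (rule inv_into_f_f[OF sg(2)]) (use that posW in blast)
    define V where "V = {w \<in> pos W. g w \<in> U'}"
    have V: "f ` (U \<inter> U') = V" unfolding V_def U(1) using fg by force
    have injf: "inj_on f U" unfolding U(1) by (rule inj_onI) (use fg in auto)
    have inv: "inv_into U f w = g w" if "w \<in> V" for w
      using inv_into_f_f[OF injf, of "g w"] fg[of w] that unfolding V_def U(1) by simp
    show "orientation_preserving 3 (f ` (U \<inter> U')) (f' \<circ> inv_into U f)"
      unfolding V
    proof (rule transition_orientation_preserving[OF sg sh])
      have "openin C U'" unfolding U' by (rule star_chart_openin[OF sh(1) op[OF h] posW(2)])
      then have "openin (top_of_set W) {w \<in> W. g w \<in> U'}"
        using openin_continuous_map_preimage[OF star_chart_continuous[OF sg(1)]] by simp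
      then have "openin (top_of_set E3) {w \<in> W. g w \<in> U'}" using openin_trans star_chart_domain[OF sg(1)] by blast
      moreover have "V = {w \<in> W. g w \<in> U'} \<inter> pos W" using posW by (auto simp: V_def)
      ultimately show "openin (top_of_set E3) V" using op[OF g] by (simp add: openin_Int)
      show "V \<subseteq> W" using posW by (auto simp: V_def)
      show "g ` V \<subseteq> h ` W'" using posW by (auto simp: V_def U')
      show "(f' \<circ> inv_into U f) w = inv_into W' h (g w)" if "w \<in> V" for w
        using inv[OF that] by (simp add: U')
    qed
  qed
qed

end

section \<open>Collapsing the boundary\<close>

lemma sum_atMost_3: "(\<Sum>n\<le>3. f n) = f 0 + f 1 + f 2 + f 3" for f :: "nat \<Rightarrow> 'a :: comm_monoid_add"
  by (simp add: eval_nat_numeral)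

lemma sum_atMost_2: "(\<Sum>n\<le>2. f n) = f 0 + f 1 + f 2" for f :: "nat \<Rightarrow> 'a :: comm_monoid_add"
  by (simp add: eval_nat_numeral)

lemma standard_simplexI:
  assumes "\<And>n. 0 \<le> x n" "\<And>n. d < n \<Longrightarrow> x n = 0" "(\<Sum>n\<le>d. x n) = 1"
  shows "x \<in> standard_simplex d"
proof -
  have "x n \<le> 1" for n
  proof (cases "n \<le> d")
    case True
    then show ?thesis using member_le_sum[of n "{..d}" x] assms by simp
  qed (use assms in simp)
  then show ?thesis using assms by (simp add: standard_simplex_def)
qed

text \<open>\<open>push\<close> stretches the part of a tetrahedron left by the truncation over the whole tetrahedron,
  contracting the cut triangles to the vertices; \<open>pull\<close> is its inverse off the vertices. At most one
  coordinate of a point exceeds \<open>1/2\<close>, and only then is \<open>excess\<close> nonzero.\<close>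

definition peak :: "(nat \<Rightarrow> real) \<Rightarrow> nat \<Rightarrow> real" where
  "peak x n = max 0 (x n - 1/2)"

definition excess :: "(nat \<Rightarrow> real) \<Rightarrow> real" where
  "excess x = (\<Sum>n\<le>3. peak x n)"

definition push :: "(nat \<Rightarrow> real) \<Rightarrow> nat \<Rightarrow> real" where
  "push x n = x n + peak x n - x n * ((excess x - peak x n) / (1/2 - (excess x - peak x n)))"

definition pull :: "(nat \<Rightarrow> real) \<Rightarrow> nat \<Rightarrow> real" where
  "pull x n = x n - peak x n / 2 + x n * (((excess x - peak x n) / 2) / (1/2 - (excess x - peak x n)))"

lemma simplex_pair_le:
  assumes "x \<in> standard_simplex d" "i \<noteq> n"
  shows "x i + x n \<le> 1"
proof -
  have nn: "0 \<le> x m" "d < m \<Longrightarrow> x m = 0" "x m \<le> 1" for m using assms(1) by (auto simp: standard_simplex_def)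
  show ?thesis
  proof (cases "i \<le> d \<and> n \<le> d")
    case True
    then have "sum x {i, n} \<le> sum x {..d}" by (intro sum_mono2) (use nn in auto)
    then show ?thesis using assms by (simp add: standard_simplex_def)
  next
    case False
    then show ?thesis using nn(2)[of i] nn(2)[of n] nn(3)[of i] nn(3)[of n] by auto
  qed
qed

lemma peak_cases:
  assumes x: "x \<in> standard_simplex 3"
  obtains "\<And>n. x n \<le> 1/2" "\<And>n. peak x n = 0" "excess x = 0"
    | i where "i \<le> 3" "1/2 < x i" "peak x i = x i - 1/2" "excess x = x i - 1/2" "\<And>n. n \<noteq> i \<Longrightarrow> peak x n = 0"
proof (cases "\<exists>i\<le>3. 1/2 < x i")
  case True
  then obtain i where i: "i \<le> 3" "1/2 < x i" by auto
  have p: "peak x n = 0" if "n \<noteq> i" for n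
    using simplex_pair_le[OF x that[symmetric]] i(2) by (simp add: peak_def)
  have "excess x = peak x i + sum (peak x) ({..3} - {i})" using i(1) by (simp add: excess_def sum.remove)
  also have "sum (peak x) ({..3} - {i}) = 0" by (rule sum.neutral) (use p in auto)
  finally show thesis using that(2)[OF i] i p by (simp add: peak_def)
next
  case False
  then have "x n \<le> 1/2" for n
    using x by (cases "n \<le> 3") (auto simp: standard_simplex_def not_less)
  then show thesis using that(1) by (simp add: peak_def excess_def)
qed

text \<open>Coordinate \<open>i\<close> is set to \<open>a\<close> and the others are rescaled by a
  common factor that restores the sum 1. Near vertex \<open>i\<close> both \<open>push\<close> and
  \<open>pull\<close> have this form.\<close>

lemma scale_off_one:
  assumes x: "x \<in> standard_simplex 3" and i: "i \<le> 3" "x i < 1" and a: "0 \<le> a" "a \<le> 1"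
    and f: "f i = a" "\<And>n. n \<noteq> i \<Longrightarrow> f n = x n * ((1 - a) / (1 - x i))"
  shows "f \<in> standard_simplex 3"
proof (rule standard_simplexI)
  have nn: "0 \<le> x n" for n using x by (simp add: standard_simplex_def)
  show "0 \<le> f n" for n using nn[of n] a i f by (cases "n = i") auto
  show "f n = 0" if "3 < n" for n using x that i f(2)[of n] by (auto simp: standard_simplex_def)
  have "sum x {..3} = x i + sum x ({..3} - {i})" using i by (simp add: sum.remove)
  then have s: "sum x ({..3} - {i}) = 1 - x i" using x by (simp add: standard_simplex_def)
  have "sum f {..3} = a + sum f ({..3} - {i})" using i f by (simp add: sum.remove)
  also have "sum f ({..3} - {i}) = sum x ({..3} - {i}) * ((1 - a) / (1 - x i))"
    unfolding sum_distrib_right by (rule sum.cong) (use f in auto)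
  finally show "sum f {..3} = 1" using i by (simp add: s)
qed

text \<open>Coordinate \<open>i\<close> is stretched affinely from the interval between 1/2 and 3/4
  to that between 1/2 and 1, and the others are rescaled. Through \<open>excess\<close> the
  definition achieves this without choosing \<open>i\<close>, which makes continuity and
  compatibility with gluings accessible.\<close>

lemma push_values:
  assumes x: "x \<in> standard_simplex 3" "\<And>n. x n \<le> 3/4"
  obtains "push x = x" "\<And>n. x n \<le> 1/2"
    | i where "i \<le> 3" "1/2 < x i" "push x i = 2 * x i - 1/2"
      "\<And>n. n \<noteq> i \<Longrightarrow> push x n = x n * ((3/2 - 2 * x i) / (1 - x i))"
proof (cases rule: peak_cases[OF x(1)])
  case 1
  then show thesis using that(1) by (simp add: push_def fun_eq_iff)
next
  case (2 i)
  have "push x n = x n * ((3/2 - 2 * x i) / (1 - x i))" if n: "n \<noteq> i" for n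
  proof -
    have "1 - x i \<noteq> 0" using x(2)[of i] by simp
    moreover have "1/2 - (x i - 1/2) = 1 - x i" by simp
    ultimately show ?thesis by (simp add: push_def 2 2(5)[OF n] field_simps)
  qed
  then show thesis using that(2) 2 by (simp add: push_def)
qed

lemma pull_values:
  assumes x: "x \<in> standard_simplex 3" "\<And>n. x n < 1"
  obtains "pull x = x" "\<And>n. x n \<le> 1/2"
    | i where "i \<le> 3" "1/2 < x i" "pull x i = x i / 2 + 1/4"
      "\<And>n. n \<noteq> i \<Longrightarrow> pull x n = x n * ((3/4 - x i / 2) / (1 - x i))"
proof (cases rule: peak_cases[OF x(1)])
  case 1
  then show thesis using that(1) by (simp add: pull_def fun_eq_iff)
next
  case (2 i)
  have a: "pull x i = x i / 2 + 1/4" by (simp add: pull_def 2(3,4) diff_divide_distrib)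
  have b: "pull x n = x n * ((3/4 - x i / 2) / (1 - x i))" if n: "n \<noteq> i" for n
  proof -
    have "1 - x i \<noteq> 0" using x(2)[of i] by simp
    moreover have "1/2 - (x i - 1/2) = 1 - x i" by simp
    ultimately show ?thesis by (simp add: pull_def 2 2(5)[OF n] field_simps)
  qed
  show thesis by (rule that(2)[OF 2(1,2) a b])
qed

lemma push_in_simplex:
  assumes x: "x \<in> standard_simplex 3" "\<And>n. x n \<le> 3/4"
  shows "push x \<in> standard_simplex 3"
proof (cases rule: push_values[OF x])
  case 1
  then show ?thesis using x by simp
next
  case (2 i)
  show ?thesis
    by (rule scale_off_one[OF x(1) 2(1), where a = "2 * x i - 1/2"]) (use 2 x(2)[of i] in auto)
qed

lemma pull_in_simplex:
  assumes x: "x \<in> standard_simplex 3" "\<And>n. x n < 1"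
  shows "pull x \<in> standard_simplex 3" "pull x n \<le> 3/4"
proof -
  have "pull x \<in> standard_simplex 3 \<and> (\<forall>n. pull x n \<le> 3/4)"
  proof (cases rule: pull_values[OF x])
    case 1
    have "x n \<le> 3/4" for n using 1(2)[of n] by simp
    then show ?thesis using x 1 by simp
  next
    case (2 i)
    have s: "pull x \<in> standard_simplex 3"
      by (rule scale_off_one[OF x(1) 2(1), where a = "x i / 2 + 1/4"]) (use 2 x(2)[of i] in auto)
    have "pull x n \<le> 3/4" for n
      using simplex_pair_le[OF s, of i n] 2(2,3) x(2)[of i] by (cases "n = i") auto
    then show ?thesis using s by blast
  qed
  then show "pull x \<in> standard_simplex 3" "pull x n \<le> 3/4" by auto
qed

text \<open>Exactly the cut triangle where coordinate \<open>n\<close> is 3/4 is contracted to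
  vertex \<open>n\<close>. At all other truncated points the coordinates of the image stay below 1,
  where \<open>pull\<close> is the inverse.\<close>

lemma push_less_one:
  assumes x: "x \<in> standard_simplex 3" "\<And>n. x n \<le> 3/4"
  shows "push x n < 1 \<or> push x = vertex_point n \<and> x n = 3/4" and "x n < 3/4 \<Longrightarrow> push x n < 1"
    and "x n = 3/4 \<Longrightarrow> push x = vertex_point n"
proof -
  have "(x n < 3/4 \<longrightarrow> push x n < 1) \<and> (x n = 3/4 \<longrightarrow> push x = vertex_point n)"
  proof (cases rule: push_values[OF x])
    case 1
    have "x n < 3/4" using 1(2)[of n] by simp
    then show ?thesis using 1(1) by simp
  next
    case (2 i)
    have le: "push x m < 1" if "m \<noteq> i" for m
      using simplex_pair_le[OF push_in_simplex[OF x], of i m] that 2(2,3) by simp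
    show ?thesis
    proof (cases "n = i")
      case True
      have "push x = vertex_point i" if "x i = 3/4"
      proof
        fix m show "push x m = vertex_point i m" using 2(3) 2(4)[of m] that by (auto simp: vertex_point_def)
      qed
      then show ?thesis using True 2(3) by auto
    next
      case False
      then show ?thesis using le[OF False] simplex_pair_le[OF x(1), of i n] 2(2) by auto
    qed
  qed
  then show "x n < 3/4 \<Longrightarrow> push x n < 1" "x n = 3/4 \<Longrightarrow> push x = vertex_point n"
    "push x n < 1 \<or> push x = vertex_point n \<and> x n = 3/4" using x(2)[of n] by (auto simp: less_le)
qed

lemma pull_push:
  assumes x: "x \<in> standard_simplex 3" "\<And>n. x n < 3/4"
  shows "pull (push x) = x"
proof -
  have le: "x n \<le> 3/4" for n using x(2)[of n] by simp
  have p: "push x \<in> standard_simplex 3" "push x n < 1" for n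
    using push_in_simplex[OF x(1) le] push_less_one(2)[OF x(1) le x(2)] by auto
  show ?thesis
  proof (cases rule: push_values[OF x(1) le])
    case 1
    show ?thesis
    proof (cases rule: pull_values[OF p])
      case (2 i)
      then show ?thesis using 1(1) 1(2)[of i] by simp
    qed (use 1 in simp)
  next
    case (2 i)
    show ?thesis
    proof (cases rule: pull_values[OF p])
      case 1
      then show ?thesis using 1(2)[of i] 2 by simp
    next
      case (2 j)
      note p2 = 2
      have "j = i" using simplex_pair_le[OF p(1), of i j] p2(2) \<open>push x i = 2 * x i - 1/2\<close> \<open>1/2 < x i\<close> by auto
      show ?thesis
      proof
        fix n
        show "pull (push x) n = x n"
        proof (cases "n = i")
          case True
          then show ?thesis using p2(3) \<open>j = i\<close> \<open>push x i = 2 * x i - 1/2\<close> by (simp add: field_simps)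
        next
          case False
          have d: "1 - x i \<noteq> 0" "3/2 - 2 * x i \<noteq> 0" using x(2)[of i] by auto
          have e: "3/4 - push x i / 2 = 1 - x i" "1 - push x i = 3/2 - 2 * x i"
            using \<open>push x i = 2 * x i - 1/2\<close> by (simp_all add: field_simps)
          have "pull (push x) n = push x n * ((3/4 - push x i / 2) / (1 - push x i))" using p2(4) False \<open>j = i\<close> by simp
          also have "\<dots> = x n * ((3/2 - 2 * x i) / (1 - x i)) * ((1 - x i) / (3/2 - 2 * x i))"
            by (simp only: e \<open>\<And>n. n \<noteq> i \<Longrightarrow> push x n = x n * ((3/2 - 2 * x i) / (1 - x i))\<close>[OF False])
          also have "\<dots> = x n" using d by simp
          finally show ?thesis .
        qed
      qed
    qed
  qed
qed

lemma push_pull: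
  assumes x: "x \<in> standard_simplex 3" "\<And>n. x n < 1"
  shows "push (pull x) = x"
proof -
  have p: "pull x \<in> standard_simplex 3" "pull x n \<le> 3/4" for n using pull_in_simplex[OF x] by auto
  show ?thesis
  proof (cases rule: pull_values[OF x])
    case 1
    then show ?thesis
    proof (cases rule: push_values[OF p])
      case (2 i)
      then show ?thesis using 1(1) \<open>\<And>n. x n \<le> 1/2\<close>[of i] by simp
    qed simp
  next
    case (2 i)
    show ?thesis
    proof (cases rule: push_values[OF p])
      case 1
      then show ?thesis using 1(2)[of i] 2 by simp
    next
      case (2 j)
      note p2 = 2
      have "j = i" using simplex_pair_le[OF p(1), of i j] p2(2) \<open>pull x i = x i / 2 + 1/4\<close> \<open>1/2 < x i\<close> by auto
      show ?thesis
      proof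
        fix n
        show "push (pull x) n = x n"
        proof (cases "n = i")
          case True
          then show ?thesis using p2(3) \<open>j = i\<close> \<open>pull x i = x i / 2 + 1/4\<close> by simp
        next
          case False
          have d: "1 - x i \<noteq> 0" "3/4 - x i / 2 \<noteq> 0" using x(2)[of i] by auto
          have "push (pull x) n = pull x n * ((3/2 - 2 * pull x i) / (1 - pull x i))" using p2(4) False \<open>j = i\<close> by simp
          also have "\<dots> = x n * ((3/4 - x i / 2) / (1 - x i)) * ((1 - x i) / (3/4 - x i / 2))"
            using \<open>pull x i = x i / 2 + 1/4\<close> \<open>\<And>n. n \<noteq> i \<Longrightarrow> pull x n = x n * ((3/4 - x i / 2) / (1 - x i))\<close>[OF False] by simp
          also have "\<dots> = x n" using d by simp
          finally show ?thesis .
        qed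
      qed
    qed
  qed
qed

lemma continuous_on_push: "continuous_on {x. x \<in> standard_simplex 3 \<and> (\<forall>n. x n \<le> 3/4)} push"
proof -
  let ?S = "{x. x \<in> standard_simplex 3 \<and> (\<forall>n. x n \<le> 3/4)}"
  have pk: "continuous_on ?S (\<lambda>x. peak x n)" for n
    unfolding peak_def by (intro continuous_intros continuous_on_max continuous_on_coordinate)
  have ex: "continuous_on ?S excess" unfolding excess_def[abs_def] by (intro continuous_intros pk)
  \<comment> \<open>The denominator is 1/2, or \<open>1 - x i\<close> for the one coordinate
    \<open>x i\<close> above 1/2; the bound 3/4 keeps the latter at least 1/4.\<close>
  have nz: "1/2 - (excess x - peak x n) \<noteq> 0" if "x \<in> ?S" for x n
  proof -
    have x: "x \<in> standard_simplex 3" using that by simp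
    show ?thesis
    proof (cases rule: peak_cases[OF x])
      case 1
      then show ?thesis by simp
    next
      case (2 i)
      have "x i \<le> 3/4" using that by simp
      then show ?thesis using 2(3,4) 2(5)[of n] by (cases "n = i") auto
    qed
  qed
  have "continuous_on ?S (\<lambda>x. push x n)" for n
    unfolding push_def
    by (intro continuous_on_add continuous_on_diff continuous_on_mult continuous_on_divide continuous_on_coordinate
        continuous_on_const pk ex ballI nz)
  then show ?thesis by (intro continuous_on_coordinatewise_then_product)
qed

context facet_pairing
begin

text \<open>A gluing permutes the nonzero coordinates, and \<open>h 0 = 0\<close> makes the others
  harmless. It is applied to the positive part of \<open>t - 1/2\<close>, whose sum is
  \<open>excess\<close>.\<close>

lemma sum_affine_extension:
  assumes F: "F \<in> facets d G" and x: "x (snd F) = 0" and h: "h 0 = (0 :: real)"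
  shows "(\<Sum>w\<le>d. h (affine_extension d G F x w)) = (\<Sum>v\<le>d. h (x v))"
proof -
  have sF: "snd F \<le> d" "snd (mate G F) \<le> d" using F mate_in[OF F] by (auto simp: facets_def)
  have split: "(\<Sum>i\<le>d. g i) = g j + sum g ({..d} - {j})" if "j \<le> d" for j and g :: "nat \<Rightarrow> real"
    using that by (simp add: sum.remove)
  have "(\<Sum>w\<le>d. h (affine_extension d G F x w)) = (\<Sum>w\<in>facet_vertices d (mate G F). h (x (vmap G (mate G F) w)))"
    by (subst split[OF sF(2)]) (simp add: affine_extension_eq[OF F] facet_vertices_def h)
  also have "\<dots> = (\<Sum>v\<in>facet_vertices d F. h (x v))"
    using sum.reindex_bij_betw[OF vmap_bij[OF mate_in[OF F]], of "\<lambda>v. h (x v)"] mate_mate[OF F] by simp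
  also have "\<dots> = (\<Sum>v\<le>d. h (x v))"
    by (subst split[OF sF(1)]) (simp add: facet_vertices_def x h)
  finally show ?thesis .
qed

end

text \<open>The increasing injection that omits the value \<open>v\<close>, known as a coface map;
  \<open>unskip v\<close> inverts it off \<open>v\<close>.\<close>

definition skip :: "nat \<Rightarrow> nat \<Rightarrow> nat" where
  "skip v r = (if r < v then r else Suc r)"

definition unskip :: "nat \<Rightarrow> nat \<Rightarrow> nat" where
  "unskip v n = (if n < v then n else n - 1)"

text \<open>Points of the triangle that cuts off the vertex \<open>v\<close>, in the barycentric coordinates of the triangle;
  its vertex \<open>r\<close> lies on the edge from \<open>v\<close> to \<open>skip v r\<close>.\<close>

definition cut_point :: "nat \<Rightarrow> (nat \<Rightarrow> real) \<Rightarrow> nat \<Rightarrow> real" where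
  "cut_point v y = (\<lambda>n. if n = v then 3/4 else if n \<le> 3 then y (unskip v n) / 4 else 0)"

definition cut_coords :: "nat \<Rightarrow> (nat \<Rightarrow> real) \<Rightarrow> nat \<Rightarrow> real" where
  "cut_coords v x = (\<lambda>r. if r \<le> 2 then 4 * x (skip v r) else 0)"

lemma le_3_cases: "(v :: nat) \<le> 3 \<Longrightarrow> v = 0 \<or> v = 1 \<or> v = 2 \<or> v = 3"
  by auto

lemma cut_point_in_simplex:
  assumes y: "y \<in> standard_simplex 2" and v: "v \<le> 3"
  shows "cut_point v y \<in> standard_simplex 3" "cut_point v y n \<le> 3/4" "cut_point v y v = 3/4"
proof -
  have nn: "0 \<le> y r" and le: "y r \<le> 1" for r using y by (auto simp: standard_simplex_def)
  have "y 0 + y 1 + y 2 = 1" using y by (simp add: standard_simplex_def sum_atMost_2)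
  then have sum: "(\<Sum>n\<le>3. cut_point v y n) = 1"
    using le_3_cases[OF v] unfolding sum_atMost_3 by (elim disjE) (simp_all add: cut_point_def unskip_def)
  show "cut_point v y \<in> standard_simplex 3"
  proof (rule standard_simplexI[OF _ _ sum])
    show "0 \<le> cut_point v y n" for n using nn by (simp add: cut_point_def)
    show "cut_point v y n = 0" if "3 < n" for n using that v by (simp add: cut_point_def)
  qed
  have "y r / 4 \<le> 3/4" for r using le[of r] by simp
  then show "cut_point v y n \<le> 3/4" "cut_point v y v = 3/4" by (simp_all add: cut_point_def)
qed

lemma cut_coords_in_simplex:
  assumes x: "x \<in> standard_simplex 3" and v: "v \<le> 3" "x v = 3/4"
  shows "cut_coords v x \<in> standard_simplex 2" "cut_point v (cut_coords v x) = x"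
proof -
  have nn: "0 \<le> x n" and out: "3 < n \<Longrightarrow> x n = 0" for n using x by (auto simp: standard_simplex_def)
  have s: "x 0 + x 1 + x 2 + x 3 = 1" using x by (simp add: standard_simplex_def sum_atMost_3)
  show "cut_coords v x \<in> standard_simplex 2"
  proof (rule standard_simplexI)
    show "0 \<le> cut_coords v x n" for n using nn by (simp add: cut_coords_def)
    show "cut_coords v x n = 0" if "2 < n" for n using that by (simp add: cut_coords_def)
    show "(\<Sum>n\<le>2. cut_coords v x n) = 1"
      using le_3_cases[OF v(1)] s v(2) unfolding sum_atMost_2
      by (elim disjE) (simp_all add: cut_coords_def skip_def eval_nat_numeral)
  qed
  show "cut_point v (cut_coords v x) = x"
  proof
    fix n
    show "cut_point v (cut_coords v x) n = x n"
      using v out[of n] by (auto simp: cut_point_def cut_coords_def skip_def unskip_def)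
  qed
qed

lemma continuous_on_cut_point: "continuous_on S (cut_point v)"
  unfolding cut_point_def
  by (intro continuous_on_coordinatewise_then_product continuous_on_if_const continuous_on_const
      continuous_on_divide continuous_on_coordinate) simp_all

lemma cut_coords_cut_point:
  assumes "y \<in> standard_simplex 2" "v \<le> 3"
  shows "cut_coords v (cut_point v y) = y"
proof
  fix r
  have "2 < r \<Longrightarrow> y r = 0" using assms by (simp add: standard_simplex_def)
  then show "cut_coords v (cut_point v y) r = y r"
    using assms(2) by (auto simp: cut_point_def cut_coords_def skip_def unskip_def)
qed

section \<open>Stretching and gluing; connectedness of the local vertices\<close>

context facet_pairing
begin

text \<open>Both formulas treat all coordinates alike and send 0 to 0, and \<open>excess\<close> is
  invariant under gluing. Hence they commute with a relabelling of the coordinates.\<close>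

lemma push_affine_extension:
  assumes d: "d = 3" and F: "F \<in> facets d G" and x: "x (snd F) = 0"
  shows "affine_extension d G F (push x) = push (affine_extension d G F x)"
    and "affine_extension d G F (pull x) = pull (affine_extension d G F x)"
proof -
  have ex: "excess (affine_extension d G F x) = excess x"
    unfolding excess_def peak_def using sum_affine_extension[where h = "\<lambda>t. max 0 (t - 1/2)", OF F, of x] x d by simp
  have z: "push (affine_extension d G F x) w = 0" "pull (affine_extension d G F x) w = 0"
    if "w \<notin> facet_vertices d (mate G F)" for w
    using that by (simp_all add: push_def pull_def peak_def affine_extension_eq[OF F])
  have nz: "push (affine_extension d G F x) w = push x (vmap G (mate G F) w)"
    "pull (affine_extension d G F x) w = pull x (vmap G (mate G F) w)"
    if "w \<in> facet_vertices d (mate G F)" for w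
    unfolding push_def pull_def ex using that by (simp_all add: peak_def affine_extension_eq[OF F])
  show "affine_extension d G F (push x) = push (affine_extension d G F x)"
    "affine_extension d G F (pull x) = pull (affine_extension d G F x)"
    unfolding affine_extension_eq[OF F, of "push x"] affine_extension_eq[OF F, of "pull x"]
    by (intro ext; simp add: z nz)+
qed

text \<open>Connectedness of the local vertices under the gluings, phrased as an induction principle
  for closed sets. It serves twice: for the single vertex class and for the connectedness of the
  boundary.\<close>

definition vertex_connected :: bool where
  "vertex_connected \<longleftrightarrow> (\<forall>S \<subseteq> {..<num_simplices G} \<times> {..d}. S \<noteq> {} \<longrightarrow>
     (\<forall>(s, v) \<in> S. \<forall>i\<le>d. i \<noteq> v \<longrightarrow> (fst (mate G (s, i)), vmap G (s, i) v) \<in> S) \<longrightarrow>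
     S = {..<num_simplices G} \<times> {..d})"

lemma vertex_connectedD:
  assumes "vertex_connected" "S \<subseteq> {..<num_simplices G} \<times> {..d}" "S \<noteq> {}"
    and "\<And>s v i. (s, v) \<in> S \<Longrightarrow> i \<le> d \<Longrightarrow> i \<noteq> v \<Longrightarrow> (fst (mate G (s, i)), vmap G (s, i) v) \<in> S"
  shows "S = {..<num_simplices G} \<times> {..d}"
  using assms(1)[unfolded vertex_connected_def, rule_format, OF assms(2,3)] assms(4) by blast

lemma vertex_neighbour:
  assumes "s < num_simplices G" "v \<le> d" "i \<le> d" "i \<noteq> v"
  shows "fst (mate G (s, i)) < num_simplices G" "vmap G (s, i) v \<le> d"
    "v \<in> facet_vertices d (s, i)"
proof -
  have F: "(s, i) \<in> facets d G" using assms by (simp add: facets_def)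
  show "fst (mate G (s, i)) < num_simplices G" using mate_in[OF F] by (auto simp: facets_def)
  show v: "v \<in> facet_vertices d (s, i)" using assms by (simp add: facet_vertices_def)
  show "vmap G (s, i) v \<le> d" using vmap_in[OF F v] by (simp add: facet_vertices_def)
qed

lemma vertex_point_in_simplex: "v \<le> d \<Longrightarrow> vertex_point v \<in> standard_simplex d"
  by (simp add: vertex_point_def)

lemma one_vertex_class:
  assumes conn: "vertex_connected" and s: "s < num_simplices G" "i \<le> d" and t: "t < num_simplices G" "j \<le> d"
  shows "point_class d G (s, vertex_point i) = point_class d G (t, vertex_point j)"
proof -
  define S where "S = {(t, j). t < num_simplices G \<and> j \<le> d \<and> point_class d G (t, vertex_point j) = point_class d G (s, vertex_point i)}"
  have "S = {..<num_simplices G} \<times> {..d}"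
  proof (rule vertex_connectedD[OF conn])
    show "S \<subseteq> {..<num_simplices G} \<times> {..d}" by (auto simp: S_def)
    show "S \<noteq> {}" using s by (auto simp: S_def)
    fix t v f assume *: "(t, v) \<in> S" "f \<le> d" "f \<noteq> v"
    then have tv: "t < num_simplices G" "v \<le> d" by (auto simp: S_def)
    have F: "(t, f) \<in> facets d G" using tv * by (simp add: facets_def)
    note n = vertex_neighbour[OF tv *(2,3)]
    have "affine_extension d G (t, f) (vertex_point v) = vertex_point (vmap G (t, f) v)"
    proof
      fix w
      show "affine_extension d G (t, f) (vertex_point v) w = vertex_point (vmap G (t, f) v) w"
      proof (cases "w \<in> facet_vertices d (mate G (t, f))")
        case True
        have "vmap G (mate G (t, f)) w = v \<longleftrightarrow> w = vmap G (t, f) v"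
          using vmap_inverse[OF mate_in[OF F] True] vmap_inverse[OF F n(3)] mate_mate[OF F] by metis
        then show ?thesis using True by (simp add: affine_extension_eq[OF F] vertex_point_def)
      next
        case False
        then have "w \<noteq> vmap G (t, f) v" using vmap_in[OF F n(3)] by metis
        then show ?thesis using False by (simp add: affine_extension_eq[OF F] vertex_point_def)
      qed
    qed
    moreover have "vertex_point v f = 0" using * by (simp add: vertex_point_def)
    ultimately have "point_class d G (fst (mate G (t, f)), vertex_point (vmap G (t, f) v)) = point_class d G (t, vertex_point v)"
      using point_class_gluing[OF F vertex_point_in_simplex[OF tv(2)]] by simp
    then show "(fst (mate G (t, f)), vmap G (t, f) v) \<in> S" using * n by (simp add: S_def)
  qed
  then have "(t, j) \<in> S" using t by simp
  then show ?thesis by (simp add: S_def)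
qed

end

section \<open>The connected boundary and its collapse\<close>

locale one_vertex_complex = fanned_complex +
  assumes vertex_connected: "vertex_connected"
begin

abbreviation Z where "Z \<equiv> point_class 3 G (0, vertex_point 0)"
abbreviation B where "B \<equiv> truncation_points G"

lemma vertex_class: "s < num_simplices G \<Longrightarrow> v \<le> 3 \<Longrightarrow> point_class 3 G (s, vertex_point v) = Z"
  by (rule one_vertex) (use nonempty in auto)

lemma complex_vertices_eq: "complex_vertices 3 G = {Z}"
proof -
  have eq: "complex_vertices 3 G = {point_class 3 G (s, vertex_point v) | s v. s < num_simplices G \<and> v \<le> 3}"
    by (simp only: complex_vertices_def point_class_def vertex_point_def)
  show ?thesis
  proof
    show "complex_vertices 3 G \<subseteq> {Z}" unfolding eq using vertex_class by blast
    have "Z \<in> complex_vertices 3 G"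
      unfolding eq by (rule CollectI, rule exI[of _ 0], rule exI[of _ 0]) (use nonempty in simp)
    then show "{Z} \<subseteq> complex_vertices 3 G" by simp
  qed
qed

definition cut_triangle :: "nat \<Rightarrow> nat \<Rightarrow> (nat \<times> (nat \<Rightarrow> real)) set set" where
  "cut_triangle s v = (\<lambda>y. point_class 3 G (s, cut_point v y)) ` standard_simplex 2"

lemma cut_point_in_points: "s < num_simplices G \<Longrightarrow> v \<le> 3 \<Longrightarrow> y \<in> standard_simplex 2 \<Longrightarrow> (s, cut_point v y) \<in> simplex_points 3 G"
  using cut_point_in_simplex(1) by (simp add: simplex_points_def)

lemma cut_point_class_in_B:
  assumes "s < num_simplices G" "v \<le> 3" "y \<in> standard_simplex 2"
  shows "point_class 3 G (s, cut_point v y) \<in> B"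
  using point_class_in_M(2)[OF cut_point_in_points[OF assms]] cut_point_in_simplex(2,3)[OF assms(3,2)] by blast

lemma B_eq: "B = (\<Union>s<num_simplices G. \<Union>v\<le>3. cut_triangle s v)"
proof
  show "(\<Union>s<num_simplices G. \<Union>v\<le>3. cut_triangle s v) \<subseteq> B"
    using cut_point_class_in_B by (auto simp: cut_triangle_def)
  show "B \<subseteq> (\<Union>s<num_simplices G. \<Union>v\<le>3. cut_triangle s v)"
  proof
    fix p assume p: "p \<in> B"
    then have "p \<in> topspace C" by (auto simp: truncation_points_def topspace_associated_manifold)
    then obtain s x where sx: "p = point_class 3 G (s, x)" "(s, x) \<in> simplex_points 3 G"
      by (auto simp: topspace_complex_space)
    then obtain v where v: "x v = 3/4" using point_class_in_M(2)[OF sx(2)] p by auto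
    have x: "s < num_simplices G" "x \<in> standard_simplex 3" using sx(2) by (auto simp: simplex_points_def)
    then have v3: "v \<le> 3" using v by (cases "v \<le> 3") (auto simp: standard_simplex_def)
    have "p \<in> cut_triangle s v"
      unfolding cut_triangle_def sx(1) using cut_coords_in_simplex[OF x(2) v3 v] by (intro image_eqI) simp_all
    then show "p \<in> (\<Union>s<num_simplices G. \<Union>v\<le>3. cut_triangle s v)" using x v3 by blast
  qed
qed

lemma B_subset: "B \<subseteq> topspace M"
  by (auto simp: truncation_points_def)

lemma subtopology_M_B: "subtopology M B = subtopology C B"
  by (rule subtopology_associated_manifold[OF B_subset])

lemma B_subset_C: "B \<subseteq> topspace C"
  using B_subset by (auto simp: topspace_associated_manifold)

lemma continuous_map_point_class:
  assumes f: "continuous_on S f" "f ` S \<subseteq> standard_simplex 3" and s: "s < num_simplices G"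
  shows "continuous_map (top_of_set S) C (\<lambda>y. point_class 3 G (s, f y))"
proof -
  have "continuous_map (top_of_set S) (top_of_set (simplex_points 3 G)) (\<lambda>y. (s, f y))"
    using f s by (auto simp: simplex_points_def intro!: continuous_intros)
  then have "continuous_map (top_of_set S) C (point_class 3 G \<circ> (\<lambda>y. (s, f y)))"
    by (rule continuous_map_compose) (rule quotient_imp_continuous_map[OF quotient_map_point_class])
  then show ?thesis by (simp add: o_def)
qed

lemma connectedin_standard_simplex': "connectedin (top_of_set (standard_simplex d)) (standard_simplex d)"
  using connectedin_standard_simplex[of d] by (simp add: euclidean_product_topology connectedin_subtopology)

lemma connectedin_cut_triangle:
  assumes "s < num_simplices G" "v \<le> 3"
  shows "connectedin (subtopology C B) (cut_triangle s v)"
proof -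
  have "continuous_map (top_of_set (standard_simplex 2)) C (\<lambda>y. point_class 3 G (s, cut_point v y))"
    using continuous_on_cut_point cut_point_in_simplex(1)[OF _ assms(2)] by (intro continuous_map_point_class assms(1)) auto
  then have "connectedin C (cut_triangle s v)"
    unfolding cut_triangle_def by (rule connectedin_continuous_map_image) (rule connectedin_standard_simplex')
  moreover have "cut_triangle s v \<subseteq> B" using B_eq assms by blast
  ultimately show ?thesis by (simp add: connectedin_subtopology)
qed

lemma neighbouring_cut_triangles_meet:
  assumes s: "s < num_simplices G" and v: "v \<le> 3" and i: "i \<le> 3" "i \<noteq> v"
  shows "cut_triangle s v \<inter> cut_triangle (fst (mate G (s, i))) (vmap G (s, i) v) \<noteq> {}"
proof -
  have F: "(s, i) \<in> facets 3 G" using s i by (simp add: facets_def)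
  note n = vertex_neighbour[OF s v i]
  \<comment> \<open>A corner of the triangle cut off at \<open>v\<close> other than the one on the
    edge towards \<open>i\<close>; its cut point has coordinate 0 at \<open>i\<close> and so lies on
    the facet to be crossed.\<close>
  define r where "r = (if unskip v i = 0 then 1 else 0 :: nat)"
  define y where "y = (\<lambda>n. if n = r then 1 else 0 :: real)"
  have y: "y \<in> standard_simplex 2" unfolding y_def by (simp add: r_def)
  let ?x = "cut_point v y" and ?y = "affine_extension 3 G (s, i) (cut_point v y)"
  have x: "?x \<in> standard_simplex 3" "?x v = 3/4" "?x i = 0"
    using cut_point_in_simplex(1,3)[OF y v] i by (auto simp: cut_point_def y_def r_def)
  have "?y \<in> standard_simplex 3" using affine_extension_in_simplex[OF F x(1)] x(3) by simp
  moreover have "?y (vmap G (s, i) v) = 3/4" using affine_extension_vmap[OF F n(3)] x(2) by simp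
  ultimately have "point_class 3 G (fst (mate G (s, i)), ?y) \<in> cut_triangle (fst (mate G (s, i))) (vmap G (s, i) v)"
    unfolding cut_triangle_def using cut_coords_in_simplex[of ?y "vmap G (s, i) v"] n(2)
    by (intro image_eqI[of _ _ "cut_coords (vmap G (s, i) v) ?y"]) simp_all
  moreover have "point_class 3 G (s, ?x) \<in> cut_triangle s v" unfolding cut_triangle_def using y by blast
  ultimately show ?thesis using point_class_gluing[OF F x(1)] x(3) by auto
qed

text \<open>The cut triangles are connected, and those of adjacent local vertices share a point. The
  local vertices whose triangles lie in one fixed component thus form a closed set, which is
  everything by \<open>vertex_connected\<close>.\<close>

lemma connected_B: "connected_space (subtopology C B)"
proof -
  let ?Y = "subtopology C B"
  have tY: "topspace ?Y = B" using B_subset_C by auto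
  have nonemptyT: "cut_triangle s v \<noteq> {}" for s v
    by (simp add: cut_triangle_def nonempty_standard_simplex)
  obtain b where b: "b \<in> cut_triangle 0 0" using nonemptyT by blast
  let ?K = "connected_component_of_set ?Y b"
  define S where "S = {(s, v). s < num_simplices G \<and> v \<le> 3 \<and> cut_triangle s v \<subseteq> ?K}"
  have grow: "cut_triangle s v \<subseteq> ?K" if sv: "s < num_simplices G" "v \<le> 3" and meet: "cut_triangle s v \<inter> ?K \<noteq> {}" for s v
  proof -
    obtain q where q: "q \<in> cut_triangle s v" "connected_component_of ?Y b q" using meet by auto
    have "cut_triangle s v \<subseteq> connected_component_of_set ?Y q"
      by (rule connected_component_of_maximal[OF connectedin_cut_triangle[OF sv] q(1)])
    then show ?thesis using q(2) connected_component_of_equiv[of ?Y b q] by simp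
  qed
  have "S = {..<num_simplices G} \<times> {..3}"
  proof (rule vertex_connectedD[OF vertex_connected])
    show "S \<subseteq> {..<num_simplices G} \<times> {..3}" by (auto simp: S_def)
    have "cut_triangle 0 0 \<subseteq> ?K"
      by (rule connected_component_of_maximal[OF connectedin_cut_triangle[OF nonempty] b]) simp
    then show "S \<noteq> {}" using nonempty by (auto simp: S_def)
    fix s v i assume *: "(s, v) \<in> S" "i \<le> 3" "i \<noteq> v"
    then have sv: "s < num_simplices G" "v \<le> 3" "cut_triangle s v \<subseteq> ?K" by (auto simp: S_def)
    note n = vertex_neighbour[OF sv(1,2) *(2,3)]
    have "cut_triangle (fst (mate G (s, i))) (vmap G (s, i) v) \<subseteq> ?K"
      using neighbouring_cut_triangles_meet[OF sv(1,2) *(2,3)] sv(3) by (intro grow n) blast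
    then show "(fst (mate G (s, i)), vmap G (s, i) v) \<in> S" using n by (simp add: S_def)
  qed
  then have T: "cut_triangle s v \<subseteq> ?K" if "s < num_simplices G" "v \<le> 3" for s v
    using that unfolding S_def by blast
  have K: "B \<subseteq> ?K"
  proof
    fix p assume "p \<in> B"
    then obtain s v where "s < num_simplices G" "v \<le> 3" "p \<in> cut_triangle s v" using B_eq by auto
    then show "p \<in> ?K" using T by blast
  qed
  show ?thesis
    unfolding connected_space_iff_connected_component tY
  proof (intro ballI)
    fix p q assume "p \<in> B" "q \<in> B"
    then have "connected_component_of ?Y b p" "connected_component_of ?Y b q" using K by auto
    then show "connected_component_of ?Y p q" by (metis connected_component_of_sym connected_component_of_trans)
  qed
qed

lemma B_nonempty: "B \<noteq> {}"
  using B_eq nonempty nonempty_standard_simplex[of 2] by (auto simp: cut_triangle_def)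

lemma boundary_components_M: "boundary_components 3 M = {B}"
proof -
  have "topspace (subtopology C B) = B" using B_subset_C by auto
  then show ?thesis
    unfolding boundary_components_def manifold_boundary_M subtopology_M_B
    by (metis B_nonempty connected_B connected_components_of_eq_singleton null_topspace_iff_trivial)
qed

text \<open>All tetrahedra are connected and contain the single vertex.\<close>

lemma connected_complex: "connected_space C"
proof -
  have "connectedin C ((\<lambda>x. point_class 3 G (s, x)) ` standard_simplex 3)" if "s < num_simplices G" for s
    by (rule connectedin_continuous_map_image[OF continuous_map_point_class connectedin_standard_simplex'])
      (use that in auto)
  then have "connectedin C (\<Union>((\<lambda>s. (\<lambda>x. point_class 3 G (s, x)) ` standard_simplex 3) ` {..<num_simplices G}))"
  proof (intro connectedin_Union)
    have "Z \<in> (\<lambda>x. point_class 3 G (s, x)) ` standard_simplex 3" if "s < num_simplices G" for s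
      using vertex_class[OF that, of 0] vertex_point_in_simplex[of 0] by (intro image_eqI[of _ _ "vertex_point 0"]) simp_all
    then show "\<Inter>((\<lambda>s. (\<lambda>x. point_class 3 G (s, x)) ` standard_simplex 3) ` {..<num_simplices G}) \<noteq> {}" by blast
  qed auto
  moreover have "\<Union>((\<lambda>s. (\<lambda>x. point_class 3 G (s, x)) ` standard_simplex 3) ` {..<num_simplices G}) = topspace C"
    by (auto simp: topspace_complex_space simplex_points_def)
  ultimately show ?thesis by (simp add: connectedin_topspace)
qed

lemma one_card_vertices: "card (complex_vertices 3 G) = 1"
  by (simp add: complex_vertices_eq)

lemma push_class_respects:
  assumes c: "(t, y) \<in> point_class 3 G (s, x)" and x: "x \<in> standard_simplex 3" "\<And>n. x n \<le> 3/4"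
  shows "point_class 3 G (t, push y) = point_class 3 G (s, push x)"
proof -
  have "(\<forall>n. snd (t, y) n \<le> 3/4) \<and> point_class 3 G (fst (t, y), push (snd (t, y))) = point_class 3 G (s, push x)"
    using c
  proof (induction rule: point_class_induct)
    case start
    then show ?case using x(2) by simp
  next
    case (glue s' f z)
    have le: "z n \<le> 3/4" for n using glue(4) by simp
    have zf: "z (snd (s', f)) = 0" using glue(3) by simp
    have "push z f = 0" using glue(3) by (simp add: push_def peak_def)
    then have "point_class 3 G (fst (mate G (s', f)), push (affine_extension 3 G (s', f) z)) = point_class 3 G (s', push z)"
      using point_class_gluing[OF glue(1) push_in_simplex[OF glue(2) le]]
      unfolding push_affine_extension(1)[where x = z, OF refl glue(1) zf] by simp
    moreover have "affine_extension 3 G (s', f) z n \<le> 3/4" for n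
      using le by (simp add: affine_extension_eq[OF glue(1)])
    ultimately show ?case using glue(4) by simp
  qed
  then show ?thesis by simp
qed

lemma pull_class_respects:
  assumes c: "(t, y) \<in> point_class 3 G (s, x)" and x: "x \<in> standard_simplex 3" "\<And>n. x n < 1"
  shows "point_class 3 G (t, pull y) = point_class 3 G (s, pull x)"
proof -
  have "(\<forall>n. snd (t, y) n < 1) \<and> point_class 3 G (fst (t, y), pull (snd (t, y))) = point_class 3 G (s, pull x)"
    using c
  proof (induction rule: point_class_induct)
    case start
    then show ?case using x(2) by simp
  next
    case (glue s' f z)
    have le: "z n < 1" for n using glue(4) by simp
    have zf: "z (snd (s', f)) = 0" using glue(3) by simp
    have "pull z f = 0" using glue(3) by (simp add: pull_def peak_def)
    then have "point_class 3 G (fst (mate G (s', f)), pull (affine_extension 3 G (s', f) z)) = point_class 3 G (s', pull z)"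
      using point_class_gluing[OF glue(1) pull_in_simplex(1)[OF glue(2) le]]
      unfolding push_affine_extension(2)[where x = z, OF refl glue(1) zf] by simp
    moreover have "affine_extension 3 G (s', f) z n < 1" for n
      using le by (simp add: affine_extension_eq[OF glue(1)])
    ultimately show ?case using glue(4) by simp
  qed
  then show ?thesis by simp
qed

definition truncated_points :: "(nat \<times> (nat \<Rightarrow> real)) set" where
  "truncated_points = {p \<in> simplex_points 3 G. \<forall>n. snd p n \<le> 3/4}"

text \<open>The truncated complex is closed, so the quotient map restricts to a quotient map over
  it. Continuous maps out of it can then be given on points of the tetrahedra.\<close>

lemma quotient_map_M: "quotient_map (top_of_set truncated_points) M (point_class 3 G)"
proof -
  have "{p \<in> topspace (top_of_set (simplex_points 3 G)). point_class 3 G p \<in> topspace M} = truncated_points"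
    using point_class_in_M(1) by (auto simp: truncated_points_def)
  then have "quotient_map (subtopology (top_of_set (simplex_points 3 G)) truncated_points)
      (subtopology C (topspace M)) (point_class 3 G)"
    by (intro quotient_map_restriction[OF quotient_map_point_class] disjI2 closedin_M)
  moreover have "simplex_points 3 G \<inter> truncated_points = truncated_points" by (auto simp: truncated_points_def)
  moreover have "subtopology C (topspace M) = M"
    using subtopology_associated_manifold[of "topspace M" G] by simp
  ultimately show ?thesis by (simp add: subtopology_subtopology)
qed

lemma topspace_M_cases:
  assumes "p \<in> topspace M"
  obtains s x where "p = point_class 3 G (s, x)" "s < num_simplices G" "x \<in> standard_simplex 3" "\<forall>n. x n \<le> 3/4"
    "p \<in> B \<longleftrightarrow> (\<exists>n. x n = 3/4)"
proof -
  have "p \<in> topspace C" using assms by (simp add: topspace_associated_manifold)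
  then obtain s x where p: "p = point_class 3 G (s, x)" "(s, x) \<in> simplex_points 3 G"
    by (auto simp: topspace_complex_space)
  have "\<forall>n. x n \<le> 3/4" using assms point_class_in_M(1)[OF p(2)] p(1) by simp
  then show thesis using that[of s x] p point_class_in_M(2)[OF p(2)] by (simp add: simplex_points_def)
qed

text \<open>\<open>push\<close> descends to the quotient because it commutes with the gluings.
  Outside \<open>B\<close> it is undone by \<open>pull\<close>, which respects the classes as well,
  so nothing but \<open>B\<close> is contracted.\<close>

lemma collapse_map_exists:
  obtains g where "continuous_map M C g" "g ` topspace M = topspace C"
    "\<And>p. p \<in> B \<Longrightarrow> g p = Z"
    "\<And>p p'. p \<in> topspace M \<Longrightarrow> p' \<in> topspace M \<Longrightarrow> g p = g p' \<longleftrightarrow> p = p' \<or> p \<in> B \<and> p' \<in> B"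
proof -
  define k where "k = (\<lambda>p. point_class 3 G (fst p, push (snd p)))"
  have T: "truncated_points \<subseteq> {..<num_simplices G} \<times> {x. x \<in> standard_simplex 3 \<and> (\<forall>n. x n \<le> 3/4)}"
    by (auto simp: truncated_points_def simplex_points_def)
  have "continuous_on truncated_points (\<lambda>p. push (snd p))"
    by (rule continuous_on_compose2[OF continuous_on_push continuous_on_snd[OF continuous_on_id]]) (use T in auto)
  then have "continuous_on truncated_points (\<lambda>p. (fst p, push (snd p)))"
    by (rule continuous_on_Pair[OF continuous_on_fst[OF continuous_on_id]])
  moreover have "(fst p, push (snd p)) \<in> simplex_points 3 G" if "p \<in> truncated_points" for p
    using that push_in_simplex by (auto simp: truncated_points_def simplex_points_def)
  ultimately have "continuous_map (top_of_set truncated_points) (top_of_set (simplex_points 3 G)) (\<lambda>p. (fst p, push (snd p)))"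
    by auto
  then have "continuous_map (top_of_set truncated_points) C (point_class 3 G \<circ> (\<lambda>p. (fst p, push (snd p))))"
    by (rule continuous_map_compose) (rule quotient_imp_continuous_map[OF quotient_map_point_class])
  then have k: "continuous_map (top_of_set truncated_points) C k" by (simp add: k_def o_def)
  have resp: "k p = k p'" if p: "p \<in> topspace (top_of_set truncated_points)" "p' \<in> topspace (top_of_set truncated_points)"
    "point_class 3 G p = point_class 3 G p'" for p p'
  proof -
    have "p \<in> point_class 3 G p'" using point_class_self[of p 3 G] p by (simp add: truncated_points_def)
    then show ?thesis
      using push_class_respects[of "fst p" "snd p" "fst p'" "snd p'"] p(2)
      by (simp add: k_def truncated_points_def simplex_points_def mem_Times_iff)
  qed
  obtain g where g: "continuous_map M C g" "g ` topspace M = k ` topspace (top_of_set truncated_points)"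
    "\<And>p. p \<in> topspace (top_of_set truncated_points) \<Longrightarrow> g (point_class 3 G p) = k p"
    using quotient_map_lift_exists[OF quotient_map_M k resp] by blast
  have gs: "g (point_class 3 G (s, x)) = point_class 3 G (s, push x)"
    if "s < num_simplices G" "x \<in> standard_simplex 3" "\<And>n. x n \<le> 3/4" for s x
    using g(3)[of "(s, x)"] that by (simp add: truncated_points_def simplex_points_def k_def)
  have gB: "g p = Z" if p: "p \<in> B" for p
  proof -
    have "p \<in> topspace M" using p B_subset by blast
    then obtain s x where sx: "p = point_class 3 G (s, x)" "s < num_simplices G" "x \<in> standard_simplex 3" "\<forall>n. x n \<le> 3/4"
      "p \<in> B \<longleftrightarrow> (\<exists>n. x n = 3/4)" by (rule topspace_M_cases)
    note sx = sx(1-3) sx(4)[rule_format] sx(5)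
    obtain v where v: "x v = 3/4" using sx(5) p by blast
    then have "v \<le> 3" using sx(3) by (cases "v \<le> 3") (auto simp: standard_simplex_def)
    then show ?thesis
      using gs[OF sx(2-4)] push_less_one(3)[OF sx(3,4) v] vertex_class[OF sx(2)] sx(1) by simp
  qed
  show thesis
  proof
    show "continuous_map M C g" by (rule g(1))
    show "g p = Z" if "p \<in> B" for p by (rule gB[OF that])
    show "g ` topspace M = topspace C"
    proof
      show "g ` topspace M \<subseteq> topspace C" using g(1) by (auto simp: continuous_map_def)
      show "topspace C \<subseteq> g ` topspace M"
      proof
        fix q assume "q \<in> topspace C"
        then obtain s y where sy: "q = point_class 3 G (s, y)" "s < num_simplices G" "y \<in> standard_simplex 3"
          by (auto simp: topspace_complex_space simplex_points_def)
        show "q \<in> g ` topspace M"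
        proof (cases "\<forall>n. y n < 1")
          case True
          then have y1: "y n < 1" for n by simp
          note pl = pull_in_simplex[OF sy(3) y1]
          have "g (point_class 3 G (s, pull y)) = q" using gs[OF sy(2) pl] push_pull[OF sy(3) y1] sy(1) by simp
          moreover have "point_class 3 G (s, pull y) \<in> topspace M"
            using point_class_in_M(1)[of s "pull y"] pl sy(2) by (simp add: simplex_points_def)
          ultimately show ?thesis by blast
        next
          case False
          then obtain v where "1 \<le> y v" by (auto simp: not_less)
          then have v: "y v = 1" using sy(3) by (intro antisym) (simp_all add: standard_simplex_def)
          then have v3: "v \<le> 3" using sy(3) by (cases "v \<le> 3") (auto simp: standard_simplex_def)
          have "y n = 0" if "n \<noteq> v" for n
            using simplex_pair_le[OF sy(3) that] v sy(3) by (intro antisym) (simp_all add: standard_simplex_def)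
          then have "y = vertex_point v" using v by (auto simp: vertex_point_def fun_eq_iff)
          then have "q = Z" using sy(1) vertex_class[OF sy(2) v3] by simp
          moreover obtain b where "b \<in> B" using B_nonempty by blast
          ultimately show ?thesis using gB B_subset by blast
        qed
      qed
    qed
    fix p p' assume p: "p \<in> topspace M" and p': "p' \<in> topspace M"
    obtain s x where sx: "p = point_class 3 G (s, x)" "s < num_simplices G" "x \<in> standard_simplex 3" "\<forall>n. x n \<le> 3/4"
      "p \<in> B \<longleftrightarrow> (\<exists>n. x n = 3/4)" by (rule topspace_M_cases[OF p])
    note sx = sx(1-3) sx(4)[rule_format] sx(5)
    obtain s' x' where sx': "p' = point_class 3 G (s', x')" "s' < num_simplices G" "x' \<in> standard_simplex 3" "\<forall>n. x' n \<le> 3/4"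
      "p' \<in> B \<longleftrightarrow> (\<exists>n. x' n = 3/4)" by (rule topspace_M_cases[OF p'])
    note sx' = sx'(1-3) sx'(4)[rule_format] sx'(5)
    \<comment> \<open>The value 1 in \<open>push x\<close> marks the points of \<open>B\<close>, and
      the set of values is an invariant of the class. So of two points with equal images both or
      neither lie in \<open>B\<close>.\<close>
    have one: "p \<in> B \<longleftrightarrow> 1 \<in> range (push x)"
    proof
      assume "p \<in> B"
      then obtain v where "x v = 3/4" using sx(5) by blast
      then have "push x v = 1" using push_less_one(3)[OF sx(3,4)] by (simp add: vertex_point_def)
      then show "1 \<in> range (push x)" by (metis rangeI)
    next
      assume "1 \<in> range (push x)"
      then obtain v where "push x v = 1" by (metis rangeE)
      then show "p \<in> B" using push_less_one(1)[OF sx(3,4), of v] sx(5) by auto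
    qed
    have one': "p' \<in> B \<longleftrightarrow> 1 \<in> range (push x')"
    proof
      assume "p' \<in> B"
      then obtain v where "x' v = 3/4" using sx'(5) by blast
      then have "push x' v = 1" using push_less_one(3)[OF sx'(3,4)] by (simp add: vertex_point_def)
      then show "1 \<in> range (push x')" by (metis rangeI)
    next
      assume "1 \<in> range (push x')"
      then obtain v where "push x' v = 1" by (metis rangeE)
      then show "p' \<in> B" using push_less_one(1)[OF sx'(3,4), of v] sx'(5) by auto
    qed
    show "g p = g p' \<longleftrightarrow> p = p' \<or> p \<in> B \<and> p' \<in> B"
    proof
      assume "p = p' \<or> p \<in> B \<and> p' \<in> B"
      then show "g p = g p'" using gB by auto
    next
      assume eq: "g p = g p'"
      have px: "push x \<in> standard_simplex 3" and px': "push x' \<in> standard_simplex 3"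
        using push_in_simplex sx sx' by blast+
      have "(s', push x') \<in> point_class 3 G (s', push x')"
        using px' sx'(2) by (intro point_class_self) (simp add: simplex_points_def)
      then have mem: "(s', push x') \<in> point_class 3 G (s, push x)"
        using eq gs[OF sx(2-4)] gs[OF sx'(2-4)] sx(1) sx'(1) by simp
      then have "range (push x') = range (push x)" by (rule range_point_class)
      then have same: "p \<in> B \<longleftrightarrow> p' \<in> B" using one one' by simp
      show "p = p' \<or> p \<in> B \<and> p' \<in> B"
      proof (cases "p \<in> B")
        case False
        then have "x n \<noteq> 3/4" "x' n \<noteq> 3/4" for n using same sx(5) sx'(5) by auto
        then have lt: "x n < 3/4" "x' n < 3/4" for n using sx(4)[of n] sx'(4)[of n] by (auto simp: less_le)
        have "push x n < 1" for n using push_less_one(2)[OF sx(3,4) lt(1)] .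
        then have "point_class 3 G (s', pull (push x')) = point_class 3 G (s, pull (push x))"
          by (rule pull_class_respects[OF mem px])
        then have "p' = p" using pull_push[OF sx(3) lt(1)] pull_push[OF sx'(3) lt(2)] sx(1) sx'(1) by simp
        then show ?thesis by simp
      qed (use same in simp)
    qed
  qed
qed

text \<open>The map of \<open>collapse_map_exists\<close> factors through the collapse of the
  boundary. The result is a continuous bijection from a compact space to a Hausdorff space, hence a
  homeomorphism.\<close>

lemma ideal_triangulation_M: "ideal_triangulation G M"
  unfolding ideal_triangulation_def
proof (intro conjI pairing manifold_M compact_M)
  show "manifold_boundary 3 M \<noteq> {}" using B_nonempty by (simp add: manifold_boundary_M)
  define R where "R = Id_on (topspace M) \<union> B \<times> B"
  have R: "equiv (topspace M) R"
    using B_subset by (intro equivI) (auto simp: R_def refl_on_def sym_def trans_def)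
  have N: "collapse_boundary 3 M = quotient_space M R"
    by (simp add: collapse_boundary_def boundary_components_M R_def)
  have cls: "R `` {p} = R `` {p'} \<longleftrightarrow> p = p' \<or> p \<in> B \<and> p' \<in> B" if "p \<in> topspace M" "p' \<in> topspace M" for p p'
    using eq_equiv_class_iff[OF R that] that by (auto simp: R_def)
  have q: "quotient_map M (quotient_space M R) (\<lambda>p. R `` {p})" by (rule quotient_map_quotient_space[OF R])
  obtain g where g: "continuous_map M C g" "g ` topspace M = topspace C" "\<And>p. p \<in> B \<Longrightarrow> g p = Z"
    "\<And>p p'. p \<in> topspace M \<Longrightarrow> p' \<in> topspace M \<Longrightarrow> g p = g p' \<longleftrightarrow> p = p' \<or> p \<in> B \<and> p' \<in> B"
    by (rule collapse_map_exists) blast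
  have resp: "g p = g p'" if "p \<in> topspace M" "p' \<in> topspace M" "R `` {p} = R `` {p'}" for p p'
    using cls[OF that(1,2)] g(4)[OF that(1,2)] that(3) by simp
  obtain h where h: "continuous_map (quotient_space M R) C h" "h ` topspace (quotient_space M R) = g ` topspace M"
    "\<And>p. p \<in> topspace M \<Longrightarrow> h (R `` {p}) = g p"
    using quotient_map_lift_exists[OF q g(1) resp] by blast
  have tq: "topspace (quotient_space M R) = (\<lambda>p. R `` {p}) ` topspace M"
    using quotient_imp_surjective_map[OF q] by simp
  show "\<exists>h. homeomorphic_map (collapse_boundary 3 M) C h \<and> h ` boundary_components 3 M = complex_vertices 3 G"
  proof (intro exI conjI)
    show "homeomorphic_map (collapse_boundary 3 M) C h"
      unfolding N
    proof (rule continuous_imp_homeomorphic_map[OF h(1) _ Hausdorff_complex_space])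
      have "compactin (quotient_space M R) ((\<lambda>p. R `` {p}) ` topspace M)"
        by (rule image_compactin[OF _ quotient_imp_continuous_map[OF q]]) (use compact_M in \<open>simp add: compact_space_def\<close>)
      then show "compact_space (quotient_space M R)" by (simp add: compact_space_def tq)
      show "h ` topspace (quotient_space M R) = topspace C" using h(2) g(2) by simp
      show "inj_on h (topspace (quotient_space M R))"
      proof (rule inj_onI)
        fix a a' assume "a \<in> topspace (quotient_space M R)" "a' \<in> topspace (quotient_space M R)" and eq: "h a = h a'"
        then obtain p p' where p: "a = R `` {p}" "p \<in> topspace M" and p': "a' = R `` {p'}" "p' \<in> topspace M"
          unfolding tq by blast
        then have "g p = g p'" using eq h(3) by simp
        then show "a = a'" using g(4)[OF p(2) p'(2)] cls[OF p(2) p'(2)] p(1) p'(1) by simp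
      qed
    qed
    obtain b where b: "b \<in> B" using B_nonempty by blast
    then have bM: "b \<in> topspace M" using B_subset by blast
    have "R `` {b} = B" using b by (auto simp: R_def)
    then have "h B = Z" using h(3)[OF bM] g(3)[OF b] by simp
    then show "h ` boundary_components 3 M = complex_vertices 3 G"
      by (simp add: boundary_components_M complex_vertices_eq)
  qed
qed

end

section \<open>The boundary as a triangulated surface\<close>

lemma skip_unskip: "n \<noteq> v \<Longrightarrow> skip v (unskip v n) = n"
  by (auto simp: skip_def unskip_def)

lemma unskip_skip: "unskip v (skip v r) = r"
  by (auto simp: skip_def unskip_def)

lemma skip_neq: "skip v r \<noteq> v"
  by (auto simp: skip_def)

lemma skip_le: "r \<le> 2 \<Longrightarrow> skip v r \<le> 3"
  by (auto simp: skip_def)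

lemma unskip_le: "n \<le> 3 \<Longrightarrow> v \<le> 3 \<Longrightarrow> n \<noteq> v \<Longrightarrow> unskip v n \<le> 2"
  by (auto simp: unskip_def)

lemma unskip_eq_iff: "n \<noteq> v \<Longrightarrow> n' \<noteq> v \<Longrightarrow> unskip v n = unskip v n' \<longleftrightarrow> n = n'"
  by (auto simp: unskip_def split: if_splits)

text \<open>The triangle \<open>4 s + v\<close> cuts the vertex \<open>v\<close> off the tetrahedron \<open>s\<close>, and its vertices are numbered as in
  \<open>cut_point\<close>.\<close>

definition link_mate :: "pairing \<Rightarrow> nat \<times> nat \<Rightarrow> nat \<times> nat" where
  "link_mate G F = (let s = fst F div 4; v = fst F mod 4; f = skip v (snd F); v' = vmap G (s, f) v in
     (4 * fst (mate G (s, f)) + v', unskip v' (snd (mate G (s, f)))))"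

definition link_vmap :: "pairing \<Rightarrow> nat \<times> nat \<Rightarrow> nat \<Rightarrow> nat" where
  "link_vmap G F w = (let s = fst F div 4; v = fst F mod 4; f = skip v (snd F) in
     unskip (vmap G (s, f) v) (vmap G (s, f) (skip v w)))"

definition link_complex :: "pairing \<Rightarrow> pairing" where
  "link_complex G = \<lparr>num_simplices = 4 * num_simplices G, mate = link_mate G, vmap = link_vmap G\<rparr>"

lemma link_complex_simps [simp]:
  "num_simplices (link_complex G) = 4 * num_simplices G"
  "mate (link_complex G) = link_mate G" "vmap (link_complex G) = link_vmap G"
  by (simp_all add: link_complex_def)

lemma link_mate_eq:
  "v \<le> 3 \<Longrightarrow> link_mate G (4 * s + v, r) = (4 * fst (mate G (s, skip v r)) + vmap G (s, skip v r) v,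
     unskip (vmap G (s, skip v r) v) (snd (mate G (s, skip v r))))"
  by (simp add: link_mate_def Let_def)

lemma link_vmap_eq:
  "v \<le> 3 \<Longrightarrow> link_vmap G (4 * s + v, r) w = unskip (vmap G (s, skip v r) v) (vmap G (s, skip v r) (skip v w))"
  by (simp add: link_vmap_def Let_def)

lemma link_facets_iff: "v \<le> 3 \<Longrightarrow> (4 * s + v, r) \<in> facets 2 (link_complex G) \<longleftrightarrow> s < num_simplices G \<and> r \<le> 2"
  by (auto simp: facets_def)

lemma link_index: obtains s v where "t = 4 * s + v" "v \<le> (3 :: nat)"
proof
  show "t = 4 * (t div 4) + t mod 4" by simp
  show "t mod 4 \<le> 3" by simp
qed

locale facet_pairing3 = facet_pairing 3 G for G
begin

abbreviation L where "L \<equiv> link_complex G"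

lemma link_data:
  assumes s: "s < num_simplices G" and v: "v \<le> 3" and r: "r \<le> 2"
  defines "F \<equiv> (s, skip v r)" and "v' \<equiv> vmap G (s, skip v r) v" and "F' \<equiv> mate G (s, skip v r)"
  shows "F \<in> facets 3 G" "v \<in> facet_vertices 3 F" "v' \<in> facet_vertices 3 F'" "v' \<le> 3" "v' \<noteq> snd F'" "F' \<in> facets 3 G"
    "snd F' \<le> 3" "fst F' < num_simplices G" "vmap G F' v' = v" "mate G F' = F"
    "skip v' (unskip v' (snd F')) = snd F'"
    "mate L (4 * s + v, r) = (4 * fst F' + v', unskip v' (snd F'))"
    "vmap L (4 * s + v, r) w = unskip v' (vmap G F (skip v w))"
proof -
  show F: "F \<in> facets 3 G" using s r skip_le by (simp add: F_def facets_def)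
  show vF: "v \<in> facet_vertices 3 F" using v skip_neq[of v r] by (auto simp: facet_vertices_def F_def)
  show v': "v' \<in> facet_vertices 3 F'" using vmap_in[OF F vF] by (simp add: v'_def F'_def F_def)
  then show "v' \<le> 3" "v' \<noteq> snd F'" by (auto simp: facet_vertices_def)
  then show "skip v' (unskip v' (snd F')) = snd F'" using skip_unskip by simp
  show F': "F' \<in> facets 3 G" using mate_in[OF F] by (simp add: F'_def F_def)
  then show "snd F' \<le> 3" "fst F' < num_simplices G" by (auto simp: facets_def)
  show "vmap G F' v' = v" using vmap_inverse[OF F vF] by (simp add: v'_def F'_def F_def)
  show "mate G F' = F" using mate_mate[OF F] by (simp add: F'_def F_def)
  show "mate L (4 * s + v, r) = (4 * fst F' + v', unskip v' (snd F'))"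
    using v by (simp add: link_mate_eq F'_def v'_def)
  show "vmap L (4 * s + v, r) w = unskip v' (vmap G F (skip v w))"
    using v by (simp add: link_vmap_eq F_def v'_def)
qed

text \<open>Side \<open>r\<close> of the triangle at \<open>v\<close> lies in the facet opposite
  \<open>skip v r\<close>, so the sides inherit their pairing from the facets of the
  tetrahedra.\<close>

lemma link_face_pairing: "face_pairing 2 L"
  unfolding face_pairing_def
proof
  fix H assume H: "H \<in> facets 2 L"
  obtain t r where tr: "H = (t, r)" by fastforce
  obtain s v where t: "t = 4 * s + v" and v: "v \<le> 3" by (rule link_index)
  have s: "s < num_simplices G" and r: "r \<le> 2" using H link_facets_iff[OF v] by (simp_all add: tr t)
  define F where "F = (s, skip v r)"
  define v' where "v' = vmap G F v"
  define F' where "F' = mate G F"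
  note d = link_data[OF s v r, folded F_def, folded v'_def F'_def]
  define r' where "r' = unskip v' (snd F')"
  have m: "mate L H = (4 * fst F' + v', r')" using d(12) by (simp add: tr t r'_def)
  have r': "r' \<le> 2" unfolding r'_def using unskip_le[OF d(7,4)] d(5) by simp
  have skr': "skip v' r' = snd F'" using d(11) by (simp add: r'_def)
  have F'eq: "(fst F', skip v' r') = F'" using skr' by simp
  \<comment> \<open>The same facts for the paired side; they show that its vertex map is the
    inverse.\<close>
  note d' = link_data[OF d(8,4) r', unfolded F'eq d(9,10)]
  have in_L: "mate L H \<in> facets 2 L" unfolding m using link_facets_iff[OF d(4)] d(8) r' by simp
  have mm: "mate L (mate L H) = H"
    unfolding m d'(12) by (simp add: F_def tr t unskip_skip)
  have neq: "mate L H \<noteq> H"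
  proof
    assume "mate L H = H"
    then have e: "4 * fst F' + v' = 4 * s + v" "r' = r" unfolding m by (simp_all add: tr t)
    then have "fst F' = s" "v' = v" using v d(4) by presburger+
    then have "F' = F" using skr' e(2) by (simp add: F_def prod_eq_iff)
    then show False using mate_neq[OF d(1)] by (simp add: F'_def)
  qed
  have fwd: "vmap L H w \<in> facet_vertices 2 (mate L H) \<and> vmap L (mate L H) (vmap L H w) = w"
    if w: "w \<in> facet_vertices 2 H" for w
  proof -
    have w2: "w \<le> 2" "w \<noteq> r" using w by (auto simp: facet_vertices_def tr)
    have u: "skip v w \<in> facet_vertices 3 F"
      using skip_le[OF w2(1), of v] w2(2) unskip_skip[of v] by (auto simp: facet_vertices_def F_def) (metis unskip_skip)
    have u': "vmap G F (skip v w) \<in> facet_vertices 3 F'" using vmap_in[OF d(1) u] by (simp add: F'_def)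
    have un: "vmap G F (skip v w) \<noteq> v'"
    proof
      assume "vmap G F (skip v w) = v'"
      then have "skip v w = v" using vmap_inverse[OF d(1) u] d(9) by (simp add: F'_def)
      then show False using skip_neq by blast
    qed
    have vm: "vmap L H w = unskip v' (vmap G F (skip v w))" using d(13) by (simp add: tr t)
    have "unskip v' (vmap G F (skip v w)) \<noteq> r'"
      unfolding r'_def using unskip_eq_iff[OF un, of "snd F'"] u' d(5) by (auto simp: facet_vertices_def)
    moreover have "unskip v' (vmap G F (skip v w)) \<le> 2"
      using u' un d(4) by (intro unskip_le) (auto simp: facet_vertices_def)
    ultimately have A: "vmap L H w \<in> facet_vertices 2 (mate L H)" unfolding vm m by (simp add: facet_vertices_def)
    have "vmap L (mate L H) (vmap L H w) = unskip v (vmap G F' (skip v' (unskip v' (vmap G F (skip v w)))))"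
      unfolding m vm d'(13) ..
    also have "\<dots> = unskip v (vmap G F' (vmap G F (skip v w)))" using skip_unskip[OF un] by simp
    also have "\<dots> = w" using vmap_inverse[OF d(1) u] unskip_skip by (simp add: F'_def)
    finally show ?thesis using A by blast
  qed
  have bwd: "vmap L (mate L H) w \<in> facet_vertices 2 H \<and> vmap L H (vmap L (mate L H) w) = w"
    if w: "w \<in> facet_vertices 2 (mate L H)" for w
  proof -
    have w2: "w \<le> 2" "w \<noteq> r'" using w unfolding m facet_vertices_def by auto
    have u: "skip v' w \<in> facet_vertices 3 F'"
      using skip_le[OF w2(1), of v'] w2(2) skr' by (auto simp: facet_vertices_def) (metis unskip_skip)
    have u': "vmap G F' (skip v' w) \<in> facet_vertices 3 F" using vmap_in[OF d(6) u] d(10) by simp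
    have un: "vmap G F' (skip v' w) \<noteq> v"
    proof
      assume "vmap G F' (skip v' w) = v"
      then have "skip v' w = v'" using vmap_inverse[OF d(6) u] d(10) by (simp add: v'_def)
      then show False using skip_neq by blast
    qed
    have vm: "vmap L (mate L H) w = unskip v (vmap G F' (skip v' w))" unfolding m d'(13) ..
    have "unskip v (vmap G F' (skip v' w)) \<noteq> r"
    proof
      assume "unskip v (vmap G F' (skip v' w)) = r"
      then have "vmap G F' (skip v' w) = skip v r" using skip_unskip[OF un] by metis
      then show False using u' by (simp add: facet_vertices_def F_def)
    qed
    moreover have "unskip v (vmap G F' (skip v' w)) \<le> 2"
      using u' un v by (intro unskip_le) (auto simp: facet_vertices_def)
    ultimately have A: "vmap L (mate L H) w \<in> facet_vertices 2 H" unfolding vm by (simp add: facet_vertices_def tr)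
    have "vmap L H (vmap L (mate L H) w) = unskip v' (vmap G F (skip v (unskip v (vmap G F' (skip v' w)))))"
      unfolding vm using d(13) by (simp add: tr t)
    also have "\<dots> = unskip v' (vmap G F (vmap G F' (skip v' w)))" using skip_unskip[OF un] by simp
    also have "\<dots> = w" using vmap_inverse[OF d(6) u] d(10) unskip_skip by simp
    finally show ?thesis using A by blast
  qed
  have "bij_betw (vmap L H) (facet_vertices 2 H) (facet_vertices 2 (mate L H))"
    by (rule bij_betwI[where g = "vmap L (mate L H)"]) (use fwd bwd in \<open>auto simp del: link_complex_simps\<close>)
  then show "mate L H \<in> facets 2 L \<and> mate L H \<noteq> H \<and> mate L (mate L H) = H \<and>
      bij_betw (vmap L H) (facet_vertices 2 H) (facet_vertices 2 (mate L H)) \<and>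
      (\<forall>v\<in>facet_vertices 2 H. vmap L (mate L H) (vmap L H v) = v)"
    using in_L mm neq fwd by blast
qed

sublocale link: facet_pairing 2 L
  by unfold_locales (rule link_face_pairing)

text \<open>Inclusion of the cut triangles commutes with the gluings, so the inclusion passes to the
  quotients.\<close>

lemma cut_point_affine_extension:
  assumes s: "s < num_simplices G" and v: "v \<le> 3" and r: "r \<le> 2" and y: "y \<in> standard_simplex 2" "y r = 0"
  shows "cut_point (vmap G (s, skip v r) v) (affine_extension 2 L (4 * s + v, r) y) =
    affine_extension 3 G (s, skip v r) (cut_point v y)"
proof
  define F where "F = (s, skip v r)"
  define v' where "v' = vmap G F v"
  define F' where "F' = mate G F"
  note d = link_data[OF s v r, folded F_def, folded v'_def F'_def]
  define r' where "r' = unskip v' (snd F')"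
  define H where "H = (4 * s + v, r)"
  have H: "H \<in> facets 2 L" using link_facets_iff[OF v] s r by (simp add: H_def)
  have m: "mate L H = (4 * fst F' + v', r')" using d(12) by (simp add: H_def r'_def)
  have r': "r' \<le> 2" unfolding r'_def using unskip_le[OF d(7,4)] d(5) by simp
  have skr': "skip v' r' = snd F'" using d(11) by (simp add: r'_def)
  have F'eq: "(fst F', skip v' r') = F'" using skr' by simp
  note d' = link_data[OF d(8,4) r', unfolded F'eq d(9,10)]
  have out: "2 < w \<Longrightarrow> affine_extension 2 L H y w = 0" for w
    by (simp add: link.affine_extension_eq[OF H] facet_vertices_def)
  fix n
  have "cut_point v' (affine_extension 2 L H y) n = affine_extension 3 G F (cut_point v y) n"
  proof (cases "n \<le> 3 \<and> n \<noteq> v' \<and> n \<noteq> snd F'")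
    case True
    then have n: "n \<in> facet_vertices 3 F'" "n \<noteq> v'" by (auto simp: facet_vertices_def)
    have nv: "vmap G F' n \<noteq> v"
    proof
      assume "vmap G F' n = v"
      then have "n = v'" using vmap_inverse[OF d(6) n(1)] d(10) by (simp add: v'_def)
      then show False using n by simp
    qed
    have n3: "vmap G F' n \<le> 3" using vmap_in[OF d(6) n(1)] by (auto simp: facet_vertices_def)
    have "unskip v' n \<noteq> r'" unfolding r'_def using unskip_eq_iff[OF n(2), of "snd F'"] True d(5) by auto
    moreover have "unskip v' n \<le> 2" using True d(4) unskip_le by simp
    ultimately have w: "unskip v' n \<in> facet_vertices 2 (mate L H)" unfolding m facet_vertices_def by simp
    have "affine_extension 2 L H y (unskip v' n) = y (vmap L (mate L H) (unskip v' n))"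
      using w by (simp add: link.affine_extension_eq[OF H] del: link_complex_simps)
    also have "vmap L (mate L H) (unskip v' n) = unskip v (vmap G F' n)"
      unfolding m d'(13) using skip_unskip[OF n(2)] by simp
    finally have "cut_point v' (affine_extension 2 L H y) n = y (unskip v (vmap G F' n)) / 4"
      using True by (simp add: cut_point_def)
    also have "\<dots> = cut_point v y (vmap G F' n)" using nv n3 by (simp add: cut_point_def)
    also have "\<dots> = affine_extension 3 G F (cut_point v y) n"
      using n(1) by (simp add: affine_extension_eq[OF d(1)] F'_def)
    finally show ?thesis .
  next
    case False
    then consider "n = v'" | "n = snd F'" "n \<noteq> v'" | "3 < n" by linarith
    then show ?thesis
    proof cases
      case 1
      then show ?thesis
        using affine_extension_vmap[OF d(1,2), of "cut_point v y"] by (simp add: cut_point_def v'_def)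
    next
      case 2
      have "affine_extension 2 L H y r' = 0" using link.affine_extension_mate[OF H, of y] unfolding m by simp
      then show ?thesis
        using 2 d(7) affine_extension_mate[OF d(1), of "cut_point v y"] by (simp add: cut_point_def r'_def F'_def)
    next
      case 3
      then show ?thesis using d(4) by (simp add: cut_point_def affine_extension_eq[OF d(1)] facet_vertices_def)
    qed
  qed
  then show "cut_point (vmap G (s, skip v r) v) (affine_extension 2 L (4 * s + v, r) y) n =
      affine_extension 3 G (s, skip v r) (cut_point v y) n"
    by (simp add: v'_def F_def H_def)
qed

lemma cut_point_class_respects:
  assumes c: "(t', y') \<in> point_class 2 L (t, y)"
  shows "point_class 3 G (t' div 4, cut_point (t' mod 4) y') = point_class 3 G (t div 4, cut_point (t mod 4) y)"
proof -
  have "point_class 3 G (fst (t', y') div 4, cut_point (fst (t', y') mod 4) (snd (t', y'))) =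
      point_class 3 G (t div 4, cut_point (t mod 4) y)"
    using c
  proof (induction rule: link.point_class_induct)
    case (glue u r z)
    obtain s v where u: "u = 4 * s + v" and v: "v \<le> 3" by (rule link_index)
    have sr: "s < num_simplices G" "r \<le> 2" using glue(1) link_facets_iff[OF v] by (simp_all add: u)
    note d = link_data[OF sr(1) v sr(2)]
    have uu: "u div 4 = s" "u mod 4 = v" using u v by auto
    have mm: "fst (mate L (u, r)) div 4 = fst (mate G (s, skip v r))" "fst (mate L (u, r)) mod 4 = vmap G (s, skip v r) v"
      using d(4) unfolding u d(12) by auto
    have z: "cut_point v z \<in> standard_simplex 3" by (rule cut_point_in_simplex(1)[OF glue(2) v])
    have zf: "cut_point v z (skip v r) = 0"
      using glue(3) skip_neq[of v r] skip_le[OF sr(2), of v] by (simp add: cut_point_def unskip_skip)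
    have "point_class 3 G (fst (mate G (s, skip v r)), affine_extension 3 G (s, skip v r) (cut_point v z)) =
        point_class 3 G (s, cut_point v z)"
      by (rule point_class_gluing[OF d(1) z zf])
    then have "point_class 3 G (fst (mate L (u, r)) div 4,
        cut_point (fst (mate L (u, r)) mod 4) (affine_extension 2 L (u, r) z)) = point_class 3 G (s, cut_point v z)"
      unfolding mm unfolding u cut_point_affine_extension[OF sr(1) v sr(2) glue(2,3)] .
    then show ?case using glue(4) unfolding fst_conv snd_conv uu by simp
  qed simp
  then show ?thesis by simp
qed

text \<open>The converse of \<open>cut_point_class_respects\<close>: along a gluing of tetrahedra
  the vertex of weight 3/4 is carried along, and the cut triangles are glued accordingly. This
  yields injectivity of the map from the link to the boundary.\<close>

lemma cut_coords_class_respects: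
  assumes s: "s < num_simplices G" and v: "v \<le> 3" and y: "y \<in> standard_simplex 2"
    and c: "(s', x') \<in> point_class 3 G (s, cut_point v y)"
  obtains v' where "v' \<le> 3" "x' v' = 3/4" "point_class 2 L (4 * s' + v', cut_coords v' x') = point_class 2 L (4 * s + v, y)"
proof -
  have "\<exists>v'\<le>3. snd (s', x') v' = 3/4 \<and>
      point_class 2 L (4 * fst (s', x') + v', cut_coords v' (snd (s', x'))) = point_class 2 L (4 * s + v, y)"
    using c
  proof (induction rule: point_class_induct)
    case start
    have "snd (s, cut_point v y) v = 3/4" using cut_point_in_simplex(3)[OF y v] by simp
    moreover have "cut_coords v (snd (s, cut_point v y)) = y" using cut_coords_cut_point[OF y v] by simp
    ultimately show ?case using v by (intro exI[of _ v]) simp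
  next
    case (glue t f x)
    obtain u where u: "u \<le> 3" "x u = 3/4"
      and IH: "point_class 2 L (4 * t + u, cut_coords u x) = point_class 2 L (4 * s + v, y)" using glue(4) by auto
    have t: "t < num_simplices G" "f \<le> 3" using glue(1) by (auto simp: facets_def)
    have fu: "f \<noteq> u" using u glue(3) by auto
    define r where "r = unskip u f"
    have r: "r \<le> 2" "skip u r = f" using unskip_le[OF t(2) u(1) fu] skip_unskip[OF fu] by (simp_all add: r_def)
    define z where "z = cut_coords u x"
    have z: "z \<in> standard_simplex 2" "cut_point u z = x"
      using cut_coords_in_simplex[OF glue(2) u] by (simp_all add: z_def)
    have zr: "z r = 0" using glue(3) r by (simp add: z_def cut_coords_def)
    note d = link_data[OF t(1) u(1) r(1), unfolded r(2)]
    have H: "(4 * t + u, r) \<in> facets 2 L" using link_facets_iff[OF u(1)] t r by simp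
    let ?v = "vmap G (t, f) u" and ?x = "affine_extension 3 G (t, f) x" and ?z = "affine_extension 2 L (4 * t + u, r) z"
    have z': "?z \<in> standard_simplex 2" using link.affine_extension_in_simplex[OF H z(1)] zr by simp
    have "cut_point ?v ?z = ?x"
      using cut_point_affine_extension[OF t(1) u(1) r(1) z(1) zr] unfolding r(2) z(2) .
    then have cz: "cut_coords ?v ?x = ?z" using cut_coords_cut_point[OF z' d(4)] by simp
    have "point_class 2 L (fst (mate L (4 * t + u, r)), ?z) = point_class 2 L (4 * t + u, z)"
      by (rule link.point_class_gluing[OF H z(1) zr])
    then have "point_class 2 L (4 * fst (mate G (t, f)) + ?v, cut_coords ?v ?x) = point_class 2 L (4 * s + v, y)"
      unfolding cz d(12) fst_conv using IH by (simp add: z_def)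
    moreover have "?x ?v = 3/4" using affine_extension_vmap[OF d(1,2), of x] u(2) by simp
    ultimately show ?case using d(4) unfolding fst_conv snd_conv by blast
  qed
  then show thesis using that by auto
qed

end

context one_vertex_complex
begin

sublocale facet_pairing3 G ..

lemma boundary_homeomorphic_link: "complex_space 2 L homeomorphic_space subtopology M (manifold_boundary 3 M)"
proof -
  define k where "k = (\<lambda>p. point_class 3 G (fst p div 4, cut_point (fst p mod 4) (snd p)))"
  have idx: "t div 4 < num_simplices G" "t mod 4 \<le> 3" if "t < 4 * num_simplices G" for t
    using that by auto
  have k: "continuous_map (top_of_set (simplex_points 2 L)) C k"
  proof -
    have sub: "(fst p div 4, cut_point (fst p mod 4) (snd p)) \<in> simplex_points 3 G" if "p \<in> simplex_points 2 L" for p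
      using that idx cut_point_in_simplex(1) by (auto simp: simplex_points_def)
    have "continuous_on (simplex_points 2 L) (\<lambda>p. (fst p div 4, cut_point (fst p mod 4) (snd p)))"
    proof (rule continuous_on_Pair)
      have c: "continuous_on A g" for A and g :: "nat \<Rightarrow> 'b :: topological_space"
        by (simp add: continuous_on_def at_discrete)
      show "continuous_on (simplex_points 2 L) (\<lambda>p. fst p div 4)"
        by (rule continuous_on_compose2[OF c[of UNIV "\<lambda>t. t div 4"] continuous_on_fst[OF continuous_on_id]]) simp
      have "continuous_on (simplex_points 2 L) (\<lambda>p. cut_point (fst p mod 4) (snd p) n)" for n
      proof -
        \<comment> \<open>The vertex depends on the discrete index of the triangle. Writing the map
          as a sum with indicator functions of that index reduces continuity to a fixed
          vertex.\<close>
        have "(\<lambda>p :: nat \<times> (nat \<Rightarrow> real). cut_point (fst p mod 4) (snd p) n) =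
          (\<lambda>p. \<Sum>v\<le>3. (if fst p mod 4 = v then 1 else 0) * cut_point v (snd p) n)"
        proof
          fix p :: "nat \<times> (nat \<Rightarrow> real)"
          have "fst p mod 4 = 0 \<or> fst p mod 4 = 1 \<or> fst p mod 4 = 2 \<or> fst p mod 4 = 3" by linarith
          then show "cut_point (fst p mod 4) (snd p) n = (\<Sum>v\<le>3. (if fst p mod 4 = v then 1 else 0) * cut_point v (snd p) n)"
            unfolding sum_atMost_3 by (elim disjE) simp_all
        qed
        moreover have "continuous_on (simplex_points 2 L) (\<lambda>p. cut_point v (snd p) n)" for v
          by (rule continuous_on_product_then_coordinatewise)
            (rule continuous_on_compose2[OF continuous_on_cut_point[of UNIV] continuous_on_snd[OF continuous_on_id]], simp)
        moreover have "continuous_on (simplex_points 2 L) (\<lambda>p. if fst p mod 4 = v then 1 else 0 :: real)" for v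
          by (rule continuous_on_compose2[OF c[of UNIV "\<lambda>t. if t mod 4 = v then 1 else 0 :: real"] continuous_on_fst[OF continuous_on_id]]) simp
        ultimately show ?thesis by (simp only:) (intro continuous_on_sum continuous_on_mult)
      qed
      then show "continuous_on (simplex_points 2 L) (\<lambda>p. cut_point (fst p mod 4) (snd p))"
        by (intro continuous_on_coordinatewise_then_product)
    qed
    then have "continuous_map (top_of_set (simplex_points 2 L)) (top_of_set (simplex_points 3 G))
        (\<lambda>p. (fst p div 4, cut_point (fst p mod 4) (snd p)))"
      using sub by auto
    then have "continuous_map (top_of_set (simplex_points 2 L)) C
        (point_class 3 G \<circ> (\<lambda>p. (fst p div 4, cut_point (fst p mod 4) (snd p))))"
      by (rule continuous_map_compose) (rule quotient_imp_continuous_map[OF quotient_map_point_class])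
    then show ?thesis by (simp add: k_def o_def)
  qed
  have resp: "k p = k p'" if p: "p \<in> topspace (top_of_set (simplex_points 2 L))" "p' \<in> topspace (top_of_set (simplex_points 2 L))"
    "point_class 2 L p = point_class 2 L p'" for p p'
  proof -
    have "p \<in> point_class 2 L p'" using point_class_self[of p 2 L] p by simp
    then show ?thesis
      using cut_point_class_respects[of "fst p" "snd p" "fst p'" "snd p'"] by (simp add: k_def)
  qed
  obtain h where h: "continuous_map (complex_space 2 L) C h"
    "h ` topspace (complex_space 2 L) = k ` topspace (top_of_set (simplex_points 2 L))"
    "\<And>p. p \<in> topspace (top_of_set (simplex_points 2 L)) \<Longrightarrow> h (point_class 2 L p) = k p"
    using quotient_map_lift_exists[OF quotient_map_point_class k resp] by blast
  have hk: "h (point_class 2 L (4 * s + v, y)) = point_class 3 G (s, cut_point v y)"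
    if "s < num_simplices G" "v \<le> 3" "y \<in> standard_simplex 2" for s v y
    using h(3)[of "(4 * s + v, y)"] that by (simp add: simplex_points_def k_def)
  have pts: "\<exists>s v y. q = point_class 2 L (4 * s + v, y) \<and> s < num_simplices G \<and> v \<le> 3 \<and> y \<in> standard_simplex 2"
    if q: "q \<in> topspace (complex_space 2 L)" for q
  proof -
    obtain t y where ty: "q = point_class 2 L (t, y)" "t < 4 * num_simplices G" "y \<in> standard_simplex 2"
      using q by (auto simp: topspace_complex_space simplex_points_def)
    obtain s v where t: "t = 4 * s + v" and v: "v \<le> 3" by (rule link_index)
    have "s < num_simplices G" using ty(2) t by simp
    then show ?thesis using ty(1,3) v unfolding t by blast
  qed
  have tB: "topspace (subtopology C B) = B" using B_subset_C by auto
  have im: "h ` topspace (complex_space 2 L) = B"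
  proof
    show "h ` topspace (complex_space 2 L) \<subseteq> B"
      using pts hk cut_point_class_in_B by fastforce
    show "B \<subseteq> h ` topspace (complex_space 2 L)"
    proof
      fix p assume "p \<in> B"
      then obtain s v y where *: "s < num_simplices G" "v \<le> 3" "y \<in> standard_simplex 2" "p = point_class 3 G (s, cut_point v y)"
        unfolding B_eq cut_triangle_def by auto
      have "(4 * s + v, y) \<in> simplex_points 2 L" using * by (simp add: simplex_points_def)
      then show "p \<in> h ` topspace (complex_space 2 L)"
        using hk[OF *(1-3)] *(4) by (auto simp: topspace_complex_space image_iff intro!: bexI[of _ "(4 * s + v, y)"])
    qed
  qed
  have "homeomorphic_map (complex_space 2 L) (subtopology C B) h"
  proof (rule continuous_imp_homeomorphic_map)
    show "continuous_map (complex_space 2 L) (subtopology C B) h"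
      using h(1) im by (auto simp: continuous_map_in_subtopology)
    show "compact_space (complex_space 2 L)" by (rule compact_complex_space)
    show "Hausdorff_space (subtopology C B)" by (intro Hausdorff_space_subtopology Hausdorff_complex_space)
    show "h ` topspace (complex_space 2 L) = topspace (subtopology C B)" using im tB by simp
    show "inj_on h (topspace (complex_space 2 L))"
    proof (rule inj_onI)
      fix q q' assume "q \<in> topspace (complex_space 2 L)" "q' \<in> topspace (complex_space 2 L)" and eq: "h q = h q'"
      then obtain s v y s' v' y' where q: "q = point_class 2 L (4 * s + v, y)" "s < num_simplices G" "v \<le> 3" "y \<in> standard_simplex 2"
        and q': "q' = point_class 2 L (4 * s' + v', y')" "s' < num_simplices G" "v' \<le> 3" "y' \<in> standard_simplex 2"
        using pts by metis
      have "(s', cut_point v' y') \<in> point_class 3 G (s', cut_point v' y')"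
        by (rule point_class_self[OF cut_point_in_points[OF q'(2-4)]])
      then have "(s', cut_point v' y') \<in> point_class 3 G (s, cut_point v y)"
        using eq hk[OF q(2-4)] hk[OF q'(2-4)] q(1) q'(1) by simp
      then obtain u where u: "u \<le> 3" "cut_point v' y' u = 3/4"
        "point_class 2 L (4 * s' + u, cut_coords u (cut_point v' y')) = point_class 2 L (4 * s + v, y)"
        by (rule cut_coords_class_respects[OF q(2-4)])
      have "u = v'"
      proof (rule ccontr)
        assume "u \<noteq> v'"
        then show False
          using simplex_pair_le[OF cut_point_in_simplex(1)[OF q'(4,3)], of u v'] u(2) cut_point_in_simplex(3)[OF q'(4,3)] by simp
      qed
      then show "q = q'" using u(3) cut_coords_cut_point[OF q'(4,3)] q(1) q'(1) by simp
    qed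
  qed
  then show ?thesis
    unfolding manifold_boundary_M subtopology_M_B by (rule homeomorphic_map_imp_homeomorphic_space)
qed

end

section \<open>Counting quotient faces\<close>

definition face_gluing :: "nat \<Rightarrow> pairing \<Rightarrow> (nat \<times> nat set) rel" where
  "face_gluing d G = {((s, A), (fst (mate G (s, i)), vmap G (s, i) ` A)) | s i A.
     (s, i) \<in> facets d G \<and> A \<subseteq> facet_vertices d (s, i)}"

lemma quotient_faces_eq: "quotient_faces d G k = local_faces d G k // equivalence_on (local_faces d G k) (face_gluing d G)"
  by (simp add: quotient_faces_def face_gluing_def)

context facet_pairing
begin

lemma sym_face_gluing: "sym (face_gluing d G)"
proof (rule symI)
  fix p q assume "(p, q) \<in> face_gluing d G"
  then obtain s i A where *: "(s, i) \<in> facets d G" "A \<subseteq> facet_vertices d (s, i)"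
    and p: "p = (s, A)" and q: "q = (fst (mate G (s, i)), vmap G (s, i) ` A)"
    by (auto simp: face_gluing_def)
  obtain t j where m: "mate G (s, i) = (t, j)" by fastforce
  have "(t, j) \<in> facets d G" using mate_in[OF *(1)] m by simp
  moreover have "vmap G (s, i) ` A \<subseteq> facet_vertices d (t, j)" using vmap_in[OF *(1)] *(2) m by auto
  ultimately have "((t, vmap G (s, i) ` A), (fst (mate G (t, j)), vmap G (t, j) ` vmap G (s, i) ` A)) \<in> face_gluing d G"
    by (auto simp: face_gluing_def)
  moreover have "vmap G (t, j) ` vmap G (s, i) ` A = A"
    using vmap_inverse[OF *(1)] *(2) m by (force simp: image_image)
  ultimately show "(q, p) \<in> face_gluing d G" using mate_mate[OF *(1)] m p q by simp
qed

lemma quotient_faces_by_label: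
  assumes inv: "\<And>s i A. (s, i) \<in> facets d G \<Longrightarrow> A \<subseteq> facet_vertices d (s, i) \<Longrightarrow> card A = Suc k \<Longrightarrow>
      c (fst (mate G (s, i)), vmap G (s, i) ` A) = c (s, A)"
    and conn: "\<And>x y. x \<in> local_faces d G k \<Longrightarrow> y \<in> local_faces d G k \<Longrightarrow> c x = c y \<Longrightarrow> (x, y) \<in> (face_gluing d G)\<^sup>*"
  shows "quotient_faces d G k = (\<lambda>l. {x \<in> local_faces d G k. c x = l}) ` c ` local_faces d G k"
    and "card (quotient_faces d G k) = card (c ` local_faces d G k)"
proof -
  have sym: "face_gluing d G \<union> (face_gluing d G)\<inverse> = face_gluing d G"
    using sym_face_gluing by (auto simp: sym_conv_converse_eq)
  have step: "y \<in> local_faces d G k \<and> c y = c x" if x: "x \<in> local_faces d G k" and g: "(x, y) \<in> face_gluing d G" for x y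
  proof -
    obtain s i A where *: "(s, i) \<in> facets d G" "A \<subseteq> facet_vertices d (s, i)" "x = (s, A)"
      "y = (fst (mate G (s, i)), vmap G (s, i) ` A)"
      using g by (auto simp: face_gluing_def)
    have A: "card A = Suc k" using x * by (simp add: local_faces_def)
    have "inj_on (vmap G (s, i)) A" using bij_betw_imp_inj_on[OF vmap_bij[OF *(1)]] *(2) by (rule inj_on_subset)
    then have "card (vmap G (s, i) ` A) = Suc k" using A by (simp add: card_image)
    moreover have "vmap G (s, i) ` A \<subseteq> {..d}" using vmap_in[OF *(1)] *(2) by (auto simp: facet_vertices_def)
    moreover have "fst (mate G (s, i)) < num_simplices G" using mate_in[OF *(1)] by (auto simp: facets_def)
    ultimately show ?thesis using inv[OF *(1,2) A] * by (simp add: local_faces_def)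
  qed
  show "quotient_faces d G k = (\<lambda>l. {x \<in> local_faces d G k. c x = l}) ` c ` local_faces d G k"
    unfolding quotient_faces_eq
    by (rule quotient_equivalence_on_by_label(1)) (use step conn in \<open>simp_all add: sym\<close>)
  show "card (quotient_faces d G k) = card (c ` local_faces d G k)"
    unfolding quotient_faces_eq
    by (rule quotient_equivalence_on_by_label(2)) (use step conn in \<open>simp_all add: sym\<close>)
qed

text \<open>The full vertex set lies in no facet, so the simplices themselves are not identified
  with each other.\<close>

lemma card_quotient_faces_top: "card (quotient_faces d G d) = num_simplices G"
proof -
  have "card (quotient_faces d G d) = card ((\<lambda>x. x) ` local_faces d G d)"
  proof (rule quotient_faces_by_label(2))
    fix s i A assume *: "(s, i) \<in> facets d G" "A \<subseteq> facet_vertices d (s, i)" "card A = Suc d"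
    have "card A \<le> card (facet_vertices d (s, i))" using *(2) by (intro card_mono) (auto simp: facet_vertices_def)
    also have "\<dots> = d" using *(1) by (simp add: facet_vertices_def facets_def)
    finally show "(fst (mate G (s, i)), vmap G (s, i) ` A) = (s, A)" using *(3) by simp
  qed auto
  also have "local_faces d G d = {..<num_simplices G} \<times> {{..d}}"
    using card_subset_eq[of "{..d}"] by (auto simp: local_faces_def)
  finally show ?thesis by (simp add: card_cartesian_product)
qed

text \<open>The label of a facet is the unordered pair of the facet and its mate. These pairs have
  two elements each and partition the set of all facets.\<close>

lemma card_quotient_faces_facets:
  assumes d: "0 < d"
  shows "2 * card (quotient_faces d G (d - 1)) = num_simplices G * Suc d"
proof -
  define miss where "miss = (\<lambda>A. the_elem ({..d} - A))"
  define c where "c = (\<lambda>(s, A). {(s, miss A), mate G (s, miss A)})"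
  have local: "\<exists>i\<le>d. A = {..d} - {i}" if A: "A \<subseteq> {..d}" "card A = d" for A
  proof -
    have "card ({..d} - A) = 1" using A by (subst card_Diff_subset) (auto intro: finite_subset)
    then obtain i where "{..d} - A = {i}" by (auto simp: card_1_singleton_iff)
    then have "A = {..d} - {i}" "i \<le> d" using A by auto
    then show ?thesis by blast
  qed
  have miss: "miss ({..d} - {i}) = i" if "i \<le> d" for i
  proof -
    have "{..d} - ({..d} - {i}) = {i}" using that by auto
    then show ?thesis by (simp add: miss_def)
  qed
  have fv: "facet_vertices d F = {..d} - {snd F}" for F by (simp add: facet_vertices_def)
  have loc: "local_faces d G (d - 1) = (\<lambda>(s, i). (s, {..d} - {i})) ` facets d G"
  proof
    show "local_faces d G (d - 1) \<subseteq> (\<lambda>(s, i). (s, {..d} - {i})) ` facets d G"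
    proof
      fix p assume "p \<in> local_faces d G (d - 1)"
      then obtain s A where p: "p = (s, A)" "s < num_simplices G" "A \<subseteq> {..d}" "card A = d"
        using d by (auto simp: local_faces_def)
      obtain i where i: "i \<le> d" "A = {..d} - {i}" using local[OF p(3,4)] by blast
      show "p \<in> (\<lambda>(s, i). (s, {..d} - {i})) ` facets d G"
        by (rule image_eqI[of _ _ "(s, i)"]) (use p i in \<open>simp_all add: facets_def\<close>)
    qed
    show "(\<lambda>(s, i). (s, {..d} - {i})) ` facets d G \<subseteq> local_faces d G (d - 1)"
      using d by (auto simp: local_faces_def facets_def)
  qed
  have cF: "c (s, {..d} - {i}) = {(s, i), mate G (s, i)}" if "i \<le> d" for s i
    using miss[OF that] by (simp add: c_def)
  have glue: "((s, {..d} - {i}), (fst (mate G (s, i)), {..d} - {snd (mate G (s, i))})) \<in> face_gluing d G"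
    if F: "(s, i) \<in> facets d G" for s i
  proof -
    have "vmap G (s, i) ` ({..d} - {i}) = {..d} - {snd (mate G (s, i))}"
      using bij_betw_imp_surj_on[OF vmap_bij[OF F]] by (simp add: fv)
    moreover have "((s, {..d} - {i}), (fst (mate G (s, i)), vmap G (s, i) ` ({..d} - {i}))) \<in> face_gluing d G"
      unfolding face_gluing_def mem_Collect_eq
      by (rule exI[of _ s], rule exI[of _ i], rule exI[of _ "{..d} - {i}"]) (use F fv in simp)
    ultimately show ?thesis by simp
  qed
  have "card (quotient_faces d G (d - 1)) = card (c ` local_faces d G (d - 1))"
  proof (rule quotient_faces_by_label(2))
    fix s i A assume *: "(s, i) \<in> facets d G" "A \<subseteq> facet_vertices d (s, i)" "card A = Suc (d - 1)"
    have "card (facet_vertices d (s, i)) = card A" using * d by (simp add: facet_vertices_def facets_def)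
    then have A: "A = {..d} - {i}" using card_subset_eq[OF _ *(2)] by (simp add: facet_vertices_def)
    obtain t j where m: "mate G (s, i) = (t, j)" by fastforce
    have "vmap G (s, i) ` A = {..d} - {j}"
      using bij_betw_imp_surj_on[OF vmap_bij[OF *(1)]] A m by (simp add: fv)
    moreover have "j \<le> d" "i \<le> d" using mate_in[OF *(1)] m *(1) by (auto simp: facets_def)
    ultimately show "c (fst (mate G (s, i)), vmap G (s, i) ` A) = c (s, A)"
      using mate_mate[OF *(1)] m A cF by auto
  next
    fix x y assume "x \<in> local_faces d G (d - 1)" "y \<in> local_faces d G (d - 1)" and eq: "c x = c y"
    then obtain s i t j where x: "x = (s, {..d} - {i})" "(s, i) \<in> facets d G" and y: "y = (t, {..d} - {j})" "(t, j) \<in> facets d G"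
      unfolding loc by auto
    have "i \<le> d" "j \<le> d" using x y by (auto simp: facets_def)
    then have "{(s, i), mate G (s, i)} = {(t, j), mate G (t, j)}" using eq cF x(1) y(1) by simp
    then have "(t, j) = (s, i) \<or> (t, j) = mate G (s, i)" by blast
    then show "(x, y) \<in> (face_gluing d G)\<^sup>*"
    proof
      assume "(t, j) = mate G (s, i)"
      then have "(x, y) \<in> face_gluing d G" using glue[OF x(2)] x(1) y(1) by (metis fst_conv snd_conv)
      then show ?thesis by blast
    qed (use x y in auto)
  qed
  also have "c ` local_faces d G (d - 1) = (\<lambda>F. {F, mate G F}) ` facets d G"
    unfolding loc image_image by (rule image_cong) (auto simp: cF facets_def)
  finally have card: "card (quotient_faces d G (d - 1)) = card ((\<lambda>F. {F, mate G F}) ` facets d G)" .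
  have fin: "finite (facets d G)" by (simp add: facets_def)
  have U: "\<Union>((\<lambda>F. {F, mate G F}) ` facets d G) = facets d G" using mate_in by auto
  have "2 * card ((\<lambda>F. {F, mate G F}) ` facets d G) = card (\<Union>((\<lambda>F. {F, mate G F}) ` facets d G))"
  proof (rule card_partition)
    show "finite ((\<lambda>F. {F, mate G F}) ` facets d G)" using fin by simp
    show "finite (\<Union>((\<lambda>F. {F, mate G F}) ` facets d G))" unfolding U by (rule fin)
    show "card e = 2" if e: "e \<in> (\<lambda>F. {F, mate G F}) ` facets d G" for e
    proof -
      obtain F where "F \<in> facets d G" "e = {F, mate G F}" using e by blast
      then show ?thesis using mate_neq[of F] by (simp add: card_insert_if)
    qed
    fix e e' assume "e \<in> (\<lambda>F. {F, mate G F}) ` facets d G" "e' \<in> (\<lambda>F. {F, mate G F}) ` facets d G" "e \<noteq> e'"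
    then obtain F F' where F: "F \<in> facets d G" "e = {F, mate G F}" "F' \<in> facets d G" "e' = {F', mate G F'}" "e \<noteq> e'"
      by blast
    note mm = mate_mate[OF F(1)] mate_mate[OF F(3)]
    have n1: "F' \<noteq> F" using F(2,4,5) by blast
    have n2: "F' \<noteq> mate G F" using F(2,4,5) mm(1) by (metis insert_commute)
    have n3: "mate G F' \<noteq> F" using n2 mm(2) by metis
    have n4: "mate G F' \<noteq> mate G F" using n1 mm by metis
    show "e \<inter> e' = {}" unfolding F(2,4) by (simp add: n1 n2 n3 n4 n1[symmetric] n2[symmetric] n3[symmetric] n4[symmetric])
  qed
  also have "\<dots> = num_simplices G * Suc d" unfolding U by (simp add: facets_def card_cartesian_product)
  finally show ?thesis using card by simp
qed

end

section \<open>Complexes glued by order-preserving maps\<close>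

text \<open>An injective self-map of a finite set has only cyclic orbits. \<open>N\<close> is the
  least period, so the listing of the orbit has no repetition.\<close>

lemma funpow_return:
  assumes fin: "finite D" and into: "\<And>x. x \<in> D \<Longrightarrow> f x \<in> D" and inj: "inj_on f D" and x: "x \<in> D"
  obtains N where "0 < N" "(f ^^ N) x = x" "inj_on (\<lambda>\<kappa>. (f ^^ \<kappa>) x) {..<N}"
proof -
  have D: "(f ^^ \<kappa>) x \<in> D" for \<kappa> by (induction \<kappa>) (use x into in auto)
  have cancel: "(f ^^ (b - a)) x = x" if "a < b" "(f ^^ a) x = (f ^^ b) x" for a b
    using that
  proof (induction a arbitrary: b)
    case 0
    have "(f ^^ b) x = (f ^^ 0) x" by (rule 0(2)[symmetric])
    then show ?case by (simp only: diff_zero funpow_0)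
  next
    case (Suc a)
    obtain b' where b: "b = Suc b'" "a < b'" using Suc.prems(1) by (rule Suc_lessE) simp
    have "f ((f ^^ a) x) = f ((f ^^ b') x)" using Suc.prems(2) b(1) by simp
    then have "(f ^^ a) x = (f ^^ b') x" by (rule inj_onD[OF inj _ D D])
    then show ?case using Suc.IH[OF b(2)] b(1) by simp
  qed
  have "\<not> inj_on (\<lambda>\<kappa>. (f ^^ \<kappa>) x) UNIV"
  proof
    assume "inj_on (\<lambda>\<kappa>. (f ^^ \<kappa>) x) UNIV"
    moreover have "finite (range (\<lambda>\<kappa>. (f ^^ \<kappa>) x))" by (rule finite_subset[OF _ fin]) (use D in blast)
    ultimately show False using finite_imageD infinite_UNIV_nat by blast
  qed
  then obtain a b where "(f ^^ a) x = (f ^^ b) x" "a < b" unfolding inj_on_def by (metis linorder_neqE_nat)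
  then have ex: "0 < b - a \<and> (f ^^ (b - a)) x = x" using cancel by simp
  define N where "N = (LEAST N. 0 < N \<and> (f ^^ N) x = x)"
  have N: "0 < N \<and> (f ^^ N) x = x" unfolding N_def by (rule LeastI[of _ "b - a"]) (rule ex)
  have least: "N \<le> N'" if "0 < N'" "(f ^^ N') x = x" for N' unfolding N_def by (rule Least_le) (use that in simp)
  have "False" if "a < b" "b < N" "(f ^^ a) x = (f ^^ b) x" for a b
    using least[of "b - a"] cancel[OF that(1,3)] that by simp
  then have "inj_on (\<lambda>\<kappa>. (f ^^ \<kappa>) x) {..<N}" by (intro linorder_inj_onI') auto
  then show ?thesis using that N by blast
qed

text \<open>The increasing bijection from the vertices other than \<open>k\<close> to those other
  than \<open>3 - k\<close>.\<close>

definition slide :: "nat \<Rightarrow> nat \<Rightarrow> nat" where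
  "slide k v = skip (3 - k) (unskip k v)"

text \<open>Since \<open>k + (3 - k)\<close> is odd, extending \<open>slide k\<close> by sending
  \<open>k\<close> to \<open>3 - k\<close> gives an odd permutation; exchanging the last two entries
  restores an even order. So crossing facets around an edge keeps the sense of rotation.\<close>

lemma slide_dart:
  assumes "even_order i j k l"
  shows "even_order (slide k i) (slide k j) (slide k l) (3 - k)" "slide k i < slide k j \<longleftrightarrow> i < j"
  by (rule insertE[OF even_order_cases[OF assms]]; (elim insertE emptyE)?; simp add: slide_def skip_def unskip_def even_order_def third_def eval_nat_numeral)+

locale ordered_pairing = facet_pairing 3 G for G +
  assumes snd_mate: "F \<in> facets 3 G \<Longrightarrow> snd (mate G F) = 3 - snd F"
    and vmap_slide: "(s, k) \<in> facets 3 G \<Longrightarrow> v \<in> facet_vertices 3 (s, k) \<Longrightarrow> vmap G (s, k) v = slide k v"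
begin

definition darts :: "(nat \<times> nat \<times> nat) set" where
  "darts = {(s, i, j). s < num_simplices G \<and> i \<le> 3 \<and> j \<le> 3 \<and> i \<noteq> j}"

fun dart_step :: "nat \<times> nat \<times> nat \<Rightarrow> nat \<times> nat \<times> nat" where
  "dart_step (s, i, j) = (fst (mate G (s, third i j)), slide (third i j) i, slide (third i j) j)"

lemma dart_third:
  assumes "(s, i, j) \<in> darts"
  shows "even_order i j (third i j) (third j i)" "(s, third i j) \<in> facets 3 G"
    "i \<in> facet_vertices 3 (s, third i j)" "j \<in> facet_vertices 3 (s, third i j)" "third j i \<in> facet_vertices 3 (s, third i j)"
proof -
  show e: "even_order i j (third i j) (third j i)" using assms by (simp add: darts_def even_order_def)
  note v = even_order_distinct[OF e]
  have "third i j \<in> {..3}" "third j i \<in> {..3}" unfolding v(2) by simp_all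
  then show "(s, third i j) \<in> facets 3 G" "i \<in> facet_vertices 3 (s, third i j)" "j \<in> facet_vertices 3 (s, third i j)"
    "third j i \<in> facet_vertices 3 (s, third i j)"
    using assms v(1) by (auto simp: darts_def facets_def facet_vertices_def)
qed

lemma dart_step_cross:
  assumes "(s, i, j) \<in> darts" "dart_step (s, i, j) = (t, i', j')"
  shows "(t, i', j') \<in> darts" "mate G (s, third i j) = (t, third j' i')"
    "vmap G (s, third i j) i = i'" "vmap G (s, third i j) j = j'" "vmap G (s, third i j) (third j i) = third i' j'"
    "i' < j' \<longleftrightarrow> i < j"
proof -
  note d = dart_third[OF assms(1)]
  define k where "k = third i j"
  have eq: "t = fst (mate G (s, k))" "i' = slide k i" "j' = slide k j" using assms(2) by (simp_all add: k_def)
  have e: "even_order i' j' (slide k (third j i)) (3 - k)" "i' < j' \<longleftrightarrow> i < j"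
    using slide_dart[OF d(1)] by (simp_all add: eq k_def)
  then have th: "third i' j' = slide k (third j i)" "third j' i' = 3 - k" and ij: "i' \<le> 3" "j' \<le> 3" "i' \<noteq> j'"
    by (simp_all add: even_order_def)
  have "t < num_simplices G" using mate_in[OF d(2)] by (auto simp: facets_def eq k_def)
  then show "(t, i', j') \<in> darts" using ij by (simp add: darts_def)
  show "mate G (s, third i j) = (t, third j' i')" using snd_mate[OF d(2)] unfolding th(2) eq(1) k_def by (metis prod.collapse snd_conv)
  show "vmap G (s, third i j) i = i'" "vmap G (s, third i j) j = j'" "vmap G (s, third i j) (third j i) = third i' j'"
    unfolding th(1) using vmap_slide[OF d(2)] d(3-5) by (simp_all add: eq k_def)
  show "i' < j' \<longleftrightarrow> i < j" by (fact e(2))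
qed

text \<open>The dart \<open>(t, a, b)\<close> that is reached determines the facet
  \<open>third b a\<close> through which it was entered; the mate and the inverse vertex bijection
  lead back.\<close>

lemma inj_on_dart_step: "inj_on dart_step darts"
proof (rule inj_onI)
  fix x y assume *: "x \<in> darts" "y \<in> darts" "dart_step x = dart_step y"
  obtain s i j where x: "x = (s, i, j)" by (cases x)
  obtain s' i' j' where y: "y = (s', i', j')" by (cases y)
  obtain t a b where z: "dart_step x = (t, a, b)" by (cases "dart_step x")
  note cx = dart_step_cross[OF *(1)[unfolded x] z[unfolded x]]
  have z': "dart_step (s', i', j') = (t, a, b)" using z *(3) y by simp
  note cy = dart_step_cross[OF *(2)[unfolded y] z']
  note dx = dart_third[OF *(1)[unfolded x]] and dy = dart_third[OF *(2)[unfolded y]]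
  have "(s, third i j) = (s', third i' j')" using mate_mate[OF dx(2)] mate_mate[OF dy(2)] cx(2) cy(2) by metis
  moreover have "i = vmap G (t, third b a) a" "j = vmap G (t, third b a) b"
    using vmap_inverse[OF dx(2)] dx(3,4) cx(2-4) by metis+
  moreover have "i' = vmap G (t, third b a) a" "j' = vmap G (t, third b a) b"
    using vmap_inverse[OF dy(2)] dy(3,4) cy(2-4) by metis+
  ultimately show "x = y" by (simp add: x y)
qed

lemma finite_darts: "finite darts"
proof (rule finite_subset)
  show "darts \<subseteq> {..<num_simplices G} \<times> {..3} \<times> {..3}" by (rule subsetI) (simp add: darts_def split_beta mem_Times_iff)
  show "finite ({..<num_simplices G} \<times> {..3 :: nat} \<times> {..3 :: nat})" by (intro finite_cartesian_product finite_lessThan finite_atMost)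
qed

text \<open>The edges keep the direction given by the order of the vertices, so a cycle of darts around
  an edge does not run into its own reversal.\<close>

lemma dart_fan:
  assumes sij: "(s, i, j) \<in> darts"
    and long: "\<And>d. d \<in> darts \<Longrightarrow> dart_step d \<noteq> d" "\<And>d. d \<in> darts \<Longrightarrow> dart_step (dart_step d) \<noteq> d"
  shows "\<exists>N tet vi vj vk vl. fan G N tet vi vj vk vl \<and> (\<forall>\<kappa>. even_order (vi \<kappa>) (vj \<kappa>) (vk \<kappa>) (vl \<kappa>)) \<and>
    tet 0 = s \<and> vi 0 = i \<and> vj 0 = j"
proof -
  have step: "dart_step x \<in> darts" if "x \<in> darts" for x
    using dart_step_cross(1) that by (metis prod.exhaust)
  define x where "x = (\<lambda>\<kappa>. (dart_step ^^ \<kappa>) (s, i, j))"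
  define tet where "tet = (\<lambda>\<kappa>. fst (x \<kappa>))"
  define vi where "vi = (\<lambda>\<kappa>. fst (snd (x \<kappa>)))"
  define vj where "vj = (\<lambda>\<kappa>. snd (snd (x \<kappa>)))"
  have x_eq: "x \<kappa> = (tet \<kappa>, vi \<kappa>, vj \<kappa>)" for \<kappa> by (simp add: tet_def vi_def vj_def)
  obtain N where N: "0 < N" "x N = x 0" "inj_on x {..<N}"
    using funpow_return[OF finite_darts step inj_on_dart_step sij] unfolding x_def by (metis funpow_0)
  have xS: "x (Suc \<kappa>) = dart_step (x \<kappa>)" for \<kappa> by (simp add: x_def)
  have xD: "x \<kappa> \<in> darts" for \<kappa> by (induction \<kappa>) (use sij step in \<open>auto simp: x_def\<close>)
  have x_per: "x (\<kappa> + N) = x \<kappa>" for \<kappa>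
  proof -
    have "x (\<kappa> + N) = (dart_step ^^ \<kappa>) (x N)" by (simp add: x_def funpow_add)
    also have "\<dots> = x \<kappa>" unfolding N(2) by (simp add: x_def)
    finally show ?thesis .
  qed
  \<comment> \<open>The wedges need an angle below pi, hence at least three tetrahedra;
    \<open>long\<close> excludes returns after one or two steps.\<close>
  have N3: "3 \<le> N"
  proof (rule ccontr)
    assume "\<not> 3 \<le> N"
    then have "N = 1 \<or> N = 2" using N(1) by linarith
    then show False using long[OF xD[of 0]] N(2) by (auto simp: xS numeral_2_eq_2)
  qed
  note D = xD[unfolded x_eq]
  note c = dart_step_cross[OF D, OF xS[unfolded x_eq, symmetric]]
  have dir: "vi \<kappa> < vj \<kappa> \<longleftrightarrow> i < j" for \<kappa>
  proof (induction \<kappa>)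
    case 0 show ?case by (simp add: vi_def vj_def x_def)
  next
    case (Suc \<kappa>) then show ?case using c(6)[of \<kappa>] by simp
  qed
  have e: "even_order (vi \<kappa>) (vj \<kappa>) (third (vi \<kappa>) (vj \<kappa>)) (third (vj \<kappa>) (vi \<kappa>))" for \<kappa>
    by (rule dart_third(1)[OF D])
  have "fan G N tet vi vj (\<lambda>\<kappa>. third (vi \<kappa>) (vj \<kappa>)) (\<lambda>\<kappa>. third (vj \<kappa>) (vi \<kappa>))"
  proof unfold_locales
    show "3 \<le> N" by (fact N3)
    fix \<kappa>
    show per: "tet (\<kappa> + N) = tet \<kappa>" "vi (\<kappa> + N) = vi \<kappa>" "vj (\<kappa> + N) = vj \<kappa>"
      using x_per[of \<kappa>] by (simp_all add: tet_def vi_def vj_def)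
    then show "third (vi (\<kappa> + N)) (vj (\<kappa> + N)) = third (vi \<kappa>) (vj \<kappa>)" "third (vj (\<kappa> + N)) (vi (\<kappa> + N)) = third (vj \<kappa>) (vi \<kappa>)"
      by simp_all
    show "tet \<kappa> < num_simplices G" using D by (simp add: darts_def)
    show "{..3} = {vi \<kappa>, vj \<kappa>, third (vi \<kappa>) (vj \<kappa>), third (vj \<kappa>) (vi \<kappa>)}"
      "distinct [vi \<kappa>, vj \<kappa>, third (vi \<kappa>) (vj \<kappa>), third (vj \<kappa>) (vi \<kappa>)]"
      using even_order_distinct[OF e] by blast+
    show "mate G (tet \<kappa>, third (vi \<kappa>) (vj \<kappa>)) = (tet (Suc \<kappa>), third (vj (Suc \<kappa>)) (vi (Suc \<kappa>)))"
      "vmap G (tet \<kappa>, third (vi \<kappa>) (vj \<kappa>)) (vi \<kappa>) = vi (Suc \<kappa>)"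
      "vmap G (tet \<kappa>, third (vi \<kappa>) (vj \<kappa>)) (vj \<kappa>) = vj (Suc \<kappa>)"
      "vmap G (tet \<kappa>, third (vi \<kappa>) (vj \<kappa>)) (third (vj \<kappa>) (vi \<kappa>)) = third (vi (Suc \<kappa>)) (vj (Suc \<kappa>))"
      by (fact c(2)[of \<kappa>], fact c(3)[of \<kappa>], fact c(4)[of \<kappa>], fact c(5)[of \<kappa>])
  next
    fix \<kappa> \<kappa>' assume less: "\<kappa> < N" "\<kappa>' < N" and eq: "tet \<kappa> = tet \<kappa>'" "{vi \<kappa>, vj \<kappa>} = {vi \<kappa>', vj \<kappa>'}"
    have "vi \<kappa> = vi \<kappa>' \<and> vj \<kappa> = vj \<kappa>'"
    proof (rule ccontr)
      assume "\<not> (vi \<kappa> = vi \<kappa>' \<and> vj \<kappa> = vj \<kappa>')"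
      then have "vi \<kappa> = vj \<kappa>'" "vj \<kappa> = vi \<kappa>'" using eq(2) by (auto simp: doubleton_eq_iff)
      moreover have "vi \<kappa> \<noteq> vj \<kappa>" using D[of \<kappa>] by (simp add: darts_def)
      ultimately show False using dir[of \<kappa>] dir[of \<kappa>'] by (metis linorder_neqE_nat order.asym)
    qed
    then have "x \<kappa> = x \<kappa>'" using eq(1) by (simp add: x_eq)
    then show "\<kappa> = \<kappa>'" using inj_onD[OF N(3)] less by simp
  qed
  moreover have "tet 0 = s" "vi 0 = i" "vj 0 = j" by (simp_all add: tet_def vi_def vj_def x_def)
  ultimately show ?thesis using e by blast
qed

end

section \<open>The complex\<close>

text \<open>Crossing the facets around the edge \<open>{0, 1}\<close> yields the edges \<open>{0, 2}\<close>, \<open>{1, 3}\<close>,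
  \<open>{2, 3}\<close>, \<open>{1, 2}\<close> and again \<open>{0, 1}\<close>. The shifts are chosen such that the index of the tetrahedron
  is decreased by \<open>1\<close> on the way, while crossing the facets around the edge \<open>{0, 3}\<close> increases it by \<open>m\<close>.\<close>

definition shift :: "nat \<Rightarrow> nat \<Rightarrow> nat \<Rightarrow> nat" where
  "shift n m i = [2 * m - 1, m, m * (n - 1), m * (n - 2) + 1] ! i"

definition cyclic_complex :: "nat \<Rightarrow> nat \<Rightarrow> pairing" where
  "cyclic_complex n m = \<lparr>num_simplices = m * n,
     mate = (\<lambda>(s, i). ((s + shift n m i) mod (m * n), 3 - i)),
     vmap = (\<lambda>(s, i). slide i)\<rparr>"

lemma card_residue_class:
  assumes "r < (m :: nat)"
  shows "card {s. s < m * n \<and> s mod m = r} = n"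
proof -
  have "{s. s < m * n \<and> s mod m = r} = (\<lambda>q. q * m + r) ` {..<n}"
  proof (intro Set.set_eqI iffI)
    fix s assume "s \<in> {s. s < m * n \<and> s mod m = r}"
    then have s: "s < m * n" "s mod m = r" by auto
    have "s div m < n" using s(1) by (simp add: less_mult_imp_div_less mult.commute)
    moreover have "s = s div m * m + r" using s(2) by (metis div_mult_mod_eq)
    ultimately show "s \<in> (\<lambda>q. q * m + r) ` {..<n}" by blast
  next
    fix s assume "s \<in> (\<lambda>q. q * m + r) ` {..<n}"
    then obtain q where q: "q < n" "s = q * m + r" by auto
    have "q * m + r < Suc q * m" using assms by simp
    also have "\<dots> \<le> n * m" using q(1) by (intro mult_right_mono) auto
    finally show "s \<in> {s. s < m * n \<and> s mod m = r}" using q(2) assms by (simp add: mult.commute)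
  qed
  moreover have "inj_on (\<lambda>q. q * m + r) {..<n}" using assms by (auto simp: inj_on_def)
  ultimately show ?thesis by (simp add: card_image)
qed

lemma slide_facet:
  assumes "k \<le> 3" "v \<le> 3" "v \<noteq> k"
  shows "slide k v \<le> 3" "slide k v \<noteq> 3 - k" "slide (3 - k) (slide k v) = v"
  using le_3_cases[OF assms(1)] le_3_cases[OF assms(2)] assms(3)
  by (elim disjE; simp add: slide_def skip_def unskip_def)+

section \<open>Edge classes of the cyclic complex\<close>

locale cyclic_pairing =
  fixes n m :: nat
  assumes n: "6 \<le> n" and m: "1 \<le> m"
begin

abbreviation T where "T \<equiv> cyclic_complex n m"
abbreviation move where "move s i \<equiv> (s + shift n m i) mod (m * n)"

lemma T_simps [simp]:
  "num_simplices T = m * n" "mate T (s, i) = (move s i, 3 - i)" "vmap T (s, i) = slide i"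
  by (simp_all add: cyclic_complex_def)

lemma K_pos: "0 < m * n" using n m by simp

text \<open>This form exhibits the shifts at the facets 2 and 3 as the negatives, modulo
  \<open>m * n\<close>, of those at 1 and 0, so that crossing a facet and crossing back
  cancel.\<close>

lemma shift_simps: "shift n m 0 = 2 * m - 1" "shift n m 1 = m" "shift n m 2 = m * n - m" "shift n m 3 = m * n - (2 * m - 1)"
proof -
  obtain k where k: "n = k + 2" by (rule that[of "n - 2"]) (use n in simp)
  show "shift n m 0 = 2 * m - 1" "shift n m 1 = m" by (simp_all add: shift_def)
  show "shift n m 2 = m * n - m" by (simp add: shift_def diff_mult_distrib2)
  show "shift n m 3 = m * n - (2 * m - 1)" using m unfolding k by (simp add: shift_def algebra_simps)
qed

lemma shift_bounds: "2 * m - 1 < m * n" "m < m * n" "6 * m \<le> m * n" "1 \<le> m"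
proof -
  show *: "6 * m \<le> m * n" using mult_le_mono2[OF n, of m] by (simp only: mult.commute)
  show "1 \<le> m" by (rule m)
  then show "2 * m - 1 < m * n" "m < m * n" using * by linarith+
qed

lemma shift_mate: "i \<le> 3 \<Longrightarrow> shift n m i + shift n m (3 - i) = m * n"
  using shift_bounds by (auto dest!: le_3_cases simp: shift_simps shift_simps(2)[simplified])

lemma move_less: "move s i < m * n" using K_pos by simp

lemma move_move: "s < m * n \<Longrightarrow> i \<le> 3 \<Longrightarrow> move (move s i) (3 - i) = s"
  using shift_mate[of i] by (simp add: mod_add_left_eq add.assoc)

lemma move_mod: "i \<in> {1, 2} \<Longrightarrow> move s i mod m = s mod m"
proof -
  have mm: "(m * n - m) mod m = 0" by (metis diff_mult_distrib2 mod_mult_self1_is_0 mult.right_neutral)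
  assume "i \<in> {1, 2}"
  then have "shift n m i mod m = 0" using mm by (auto simp: shift_simps simp del: One_nat_def)
  then have "(s + shift n m i) mod m = s mod m" by (metis mod_add_right_eq add_0_right)
  then show ?thesis by (simp add: mod_mod_cancel)
qed

sublocale ordered_pairing T
proof
  show "face_pairing 3 T"
    unfolding face_pairing_def
  proof (intro ballI)
    fix F assume "F \<in> facets 3 T"
    then obtain s i where F: "F = (s, i)" "s < m * n" "i \<le> 3" by (auto simp: facets_def)
    have i: "3 - i \<noteq> i" "3 - i \<le> 3" "3 - (3 - i) = i" using le_3_cases[OF F(3)] by auto
    have mm: "mate T (mate T F) = F" using move_move[OF F(2,3)] i(3) F(1) by simp
    have mF: "mate T F \<in> facets 3 T" using move_less[of s i] by (simp add: F facets_def)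
    have fv: "facet_vertices 3 F = {..3} - {i}" "facet_vertices 3 (mate T F) = {..3} - {3 - i}" by (simp_all add: F facet_vertices_def)
    have v: "vmap T F = slide i" "vmap T (mate T F) = slide (3 - i)" by (simp_all add: F)
    have "bij_betw (slide i) ({..3} - {i}) ({..3} - {3 - i})"
      by (rule bij_betw_byWitness[where f' = "slide (3 - i)"])
        (use slide_facet[OF F(3)] slide_facet[OF i(2)] i(3) in auto)
    then show "mate T F \<in> facets 3 T \<and> mate T F \<noteq> F \<and> mate T (mate T F) = F \<and>
      bij_betw (vmap T F) (facet_vertices 3 F) (facet_vertices 3 (mate T F)) \<and>
      (\<forall>v\<in>facet_vertices 3 F. vmap T (mate T F) (vmap T F v) = v)"
      using mF mm i(1) slide_facet(3)[OF F(3)] unfolding fv v by (simp add: F)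
  qed
next
  fix F assume "F \<in> facets 3 T"
  then show "snd (mate T F) = 3 - snd F" by (cases F) simp
qed simp

text \<open>Unlike \<open>dart_step\<close>, this relation crosses either of the two facets that
  contain the edge, and is therefore symmetric.\<close>

definition dart_gluing :: "((nat \<times> nat \<times> nat) \<times> (nat \<times> nat \<times> nat)) set" where
  "dart_gluing = {((s, i, j), (move s k, slide k i, slide k j)) | s i j k.
     s < m * n \<and> i \<le> 3 \<and> j \<le> 3 \<and> k \<le> 3 \<and> i \<noteq> j \<and> k \<noteq> i \<and> k \<noteq> j}"

lemma dart_gluingI: "s < m * n \<Longrightarrow> i \<le> 3 \<Longrightarrow> j \<le> 3 \<Longrightarrow> k \<le> 3 \<Longrightarrow> i \<noteq> j \<Longrightarrow> k \<noteq> i \<Longrightarrow> k \<noteq> j \<Longrightarrow>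
    ((s, i, j), (move s k, slide k i, slide k j)) \<in> dart_gluing"
  unfolding dart_gluing_def by blast

lemma dart_gluingE:
  assumes "(p, q) \<in> dart_gluing"
  obtains s i j k where "p = (s, i, j)" "q = (move s k, slide k i, slide k j)" "s < m * n" "i \<le> 3" "j \<le> 3" "k \<le> 3" "i \<noteq> j" "k \<noteq> i" "k \<noteq> j"
  using assms unfolding dart_gluing_def by blast

lemma sym_dart_gluing: "sym dart_gluing"
proof (rule symI)
  fix p q assume "(p, q) \<in> dart_gluing"
  then obtain s i j k where p: "p = (s, i, j)" and q: "q = (move s k, slide k i, slide k j)"
    and *: "s < m * n" "i \<le> 3" "j \<le> 3" "k \<le> 3" "i \<noteq> j" "k \<noteq> i" "k \<noteq> j" by (rule dart_gluingE)
  note si = slide_facet[OF *(4,2) *(6)[symmetric]] and sj = slide_facet[OF *(4,3) *(7)[symmetric]]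
  have neq: "slide k i \<noteq> slide k j" using si(3) sj(3) *(5) by metis
  have "((move s k, slide k i, slide k j), (move (move s k) (3 - k), slide (3 - k) (slide k i), slide (3 - k) (slide k j))) \<in> dart_gluing"
    by (rule dart_gluingI[OF move_less si(1) sj(1) _ neq not_sym[OF si(2)] not_sym[OF sj(2)]]) simp
  then show "(q, p) \<in> dart_gluing" unfolding p q si(3) sj(3) move_move[OF *(1,4)] .
qed

text \<open>The labels \<open>0, \<dots>, m - 1\<close> are those of the edges of valence \<open>n\<close>.\<close>

definition edge_label :: "nat \<Rightarrow> nat set \<Rightarrow> nat" where
  "edge_label s A = (if A = {0, 3} then s mod m else m)"

text \<open>Crossing facet 1 or 2 shifts by a multiple of \<open>m\<close> and sends the pair {0,
  3}, and only it, to {0, 3}. The facets 0 and 3 do not contain this edge, nor do the facets to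
  which they are glued.\<close>

lemma edge_label_step:
  assumes "i \<le> 3" "j \<le> 3" "i \<noteq> j" "k \<le> 3" "k \<noteq> i" "k \<noteq> j"
  shows "edge_label (move s k) {slide k i, slide k j} = edge_label s {i, j}"
proof (cases "k = 1 \<or> k = 2")
  case True
  then have "{slide k i, slide k j} = {0, 3} \<longleftrightarrow> {i, j} = {0, 3}"
    using le_3_cases[OF assms(1)] le_3_cases[OF assms(2)] assms(3,5,6)
    by (elim disjE; simp add: slide_def skip_def unskip_def doubleton_eq_iff)
  moreover have "move s k mod m = s mod m" by (rule move_mod) (use True in simp)
  ultimately show ?thesis by (simp add: edge_label_def)
next
  case False
  then have "k = 0 \<or> k = 3" using le_3_cases[OF assms(4)] by blast
  then have "{slide k i, slide k j} \<noteq> {0, 3}" "{i, j} \<noteq> {0, 3}"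
    using le_3_cases[OF assms(1)] le_3_cases[OF assms(2)] assms(3,5,6)
    by (elim disjE; simp add: slide_def skip_def unskip_def doubleton_eq_iff)+
  then show ?thesis by (simp add: edge_label_def)
qed

lemma dart_cycle:
  assumes "s < m * n"
  shows "((s, 0, 3), (move s 1, 0, 3)) \<in> dart_gluing" "((s, 0, 1), (move s 2, 0, 2)) \<in> dart_gluing"
    "((s, 0, 2), (move s 3, 1, 3)) \<in> dart_gluing" "((s, 1, 3), (move s 2, 2, 3)) \<in> dart_gluing"
    "((s, 2, 3), (move s 0, 1, 2)) \<in> dart_gluing" "((s, 1, 2), (move s 0, 0, 1)) \<in> dart_gluing"
  using dart_gluingI[OF assms, of 0 3 1] dart_gluingI[OF assms, of 0 1 2] dart_gluingI[OF assms, of 0 2 3]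
    dart_gluingI[OF assms, of 1 3 2] dart_gluingI[OF assms, of 2 3 0] dart_gluingI[OF assms, of 1 2 0]
  by (simp_all add: slide_def skip_def unskip_def numeral_2_eq_2 numeral_3_eq_3)

abbreviation dart_eq :: "nat \<times> nat \<times> nat \<Rightarrow> nat \<times> nat \<times> nat \<Rightarrow> bool" (infix \<open>\<leadsto>\<close> 50) where
  "d \<leadsto> d' \<equiv> (d, d') \<in> dart_gluing\<^sup>*"

lemma dart_eq_sym: "d \<leadsto> d' \<Longrightarrow> d' \<leadsto> d"
  using sym_rtrancl[OF sym_dart_gluing] by (rule symD)

lemma dart_eq_trans: "d \<leadsto> d' \<Longrightarrow> d' \<leadsto> d'' \<Longrightarrow> d \<leadsto> d''"
  by (rule rtrancl_trans)

text \<open>Crossing facet 1 repeatedly adds \<open>m\<close> each time, so one climbs from the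
  residue of \<open>s\<close> to \<open>s\<close> itself.\<close>

lemma dart_eq_03_mod:
  assumes "s < m * n"
  shows "(s mod m, 0, 3) \<leadsto> (s, 0, 3)"
proof -
  have "(s mod m, 0, 3) \<leadsto> (s mod m + q * m, 0, 3)" if "s mod m + q * m < m * n" for q
    using that
  proof (induction q)
    case (Suc q)
    then have "s mod m + q * m < m * n" "(s mod m + q * m + m) mod (m * n) = s mod m + Suc q * m" by (simp_all add: algebra_simps)
    then show ?case using Suc.IH dart_cycle(1)[of "s mod m + q * m"] by (simp add: shift_simps(2)[simplified] rtrancl.rtrancl_into_rtrancl)
  qed simp
  from this[of "s div m"] show ?thesis using assms by (simp add: mod_div_mult_eq)
qed

lemma dart_eq_01: assumes "s < m * n" "t < m * n" shows "(s, 0, 1) \<leadsto> (t, 0, 1)"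
proof -
  have red: "(Suc s, 0, 1) \<leadsto> (s, 0, 1)" if s: "Suc s < m * n" for s
  proof -
    have K: "move x i < m * n" for x i by (rule move_less)
    have "(Suc s, 0, 1) \<leadsto> (move (move (move (move (move (Suc s) 2) 3) 2) 0) 0, 0, 1)"
      using dart_cycle(2)[OF s] dart_cycle(3)[OF K] dart_cycle(4)[OF K] dart_cycle(5)[OF K] dart_cycle(6)[OF K]
      by (meson r_into_rtrancl rtrancl_trans)
    moreover have "move (move (move (move (move (Suc s) 2) 3) 2) 0) 0 = s"
    proof -
      have "move (move (move (move (move (Suc s) 2) 3) 2) 0) 0 =
        (Suc s + shift n m 2 + shift n m 3 + shift n m 2 + shift n m 0 + shift n m 0) mod (m * n)"
        by (simp add: mod_add_left_eq)
      \<comment> \<open>The five shifts add up to \<open>3 * (m * n) - 1\<close>: the terms in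
        \<open>m\<close> cancel and one tour lowers the index by 1.\<close>
      also have "Suc s + shift n m 2 + shift n m 3 + shift n m 2 + shift n m 0 + shift n m 0 = s + 3 * (m * n)"
        unfolding shift_simps using shift_bounds by linarith
      also have "\<dots> mod (m * n) = s" using s by simp
      finally show ?thesis .
    qed
    ultimately show ?thesis by simp
  qed
  have zero: "(s, 0, 1) \<leadsto> (0, 0, 1)" if "s < m * n" for s
    using that
  proof (induction s)
    case (Suc s)
    show ?case by (rule dart_eq_trans[OF red[OF Suc.prems] Suc.IH[OF Suc_lessD[OF Suc.prems]]])
  qed simp
  show ?thesis by (rule dart_eq_trans[OF zero[OF assms(1)] dart_eq_sym[OF zero[OF assms(2)]]])
qed

text \<open>The edge follows the tour {0, 2}, {1, 3}, {2, 3}, {1, 2}, {0, 1} to its end.\<close>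

lemma dart_eq_01_ex:
  assumes s: "s < m * n" and ij: "i < j" "j \<le> 3" "(i, j) \<noteq> (0, 3)"
  shows "\<exists>t<m * n. (s, i, j) \<leadsto> (t, 0, 1)"
proof -
  have step: "\<exists>t<m * n. (s, p) \<leadsto> (t, 0, 1)" if "((s, p), (move s k, q)) \<in> dart_gluing" "\<forall>s<m * n. \<exists>t<m * n. (s, q) \<leadsto> (t, 0, 1)" for s p k q
    using that move_less[of s k] by (meson converse_rtrancl_into_rtrancl)
  have 12: "\<forall>s<m * n. \<exists>t<m * n. (s, 1, 2) \<leadsto> (t, 0, 1)"
    using step[OF dart_cycle(6)] by blast
  have 23: "\<forall>s<m * n. \<exists>t<m * n. (s, 2, 3) \<leadsto> (t, 0, 1)"
    using step[OF dart_cycle(5) 12] by blast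
  have 13: "\<forall>s<m * n. \<exists>t<m * n. (s, 1, 3) \<leadsto> (t, 0, 1)"
    using step[OF dart_cycle(4) 23] by blast
  have 02: "\<forall>s<m * n. \<exists>t<m * n. (s, 0, 2) \<leadsto> (t, 0, 1)"
    using step[OF dart_cycle(3) 13] by blast
  have "(i, j) \<in> {(0, 1), (0, 2), (1, 2), (1, 3), (2, 3)}"
    using ij le_3_cases[of i] le_3_cases[of j] by auto
  then show ?thesis using s 12 23 13 02 by auto
qed

lemma dart_connected:
  assumes "s < m * n" "i < j" "j \<le> 3" "s' < m * n" "i' < j'" "j' \<le> 3" "edge_label s {i, j} = edge_label s' {i', j'}"
  shows "(s, i, j) \<leadsto> (s', i', j')"
proof (cases "(i, j) = (0, 3)")
  case True
  have less: "x mod m < m" for x using m by simp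
  have "edge_label s {i, j} = s mod m" using True by (simp add: edge_label_def)
  then have "edge_label s' {i', j'} \<noteq> m" using assms(7) less[of s] by simp
  then have "{i', j'} = {0, 3}" "s mod m = s' mod m" using assms(7) True by (auto simp: edge_label_def split: if_splits)
  then have "(i', j') = (0, 3)" using assms(5) by (auto simp: doubleton_eq_iff)
  then show ?thesis
    using dart_eq_03_mod[OF assms(1)] dart_eq_03_mod[OF assms(4)] \<open>s mod m = s' mod m\<close> True dart_eq_sym dart_eq_trans
    by (metis prod.inject)
next
  case False
  have less: "x mod m < m" for x using m by simp
  have "{i, j} \<noteq> {0, 3}" using False assms(2) by (auto simp: doubleton_eq_iff)
  then have "edge_label s' {i', j'} = m" using assms(7) by (simp add: edge_label_def)
  then have "{i', j'} \<noteq> {0, 3}" using less[of s'] by (auto simp: edge_label_def)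
  then have F': "(i', j') \<noteq> (0, 3)" by auto
  obtain t t' where "t < m * n" "(s, i, j) \<leadsto> (t, 0, 1)" "t' < m * n" "(s', i', j') \<leadsto> (t', 0, 1)"
    using dart_eq_01_ex[OF assms(1-3) False] dart_eq_01_ex[OF assms(4-6) F'] by blast
  then show ?thesis using dart_eq_01 dart_eq_sym dart_eq_trans by meson
qed

end

section \<open>Short cycles of darts and connectedness of the local vertices\<close>

lemma rtrancl_map_rel:
  assumes "(x, y) \<in> r\<^sup>*" and "\<And>x y. (x, y) \<in> r \<Longrightarrow> (f x, f y) \<in> s"
  shows "(f x, f y) \<in> s\<^sup>*"
  using assms(1) by (induction rule: rtrancl_induct) (auto intro: rtrancl_into_rtrancl assms(2))

lemma pair_subset_cases:
  assumes "A \<subseteq> {..3 :: nat}" "card A = 2"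
  obtains i j where "A = {i, j}" "i < j" "j \<le> 3"
proof -
  obtain x y where "A = {x, y}" "x \<noteq> y" using assms(2) by (meson card_2_iff)
  then show ?thesis
    using that[of x y] that[of y x] assms(1) by (cases "x < y") (auto simp: insert_commute)
qed

lemma slide_less:
  assumes "k \<le> 3" "v \<le> 3" "w \<le> 3" "v \<noteq> k" "w \<noteq> k"
  shows "slide k v < slide k w \<longleftrightarrow> v < w"
  using assms(4,5) le_3_cases[OF assms(1)] le_3_cases[OF assms(2)] le_3_cases[OF assms(3)]
  by (elim disjE; simp add: slide_def skip_def unskip_def)

definition slide_pair :: "nat \<times> nat \<Rightarrow> nat \<times> nat" where
  "slide_pair = (\<lambda>(i, j). (slide (third i j) i, slide (third i j) j))"

lemma slide_pair_simps:
  "slide_pair (0, 1) = (0, 2)" "slide_pair (0, 2) = (1, 3)" "slide_pair (1, 3) = (2, 3)" "slide_pair (2, 3) = (1, 2)" "slide_pair (1, 2) = (0, 1)"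
  "slide_pair (2, 0) = (1, 0)" "slide_pair (3, 1) = (2, 0)" "slide_pair (3, 2) = (3, 1)" "slide_pair (2, 1) = (3, 2)" "slide_pair (1, 0) = (2, 1)"
  by (simp_all add: slide_pair_def third_def slide_def skip_def unskip_def)

text \<open>The ten directed vertex pairs other than (0, 3) and (3, 0) form two cycles of length 5,
  so neither one step nor two steps return.\<close>

lemma slide_pair_neq:
  assumes "i \<le> 3" "j \<le> 3" "i \<noteq> j" "(i, j) \<noteq> (0, 3)" "(i, j) \<noteq> (3, 0)"
  shows "slide_pair (i, j) \<noteq> (i, j)" "slide_pair (slide_pair (i, j)) \<noteq> (i, j)"
proof -
  have "(i, j) \<in> {(0, 1), (0, 2), (1, 3), (2, 3), (1, 2), (2, 0), (3, 1), (3, 2), (2, 1), (1, 0)}"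
    using le_3_cases[OF assms(1)] le_3_cases[OF assms(2)] assms(3-5) by (elim disjE) simp_all
  then show "slide_pair (i, j) \<noteq> (i, j)" "slide_pair (slide_pair (i, j)) \<noteq> (i, j)"
    by (elim insertE emptyE; simp only: slide_pair_simps; simp)+
qed

lemma add_mod_neq:
  assumes "s < k" "0 < a" "a < (k :: nat)"
  shows "(s + a) mod k \<noteq> s"
  using assms by (cases "s + a < k") (simp_all add: le_mod_geq)

context cyclic_pairing
begin

text \<open>For five of the six edges the vertex pair itself changes. For {0, 3} it stays, and the
  tetrahedron moves by \<open>m\<close> in one sense or the other, so that \<open>n \<ge> 6\<close>
  excludes a return within two steps.\<close>

lemma dart_step_neq:
  assumes "d \<in> darts"
  shows "dart_step d \<noteq> d" "dart_step (dart_step d) \<noteq> d"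
proof -
  obtain s i j where d: "d = (s, i, j)" by (cases d)
  then have s: "s < m * n" and ij: "i \<le> 3" "j \<le> 3" "i \<noteq> j" using assms by (auto simp: darts_def)
  have twice: "move (move s k) k = (s + 2 * shift n m k) mod (m * n)" for k
    by (simp add: mod_add_left_eq mult_2 add.assoc)
  \<comment> \<open>The double shift exceeds \<open>m * n\<close>; reduced by one full turn it lies
    strictly between 0 and \<open>m * n\<close>.\<close>
  have "2 * shift n m 2 = (m * n - 2 * m) + m * n" using shift_bounds by (simp add: shift_simps)
  then have "move (move s 2) 2 = (s + (m * n - 2 * m) + m * n) mod (m * n)" unfolding twice by (simp add: add.assoc)
  then have t2: "move (move s 2) 2 = (s + (m * n - 2 * m)) mod (m * n)" by simp
  have t1: "move (move s 1) 1 = (s + 2 * m) mod (m * n)" unfolding twice by (simp add: shift_simps(2)[simplified])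
  have m1: "move s 1 \<noteq> s" "move (move s 1) 1 \<noteq> s"
    unfolding t1 unfolding shift_simps by (rule add_mod_neq[OF s]; use shift_bounds in linarith)+
  have m2: "move s 2 \<noteq> s" "move (move s 2) 2 \<noteq> s"
    unfolding t2 unfolding shift_simps by (rule add_mod_neq[OF s]; use shift_bounds in linarith)+
  consider "(i, j) = (0, 3)" | "(i, j) = (3, 0)" | "(i, j) \<noteq> (0, 3)" "(i, j) \<noteq> (3, 0)" by blast
  then have "dart_step d \<noteq> d \<and> dart_step (dart_step d) \<noteq> d"
  proof cases
    case 1
    have th: "third 0 3 = 1" "slide 1 0 = 0" "slide 1 3 = 3" by (simp_all add: third_def slide_def skip_def unskip_def)
    have st: "dart_step (t, 0, 3) = (move t 1, 0, 3)" for t unfolding dart_step.simps th by simp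
    have "d = (s, 0, 3)" using 1 d by simp
    then show ?thesis using m1 by (simp only: st prod.inject) blast
  next
    case 2
    have th: "third 3 0 = 2" "slide 2 0 = 0" "slide 2 3 = 3" by (simp_all add: third_def slide_def skip_def unskip_def)
    have st: "dart_step (t, 3, 0) = (move t 2, 3, 0)" for t unfolding dart_step.simps th by simp
    have "d = (s, 3, 0)" using 2 d by simp
    then show ?thesis using m2 by (simp only: st prod.inject) blast
  next
    case 3
    have snd_step: "snd (dart_step x) = slide_pair (snd x)" for x by (cases x) (simp add: slide_pair_def)
    have "slide_pair (i, j) \<noteq> (i, j) \<and> slide_pair (slide_pair (i, j)) \<noteq> (i, j)"
      using slide_pair_neq[OF ij 3] by blast
    then show ?thesis unfolding d by (metis snd_step snd_conv)
  qed
  then show "dart_step d \<noteq> d" "dart_step (dart_step d) \<noteq> d" by blast+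
qed

lemma edge_label_other: "i < j \<Longrightarrow> (i, j) \<noteq> (0, 3) \<Longrightarrow> edge_label s {i, j} = m"
  by (auto simp: edge_label_def doubleton_eq_iff)

text \<open>Identifications of edges carry smaller ends to smaller ends and larger ends to larger
  ends, and all edges other than {0, 3} are identified. Vertex 1 is the larger end of {0, 1} and the
  smaller end of {1, 2}, which links the two kinds of ends.\<close>

lemma vertex_connected_T: "vertex_connected"
  unfolding vertex_connected_def
proof (intro allI impI)
  fix S assume sub: "S \<subseteq> {..<num_simplices T} \<times> {..3}" and ne: "S \<noteq> {}"
    and closed: "\<forall>(s, v)\<in>S. \<forall>i\<le>3. i \<noteq> v \<longrightarrow> (fst (mate T (s, i)), vmap T (s, i) v) \<in> S"
  have cl: "(move s k, slide k v) \<in> S" if "(s, v) \<in> S" "k \<le> 3" "k \<noteq> v" for s v k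
    using closed that by fastforce
  have "(fst p, fst (snd p)) \<in> S \<longrightarrow> (fst q, fst (snd q)) \<in> S" if "p \<leadsto> q" for p q
    using that
  proof (induction rule: rtrancl_induct)
    case (step y z)
    from step.hyps(2) obtain s i j k where "y = (s, i, j)" "z = (move s k, slide k i, slide k j)" "k \<le> 3" "k \<noteq> i"
      by (rule dart_gluingE)
    then show ?case using step.IH cl[of s i k] by simp
  qed blast
  then have fst_S: "(s, i) \<in> S \<Longrightarrow> (t, i') \<in> S" if "(s, i, j) \<leadsto> (t, i', j')" for s i j t i' j' using that by fastforce
  have "(fst p, snd (snd p)) \<in> S \<longrightarrow> (fst q, snd (snd q)) \<in> S" if "p \<leadsto> q" for p q
    using that
  proof (induction rule: rtrancl_induct)
    case (step y z)
    from step.hyps(2) obtain s i j k where "y = (s, i, j)" "z = (move s k, slide k i, slide k j)" "k \<le> 3" "k \<noteq> j"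
      by (rule dart_gluingE)
    then show ?case using step.IH cl[of s j k] by simp
  qed blast
  then have snd_S: "(s, j) \<in> S \<Longrightarrow> (t, j') \<in> S" if "(s, i, j) \<leadsto> (t, i', j')" for s i j t i' j' using that by fastforce
  have conn: "(s, i, j) \<leadsto> (t, i', j')"
    if "s < m * n" "t < m * n" "i < j" "j \<le> 3" "i' < j'" "j' \<le> 3" "(i, j) \<noteq> (0, 3)" "(i', j') \<noteq> (0, 3)" for s t i j i' j'
    by (rule dart_connected) (use that edge_label_other in \<open>simp_all del: One_nat_def\<close>)
  obtain s v where sv: "(s, v) \<in> S" using ne by auto
  then have s: "s < m * n" and v: "v \<le> 3" using sub by auto
  have S1: "(t, 1) \<in> S" if t: "t < m * n" for t
    using le_3_cases[OF v]
  proof (elim disjE)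
    assume "v = 0"
    then show ?thesis using fst_S[OF conn[OF s t, of 0 1 1 2]] sv by simp
  next
    assume "v = 1"
    then show ?thesis using fst_S[OF conn[OF s t, of 1 2 1 2]] sv by simp
  next
    assume "v = 2"
    then show ?thesis using snd_S[OF conn[OF s t, of 0 2 0 1]] sv by simp
  next
    assume "v = 3"
    then show ?thesis using snd_S[OF conn[OF s t, of 1 3 0 1]] sv by simp
  qed
  have "(t, w) \<in> S" if t: "t < m * n" and w: "w \<le> 3" for t w
    using le_3_cases[OF w]
  proof (elim disjE)
    assume "w = 0"
    then show ?thesis using fst_S[OF conn[OF t t, of 1 2 0 1]] S1[OF t] by simp
  next
    assume "w = 1"
    then show ?thesis using S1[OF t] by simp
  next
    assume "w = 2"
    then show ?thesis using snd_S[OF conn[OF t t, of 0 1 0 2]] S1[OF t] by simp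
  next
    assume "w = 3"
    then show ?thesis using snd_S[OF conn[OF t t, of 0 1 1 3]] S1[OF t] by simp
  qed
  then show "S = {..<num_simplices T} \<times> {..3}" using sub by auto
qed

sublocale one_vertex_complex T
proof
  show "0 < num_simplices T" using K_pos by simp
  show "point_class 3 T (s, vertex_point i) = point_class 3 T (t, vertex_point j)"
    if "s < num_simplices T" "t < num_simplices T" "i \<le> 3" "j \<le> 3" for s t i j
    by (rule one_vertex_class[OF vertex_connected_T that(1,3,2,4)])
  show "\<exists>N tet vi vj vk vl. fan T N tet vi vj vk vl \<and> (\<forall>\<kappa>. even_order (vi \<kappa>) (vj \<kappa>) (vk \<kappa>) (vl \<kappa>)) \<and>
      tet 0 = s \<and> vi 0 = i \<and> vj 0 = j"
    if "s < num_simplices T" "i \<le> 3" "j \<le> 3" "i \<noteq> j" for s i j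
  proof (rule dart_fan)
    show "(s, i, j) \<in> darts" using that by (simp add: darts_def)
  qed (fact dart_step_neq)+
  show "vertex_connected" by (rule vertex_connected_T)
qed

section \<open>The quotient edges and their valences\<close>

definition edges_labelled :: "nat \<Rightarrow> (nat \<times> nat set) set" where
  "edges_labelled l = {(s, A) \<in> local_faces 3 T 1. edge_label s A = l}"

lemma edge_labels: "(\<lambda>(s, A). edge_label s A) ` local_faces 3 T 1 = {..m}"
proof
  show "(\<lambda>(s, A). edge_label s A) ` local_faces 3 T 1 \<subseteq> {..m}"
    using m by (auto simp: edge_label_def intro: less_imp_le)
  show "{..m} \<subseteq> (\<lambda>(s, A). edge_label s A) ` local_faces 3 T 1"
  proof
    fix l assume "l \<in> {..m}"
    show "l \<in> (\<lambda>(s, A). edge_label s A) ` local_faces 3 T 1"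
    proof (cases "l = m")
      case True
      have "l = (case (0, {0, 1}) of (s, A) \<Rightarrow> edge_label s A)" using True by (simp add: edge_label_def doubleton_eq_iff)
      moreover have "(0, {0, 1}) \<in> local_faces 3 T 1" using K_pos by (simp add: local_faces_def)
      ultimately show ?thesis by (rule image_eqI)
    next
      case False
      then have l: "l < m" using \<open>l \<in> {..m}\<close> by simp
      have "l = (case (l, {0, 3}) of (s, A) \<Rightarrow> edge_label s A)" using l by (simp add: edge_label_def)
      moreover have "(l, {0, 3}) \<in> local_faces 3 T 1" using less_trans[OF l shift_bounds(2)] by (simp add: local_faces_def)
      ultimately show ?thesis by (rule image_eqI)
    qed
  qed
qed

lemma quotient_edges: "quotient_faces 3 T 1 = edges_labelled ` {..m}"
proof -
  have "quotient_faces 3 T 1 = (\<lambda>l. {x \<in> local_faces 3 T 1. (\<lambda>(s, A). edge_label s A) x = l}) `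
      (\<lambda>(s, A). edge_label s A) ` local_faces 3 T 1"
  proof (rule quotient_faces_by_label(1))
    fix s k A assume *: "(s, k) \<in> facets 3 T" "A \<subseteq> facet_vertices 3 (s, k)" "card A = Suc 1"
    have "A \<subseteq> {..3}" "card A = 2" using * by (auto simp: facet_vertices_def)
    then obtain i j where A: "A = {i, j}" "i < j" "j \<le> 3" by (rule pair_subset_cases)
    have k: "k \<le> 3" "k \<noteq> i" "k \<noteq> j" using * A by (auto simp: facets_def facet_vertices_def)
    show "(case (fst (mate T (s, k)), vmap T (s, k) ` A) of (s, A) \<Rightarrow> edge_label s A) = (case (s, A) of (s, A) \<Rightarrow> edge_label s A)"
      using edge_label_step[of i j k s] A k by simp
  next
    fix x y assume *: "x \<in> local_faces 3 T 1" "y \<in> local_faces 3 T 1"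
      "(case x of (s, A) \<Rightarrow> edge_label s A) = (case y of (s, A) \<Rightarrow> edge_label s A)"
    obtain s A t A' where xy: "x = (s, A)" "y = (t, A')" by (cases x, cases y)
    have sA: "s < m * n" "A \<subseteq> {..3}" "card A = 2" and tA: "t < m * n" "A' \<subseteq> {..3}" "card A' = 2"
      using * xy by (auto simp: local_faces_def)
    obtain i j where A: "A = {i, j}" "i < j" "j \<le> 3" using sA(2,3) by (rule pair_subset_cases)
    obtain i' j' where A': "A' = {i', j'}" "i' < j'" "j' \<le> 3" using tA(2,3) by (rule pair_subset_cases)
    have "(s, i, j) \<leadsto> (t, i', j')"
      by (rule dart_connected[OF sA(1) A(2,3) tA(1) A'(2,3)]) (use *(3) xy A A' in simp)
    then have "((\<lambda>(s, i, j). (s, {i, j})) (s, i, j), (\<lambda>(s, i, j). (s, {i, j})) (t, i', j')) \<in> (face_gluing 3 T)\<^sup>*"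
    proof (rule rtrancl_map_rel)
      fix p q assume "(p, q) \<in> dart_gluing"
      then obtain s i j k where p: "p = (s, i, j)" and q: "q = (move s k, slide k i, slide k j)"
        and *: "s < m * n" "i \<le> 3" "j \<le> 3" "k \<le> 3" "i \<noteq> j" "k \<noteq> i" "k \<noteq> j" by (rule dart_gluingE)
      have "((s, {i, j}), (fst (mate T (s, k)), vmap T (s, k) ` {i, j})) \<in> face_gluing 3 T"
        unfolding face_gluing_def mem_Collect_eq
        by (rule exI[of _ s], rule exI[of _ k], rule exI[of _ "{i, j}"]) (use * in \<open>auto simp: facets_def facet_vertices_def\<close>)
      then show "((\<lambda>(s, i, j). (s, {i, j})) p, (\<lambda>(s, i, j). (s, {i, j})) q) \<in> face_gluing 3 T"
        by (simp add: p q)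
    qed
    then show "(x, y) \<in> (face_gluing 3 T)\<^sup>*" by (simp add: xy A A')
  qed
  moreover have "{x \<in> local_faces 3 T 1. (\<lambda>(s, A). edge_label s A) x = l} = edges_labelled l" for l
    by (auto simp: edges_labelled_def)
  ultimately show ?thesis unfolding edge_labels by simp
qed

lemma edges_labelled_less:
  assumes "r < m"
  shows "edges_labelled r = {s. s < m * n \<and> s mod m = r} \<times> {{0, 3}}"
  using assms by (auto simp: edges_labelled_def edge_label_def local_faces_def split: if_splits)

lemma edges_labelled_m: "edges_labelled m = {..<m * n} \<times> {{0, 1}, {0, 2}, {1, 2}, {1, 3}, {2, 3}}"
proof (intro Set.set_eqI iffI)
  fix x assume x: "x \<in> edges_labelled m"
  obtain s A where xs: "x = (s, A)" by (cases x)
  have *: "s < m * n" "A \<subseteq> {..3}" "card A = 2" "edge_label s A = m" using x xs by (auto simp: edges_labelled_def local_faces_def)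
  obtain i j where A: "A = {i, j}" "i < j" "j \<le> 3" using *(2,3) by (rule pair_subset_cases)
  have "s mod m < m" using m by simp
  then have "A \<noteq> {0, 3}" using *(4) by (auto simp: edge_label_def)
  then have "(i, j) \<in> {(0, 1), (0, 2), (1, 2), (1, 3), (2, 3)}"
    using A le_3_cases[of i] le_3_cases[of j] by auto
  then show "x \<in> {..<m * n} \<times> {{0, 1}, {0, 2}, {1, 2}, {1, 3}, {2, 3}}" using *(1) xs A(1) by auto
next
  fix x assume "x \<in> {..<m * n} \<times> {{0, 1}, {0, 2}, {1, 2}, {1, 3}, {2, 3 :: nat}}"
  then obtain s A where xs: "x = (s, A)" "s < m * n" "A \<in> {{0, 1}, {0, 2}, {1, 2}, {1, 3}, {2, 3}}" by blast
  then show "x \<in> edges_labelled m"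
    unfolding edges_labelled_def local_faces_def xs(1)
    by (elim insertE emptyE) (simp_all add: edge_label_def doubleton_eq_iff)
qed

lemma valence_edges_labelled_less: "r < m \<Longrightarrow> valence (edges_labelled r) = n"
  by (simp add: valence_def edges_labelled_less card_cartesian_product card_residue_class)

lemma card_other_pairs: "card {{0, 1}, {0, 2}, {1, 2}, {1, 3}, {2, 3 :: nat}} = 5"
  by (simp add: doubleton_eq_iff card_insert_if)

lemma valence_edges_labelled_m: "valence (edges_labelled m) = 5 * m * n"
  unfolding valence_def edges_labelled_m card_cartesian_product card_other_pairs by simp

lemma occurrences_in_edges:
  assumes "s < m * n"
  shows "occurrences_in s (edges_labelled (s mod m)) = 1" "occurrences_in s (edges_labelled m) = 5"
proof -
  have "s mod m < m" using m by simp
  then have "{A. (s, A) \<in> edges_labelled (s mod m)} = {{0, 3}}" using assms by (auto simp: edges_labelled_less)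
  then show "occurrences_in s (edges_labelled (s mod m)) = 1" by (simp add: occurrences_in_def)
  have "{A. (s, A) \<in> edges_labelled m} = {{0, 1}, {0, 2}, {1, 2}, {1, 3}, {2, 3}}"
    using assms unfolding edges_labelled_m by blast
  then show "occurrences_in s (edges_labelled m) = 5" unfolding occurrences_in_def by (simp only: card_other_pairs)
qed

lemma inj_on_edges_labelled: "inj_on edges_labelled {..m}"
proof (rule inj_onI)
  fix l l' assume "l \<in> {..m}" "l' \<in> {..m}" and eq: "edges_labelled l = edges_labelled l'"
  have "l \<in> (\<lambda>(s, A). edge_label s A) ` local_faces 3 T 1" unfolding edge_labels by fact
  then obtain s A where "(s, A) \<in> edges_labelled l" by (auto simp: edges_labelled_def)
  then have "edge_label s A = l" "edge_label s A = l'" using eq by (auto simp: edges_labelled_def)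
  then show "l = l'" by simp
qed

end

section \<open>The boundary surface\<close>

text \<open>In the triangles that cut off the vertices, the side maps are order-preserving as well.\<close>

lemma link_slide:
  fixes v r x :: nat
  assumes "v \<le> 3" "r \<le> 2"
  defines "k \<equiv> skip v r"
  defines "r' \<equiv> unskip (slide k v) (3 - k)"
  shows "r' \<le> 2" "(- 1 :: int) ^ slide k v = - ((- 1) ^ v * (- 1) ^ (r + r'))"
    and "x \<le> 2 \<Longrightarrow> x \<noteq> r \<Longrightarrow> unskip (slide k v) (slide k (skip v x)) = skip r' (unskip r x)"
proof -
  have r: "r = 0 \<or> r = 1 \<or> r = 2" using assms(2) by auto
  show "r' \<le> 2" "(- 1 :: int) ^ slide k v = - ((- 1) ^ v * (- 1) ^ (r + r'))"
    using le_3_cases[OF assms(1)] r unfolding r'_def k_def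
    by (elim disjE; simp add: slide_def skip_def unskip_def)+
  assume "x \<le> 2" "x \<noteq> r"
  then have "x = 0 \<or> x = 1 \<or> x = 2" by auto
  then show "unskip (slide k v) (slide k (skip v x)) = skip r' (unskip r x)"
    using le_3_cases[OF assms(1)] r \<open>x \<noteq> r\<close> unfolding r'_def k_def
    by (elim disjE; simp add: slide_def skip_def unskip_def)
qed

text \<open>The permutation is a cycle through the numbers from \<open>r\<close> to
  \<open>r'\<close>, and its length exceeds their distance by 1.\<close>

lemma sign_order_preserving_extension:
  assumes "r \<le> 2" "r' \<le> 2"
  shows "sign (\<lambda>x. if x \<in> {..2} - {r} then skip r' (unskip r x) else if x = r then r' else x) = (- 1) ^ (r + r')"
    (is "sign (?p r r') = _")
proof -
  have "r = 0 \<or> r = 1 \<or> r = 2" "r' = 0 \<or> r' = 1 \<or> r' = 2" using assms by auto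
  moreover have "?p 0 0 = id" "?p 1 1 = id" "?p 2 2 = id"
    "?p 0 1 = Transposition.transpose 0 1" "?p 1 0 = Transposition.transpose 0 1" "?p 1 2 = Transposition.transpose 1 2" "?p 2 1 = Transposition.transpose 1 2"
    "?p 0 2 = Transposition.transpose 0 1 \<circ> Transposition.transpose 0 2" "?p 2 0 = Transposition.transpose 0 2 \<circ> Transposition.transpose 0 1"
    by (auto simp: fun_eq_iff skip_def unskip_def Transposition.transpose_def)
  ultimately show ?thesis
    by (elim disjE) (simp_all only: sign_id sign_compose permutation_swap_id sign_swap_id, simp_all)
qed

context cyclic_pairing
begin

lemma coherently_orientable_link: "coherently_orientable 2 L"
  unfolding coherently_orientable_def
proof (intro exI conjI)
  \<comment> \<open>All tetrahedra are oriented by their vertex order. The triangle cut off at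
    \<open>v\<close> is parallel to the facet opposite \<open>v\<close> and receives the sign of the
    orientation induced there.\<close>
  let ?o = "\<lambda>t. (- 1 :: int) ^ (t mod 4)"
  show "\<forall>t. ?o t \<in> {1, - 1}" by (simp add: minus_one_power_iff)
  show "\<forall>(t, r) \<in> facets 2 L. case mate L (t, r) of (t', r') \<Rightarrow>
     ?o t' = - ?o t * sign (\<lambda>x. if x \<in> facet_vertices 2 (t, r) then vmap L (t, r) x else if x = r then r' else x)"
  proof (clarify)
    fix t r t' r' assume F: "(t, r) \<in> facets 2 L" and m: "mate L (t, r) = (t', r')"
    obtain s v where t: "t = 4 * s + v" and v: "v \<le> 3" by (rule link_index)
    have s: "s < num_simplices T" and r: "r \<le> 2" using F link_facets_iff[OF v] by (simp_all add: t)
    note d = link_data[OF s v r]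
    define k where "k = skip v r"
    have k: "k \<le> 3" "k \<noteq> v" using skip_le[OF r] skip_neq by (simp_all add: k_def)
    have m': "(t', r') = (4 * move s k + slide k v, unskip (slide k v) (3 - k))"
      using d(12)[folded k_def] m unfolding t by simp
    have sv: "slide k v \<le> 3" using slide_facet(1)[OF k(1) v k(2)[symmetric]] .
    have t': "t' mod 4 = slide k v" and tm: "t mod 4 = v" and r': "r' = unskip (slide k v) (3 - k)"
      using m' sv v t by auto
    note l = link_slide[OF v r, folded k_def, folded r']
    have "(\<lambda>x. if x \<in> facet_vertices 2 (t, r) then vmap L (t, r) x else if x = r then r' else x) =
      (\<lambda>x. if x \<in> {..2} - {r} then skip r' (unskip r x) else if x = r then r' else x)"
    proof (intro ext)
      fix x
      have "vmap L (t, r) x = skip r' (unskip r x)" if "x \<le> 2" "x \<noteq> r"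
        using d(13)[of x, folded k_def] l(3)[OF that] unfolding t by simp
      then show "(if x \<in> facet_vertices 2 (t, r) then vmap L (t, r) x else if x = r then r' else x) =
        (if x \<in> {..2} - {r} then skip r' (unskip r x) else if x = r then r' else x)"
        by (simp add: facet_vertices_def del: link_complex_simps)
    qed
    then show "?o t' = - ?o t * sign (\<lambda>x. if x \<in> facet_vertices 2 (t, r) then vmap L (t, r) x else if x = r then r' else x)"
      unfolding t' tm using l(2) sign_order_preserving_extension[OF r l(1)] by simp
  qed
qed

text \<open>The vertices of the link are the ends of the edges, that is, the classes of darts.\<close>

lemma card_link_vertices: "card (quotient_faces 2 L 0) = 2 * (m + 1)"
proof -
  \<comment> \<open>A corner of a cut triangle is the end \<open>v\<close> of an edge
    \<open>{v, w}\<close>. Its label records the class of the edge and whether the corner is at the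
    smaller or the larger end.\<close>
  define c where "c = (\<lambda>(t, A). let s = t div 4; v = t mod 4; w = skip v (the_elem A) in (edge_label s {v, w}, v < w))"
  have c: "c (4 * s + v, {r}) = (edge_label s {v, skip v r}, v < skip v r)" if "v \<le> 3" for s v r
    using that by (simp add: c_def Let_def)
  have c': "c (4 * s + v, {unskip v w}) = (edge_label s {v, w}, v < w)" if "v \<le> 3" "w \<noteq> v" for s v w
    using c[OF that(1)] skip_unskip[OF that(2)] by simp
  have local: "\<exists>s v w. x = (4 * s + v, {unskip v w}) \<and> s < m * n \<and> v \<le> 3 \<and> w \<le> 3 \<and> v \<noteq> w"
    if x: "x \<in> local_faces 2 L 0" for x
  proof -
    obtain t A where tA: "x = (t, A)" "t < 4 * (m * n)" "A \<subseteq> {..2}" "card A = Suc 0"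
      using x by (auto simp: local_faces_def)
    obtain r where A: "A = {r}" using tA(4) by (auto simp: card_Suc_eq)
    obtain s v where t: "t = 4 * s + v" and v: "v \<le> 3" by (rule link_index)
    have r: "r \<le> 2" using tA(3) A by simp
    show ?thesis
      by (rule exI[of _ s], rule exI[of _ v], rule exI[of _ "skip v r"])
        (use tA t v A r skip_le[OF r] skip_neq[of v r] in \<open>simp add: unskip_skip\<close>)
  qed
  have in_local: "(4 * s + v, {unskip v w}) \<in> local_faces 2 L 0" if "s < m * n" "v \<le> 3" "w \<le> 3" "w \<noteq> v" for s v w
    using that unskip_le[OF that(3,2,4)] by (simp add: local_faces_def)
  have glue: "vmap L (4 * s + v, unskip v k) (unskip v w) = unskip (slide k v) (slide k w)"
      "fst (mate L (4 * s + v, unskip v k)) = 4 * move s k + slide k v"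
      "(4 * s + v, unskip v k) \<in> facets 2 L"
    if "s < m * n" "v \<le> 3" "w \<le> 3" "w \<noteq> v" "k \<le> 3" "k \<noteq> v" for s v w k
  proof -
    have s: "s < num_simplices T" and r: "unskip v k \<le> 2" using that(1) unskip_le[OF that(5,2,6)] by simp_all
    note d = link_data[OF s that(2) r, unfolded skip_unskip[OF that(6)]]
    show "vmap L (4 * s + v, unskip v k) (unskip v w) = unskip (slide k v) (slide k w)"
      unfolding d(13) skip_unskip[OF that(4)] by simp
    show "fst (mate L (4 * s + v, unskip v k)) = 4 * move s k + slide k v" unfolding d(12) by simp
    show "(4 * s + v, unskip v k) \<in> facets 2 L" using link_facets_iff[OF that(2)] s r by simp
  qed
  have "card (quotient_faces 2 L 0) = card (c ` local_faces 2 L 0)"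
  proof (rule link.quotient_faces_by_label(2))
    fix t r A assume *: "(t, r) \<in> facets 2 L" "A \<subseteq> facet_vertices 2 (t, r)" "card A = Suc 0"
    have "(t, A) \<in> local_faces 2 L 0" using * by (auto simp: local_faces_def facets_def facet_vertices_def)
    then obtain s v w where tA: "t = 4 * s + v" "A = {unskip v w}" and svw: "s < m * n" "v \<le> 3" "w \<le> 3" "v \<noteq> w"
      using local by blast
    define k where "k = skip v r"
    have "r \<le> 2" using *(1) by (simp add: facets_def)
    then have k: "k \<le> 3" "k \<noteq> v" "r = unskip v k" using skip_le skip_neq unskip_skip by (simp_all add: k_def)
    have "unskip v w \<noteq> r" using *(2) tA(2) by (simp add: facet_vertices_def)
    then have kw: "k \<noteq> w" using k(3) by auto
    note g = glue[OF svw(1-3) svw(4)[symmetric] k(1,2)]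
    have sl: "slide k v < slide k w \<longleftrightarrow> v < w" "slide k w < slide k v \<longleftrightarrow> w < v"
      using slide_less[OF k(1) svw(2,3)] slide_less[OF k(1) svw(3,2)] k(2) kw by auto
    then have neq: "slide k w \<noteq> slide k v" using svw(4) by (metis linorder_neqE_nat less_irrefl)
    have le: "slide k v \<le> 3" using slide_facet(1)[OF k(1) svw(2)] k(2) by simp
    show "c (fst (mate L (t, r)), vmap L (t, r) ` A) = c (t, A)"
      unfolding tA k(3) image_insert image_empty g(1,2) c'[OF svw(2) svw(4)[symmetric]] c'[OF le neq] sl(1)
      using edge_label_step[OF svw(2-4) k(1,2) kw] by simp
  next
    fix x y assume *: "x \<in> local_faces 2 L 0" "y \<in> local_faces 2 L 0" "c x = c y"
    obtain s v w where x: "x = (4 * s + v, {unskip v w})" and sv: "s < m * n" "v \<le> 3" "w \<le> 3" "v \<noteq> w"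
      using local[OF *(1)] by blast
    obtain s' v' w' where y: "y = (4 * s' + v', {unskip v' w'})" and sv': "s' < m * n" "v' \<le> 3" "w' \<le> 3" "v' \<noteq> w'"
      using local[OF *(2)] by blast
    have lab: "edge_label s {v, w} = edge_label s' {v', w'}" "v < w \<longleftrightarrow> v' < w'"
      using *(3) c'[OF sv(2) sv(4)[symmetric]] c'[OF sv'(2) sv'(4)[symmetric]] by (simp_all add: x y)
    have eq: "(s, v, w) \<leadsto> (s', v', w')"
    proof (cases "v < w")
      case True
      then show ?thesis using dart_connected[OF sv(1) _ sv(3) sv'(1) _ sv'(3) lab(1)] lab(2) by simp
    next
      case False
      then have wv: "w < v" "w' < v'" using lab(2) sv(4) sv'(4) by auto
      \<comment> \<open>\<open>dart_connected\<close> speaks of increasing darts. The gluing treats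
        both ends alike, so the connection carries over to the reversed darts.\<close>
      have "(s, w, v) \<leadsto> (s', w', v')"
        by (rule dart_connected[OF sv(1) wv(1) sv(2) sv'(1) wv(2) sv'(2)]) (use lab(1) in \<open>simp add: insert_commute\<close>)
      then have "((\<lambda>(s, i, j). (s, j, i)) (s, w, v), (\<lambda>(s, i, j). (s, j, i)) (s', w', v')) \<in> dart_gluing\<^sup>*"
      proof (rule rtrancl_map_rel)
        fix p q assume "(p, q) \<in> dart_gluing"
        then obtain s i j k where "p = (s, i, j)" "q = (move s k, slide k i, slide k j)"
          "s < m * n" "i \<le> 3" "j \<le> 3" "k \<le> 3" "i \<noteq> j" "k \<noteq> i" "k \<noteq> j" by (rule dart_gluingE)
        then show "((\<lambda>(s, i, j). (s, j, i)) p, (\<lambda>(s, i, j). (s, j, i)) q) \<in> dart_gluing"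
          using dart_gluingI[of s j i k] by simp
      qed
      then show ?thesis by simp
    qed
    define f where "f = (\<lambda>(s, i, j). (4 * s + i, {unskip i j}))"
    have "(f (s, v, w), f (s', v', w')) \<in> (face_gluing 2 L)\<^sup>*"
      using eq
    proof (rule rtrancl_map_rel)
      fix p q assume "(p, q) \<in> dart_gluing"
      then obtain s i j k where p: "p = (s, i, j)" and q: "q = (move s k, slide k i, slide k j)"
        and *: "s < m * n" "i \<le> 3" "j \<le> 3" "k \<le> 3" "i \<noteq> j" "k \<noteq> i" "k \<noteq> j" by (rule dart_gluingE)
      note g = glue[OF *(1-3) *(5)[symmetric] *(4,6)]
      have "unskip i j \<noteq> unskip i k" using unskip_eq_iff[OF *(5)[symmetric] *(6)] *(7) by simp
      then have fv: "{unskip i j} \<subseteq> facet_vertices 2 (4 * s + i, unskip i k)"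
        using unskip_le[OF *(3,2) *(5)[symmetric]] by (simp add: facet_vertices_def)
      have "((4 * s + i, {unskip i j}), (fst (mate L (4 * s + i, unskip i k)), vmap L (4 * s + i, unskip i k) ` {unskip i j})) \<in> face_gluing 2 L"
        unfolding face_gluing_def mem_Collect_eq
        by (rule exI[of _ "4 * s + i"], rule exI[of _ "unskip i k"], rule exI[of _ "{unskip i j}"]) (use g(3) fv in blast)
      then show "(f p, f q) \<in> face_gluing 2 L"
        unfolding image_insert image_empty g(1,2) by (simp add: f_def p q)
    qed
    then show "(x, y) \<in> (face_gluing 2 L)\<^sup>*" by (simp add: x y f_def)
  qed
  also have "c ` local_faces 2 L 0 = {..m} \<times> UNIV"
  proof
    show "c ` local_faces 2 L 0 \<subseteq> {..m} \<times> UNIV"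
    proof
      fix z assume "z \<in> c ` local_faces 2 L 0"
      then obtain x where z: "z = c x" "x \<in> local_faces 2 L 0" by blast
      obtain s v w where x: "x = (4 * s + v, {unskip v w})" "v \<le> 3" "v \<noteq> w" using local[OF z(2)] by blast
      have "edge_label s {v, w} \<le> m" using m by (simp add: edge_label_def less_imp_le)
      then show "z \<in> {..m} \<times> UNIV" using z(1) c'[OF x(2) x(3)[symmetric], of s] x(1) by simp
    qed
    show "{..m} \<times> UNIV \<subseteq> c ` local_faces 2 L 0"
    proof
      fix z :: "nat \<times> bool" assume "z \<in> {..m} \<times> UNIV"
      then obtain l b where z: "z = (l, b)" "l \<le> m" by auto
      have ends: "(l, b) \<in> c ` local_faces 2 L 0"
        if ij: "i < j" "j \<le> 3" and s: "s < m * n" and l: "edge_label s {i, j} = l" for i j s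
      proof (cases b)
        case True
        have "c (4 * s + i, {unskip i j}) = (l, b)" using c'[of i j s] ij l True by simp
        moreover have "(4 * s + i, {unskip i j}) \<in> local_faces 2 L 0" by (rule in_local) (use ij s in auto)
        ultimately show ?thesis by (metis imageI)
      next
        case False
        have "c (4 * s + j, {unskip j i}) = (l, b)" using c'[of j i s] ij l False by (simp add: insert_commute)
        moreover have "(4 * s + j, {unskip j i}) \<in> local_faces 2 L 0" by (rule in_local) (use ij s in auto)
        ultimately show ?thesis by (metis imageI)
      qed
      show "z \<in> c ` local_faces 2 L 0"
      proof (cases "l = m")
        case True
        then show ?thesis unfolding z(1) by (intro ends[of 0 1 0]) (use K_pos edge_label_other[of 0 1 0] in simp_all)
      next
        case False
        then have "l < m" using z(2) by simp
        then show ?thesis unfolding z(1)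
          by (intro ends[of 0 3 l]) (use less_trans[OF _ shift_bounds(2)] in \<open>simp_all add: edge_label_def\<close>)
      qed
    qed
  qed
  finally show ?thesis by (simp add: card_cartesian_product)
qed

lemma Euler_characteristic_link: "Euler_characteristic 2 L = 2 - 2 * int (m * (n - 1))"
proof -
  have 2: "card (quotient_faces 2 L 2) = 4 * (m * n)" using link.card_quotient_faces_top by simp
  have 1: "card (quotient_faces 2 L 1) = 6 * (m * n)" using link.card_quotient_faces_facets by simp
  have "Euler_characteristic 2 L = int (card (quotient_faces 2 L 0)) - int (card (quotient_faces 2 L 1)) + int (card (quotient_faces 2 L 2))"
    by (simp add: Euler_characteristic_def numeral_2_eq_2)
  also have "\<dots> = 2 - 2 * int (m * (n - 1))"
    unfolding card_link_vertices 1 2 using n by (simp add: of_nat_diff algebra_simps)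
  finally show ?thesis .
qed

lemma boundary_surface:
  "closed_orientable_surface_of_genus (m * (n - 1)) (subtopology M (manifold_boundary 3 M))"
  unfolding closed_orientable_surface_of_genus_def
proof (intro conjI exI)
  have eq: "subtopology M (manifold_boundary 3 M) = subtopology C B"
    unfolding manifold_boundary_M by (rule subtopology_M_B)
  show "topspace (subtopology M (manifold_boundary 3 M)) \<noteq> {}"
    unfolding eq using B_nonempty B_subset_C by auto
  show "connected_space (subtopology M (manifold_boundary 3 M))" unfolding eq by (rule connected_B)
  show "face_pairing 2 L" by (rule link_face_pairing)
  show "coherently_orientable 2 L" by (rule coherently_orientable_link)
  show "complex_space 2 L homeomorphic_space subtopology M (manifold_boundary 3 M)" by (rule boundary_homeomorphic_link)
  show "Euler_characteristic 2 L = 2 - 2 * int (m * (n - 1))" by (rule Euler_characteristic_link)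
qed

end

theorem proposition4p7:
  fixes n m :: nat
  assumes "n \<ge> 6" and "m \<ge> 1" and "gcd n m = 1"
  shows "\<exists>T a b.
    ideal_triangulation T (associated_manifold T) \<and>
    connected_space (complex_space 3 T) \<and>
    orientable_manifold 3 (associated_manifold T) \<and>
    card (complex_vertices 3 T) = 1 \<and>
    num_simplices T = m * n \<and>
    quotient_faces 3 T 1 = insert b (a ` {..<m}) \<and>
    inj_on a {..<m} \<and> b \<notin> a ` {..<m} \<and>
    (\<forall>r<m. valence (a r) = n) \<and> valence b = 5 * m * n \<and>
    (\<forall>s<m * n. (\<exists>r<m. occurrences_in s (a r) = 1) \<and> occurrences_in s b = 5) \<and>
    closed_orientable_surface_of_genus (m * (n - 1))
      (subtopology (associated_manifold T) (manifold_boundary 3 (associated_manifold T)))"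
proof -
  interpret cyclic_pairing n m by unfold_locales (use assms in auto)
  have m: "{..m} = insert m {..<m}" by auto
  show ?thesis
  proof (rule exI[of _ T], rule exI[of _ edges_labelled], rule exI[of _ "edges_labelled m"], intro conjI allI impI)
    show "ideal_triangulation T M" by (rule ideal_triangulation_M)
    show "connected_space C" by (rule connected_complex)
    show "orientable_manifold 3 M" by (rule orientable_M)
    show "card (complex_vertices 3 T) = 1" by (rule one_card_vertices)
    show "num_simplices T = m * n" by simp
    show "quotient_faces 3 T 1 = insert (edges_labelled m) (edges_labelled ` {..<m})"
      unfolding quotient_edges m by simp
    show "inj_on edges_labelled {..<m}" by (rule inj_on_subset[OF inj_on_edges_labelled]) auto
    show "edges_labelled m \<notin> edges_labelled ` {..<m}"
    proof
      assume "edges_labelled m \<in> edges_labelled ` {..<m}"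
      then obtain r where "r < m" "edges_labelled m = edges_labelled r" by auto
      then show False using inj_onD[OF inj_on_edges_labelled, of m r] by simp
    qed
    show "valence (edges_labelled r) = n" if "r < m" for r using that by (rule valence_edges_labelled_less)
    show "valence (edges_labelled m) = 5 * m * n" by (rule valence_edges_labelled_m)
    show "\<exists>r<m. occurrences_in s (edges_labelled r) = 1" if "s < m * n" for s
      using occurrences_in_edges(1)[OF that] assms(2) by (intro exI[of _ "s mod m"]) simp
    show "occurrences_in s (edges_labelled m) = 5" if "s < m * n" for s using that by (rule occurrences_in_edges(2))
    show "closed_orientable_surface_of_genus (m * (n - 1)) (subtopology M (manifold_boundary 3 M))"
      by (rule boundary_surface)
  qed
qed

end
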